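(* Let $H$ be a cocommutative Hopf algebra over a field $k$ and $A$ a faithfully flat $H$-Galois extension of $B=A^{\mathrm{co}H}$. The action of $\mathrm{Pic}(B)$ on $Z(B)$ induces an action of $\mathrm{Pic}(B)^H$ on $Z^n(H,Z(B))$, $B^n(H,Z(B))$ and $H^n(H,Z(B))$. More precisely, for $[\underline M]\in\mathrm{Pic}(B)^H$, if $f:H^{\otimes n}\to Z(B)$ is a cocycle (resp. a coboundary), then $\xi_M\circ f$ is also a cocycle (resp. a coboundary).
   Context: **Conventions.** $\otimes=\otimes_k$; $S,\varepsilon$ are the antipode and counit of $H$; $\Delta(h)=h_{(1)}\otimes h_{(2)}$; right coactions are written $\rho(m)=m_{[0]}\otimes m_{[1]}$, $M^{\mathrm{co}H}=\{m:\rho(m)=m\otimes1\}$. A right $H$-comodule algebra $A$ is a faithfully flat $H$-Galois extension of $B=A^{\mathrm{co}H}$ if $\mathrm{can}:A\otimes_BA\to A\otimes H$, $a\otimes_Bb\mapsto ab_{[0]}\otimes b_{[1]}$, is bijective and $A$ is faithfully flat as a left $B$-module. Write $\mathrm{can}^{-1}(1\otimes h)=\sum_il_i(h)\otimes_Br_i(h)$. $Z(B)$ is a left $H$-module algebra via $h\cdot x=\sum_il_i(S^{-1}(h))\,x\,r_i(S^{-1}(h))$ (Miyashita–Ulbrich action). **Sweedler cohomology.** $Z^n,B^n,H^n=Z^n/B^n$ are the cocycles, coboundaries and cohomology of the complex of abelian groups $\mathrm{Reg}(H^{\otimes n},Z(B))$ (convolution invertible linear maps $H^{\otimes n}\to Z(B)$,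 under convolution $*$) with differential $$D(f)=f_0*f_1^{-1}*f_2*\cdots*f_{n+1}^{(-1)^{n+1}},$$ where $f_0(h_1\otimes\cdots\otimes h_{n+1})=h_1\cdot f(h_2\otimes\cdots\otimes h_{n+1})$, $f_i(h_1\otimes\cdots\otimes h_{n+1})=f(h_1\otimes\cdots\otimes h_ih_{i+1}\otimes\cdots\otimes h_{n+1})$ for $1\le i\le n$, and $f_{n+1}(h_1\otimes\cdots\otimes h_{n+1})=f(h_1\otimes\cdots\otimes h_n)\varepsilon(h_{n+1})$. **Picard group and action on $Z(B)$.** $\mathrm{Pic}(B)$ is the group of isomorphism classes of strict Morita contexts $\underline M=(B,B,M,N,\alpha,\beta)$ ($\alpha:M\otimes_BN\to B$, $\beta:N\otimes_BM\to B$), multiplication induced by $\otimes_B$. It acts on $Z(B)$ via $\xi_M:Z(B)\to Z(B)$, where $\xi_M(x)=y$ iff $mx=ym$ for all $m\in M$. **The subgroup $\mathrm{Pic}(B)^H$.** $A^e=A\otimes A^{\mathrm{op}}$, $B^e=B\otimes B^{\mathrm{op}}$, $A^{\square e}=\{\sum_ka_k\otimes a'_k\in A^e:\sum_ka_{k[0]}\otimes a'_k\otimes a_{k[1]}=\sum_ka_k\otimes a'_{k[0]}\otimes S(a'_{k[1]})\}$, a subalgebra of $A^e$ containing $B^e$, with right coaction $\sum a_k\otimes a'_k\mapsto\sum a_{k[0]}\otimes a'_k\otimes a_{k[1]}$. $B$-bimodules are left $B^e$-modules via $(b\otimes b')m=bmb'$. ${}_B\mathcal M_B^H$ is the category of $B$-bimodules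 $P$ with right $H$-coaction such that $\rho(bpb')=bp_{[0]}b'\otimes p_{[1]}$. For $P,Q$ in it, $P\otimes_B^HQ=\{\sum p_i\otimes_Bq_i\in P\otimes_BQ:\sum p_{i[0]}\otimes_Bq_i\otimes p_{i[1]}=\sum p_i\otimes_Bq_{i[0]}\otimes q_{i[1]}\}$. For a $B$-bimodule $M$, $M\otimes H$ (bimodule structure from $M$, coaction $M\otimes\Delta$) and $A^{\square e}\otimes_{B^e}M$ (left $B^e$-action and coaction from $A^{\square e}$) lie in ${}_B\mathcal M_B^H$. Given isomorphisms $\varphi_M:A^{\square e}\otimes_{B^e}M\to M\otimes H$ and $\varphi_{M'}:A^{\square e}\otimes_{B^e}M'\to M'\otimes H$ in ${}_B\mathcal M_B^H$, put $\varphi_{M\otimes_BM'}=\kappa^{-1}\circ(\varphi_M\otimes_B^H\varphi_{M'})\circ g$, where $\kappa:M\otimes_BM'\otimes H\to(M\otimes H)\otimes_B^H(M'\otimes H)$, $\kappa(m\otimes m'\otimes h)=(m\otimes h_{(1)})\otimes_B(m'\otimes h_{(2)})$, and $g:A^{\square e}\otimes_{B^e}(M\otimes_BM')\to(A^{\square e}\otimes_{B^e}M)\otimes_B^H(A^{\square e}\otimes_{B^e}M')$, $g(\sum_k(a_k\otimes a'_k)\otimes(m\otimes m'))=\sum_{i,k}((a_{k[0]}\otimes l_i(a_{k[1]}))\otimes m)\otimes_B((r_i(a_{k[1]})\otimes a'_k)\otimes m')$, are isomorphisms. Let $\varphi_B(\sum_k(a_k\otimes a'_k)\otimes b)=\sum_ka_{k[0]}ba'_k\otimes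 a_{k[1]}$. $\underline M$ is $H$-stable if there exist isomorphisms $\varphi_M:A^{\square e}\otimes_{B^e}M\to M\otimes H$ and $\varphi_N:A^{\square e}\otimes_{B^e}N\to N\otimes H$ in ${}_B\mathcal M_B^H$ with $\varphi_B\circ(A^{\square e}\otimes_{B^e}\alpha)=(\alpha\otimes H)\circ\varphi_{M\otimes_BN}$ and $\varphi_B\circ(A^{\square e}\otimes_{B^e}\beta)=(\beta\otimes H)\circ\varphi_{N\otimes_BM}$. $\mathrm{Pic}(B)^H$ is the subgroup of $\mathrm{Pic}(B)$ of classes of $H$-stable contexts. *)

theory Defs
  imports "HOL-Algebra.Free_Abelian_Groups" "HOL-Algebra.Module" "HOL-Algebra.Bij"
begin

section \<open>Tensor products\<close>

text \<open>
  Elements of a tensor product are cosets in the free abelian group on pairs. An algebra over a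
  field \<open>k\<close> is a record of type \<^typ>\<open>('k, 'a) module\<close>, whose ring operations are the
  multiplication of the algebra; for mere modules the fields \<open>mult\<close> and \<open>one\<close> carry no meaning.
\<close>

type_synonym ('m, 'n) tens = "('m \<times> 'n \<Rightarrow>\<^sub>0 int) set"

definition tensor_relations ::
  "'r set \<Rightarrow> ('m \<Rightarrow> 'r \<Rightarrow> 'm) \<Rightarrow> ('r \<Rightarrow> 'n \<Rightarrow> 'n) \<Rightarrow> ('m, 'x) ring_scheme \<Rightarrow> ('n, 'y) ring_scheme
    \<Rightarrow> ('m, 'n) tens" where
  "tensor_relations R ra la M N =
    generate (free_Abelian_group (carrier M \<times> carrier N))
     ({frag_of (x \<oplus>\<^bsub>M\<^esub> x', y) - (frag_of (x, y) + frag_of (x', y)) | x x' y.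
         x \<in> carrier M \<and> x' \<in> carrier M \<and> y \<in> carrier N} \<union>
      {frag_of (x, y \<oplus>\<^bsub>N\<^esub> y') - (frag_of (x, y) + frag_of (x, y')) | x y y'.
         x \<in> carrier M \<and> y \<in> carrier N \<and> y' \<in> carrier N} \<union>
      {frag_of (ra x r, y) - frag_of (x, la r y) | x r y.
         x \<in> carrier M \<and> r \<in> R \<and> y \<in> carrier N})"

definition quotient_ab :: "'s set \<Rightarrow> ('s \<Rightarrow>\<^sub>0 int) set \<Rightarrow> ('s \<Rightarrow>\<^sub>0 int) set ring" where
  "quotient_ab S K =
    (let Q = free_Abelian_group S Mod K
     in \<lparr>carrier = carrier Q, mult = undefined, one = undefined,
         zero = \<one>\<^bsub>Q\<^esub>, add = (\<lambda>X Y. X \<otimes>\<^bsub>Q\<^esub> Y)\<rparr>)"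

text \<open>The tensor product of a right module \<open>M\<close> and a left module \<open>N\<close> over a ring with carrier \<open>R\<close>,
  the actions being \<open>ra\<close> and \<open>la\<close>, and its elements \<open>x \<otimes> y\<close>.\<close>

definition tensor ::
  "'r set \<Rightarrow> ('m \<Rightarrow> 'r \<Rightarrow> 'm) \<Rightarrow> ('r \<Rightarrow> 'n \<Rightarrow> 'n) \<Rightarrow> ('m, 'x) ring_scheme \<Rightarrow> ('n, 'y) ring_scheme
    \<Rightarrow> ('m, 'n) tens ring" where
  "tensor R ra la M N = quotient_ab (carrier M \<times> carrier N) (tensor_relations R ra la M N)"

definition tensor_elem ::
  "'r set \<Rightarrow> ('m \<Rightarrow> 'r \<Rightarrow> 'm) \<Rightarrow> ('r \<Rightarrow> 'n \<Rightarrow> 'n) \<Rightarrow> ('m, 'x) ring_scheme \<Rightarrow> ('n, 'y) ring_scheme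
    \<Rightarrow> 'm \<Rightarrow> 'n \<Rightarrow> ('m, 'n) tens" where
  "tensor_elem R ra la M N x y =
    tensor_relations R ra la M N #>\<^bsub>free_Abelian_group (carrier M \<times> carrier N)\<^esub> frag_of (x, y)"

text \<open>\<open>tsum G X F\<close> is the sum of the \<open>F x\<^sub>i y\<^sub>i\<close> in \<open>G\<close>, where \<open>X\<close> is the sum of the \<open>x\<^sub>i \<otimes> y\<^sub>i\<close>. The
  representative is immaterial when \<open>F\<close> is biadditive and balanced, as it is in all uses below.\<close>

definition tsum ::
  "('g, 'z) ring_scheme \<Rightarrow> ('m, 'n) tens \<Rightarrow> ('m \<Rightarrow> 'n \<Rightarrow> 'g) \<Rightarrow> 'g" where
  "tsum G X F =
    (let c = (SOME c. c \<in> X)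
     in \<Oplus>\<^bsub>G\<^esub>p\<in>Poly_Mapping.keys c. [Poly_Mapping.lookup c p] \<cdot>\<^bsub>G\<^esub> F (fst p) (snd p))"

subsection \<open>Tensor products over the ground field\<close>

definition ktens_elem ::
  "'k ring \<Rightarrow> ('k, 'm, 'x) module_scheme \<Rightarrow> ('k, 'n, 'y) module_scheme \<Rightarrow> 'm \<Rightarrow> 'n \<Rightarrow> ('m, 'n) tens"
  where
  "ktens_elem k M N = tensor_elem (carrier k) (\<lambda>x c. c \<odot>\<^bsub>M\<^esub> x) (\<lambda>c y. c \<odot>\<^bsub>N\<^esub> y) M N"

definition ktens ::
  "'k ring \<Rightarrow> ('k, 'm, 'x) module_scheme \<Rightarrow> ('k, 'n, 'y) module_scheme \<Rightarrow> ('k, ('m, 'n) tens) module"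
  where
  "ktens k M N =
    (let T = tensor (carrier k) (\<lambda>x c. c \<odot>\<^bsub>M\<^esub> x) (\<lambda>c y. c \<odot>\<^bsub>N\<^esub> y) M N
     in \<lparr>carrier = carrier T,
         mult = (\<lambda>X Y. tsum T X (\<lambda>x y. tsum T Y (\<lambda>x' y'.
                   ktens_elem k M N (x \<otimes>\<^bsub>M\<^esub> x') (y \<otimes>\<^bsub>N\<^esub> y')))),
         one = ktens_elem k M N \<one>\<^bsub>M\<^esub> \<one>\<^bsub>N\<^esub>,
         zero = \<zero>\<^bsub>T\<^esub>, add = (\<lambda>X Y. X \<oplus>\<^bsub>T\<^esub> Y),
         smult = (\<lambda>c X. tsum T X (\<lambda>x y. ktens_elem k M N (c \<odot>\<^bsub>M\<^esub> x) y))\<rparr>)"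

definition op_alg :: "('a, 'x) ring_scheme \<Rightarrow> ('a, 'x) ring_scheme" where
  "op_alg A = A\<lparr>mult := (\<lambda>x y. y \<otimes>\<^bsub>A\<^esub> x)\<rparr>"

definition base_module :: "'k ring \<Rightarrow> ('k, 'k) module" where
  "base_module k =
    \<lparr>carrier = carrier k, mult = (\<lambda>x y. x \<otimes>\<^bsub>k\<^esub> y), one = \<one>\<^bsub>k\<^esub>,
     zero = \<zero>\<^bsub>k\<^esub>, add = (\<lambda>x y. x \<oplus>\<^bsub>k\<^esub> y), smult = (\<lambda>c x. c \<otimes>\<^bsub>k\<^esub> x)\<rparr>"

definition additive_maps ::
  "('m, 'x) ring_scheme \<Rightarrow> ('n, 'y) ring_scheme \<Rightarrow> ('m \<Rightarrow> 'n) set" where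
  "additive_maps V W = {f \<in> carrier V \<rightarrow> carrier W.
     \<forall>x\<in>carrier V. \<forall>y\<in>carrier V. f (x \<oplus>\<^bsub>V\<^esub> y) = f x \<oplus>\<^bsub>W\<^esub> f y}"

definition linear_maps ::
  "'k ring \<Rightarrow> ('k, 'm, 'x) module_scheme \<Rightarrow> ('k, 'n, 'y) module_scheme \<Rightarrow> ('m \<Rightarrow> 'n) set" where
  "linear_maps k V W = {f \<in> additive_maps V W.
     \<forall>c\<in>carrier k. \<forall>x\<in>carrier V. f (c \<odot>\<^bsub>V\<^esub> x) = c \<odot>\<^bsub>W\<^esub> f x}"


section \<open>Hopf algebras and comodule algebras\<close>

definition k_algebra :: "'k ring \<Rightarrow> ('k, 'a, 'x) module_scheme \<Rightarrow> bool" where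
  "k_algebra k A \<longleftrightarrow> ring A \<and> module k A \<and>
    (\<forall>c\<in>carrier k. \<forall>x\<in>carrier A. \<forall>y\<in>carrier A.
       (c \<odot>\<^bsub>A\<^esub> x) \<otimes>\<^bsub>A\<^esub> y = c \<odot>\<^bsub>A\<^esub> (x \<otimes>\<^bsub>A\<^esub> y) \<and> x \<otimes>\<^bsub>A\<^esub> (c \<odot>\<^bsub>A\<^esub> y) = c \<odot>\<^bsub>A\<^esub> (x \<otimes>\<^bsub>A\<^esub> y))"

record ('k, 'h) hopf = "('k, 'h) module" +
  comult :: "'h \<Rightarrow> ('h, 'h) tens"
  counit :: "'h \<Rightarrow> 'k"
  antipode :: "'h \<Rightarrow> 'h"

definition hopf_algebra :: "'k ring \<Rightarrow> ('k, 'h) hopf \<Rightarrow> bool" where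
  "hopf_algebra k H \<longleftrightarrow>
    k_algebra k H \<and>
    comult H \<in> linear_maps k H (ktens k H H) \<inter> ring_hom H (ktens k H H) \<and>
    counit H \<in> linear_maps k H (base_module k) \<inter> ring_hom H k \<and>
    antipode H \<in> linear_maps k H H \<and>
    (\<forall>h\<in>carrier H.
      (let HH = ktens k H H; HHH = ktens k HH H in
        tsum HHH (comult H h) (\<lambda>x y. ktens_elem k HH H (comult H x) y) =
        tsum HHH (comult H h) (\<lambda>x y. tsum HHH (comult H y) (\<lambda>y' y''.
          ktens_elem k HH H (ktens_elem k H H x y') y''))) \<and>
      tsum H (comult H h) (\<lambda>x y. counit H x \<odot>\<^bsub>H\<^esub> y) = h \<and>
      tsum H (comult H h) (\<lambda>x y. counit H y \<odot>\<^bsub>H\<^esub> x) = h \<and>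
      tsum H (comult H h) (\<lambda>x y. antipode H x \<otimes>\<^bsub>H\<^esub> y) = counit H h \<odot>\<^bsub>H\<^esub> \<one>\<^bsub>H\<^esub> \<and>
      tsum H (comult H h) (\<lambda>x y. x \<otimes>\<^bsub>H\<^esub> antipode H y) = counit H h \<odot>\<^bsub>H\<^esub> \<one>\<^bsub>H\<^esub>)"

definition cocommutative :: "'k ring \<Rightarrow> ('k, 'h) hopf \<Rightarrow> bool" where
  "cocommutative k H \<longleftrightarrow> (\<forall>h\<in>carrier H.
     tsum (ktens k H H) (comult H h) (\<lambda>x y. ktens_elem k H H y x) = comult H h)"

record ('k, 'a, 'h) comod_alg = "('k, 'a) module" +
  coact :: "'a \<Rightarrow> ('a, 'h) tens"

definition comodule_algebra :: "'k ring \<Rightarrow> ('k, 'h) hopf \<Rightarrow> ('k, 'a, 'h) comod_alg \<Rightarrow> bool" where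
  "comodule_algebra k H A \<longleftrightarrow>
    k_algebra k A \<and>
    coact A \<in> linear_maps k A (ktens k A H) \<inter> ring_hom A (ktens k A H) \<and>
    (\<forall>a\<in>carrier A.
      (let AH = ktens k A H; AHH = ktens k AH H in
        tsum AHH (coact A a) (\<lambda>x h. ktens_elem k AH H (coact A x) h) =
        tsum AHH (coact A a) (\<lambda>x h. tsum AHH (comult H h) (\<lambda>h' h''.
          ktens_elem k AH H (ktens_elem k A H x h') h''))) \<and>
      tsum A (coact A a) (\<lambda>x h. counit H h \<odot>\<^bsub>A\<^esub> x) = a)"

definition coinv ::
  "'k ring \<Rightarrow> ('k, 'h) hopf \<Rightarrow> ('k, 'a, 'h) comod_alg \<Rightarrow> ('k, 'a, 'h) comod_alg" where
  "coinv k H A = A\<lparr>carrier := {a \<in> carrier A. coact A a = ktens_elem k A H a \<one>\<^bsub>H\<^esub>}\<rparr>"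

definition center :: "('a, 'x) ring_scheme \<Rightarrow> ('a, 'x) ring_scheme" where
  "center B = B\<lparr>carrier := {x \<in> carrier B. \<forall>b\<in>carrier B. x \<otimes>\<^bsub>B\<^esub> b = b \<otimes>\<^bsub>B\<^esub> x}\<rparr>"


section \<open>Bimodules\<close>

record ('k, 'm, 'b) bimod = "('k, 'm) module" +
  lact :: "'b \<Rightarrow> 'm \<Rightarrow> 'm"
  ract :: "'m \<Rightarrow> 'b \<Rightarrow> 'm"

definition make_bimod ::
  "('m, 'x) ring_scheme \<Rightarrow> ('k \<Rightarrow> 'm \<Rightarrow> 'm) \<Rightarrow> ('b \<Rightarrow> 'm \<Rightarrow> 'm) \<Rightarrow> ('m \<Rightarrow> 'b \<Rightarrow> 'm) \<Rightarrow> ('k, 'm, 'b) bimod"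
  where
  "make_bimod T s l r =
    \<lparr>carrier = carrier T, mult = (\<lambda>x y. x \<otimes>\<^bsub>T\<^esub> y), one = \<one>\<^bsub>T\<^esub>,
     zero = \<zero>\<^bsub>T\<^esub>, add = (\<lambda>x y. x \<oplus>\<^bsub>T\<^esub> y), smult = s, lact = l, ract = r\<rparr>"

definition right_module :: "('b, 'y) ring_scheme \<Rightarrow> ('m, 'x) ring_scheme \<Rightarrow> ('m \<Rightarrow> 'b \<Rightarrow> 'm) \<Rightarrow> bool" where
  "right_module B M ra \<longleftrightarrow> abelian_group M \<and>
    (\<forall>x\<in>carrier M. \<forall>b\<in>carrier B. ra x b \<in> carrier M) \<and>
    (\<forall>x\<in>carrier M. \<forall>y\<in>carrier M. \<forall>b\<in>carrier B. ra (x \<oplus>\<^bsub>M\<^esub> y) b = ra x b \<oplus>\<^bsub>M\<^esub> ra y b) \<and>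
    (\<forall>x\<in>carrier M. \<forall>b\<in>carrier B. \<forall>b'\<in>carrier B. ra x (b \<oplus>\<^bsub>B\<^esub> b') = ra x b \<oplus>\<^bsub>M\<^esub> ra x b') \<and>
    (\<forall>x\<in>carrier M. \<forall>b\<in>carrier B. \<forall>b'\<in>carrier B. ra x (b \<otimes>\<^bsub>B\<^esub> b') = ra (ra x b) b') \<and>
    (\<forall>x\<in>carrier M. ra x \<one>\<^bsub>B\<^esub> = x)"

text \<open>The two induced \<open>k\<close>-actions on a bimodule agree, so that bimodules are modules over the
  enveloping algebra; the field \<open>smult\<close> records this common action.\<close>

definition bimodule :: "'k ring \<Rightarrow> ('k, 'b, 'y) module_scheme \<Rightarrow> ('k, 'm, 'b) bimod \<Rightarrow> bool" where
  "bimodule k B M \<longleftrightarrow> module k M \<and>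
    right_module B M (ract M) \<and> right_module (op_alg B) M (\<lambda>x b. lact M b x) \<and>
    (\<forall>b\<in>carrier B. \<forall>x\<in>carrier M. \<forall>b'\<in>carrier B. ract M (lact M b x) b' = lact M b (ract M x b')) \<and>
    (\<forall>c\<in>carrier k. \<forall>x\<in>carrier M.
       c \<odot>\<^bsub>M\<^esub> x = lact M (c \<odot>\<^bsub>B\<^esub> \<one>\<^bsub>B\<^esub>) x \<and> c \<odot>\<^bsub>M\<^esub> x = ract M x (c \<odot>\<^bsub>B\<^esub> \<one>\<^bsub>B\<^esub>))"

definition bimod_iso ::
  "'k ring \<Rightarrow> ('k, 'b, 'y) module_scheme \<Rightarrow> ('k, 'm, 'b) bimod \<Rightarrow> ('k, 'n, 'b) bimod \<Rightarrow> ('m \<Rightarrow> 'n) set" where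
  "bimod_iso k B M N = {f \<in> linear_maps k M N.
     bij_betw f (carrier M) (carrier N) \<and>
     (\<forall>b\<in>carrier B. \<forall>x\<in>carrier M. f (lact M b x) = lact N b (f x) \<and> f (ract M x b) = ract N (f x) b)}"

definition regular_bimod :: "('k, 'b, 'y) module_scheme \<Rightarrow> ('k, 'b, 'b) bimod" where
  "regular_bimod X =
    make_bimod X (\<lambda>c x. c \<odot>\<^bsub>X\<^esub> x) (\<lambda>b x. b \<otimes>\<^bsub>X\<^esub> x) (\<lambda>x b. x \<otimes>\<^bsub>X\<^esub> b)"

definition btens_elem ::
  "('b, 'y) ring_scheme \<Rightarrow> ('k, 'm, 'b) bimod \<Rightarrow> ('k, 'n, 'b) bimod \<Rightarrow> 'm \<Rightarrow> 'n \<Rightarrow> ('m, 'n) tens" where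
  "btens_elem B M N = tensor_elem (carrier B) (ract M) (lact N) M N"

definition btens ::
  "('b, 'y) ring_scheme \<Rightarrow> ('k, 'm, 'b) bimod \<Rightarrow> ('k, 'n, 'b) bimod \<Rightarrow> ('k, ('m, 'n) tens, 'b) bimod" where
  "btens B M N =
    (let T = tensor (carrier B) (ract M) (lact N) M N
     in make_bimod T
          (\<lambda>c X. tsum T X (\<lambda>x y. btens_elem B M N (c \<odot>\<^bsub>M\<^esub> x) y))
          (\<lambda>b X. tsum T X (\<lambda>x y. btens_elem B M N (lact M b x) y))
          (\<lambda>X b. tsum T X (\<lambda>x y. btens_elem B M N x (ract N y b))))"


section \<open>Faithfully flat Hopf--Galois extensions\<close>

definition right_module_hom ::
  "('b, 'y) ring_scheme \<Rightarrow> ('m, 'x) ring_scheme \<Rightarrow> ('m \<Rightarrow> 'b \<Rightarrow> 'm) \<Rightarrow>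
    ('n, 'z) ring_scheme \<Rightarrow> ('n \<Rightarrow> 'b \<Rightarrow> 'n) \<Rightarrow> ('m \<Rightarrow> 'n) set" where
  "right_module_hom B M ra N rb = {f \<in> additive_maps M N.
     \<forall>x\<in>carrier M. \<forall>b\<in>carrier B. f (ra x b) = rb (f x) b}"

definition exact_at ::
  "('m, 'x) ring_scheme \<Rightarrow> ('n, 'y) ring_scheme \<Rightarrow> ('p, 'z) ring_scheme \<Rightarrow>
    ('m \<Rightarrow> 'n) \<Rightarrow> ('n \<Rightarrow> 'p) \<Rightarrow> bool" where
  "exact_at M N P f g \<longleftrightarrow> f ` carrier M = {y \<in> carrier N. g y = \<zero>\<^bsub>P\<^esub>}"

text \<open>The functor \<open>- \<otimes>\<^sub>B L\<close> preserves and reflects exactness. A formula of HOL cannot quantify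
  over modules in all types. Here the modules have elements of type \<^typ>\<open>(nat \<Rightarrow> 'b) set\<close>: every
  countably generated right \<open>B\<close>-module is a quotient of the module of finitely supported
  sequences in \<open>B\<close>, hence occurs among these up to isomorphism, and flatness and faithfulness are
  determined by finitely generated modules.\<close>

definition faithfully_flat ::
  "('b, 'y) ring_scheme \<Rightarrow> ('l, 'x) ring_scheme \<Rightarrow> ('b \<Rightarrow> 'l \<Rightarrow> 'l) \<Rightarrow> bool" where
  "faithfully_flat B L la \<longleftrightarrow>
    (\<forall>(M :: (nat \<Rightarrow> 'b) set ring) ra (N :: (nat \<Rightarrow> 'b) set ring) rb (P :: (nat \<Rightarrow> 'b) set ring) rc f g.
      right_module B M ra \<and> right_module B N rb \<and> right_module B P rc \<and>
      f \<in> right_module_hom B M ra N rb \<and> g \<in> right_module_hom B N rb P rc \<longrightarrow>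
      (let ML = tensor (carrier B) ra la M L;
           NL = tensor (carrier B) rb la N L;
           PL = tensor (carrier B) rc la P L
       in exact_at M N P f g \<longleftrightarrow>
          exact_at ML NL PL
            (\<lambda>X. tsum NL X (\<lambda>x l. tensor_elem (carrier B) rb la N L (f x) l))
            (\<lambda>X. tsum PL X (\<lambda>x l. tensor_elem (carrier B) rc la P L (g x) l))))"

definition A_tens_A ::
  "'k ring \<Rightarrow> ('k, 'h) hopf \<Rightarrow> ('k, 'a, 'h) comod_alg \<Rightarrow> ('k, ('a, 'a) tens, 'a) bimod" where
  "A_tens_A k H A = btens (coinv k H A) (regular_bimod A) (regular_bimod A)"

definition can ::
  "'k ring \<Rightarrow> ('k, 'h) hopf \<Rightarrow> ('k, 'a, 'h) comod_alg \<Rightarrow> ('a, 'a) tens \<Rightarrow> ('a, 'h) tens" where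
  "can k H A X =
    tsum (ktens k A H) X (\<lambda>a b. tsum (ktens k A H) (coact A b) (\<lambda>b' h.
      ktens_elem k A H (a \<otimes>\<^bsub>A\<^esub> b') h))"

definition ff_galois :: "'k ring \<Rightarrow> ('k, 'h) hopf \<Rightarrow> ('k, 'a, 'h) comod_alg \<Rightarrow> bool" where
  "ff_galois k H A \<longleftrightarrow>
    comodule_algebra k H A \<and>
    bij_betw (can k H A) (carrier (A_tens_A k H A)) (carrier (ktens k A H)) \<and>
    faithfully_flat (coinv k H A) A (\<lambda>b a. b \<otimes>\<^bsub>A\<^esub> a)"

text \<open>\<open>transl k H A h\<close> is the sum of the \<open>l\<^sub>i(h) \<otimes>\<^sub>B r\<^sub>i(h)\<close>.\<close>

definition transl ::
  "'k ring \<Rightarrow> ('k, 'h) hopf \<Rightarrow> ('k, 'a, 'h) comod_alg \<Rightarrow> 'h \<Rightarrow> ('a, 'a) tens" where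
  "transl k H A h =
    inv_into (carrier (A_tens_A k H A)) (can k H A) (ktens_elem k A H \<one>\<^bsub>A\<^esub> h)"

definition miyashita_ulbrich ::
  "'k ring \<Rightarrow> ('k, 'h) hopf \<Rightarrow> ('k, 'a, 'h) comod_alg \<Rightarrow> 'h \<Rightarrow> 'a \<Rightarrow> 'a" where
  "miyashita_ulbrich k H A h x =
    tsum A (transl k H A (inv_into (carrier H) (antipode H) h)) (\<lambda>l r. l \<otimes>\<^bsub>A\<^esub> x \<otimes>\<^bsub>A\<^esub> r)"

definition ZB :: "'k ring \<Rightarrow> ('k, 'h) hopf \<Rightarrow> ('k, 'a, 'h) comod_alg \<Rightarrow> ('k, 'a, 'h) comod_alg" where
  "ZB k H A = center (coinv k H A)"


section \<open>Sweedler cohomology\<close>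

text \<open>The \<open>n\<close>-th tensor power of \<open>H\<close>, with \<open>n\<close> not fixed by the type, is presented as
  \<open>k \<otimes> H \<otimes> \<dots> \<otimes> H\<close>: the generator \<open>(c, [h\<^sub>1, \<dots>, h\<^sub>n])\<close> stands for \<open>c (h\<^sub>1 \<otimes> \<dots> \<otimes> h\<^sub>n)\<close>. The scalar
  makes the power for \<open>n = 0\<close> the ground field.\<close>

definition tpow_gens :: "'k ring \<Rightarrow> ('k, 'h, 'x) module_scheme \<Rightarrow> nat \<Rightarrow> ('k \<times> 'h list) set" where
  "tpow_gens k H n = carrier k \<times> {hs. length hs = n \<and> set hs \<subseteq> carrier H}"

definition tpow_relations ::
  "'k ring \<Rightarrow> ('k, 'h, 'x) module_scheme \<Rightarrow> nat \<Rightarrow> ('k, 'h list) tens" where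
  "tpow_relations k H n =
    generate (free_Abelian_group (tpow_gens k H n))
     ({frag_of (c \<oplus>\<^bsub>k\<^esub> d, hs) - (frag_of (c, hs) + frag_of (d, hs)) | c d hs.
         (c, hs) \<in> tpow_gens k H n \<and> d \<in> carrier k} \<union>
      {frag_of (c, hs[i := x \<oplus>\<^bsub>H\<^esub> y]) - (frag_of (c, hs[i := x]) + frag_of (c, hs[i := y])) | c hs i x y.
         (c, hs) \<in> tpow_gens k H n \<and> i < n \<and> x \<in> carrier H \<and> y \<in> carrier H} \<union>
      {frag_of (c, hs[i := d \<odot>\<^bsub>H\<^esub> x]) - frag_of (c \<otimes>\<^bsub>k\<^esub> d, hs[i := x]) | c hs i d x.
         (c, hs) \<in> tpow_gens k H n \<and> i < n \<and> d \<in> carrier k \<and> x \<in> carrier H})"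

definition tpow ::
  "'k ring \<Rightarrow> ('k, 'h, 'x) module_scheme \<Rightarrow> nat \<Rightarrow> ('k, ('k, 'h list) tens) module" where
  "tpow k H n =
    (let T = quotient_ab (tpow_gens k H n) (tpow_relations k H n)
     in \<lparr>carrier = carrier T, mult = undefined, one = undefined,
         zero = \<zero>\<^bsub>T\<^esub>, add = (\<lambda>X Y. X \<oplus>\<^bsub>T\<^esub> Y),
         smult = (\<lambda>d X. tsum T X (\<lambda>c hs.
           tpow_relations k H n #>\<^bsub>free_Abelian_group (tpow_gens k H n)\<^esub> frag_of (d \<otimes>\<^bsub>k\<^esub> c, hs)))\<rparr>)"

definition tpow_elem ::
  "'k ring \<Rightarrow> ('k, 'h, 'x) module_scheme \<Rightarrow> 'h list \<Rightarrow> ('k, 'h list) tens" where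
  "tpow_elem k H hs =
    tpow_relations k H (length hs) #>\<^bsub>free_Abelian_group (tpow_gens k H (length hs))\<^esub> frag_of (\<one>\<^bsub>k\<^esub>, hs)"

text \<open>The map on a tensor power given on \<open>h\<^sub>1 \<otimes> \<dots> \<otimes> h\<^sub>n\<close> by a multilinear \<open>F\<close>.\<close>

definition tpow_map ::
  "'k ring \<Rightarrow> ('k, 'h, 'x) module_scheme \<Rightarrow> nat \<Rightarrow> ('k, 'g, 'z) module_scheme \<Rightarrow>
    ('h list \<Rightarrow> 'g) \<Rightarrow> ('k, 'h list) tens \<Rightarrow> 'g" where
  "tpow_map k H n G F = (\<lambda>X\<in>carrier (tpow k H n). tsum G X (\<lambda>c hs. c \<odot>\<^bsub>G\<^esub> F hs))"

text \<open>The sum of \<open>F [h\<^sub>1\<^sub>(\<^sub>1\<^sub>), \<dots>, h\<^sub>n\<^sub>(\<^sub>1\<^sub>)] [h\<^sub>1\<^sub>(\<^sub>2\<^sub>), \<dots>, h\<^sub>n\<^sub>(\<^sub>2\<^sub>)]\<close>.\<close>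

primrec sweedler_sum ::
  "('k, 'h) hopf \<Rightarrow> ('g, 'z) ring_scheme \<Rightarrow> 'h list \<Rightarrow> ('h list \<Rightarrow> 'h list \<Rightarrow> 'g) \<Rightarrow> 'g" where
  "sweedler_sum H G [] F = F [] []"
| "sweedler_sum H G (h # hs) F =
     tsum G (comult H h) (\<lambda>x y. sweedler_sum H G hs (\<lambda>xs ys. F (x # xs) (y # ys)))"

type_synonym ('k, 'a, 'h) cochain = "('k, 'h list) tens \<Rightarrow> 'a"

definition conv_monoid ::
  "'k ring \<Rightarrow> ('k, 'h) hopf \<Rightarrow> ('k, 'a, 'h) comod_alg \<Rightarrow> nat \<Rightarrow> ('k, 'a, 'h) cochain monoid" where
  "conv_monoid k H A n =
    (let Z = ZB k H A; T = tpow k H n in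
     \<lparr>carrier = linear_maps k T Z \<inter> extensional (carrier T),
      mult = (\<lambda>f g. tpow_map k H n Z (\<lambda>hs. sweedler_sum H Z hs (\<lambda>xs ys.
                f (tpow_elem k H xs) \<otimes>\<^bsub>Z\<^esub> g (tpow_elem k H ys)))),
      one = tpow_map k H n Z (\<lambda>hs. foldr (\<lambda>h c. counit H h \<otimes>\<^bsub>k\<^esub> c) hs \<one>\<^bsub>k\<^esub> \<odot>\<^bsub>Z\<^esub> \<one>\<^bsub>Z\<^esub>)\<rparr>)"

definition Reg ::
  "'k ring \<Rightarrow> ('k, 'h) hopf \<Rightarrow> ('k, 'a, 'h) comod_alg \<Rightarrow> nat \<Rightarrow> ('k, 'a, 'h) cochain monoid" where
  "Reg k H A n = units_of (conv_monoid k H A n)"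

text \<open>The list positions are counted from 0, so \<open>h\<^sub>i\<close> is \<open>hs ! (i - 1)\<close>.\<close>

definition face ::
  "'k ring \<Rightarrow> ('k, 'h) hopf \<Rightarrow> ('k, 'a, 'h) comod_alg \<Rightarrow> nat \<Rightarrow> nat \<Rightarrow>
    ('k, 'a, 'h) cochain \<Rightarrow> ('k, 'a, 'h) cochain" where
  "face k H A n i f =
    tpow_map k H (Suc n) (ZB k H A) (\<lambda>hs.
      if i = 0 then miyashita_ulbrich k H A (hd hs) (f (tpow_elem k H (tl hs)))
      else if i \<le> n then
        f (tpow_elem k H (take (i - 1) hs @ (hs ! (i - 1) \<otimes>\<^bsub>H\<^esub> hs ! i) # drop (i + 1) hs))
      else counit H (hs ! n) \<odot>\<^bsub>A\<^esub> f (tpow_elem k H (take n hs)))"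

definition sweedler_D ::
  "'k ring \<Rightarrow> ('k, 'h) hopf \<Rightarrow> ('k, 'a, 'h) comod_alg \<Rightarrow> nat \<Rightarrow>
    ('k, 'a, 'h) cochain \<Rightarrow> ('k, 'a, 'h) cochain" where
  "sweedler_D k H A n f =
    (let R = Reg k H A (Suc n) in
     foldr (\<lambda>i g. (if even i then face k H A n i f else inv\<^bsub>R\<^esub> (face k H A n i f)) \<otimes>\<^bsub>R\<^esub> g)
       [0..<n + 2] \<one>\<^bsub>R\<^esub>)"

definition cocycles ::
  "'k ring \<Rightarrow> ('k, 'h) hopf \<Rightarrow> ('k, 'a, 'h) comod_alg \<Rightarrow> nat \<Rightarrow> ('k, 'a, 'h) cochain monoid" where
  "cocycles k H A n = (Reg k H A n)
     \<lparr>carrier := {f \<in> carrier (Reg k H A n). sweedler_D k H A n f = \<one>\<^bsub>Reg k H A (Suc n)\<^esub>}\<rparr>"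

text \<open>The complex starts in degree 0.\<close>

definition coboundaries ::
  "'k ring \<Rightarrow> ('k, 'h) hopf \<Rightarrow> ('k, 'a, 'h) comod_alg \<Rightarrow> nat \<Rightarrow> ('k, 'a, 'h) cochain monoid" where
  "coboundaries k H A n = (Reg k H A n)
     \<lparr>carrier := (case n of 0 \<Rightarrow> {\<one>\<^bsub>Reg k H A 0\<^esub>}
                  | Suc m \<Rightarrow> sweedler_D k H A m ` carrier (Reg k H A m))\<rparr>"

definition cohomology ::
  "'k ring \<Rightarrow> ('k, 'h) hopf \<Rightarrow> ('k, 'a, 'h) comod_alg \<Rightarrow> nat \<Rightarrow> ('k, 'a, 'h) cochain set monoid" where
  "cohomology k H A n = cocycles k H A n Mod carrier (coboundaries k H A n)"


section \<open>Morita contexts and the Picard group\<close>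

record ('k, 'b, 'm, 'n) morita =
  modM :: "('k, 'm, 'b) bimod"
  modN :: "('k, 'n, 'b) bimod"
  alpha :: "('m, 'n) tens \<Rightarrow> 'b"
  beta :: "('n, 'm) tens \<Rightarrow> 'b"

definition strict_morita ::
  "'k ring \<Rightarrow> ('k, 'b, 'y) module_scheme \<Rightarrow> ('k, 'b, 'm, 'n) morita \<Rightarrow> bool" where
  "strict_morita k B X \<longleftrightarrow>
    (let M = modM X; N = modN X in
      bimodule k B M \<and> bimodule k B N \<and>
      alpha X \<in> bimod_iso k B (btens B M N) (regular_bimod B) \<and>
      beta X \<in> bimod_iso k B (btens B N M) (regular_bimod B) \<and>
      (\<forall>m\<in>carrier M. \<forall>n\<in>carrier N. \<forall>m'\<in>carrier M.
         lact M (alpha X (btens_elem B M N m n)) m' = ract M m (beta X (btens_elem B N M n m'))) \<and>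
      (\<forall>n\<in>carrier N. \<forall>m\<in>carrier M. \<forall>n'\<in>carrier N.
         lact N (beta X (btens_elem B N M n m)) n' = ract N n (alpha X (btens_elem B M N m n'))))"

definition morita_iso ::
  "'k ring \<Rightarrow> ('k, 'b, 'y) module_scheme \<Rightarrow> ('k, 'b, 'm, 'n) morita \<Rightarrow> ('k, 'b, 'm2, 'n2) morita \<Rightarrow> bool"
  where
  "morita_iso k B X Y \<longleftrightarrow>
    (\<exists>f\<in>bimod_iso k B (modM X) (modM Y). \<exists>g\<in>bimod_iso k B (modN X) (modN Y).
      (\<forall>T\<in>carrier (btens B (modM X) (modN X)).
         alpha Y (tsum (btens B (modM Y) (modN Y)) T (\<lambda>m n. btens_elem B (modM Y) (modN Y) (f m) (g n)))
           = alpha X T) \<and>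
      (\<forall>T\<in>carrier (btens B (modN X) (modM X)).
         beta Y (tsum (btens B (modN Y) (modM Y)) T (\<lambda>n m. btens_elem B (modN Y) (modM Y) (g n) (f m)))
           = beta X T))"

definition morita_unit :: "('k, 'b, 'y) module_scheme \<Rightarrow> ('k, 'b, 'b, 'b) morita" where
  "morita_unit B =
    \<lparr>modM = regular_bimod B, modN = regular_bimod B,
     alpha = (\<lambda>X. tsum B X (\<lambda>x y. x \<otimes>\<^bsub>B\<^esub> y)), beta = (\<lambda>X. tsum B X (\<lambda>x y. x \<otimes>\<^bsub>B\<^esub> y))\<rparr>"

definition morita_tensor ::
  "('k, 'b, 'y) module_scheme \<Rightarrow> ('k, 'b, 'm, 'n) morita \<Rightarrow> ('k, 'b, 'm2, 'n2) morita \<Rightarrow>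
    ('k, 'b, ('m, 'm2) tens, ('n2, 'n) tens) morita" where
  "morita_tensor B X Y =
    (let M = modM X; N = modN X; M' = modM Y; N' = modN Y in
     \<lparr>modM = btens B M M', modN = btens B N' N,
      alpha = (\<lambda>T. tsum B T (\<lambda>U V. tsum B U (\<lambda>m m'. tsum B V (\<lambda>n' n.
         alpha X (btens_elem B M N m (lact N (alpha Y (btens_elem B M' N' m' n')) n)))))),
      beta = (\<lambda>T. tsum B T (\<lambda>V U. tsum B V (\<lambda>n' n. tsum B U (\<lambda>m m'.
         beta Y (btens_elem B N' M' n' (lact M' (beta X (btens_elem B N M n m)) m'))))))\<rparr>)"

text \<open>In a strict Morita context \<open>M\<close> and \<open>N\<close> are finitely generated projective, hence isomorphic to
  submodules of a finite power of \<open>B\<close>. Contexts whose modules have elements of type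
  \<^typ>\<open>nat \<Rightarrow> 'b\<close> therefore represent all isomorphism classes, and a product class, although formed in
  another type, has representatives in this one.\<close>

type_synonym ('k, 'b) pic_class = "('k, 'b, nat \<Rightarrow> 'b, nat \<Rightarrow> 'b) morita set"

definition morita_class ::
  "'k ring \<Rightarrow> ('k, 'b, 'y) module_scheme \<Rightarrow> ('k, 'b, 'm, 'n) morita \<Rightarrow> ('k, 'b) pic_class" where
  "morita_class k B X = {Y. strict_morita k B Y \<and> morita_iso k B X Y}"

definition Pic :: "'k ring \<Rightarrow> ('k, 'b, 'y) module_scheme \<Rightarrow> ('k, 'b) pic_class monoid" where
  "Pic k B =
    \<lparr>carrier = {morita_class k B (X :: ('k, 'b, nat \<Rightarrow> 'b, nat \<Rightarrow> 'b) morita) | X. strict_morita k B X},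
     mult = (\<lambda>C D. \<Union>X\<in>C. \<Union>Y\<in>D. morita_class k B (morita_tensor B X Y)),
     one = morita_class k B (morita_unit B)\<rparr>"

definition xi ::
  "('b, 'y) ring_scheme \<Rightarrow> ('k, 'b, 'm, 'n) morita \<Rightarrow> 'b \<Rightarrow> 'b" where
  "xi B X x = (THE y. y \<in> carrier (center B) \<and>
     (\<forall>m\<in>carrier (modM X). ract (modM X) m x = lact (modM X) y m))"

definition xi_class :: "('b, 'y) ring_scheme \<Rightarrow> ('k, 'b) pic_class \<Rightarrow> 'b \<Rightarrow> 'b" where
  "xi_class B C = xi B (SOME X. X \<in> C)"


section \<open>The subgroup of stable classes\<close>

definition env :: "'k ring \<Rightarrow> ('k, 'a, 'x) module_scheme \<Rightarrow> ('k, ('a, 'a) tens) module" where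
  "env k A = ktens k A (op_alg A)"

definition env_elem :: "'k ring \<Rightarrow> ('k, 'a, 'x) module_scheme \<Rightarrow> 'a \<Rightarrow> 'a \<Rightarrow> ('a, 'a) tens" where
  "env_elem k A = ktens_elem k A (op_alg A)"

text \<open>The maps sending \<open>a \<otimes> a'\<close> to \<open>a\<^sub>[\<^sub>0\<^sub>] \<otimes> a' \<otimes> a\<^sub>[\<^sub>1\<^sub>]\<close> and to \<open>a \<otimes> a'\<^sub>[\<^sub>0\<^sub>] \<otimes> S(a'\<^sub>[\<^sub>1\<^sub>])\<close>.\<close>

definition env_coact_l ::
  "'k ring \<Rightarrow> ('k, 'h) hopf \<Rightarrow> ('k, 'a, 'h) comod_alg \<Rightarrow> ('a, 'a) tens \<Rightarrow> (('a, 'a) tens, 'h) tens" where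
  "env_coact_l k H A X =
    (let E = env k A; EH = ktens k E H in
     tsum EH X (\<lambda>a a'. tsum EH (coact A a) (\<lambda>b h. ktens_elem k E H (env_elem k A b a') h)))"

definition env_coact_r ::
  "'k ring \<Rightarrow> ('k, 'h) hopf \<Rightarrow> ('k, 'a, 'h) comod_alg \<Rightarrow> ('a, 'a) tens \<Rightarrow> (('a, 'a) tens, 'h) tens" where
  "env_coact_r k H A X =
    (let E = env k A; EH = ktens k E H in
     tsum EH X (\<lambda>a a'. tsum EH (coact A a') (\<lambda>b h.
       ktens_elem k E H (env_elem k A a b) (antipode H h))))"

definition sq :: "'k ring \<Rightarrow> ('k, 'h) hopf \<Rightarrow> ('k, 'a, 'h) comod_alg \<Rightarrow> ('k, ('a, 'a) tens) module" where
  "sq k H A = (env k A)\<lparr>carrier := {X \<in> carrier (env k A). env_coact_l k H A X = env_coact_r k H A X}\<rparr>"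

text \<open>For a subalgebra, a tensor product formed from it is a different set of cosets than the one
  formed from the ambient algebra, so the usual identifications become explicit maps. An expression
  whose single terms lie only in the ambient tensor product, while their sum lies in the smaller
  one, is read as the preimage of the sum under the canonical map. This concerns the coaction of
  \<open>sq\<close>, the map \<open>sq_split\<close> and \<open>phi_B\<close>.\<close>

definition sq_coact ::
  "'k ring \<Rightarrow> ('k, 'h) hopf \<Rightarrow> ('k, 'a, 'h) comod_alg \<Rightarrow> ('a, 'a) tens \<Rightarrow> (('a, 'a) tens, 'h) tens" where
  "sq_coact k H A X =
    inv_into (carrier (ktens k (sq k H A) H))
      (\<lambda>Y. tsum (ktens k (env k A) H) Y (ktens_elem k (env k A) H))
      (env_coact_l k H A X)"

text \<open>The map from the enveloping algebra of \<open>B\<close> to that of \<open>A\<close>, and its action on bimodules.\<close>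

definition env_incl ::
  "'k ring \<Rightarrow> ('k, 'a, 'h) comod_alg \<Rightarrow> ('a, 'a) tens \<Rightarrow> ('a, 'a) tens" where
  "env_incl k A r = tsum (env k A) r (env_elem k A)"

definition env_act :: "('k, 'm, 'b) bimod \<Rightarrow> ('b, 'b) tens \<Rightarrow> 'm \<Rightarrow> 'm" where
  "env_act M r m = tsum M r (\<lambda>b b'. ract M (lact M b m) b')"

definition sqtens_elem ::
  "'k ring \<Rightarrow> ('k, 'h) hopf \<Rightarrow> ('k, 'a, 'h) comod_alg \<Rightarrow> ('k, 'm, 'a) bimod \<Rightarrow>
    ('a, 'a) tens \<Rightarrow> 'm \<Rightarrow> (('a, 'a) tens, 'm) tens" where
  "sqtens_elem k H A M =
    tensor_elem (carrier (env k (coinv k H A))) (\<lambda>x r. x \<otimes>\<^bsub>env k A\<^esub> env_incl k A r) (env_act M)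
      (sq k H A) M"

definition sqtens ::
  "'k ring \<Rightarrow> ('k, 'h) hopf \<Rightarrow> ('k, 'a, 'h) comod_alg \<Rightarrow> ('k, 'm, 'a) bimod \<Rightarrow>
    ('k, (('a, 'a) tens, 'm) tens, 'a) bimod" where
  "sqtens k H A M =
    (let E = env k A;
         T = tensor (carrier (env k (coinv k H A))) (\<lambda>x r. x \<otimes>\<^bsub>E\<^esub> env_incl k A r) (env_act M)
               (sq k H A) M
     in make_bimod T
          (\<lambda>c Y. tsum T Y (\<lambda>x m. sqtens_elem k H A M (c \<odot>\<^bsub>E\<^esub> x) m))
          (\<lambda>b Y. tsum T Y (\<lambda>x m. sqtens_elem k H A M (env_elem k A b \<one>\<^bsub>A\<^esub> \<otimes>\<^bsub>E\<^esub> x) m))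
          (\<lambda>Y b. tsum T Y (\<lambda>x m. sqtens_elem k H A M (env_elem k A \<one>\<^bsub>A\<^esub> b \<otimes>\<^bsub>E\<^esub> x) m)))"

definition sqtens_coact ::
  "'k ring \<Rightarrow> ('k, 'h) hopf \<Rightarrow> ('k, 'a, 'h) comod_alg \<Rightarrow> ('k, 'm, 'a) bimod \<Rightarrow>
    (('a, 'a) tens, 'm) tens \<Rightarrow> ((('a, 'a) tens, 'm) tens, 'h) tens" where
  "sqtens_coact k H A M Y =
    (let P = sqtens k H A M; PH = ktens k P H in
     tsum PH Y (\<lambda>x m. tsum PH (sq_coact k H A x) (\<lambda>u h.
       ktens_elem k P H (sqtens_elem k H A M u m) h)))"

definition bimod_H :: "'k ring \<Rightarrow> ('k, 'h) hopf \<Rightarrow> ('k, 'm, 'b) bimod \<Rightarrow> ('k, ('m, 'h) tens, 'b) bimod" where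
  "bimod_H k H M =
    (let T = ktens k M H
     in make_bimod T (\<lambda>c X. c \<odot>\<^bsub>T\<^esub> X)
          (\<lambda>b X. tsum T X (\<lambda>m h. ktens_elem k M H (lact M b m) h))
          (\<lambda>X b. tsum T X (\<lambda>m h. ktens_elem k M H (ract M m b) h)))"

definition bimod_H_coact ::
  "'k ring \<Rightarrow> ('k, 'h) hopf \<Rightarrow> ('k, 'm, 'b) bimod \<Rightarrow> ('m, 'h) tens \<Rightarrow> (('m, 'h) tens, 'h) tens" where
  "bimod_H_coact k H M X =
    (let P = bimod_H k H M; PH = ktens k P H in
     tsum PH X (\<lambda>m h. tsum PH (comult H h) (\<lambda>h' h''. ktens_elem k P H (ktens_elem k M H m h') h'')))"

text \<open>Isomorphisms in the category of \<open>B\<close>-bimodules with compatible \<open>H\<close>-coaction.\<close>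

definition cobimod_iso ::
  "'k ring \<Rightarrow> ('k, 'h) hopf \<Rightarrow> ('k, 'b, 'y) module_scheme \<Rightarrow>
    ('k, 'p, 'b) bimod \<Rightarrow> ('p \<Rightarrow> ('p, 'h) tens) \<Rightarrow> ('k, 'q, 'b) bimod \<Rightarrow> ('q \<Rightarrow> ('q, 'h) tens) \<Rightarrow>
    ('p \<Rightarrow> 'q) set" where
  "cobimod_iso k H B P rP Q rQ = {f \<in> bimod_iso k B P Q.
     \<forall>p\<in>carrier P. rQ (f p) = tsum (ktens k Q H) (rP p) (\<lambda>x h. ktens_elem k Q H (f x) h)}"

definition kappa ::
  "'k ring \<Rightarrow> ('k, 'h) hopf \<Rightarrow> ('k, 'b, 'y) module_scheme \<Rightarrow> ('k, 'm, 'b) bimod \<Rightarrow> ('k, 'n, 'b) bimod \<Rightarrow>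
    (('m, 'n) tens, 'h) tens \<Rightarrow> (('m, 'h) tens, ('n, 'h) tens) tens" where
  "kappa k H B M N Y =
    (let P = bimod_H k H M; Q = bimod_H k H N; T = btens B P Q in
     tsum T Y (\<lambda>X h. tsum T X (\<lambda>m n. tsum T (comult H h) (\<lambda>h' h''.
       btens_elem B P Q (ktens_elem k M H m h') (ktens_elem k N H n h'')))))"

text \<open>\<open>A\<^sup>e\<close> and its subalgebra \<open>sq\<close> as \<open>B\<close>-bimodules via \<open>b (a \<otimes> a') b' = b a \<otimes> a' b'\<close>; the
  element \<open>sq_split k H A x\<close> of the tensor square of \<open>sq\<close> over \<open>B\<close> is the sum of the
  \<open>(a\<^sub>[\<^sub>0\<^sub>] \<otimes> l\<^sub>i(a\<^sub>[\<^sub>1\<^sub>])) \<otimes>\<^sub>B (r\<^sub>i(a\<^sub>[\<^sub>1\<^sub>]) \<otimes> a')\<close>.\<close>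

definition env_bimod ::
  "'k ring \<Rightarrow> ('k, 'a, 'h) comod_alg \<Rightarrow> ('k, ('a, 'a) tens) module \<Rightarrow> ('k, ('a, 'a) tens, 'a) bimod" where
  "env_bimod k A U =
    make_bimod U (\<lambda>c x. c \<odot>\<^bsub>U\<^esub> x)
      (\<lambda>b x. env_elem k A b \<one>\<^bsub>A\<^esub> \<otimes>\<^bsub>env k A\<^esub> x) (\<lambda>x b. env_elem k A \<one>\<^bsub>A\<^esub> b \<otimes>\<^bsub>env k A\<^esub> x)"

definition sq_split ::
  "'k ring \<Rightarrow> ('k, 'h) hopf \<Rightarrow> ('k, 'a, 'h) comod_alg \<Rightarrow>
    ('a, 'a) tens \<Rightarrow> (('a, 'a) tens, ('a, 'a) tens) tens" where
  "sq_split k H A x =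
    (let B = coinv k H A; E = env_bimod k A (env k A); U = env_bimod k A (sq k H A); EE = btens B E E
     in inv_into (carrier (btens B U U)) (\<lambda>Y. tsum EE Y (btens_elem B E E))
          (tsum EE x (\<lambda>a a'. tsum EE (coact A a) (\<lambda>b h. tsum EE (transl k H A h) (\<lambda>l r.
             btens_elem B E E (env_elem k A b l) (env_elem k A r a'))))))"

definition g_map ::
  "'k ring \<Rightarrow> ('k, 'h) hopf \<Rightarrow> ('k, 'a, 'h) comod_alg \<Rightarrow> ('k, 'm, 'a) bimod \<Rightarrow> ('k, 'n, 'a) bimod \<Rightarrow>
    (('a, 'a) tens, ('m, 'n) tens) tens \<Rightarrow> ((('a, 'a) tens, 'm) tens, (('a, 'a) tens, 'n) tens) tens"
  where
  "g_map k H A M N Y =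
    (let B = coinv k H A; P = sqtens k H A M; Q = sqtens k H A N; T = btens B P Q in
     tsum T Y (\<lambda>x X. tsum T X (\<lambda>m n. tsum T (sq_split k H A x) (\<lambda>u v.
       btens_elem B P Q (sqtens_elem k H A M u m) (sqtens_elem k H A N v n)))))"

text \<open>\<open>g\<close> takes values in the cotensor part of the tensor product over \<open>B\<close>, colinear maps preserve
  that part, and \<open>kappa\<close> is a bijection onto it. Since \<open>kappa\<close> is injective, its inverse can be
  applied without restricting the codomains.\<close>

definition phi_tensor ::
  "'k ring \<Rightarrow> ('k, 'h) hopf \<Rightarrow> ('k, 'a, 'h) comod_alg \<Rightarrow> ('k, 'm, 'a) bimod \<Rightarrow> ('k, 'n, 'a) bimod \<Rightarrow>
    ((('a, 'a) tens, 'm) tens \<Rightarrow> ('m, 'h) tens) \<Rightarrow> ((('a, 'a) tens, 'n) tens \<Rightarrow> ('n, 'h) tens) \<Rightarrow>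
    (('a, 'a) tens, ('m, 'n) tens) tens \<Rightarrow> (('m, 'n) tens, 'h) tens" where
  "phi_tensor k H A M N \<phi>M \<phi>N Y =
    (let B = coinv k H A; MH = bimod_H k H M; NH = bimod_H k H N
     in inv_into (carrier (bimod_H k H (btens B M N))) (kappa k H B M N)
          (tsum (btens B MH NH) (g_map k H A M N Y) (\<lambda>p q. btens_elem B MH NH (\<phi>M p) (\<phi>N q))))"

definition phi_B ::
  "'k ring \<Rightarrow> ('k, 'h) hopf \<Rightarrow> ('k, 'a, 'h) comod_alg \<Rightarrow> (('a, 'a) tens, 'a) tens \<Rightarrow> ('a, 'h) tens" where
  "phi_B k H A Y =
    (let AH = ktens k A H in
     inv_into (carrier (ktens k (coinv k H A) H)) (\<lambda>Z. tsum AH Z (ktens_elem k A H))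
       (tsum AH Y (\<lambda>x b. tsum AH x (\<lambda>a a'. tsum AH (coact A a) (\<lambda>a0 h.
          ktens_elem k A H (a0 \<otimes>\<^bsub>A\<^esub> b \<otimes>\<^bsub>A\<^esub> a') h)))))"

text \<open>Compatibility of \<open>\<phi>M\<close> and \<open>\<phi>N\<close> with a bimodule map \<open>\<gamma>\<close> from \<open>M \<otimes>\<^sub>B N\<close> to \<open>B\<close>.\<close>

definition phi_compat ::
  "'k ring \<Rightarrow> ('k, 'h) hopf \<Rightarrow> ('k, 'a, 'h) comod_alg \<Rightarrow> ('k, 'm, 'a) bimod \<Rightarrow> ('k, 'n, 'a) bimod \<Rightarrow>
    ((('a, 'a) tens, 'm) tens \<Rightarrow> ('m, 'h) tens) \<Rightarrow> ((('a, 'a) tens, 'n) tens \<Rightarrow> ('n, 'h) tens) \<Rightarrow>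
    (('m, 'n) tens \<Rightarrow> 'a) \<Rightarrow> bool" where
  "phi_compat k H A M N \<phi>M \<phi>N \<gamma> \<longleftrightarrow>
    (let B = coinv k H A; RB = regular_bimod B in
     \<forall>Y\<in>carrier (sqtens k H A (btens B M N)).
       phi_B k H A (tsum (sqtens k H A RB) Y (\<lambda>x T. sqtens_elem k H A RB x (\<gamma> T))) =
       tsum (ktens k B H) (phi_tensor k H A M N \<phi>M \<phi>N Y) (\<lambda>T h. ktens_elem k B H (\<gamma> T) h))"

definition H_stable ::
  "'k ring \<Rightarrow> ('k, 'h) hopf \<Rightarrow> ('k, 'a, 'h) comod_alg \<Rightarrow> ('k, 'a, 'm, 'n) morita \<Rightarrow> bool" where
  "H_stable k H A X \<longleftrightarrow>
    (let B = coinv k H A; M = modM X; N = modN X in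
     \<exists>\<phi>M \<in> cobimod_iso k H B (sqtens k H A M) (sqtens_coact k H A M) (bimod_H k H M) (bimod_H_coact k H M).
     \<exists>\<phi>N \<in> cobimod_iso k H B (sqtens k H A N) (sqtens_coact k H A N) (bimod_H k H N) (bimod_H_coact k H N).
       phi_compat k H A M N \<phi>M \<phi>N (alpha X) \<and> phi_compat k H A N M \<phi>N \<phi>M (beta X))"

definition PicH ::
  "'k ring \<Rightarrow> ('k, 'h) hopf \<Rightarrow> ('k, 'a, 'h) comod_alg \<Rightarrow> ('k, 'a) pic_class monoid" where
  "PicH k H A = (let B = coinv k H A in
    (Pic k B)\<lparr>carrier := {morita_class k B (X :: ('k, 'a, nat \<Rightarrow> 'a, nat \<Rightarrow> 'a) morita) | X.
       strict_morita k B X \<and> H_stable k H A X}\<rparr>)"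


section \<open>The induced actions\<close>

definition act_cochain ::
  "'k ring \<Rightarrow> ('k, 'h) hopf \<Rightarrow> ('k, 'a, 'h) comod_alg \<Rightarrow> nat \<Rightarrow> ('k, 'a) pic_class \<Rightarrow>
    ('k, 'a, 'h) cochain \<Rightarrow> ('k, 'a, 'h) cochain" where
  "act_cochain k H A n C f = compose (carrier (tpow k H n)) (xi_class (coinv k H A) C) f"

text \<open>\<open>G\<close> acts on the group \<open>E\<close> by automorphisms. The unit law is stated separately because
  \<^const>\<open>hom\<close> does not presuppose that its arguments are groups.\<close>

definition acts_by_automorphisms ::
  "('g, 'x) monoid_scheme \<Rightarrow> ('e, 'y) monoid_scheme \<Rightarrow> ('g \<Rightarrow> 'e \<Rightarrow> 'e) \<Rightarrow> bool" where
  "acts_by_automorphisms G E act \<longleftrightarrow>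
    (\<lambda>c. restrict (act c) (carrier E)) \<in> hom G (AutoGroup E) \<and>
    restrict (act \<one>\<^bsub>G\<^esub>) (carrier E) = \<one>\<^bsub>AutoGroup E\<^esub>"

end

theory Submission imports Defs begin

text \<open>
  Pushing cochains forward along a map \<open>\<xi> : Z(B) \<rightarrow> Z(B)\<close> respects convolution when \<open>\<xi>\<close> is an algebra
  automorphism, and it respects the faces of the Sweedler complex when \<open>\<xi>\<close> commutes with the
  Miyashita-Ulbrich action of \<open>H\<close> as well (\<open>push_mult\<close>, \<open>push_face\<close>). So the theorem reduces to the
  equivariance of \<open>\<xi>\<^sub>M\<close> for an \<open>H\<close>-stable context (\<open>stable_equivariant\<close>) and to the fact that
  \<open>M \<mapsto> \<xi>\<^sub>M\<close> is a well-defined homomorphism on classes.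

  Equivariance. In \<open>A\<close> a central element \<open>x\<close> of \<open>B\<close> can be moved past any \<open>a\<close>:
  \<open>a x = (a\<^sub>[\<^sub>1\<^sub>] \<cdot> x) a\<^sub>[\<^sub>0\<^sub>]\<close> and \<open>x a = a\<^sub>[\<^sub>0\<^sub>] (S(a\<^sub>[\<^sub>1\<^sub>]) \<cdot> x)\<close>. The coaction \<open>u \<mapsto> u\<^sub>0 \<otimes> u\<^sub>1\<close> of \<open>A\<^sup>\<box>\<^sup>e\<close> can be
  computed from the coaction of either tensor factor of \<open>A \<otimes> A\<^sup>o\<^sup>p\<close>, with an antipode for the second one.
  The first description turns the first rule into \<open>(u\<^sub>1 \<cdot> z \<otimes> 1) u\<^sub>0 = u (z \<otimes> 1)\<close>, the second one turns
  the second rule into \<open>(1 \<otimes> u\<^sub>1 \<cdot> y) u\<^sub>0 = u (1 \<otimes> y)\<close>. Now let \<open>m y = z m\<close> for all \<open>m\<close> in \<open>M\<close>, that is,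
  \<open>z = \<xi>\<^sub>M(y)\<close>. Then \<open>u (z \<otimes> 1) \<otimes> m = u \<otimes> z m = u \<otimes> m y = u (1 \<otimes> y) \<otimes> m\<close> in \<open>P = A\<^sup>\<box>\<^sup>e \<otimes> M\<close> over the
  enveloping algebra of \<open>B\<close>, so that \<open>(p\<^sub>1 \<cdot> z) p\<^sub>0 = p\<^sub>0 (p\<^sub>1 \<cdot> y)\<close> for all \<open>p\<close> in \<open>P\<close> (\<open>rho_act\<close>). A colinear
  isomorphism of bimodules carries this law to \<open>M \<otimes> H\<close>. There, evaluated at \<open>m \<otimes> g\<close> and with the
  counit applied, it reads \<open>(g \<cdot> z) m = m (g \<cdot> y)\<close> (\<open>stable_action\<close>), which says that
  \<open>\<xi>\<^sub>M(g \<cdot> y) = g \<cdot> \<xi>\<^sub>M(y)\<close>. That the coaction of \<open>A\<^sup>\<box>\<^sup>e\<close> takes values in \<open>A\<^sup>\<box>\<^sup>e \<otimes> H\<close> rests on two facts: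
  over a field tensoring preserves equalizers (\<open>equalizer_tensor\<close>), and \<open>H\<close> is cocommutative
  (\<open>SQ_subcomodule\<close>).

  Classes. Isomorphic contexts have the same \<open>\<xi>\<close>, and \<open>\<xi>\<close> is multiplicative for tensor products of
  contexts (\<open>xi_iso\<close>, \<open>strict_tensor\<close>). A product class consists of contexts on \<open>B\<close>-valued sequences,
  whereas a tensor product lives on cosets; since a finitely generated projective module embeds into
  finite sequences, the class has members (\<open>morita_class_nonempty\<close>), and \<open>xi_class\<close> is multiplicative.

  Before this, the tensor products over \<open>k\<close>, over \<open>B\<close> and over enveloping algebras and the tensor
  powers of \<open>H\<close> are shown to have their universal properties; the operator \<open>tsum\<close> then behaves as a
  sum over the terms of a tensor, and Sweedler notation becomes a calculus of nested \<open>tsum\<close>.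
\<close>

section \<open>Tensor products and their universal property\<close>

subsection \<open>Evaluating formal sums\<close>

lemma foldSetD_congD:
  assumes "(B, y) \<in> foldSetD D (h \<circ> f) e" "B \<subseteq> A" "\<And>x. x \<in> A \<Longrightarrow> f x = g x"
  shows "(B, y) \<in> foldSetD D (h \<circ> g) e"
  using assms
proof (induction rule: foldSetD.induct)
  case emptyI
  then show ?case by (auto intro: foldSetD.emptyI)
next
  case (insertI x A' y)
  have "h (g x) y \<in> D" using insertI by (metis comp_apply insert_subset)
  moreover have "(A', y) \<in> foldSetD D (h \<circ> g) e" using insertI by blast
  ultimately have "(insert x A', (h \<circ> g) x y) \<in> foldSetD D (h \<circ> g) e"
    using insertI(1) by (intro foldSetD.insertI) (auto simp: comp_def)
  moreover have "(h \<circ> g) x y = (h \<circ> f) x y" using insertI by auto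
  ultimately show ?case by metis
qed

text \<open>A finite sum is a fold that looks only at values on the index set; terms below \<open>tsum\<close> can therefore
  be rewritten before closure is known.\<close>

lemma finsum_cong_weak:
  assumes "\<And>x. x \<in> A \<Longrightarrow> f x = g x"
  shows "finsum G f A = finsum G g A"
proof -
  have "foldD D (h \<circ> f) e A = foldD D (h \<circ> g) e A" for D :: "'b set" and h :: "'b \<Rightarrow> 'b \<Rightarrow> 'b" and e
  proof -
    have "(A, y) \<in> foldSetD D (h \<circ> f) e \<longleftrightarrow> (A, y) \<in> foldSetD D (h \<circ> g) e" for y
      using foldSetD_congD[of A y D h f e A g] foldSetD_congD[of A y D h g e A f] assms by auto
    then show ?thesis by (simp add: foldD_def)
  qed
  then show ?thesis by (simp add: finsum_def finprod_def)
qed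

lemmas free_Abelian_group_cases_induct [consumes 1, case_names zero diff frag] =
  free_Abelian_group_induct

lemma keys_frag2: "p \<in> S \<Longrightarrow> q \<in> S \<Longrightarrow> Poly_Mapping.keys (frag_of p + frag_of q) \<subseteq> S"
  using keys_add[of "frag_of p" "frag_of q"] by auto

lemma keys_relator2: "p \<in> S \<Longrightarrow> q \<in> S \<Longrightarrow> Poly_Mapping.keys (frag_of p - frag_of q) \<subseteq> S"
  using keys_diff[of "frag_of p" "frag_of q"] by auto

lemma keys_relator3: "p \<in> S \<Longrightarrow> q \<in> S \<Longrightarrow> r \<in> S \<Longrightarrow> Poly_Mapping.keys (frag_of p - (frag_of q + frag_of r)) \<subseteq> S"
  using keys_diff[of "frag_of p" "frag_of q + frag_of r"] keys_frag2[of q S r] by auto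

definition formal_sum :: "('g, 'z) ring_scheme \<Rightarrow> ('p \<Rightarrow> 'g) \<Rightarrow> ('p \<Rightarrow>\<^sub>0 int) \<Rightarrow> 'g" where
  "formal_sum G f c = (\<Oplus>\<^bsub>G\<^esub>p\<in>Poly_Mapping.keys c. [Poly_Mapping.lookup c p] \<cdot>\<^bsub>G\<^esub> f p)"

lemma formal_sum_cong:
  assumes "Poly_Mapping.keys c \<subseteq> S" "\<And>p. p \<in> S \<Longrightarrow> f p = g p"
  shows "formal_sum G f c = formal_sum G g c"
  unfolding formal_sum_def using assms by (intro finsum_cong_weak) auto

context abelian_group
begin

lemma add_int_pow_mult:
  "x \<in> carrier G \<Longrightarrow> [(i + j :: int)] \<cdot> x = [i] \<cdot> x \<oplus> [j] \<cdot> x"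
  using group.int_pow_mult[OF a_group, of x i j] by (simp add: add_pow_def)

lemma formal_sum_superset:
  assumes "finite T" "Poly_Mapping.keys c \<subseteq> T" "f \<in> T \<rightarrow> carrier G"
  shows "formal_sum G f c = (\<Oplus>p\<in>T. [Poly_Mapping.lookup c p] \<cdot> f p)"
  unfolding formal_sum_def
proof (rule add.finprod_mono_neutral_cong_left)
  show "[Poly_Mapping.lookup c i] \<cdot> f i = \<zero>" if "i \<in> T - Poly_Mapping.keys c" for i
    using that assms by (auto simp: in_keys_iff add_pow_def)
qed (use assms in auto)

lemma formal_sum_closed:
  assumes "Poly_Mapping.keys c \<subseteq> S" "f \<in> S \<rightarrow> carrier G"
  shows "formal_sum G f c \<in> carrier G"
  unfolding formal_sum_def using assms by (auto intro!: finsum_closed)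

lemma formal_sum_add:
  assumes "Poly_Mapping.keys c \<subseteq> S" "Poly_Mapping.keys d \<subseteq> S" "f \<in> S \<rightarrow> carrier G"
  shows "formal_sum G f (c + d) = formal_sum G f c \<oplus> formal_sum G f d"
proof -
  let ?T = "Poly_Mapping.keys c \<union> Poly_Mapping.keys d"
  have f: "f \<in> ?T \<rightarrow> carrier G" using assms by auto
  have "formal_sum G f (c + d) = (\<Oplus>p\<in>?T. [Poly_Mapping.lookup (c + d) p] \<cdot> f p)"
    using f keys_add[of c d] by (intro formal_sum_superset) auto
  also have "\<dots> = (\<Oplus>p\<in>?T. [Poly_Mapping.lookup c p] \<cdot> f p \<oplus> [Poly_Mapping.lookup d p] \<cdot> f p)"
    using f by (intro finsum_cong_weak) (auto simp: lookup_add intro!: add_int_pow_mult)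
  also have "\<dots> = (\<Oplus>p\<in>?T. [Poly_Mapping.lookup c p] \<cdot> f p) \<oplus> (\<Oplus>p\<in>?T. [Poly_Mapping.lookup d p] \<cdot> f p)"
    using f by (intro finsum_addf) auto
  also have "\<dots> = formal_sum G f c \<oplus> formal_sum G f d"
    using f by (simp add: formal_sum_superset[of ?T])
  finally show ?thesis .
qed

lemma formal_sum_zero [simp]: "formal_sum G f 0 = \<zero>"
  by (simp add: formal_sum_def)

lemma formal_sum_frag_of [simp]: "f p \<in> carrier G \<Longrightarrow> formal_sum G f (frag_of p) = f p"
  by (simp add: formal_sum_def)

lemma formal_sum_minus:
  assumes "Poly_Mapping.keys c \<subseteq> S" "f \<in> S \<rightarrow> carrier G"
  shows "formal_sum G f (- c) = \<ominus> formal_sum G f c"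
proof -
  have "formal_sum G f (- c) \<oplus> formal_sum G f c = formal_sum G f (- c + c)"
    using formal_sum_add[of "- c" S c f] assms by simp
  then have "formal_sum G f (- c) \<oplus> formal_sum G f c = \<zero>" by simp
  then show ?thesis
    using assms by (metis formal_sum_closed keys_minus minus_equality)
qed

lemma formal_sum_diff:
  assumes "Poly_Mapping.keys c \<subseteq> S" "Poly_Mapping.keys d \<subseteq> S" "f \<in> S \<rightarrow> carrier G"
  shows "formal_sum G f (c - d) = formal_sum G f c \<ominus> formal_sum G f d"
  using formal_sum_add[of c S "- d" f] formal_sum_minus[of d S f] assms
  by (simp add: a_minus_def)

lemma formal_sum_relator2:
  assumes "f \<in> S \<rightarrow> carrier G" "p \<in> S" "q \<in> S" "f p = f q"
  shows "formal_sum G f (frag_of p - frag_of q) = \<zero>"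
  using assms formal_sum_diff[of "frag_of p" S "frag_of q" f] funcset_mem[OF assms(1,3)]
  by (simp add: a_minus_def r_neg)

lemma formal_sum_relator3:
  assumes f: "f \<in> S \<rightarrow> carrier G" and p: "p \<in> S" "q \<in> S" "r \<in> S" and eq: "f p = f q \<oplus> f r"
  shows "formal_sum G f (frag_of p - (frag_of q + frag_of r)) = \<zero>"
  using p eq keys_frag2[OF p(2,3)] funcset_mem[OF f]
  by (simp add: formal_sum_diff[OF _ _ f] formal_sum_add[OF _ _ f] a_minus_def r_neg)

lemma formal_sum_pointwise_add:
  assumes "Poly_Mapping.keys c \<subseteq> S" "f \<in> S \<rightarrow> carrier G" "g \<in> S \<rightarrow> carrier G"
  shows "formal_sum G (\<lambda>p. f p \<oplus> g p) c = formal_sum G f c \<oplus> formal_sum G g c"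
proof -
  have "formal_sum G (\<lambda>p. f p \<oplus> g p) c =
      (\<Oplus>p\<in>Poly_Mapping.keys c. [Poly_Mapping.lookup c p] \<cdot> f p \<oplus> [Poly_Mapping.lookup c p] \<cdot> g p)"
    unfolding formal_sum_def
  proof (intro finsum_cong_weak)
    fix p assume "p \<in> Poly_Mapping.keys c"
    then have "f p \<in> carrier G" "g p \<in> carrier G" using assms by auto
    then show "[Poly_Mapping.lookup c p] \<cdot> (f p \<oplus> g p) =
        [Poly_Mapping.lookup c p] \<cdot> f p \<oplus> [Poly_Mapping.lookup c p] \<cdot> g p"
      by (intro add.int_pow_mult_distrib a_comm)
  qed
  then show ?thesis
    using assms unfolding formal_sum_def by (subst finsum_addf[symmetric]) auto
qed

lemma formal_sum_pointwise_zero: "formal_sum G (\<lambda>p. \<zero>) c = \<zero>"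
  by (simp add: formal_sum_def)

end

lemma abelian_group_cong:
  assumes "abelian_group G" "carrier G = carrier G'" "add G = add G'" "zero G = zero G'"
  shows "abelian_group G'"
proof -
  interpret G: abelian_group G by fact
  show ?thesis
    using assms(2-4) G.l_neg G.a_inv_closed
    by (intro abelian_groupI) (auto simp: G.a_ac simp flip: assms(2-4) intro!: bexI)
qed

definition additive :: "('m, 'x) ring_scheme \<Rightarrow> ('n, 'y) ring_scheme \<Rightarrow> ('m \<Rightarrow> 'n) \<Rightarrow> bool" where
  "additive V W f \<longleftrightarrow> f \<in> additive_maps V W"

lemma additiveI [intro?]:
  assumes "\<And>x. x \<in> carrier V \<Longrightarrow> f x \<in> carrier W"
    and "\<And>x y. x \<in> carrier V \<Longrightarrow> y \<in> carrier V \<Longrightarrow> f (x \<oplus>\<^bsub>V\<^esub> y) = f x \<oplus>\<^bsub>W\<^esub> f y"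
  shows "additive V W f"
  using assms by (auto simp: additive_def additive_maps_def)

lemma additive_closed: "additive V W f \<Longrightarrow> x \<in> carrier V \<Longrightarrow> f x \<in> carrier W"
  by (auto simp: additive_def additive_maps_def)

lemma additive_add:
  "additive V W f \<Longrightarrow> x \<in> carrier V \<Longrightarrow> y \<in> carrier V \<Longrightarrow> f (x \<oplus>\<^bsub>V\<^esub> y) = f x \<oplus>\<^bsub>W\<^esub> f y"
  by (auto simp: additive_def additive_maps_def)

lemma additive_zero:
  assumes "additive V W f" "abelian_group V" "abelian_group W"
  shows "f \<zero>\<^bsub>V\<^esub> = \<zero>\<^bsub>W\<^esub>"
proof -
  interpret V: abelian_group V by fact
  interpret W: abelian_group W by fact
  have "f \<zero>\<^bsub>V\<^esub> \<oplus>\<^bsub>W\<^esub> f \<zero>\<^bsub>V\<^esub> = f \<zero>\<^bsub>V\<^esub>"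
    using additive_add[OF assms(1), of "\<zero>\<^bsub>V\<^esub>" "\<zero>\<^bsub>V\<^esub>"] by simp
  then show ?thesis using additive_closed[OF assms(1) V.zero_closed]
    by (metis W.add.r_cancel_one)
qed

lemma additive_minus:
  assumes "additive V W f" "abelian_group V" "abelian_group W" "x \<in> carrier V"
  shows "f (\<ominus>\<^bsub>V\<^esub> x) = \<ominus>\<^bsub>W\<^esub> f x"
proof -
  interpret V: abelian_group V by fact
  interpret W: abelian_group W by fact
  have "f (\<ominus>\<^bsub>V\<^esub> x) \<oplus>\<^bsub>W\<^esub> f x = \<zero>\<^bsub>W\<^esub>"
    using additive_add[OF assms(1), of "\<ominus>\<^bsub>V\<^esub> x" x] assms(4) additive_zero[OF assms(1-3)]
    by (simp add: V.l_neg)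
  then show ?thesis
    using additive_closed[OF assms(1)] assms(4) by (metis V.a_inv_closed W.minus_equality)
qed

lemma additive_id: "additive V V (\<lambda>x. x)"
  by (rule additiveI) auto

lemma additive_comp:
  "additive V W f \<Longrightarrow> additive W U g \<Longrightarrow> additive V U (\<lambda>x. g (f x))"
  by (auto simp: additive_def additive_maps_def Pi_def)

lemma additive_plus: "additive V G f \<Longrightarrow> additive V G g \<Longrightarrow> abelian_group G \<Longrightarrow> additive V G (\<lambda>x. f x \<oplus>\<^bsub>G\<^esub> g x)"
proof (rule additiveI)
  assume f: "additive V G f" and g: "additive V G g" and "abelian_group G"
  then interpret G: abelian_group G by simp
  show "f x \<oplus>\<^bsub>G\<^esub> g x \<in> carrier G" if "x \<in> carrier V" for x
    using additive_closed[OF f that] additive_closed[OF g that] by simp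
  show "f (x \<oplus>\<^bsub>V\<^esub> y) \<oplus>\<^bsub>G\<^esub> g (x \<oplus>\<^bsub>V\<^esub> y) = f x \<oplus>\<^bsub>G\<^esub> g x \<oplus>\<^bsub>G\<^esub> (f y \<oplus>\<^bsub>G\<^esub> g y)"
    if "x \<in> carrier V" "y \<in> carrier V" for x y
    using that additive_closed[OF f] additive_closed[OF g]
    by (simp add: additive_add[OF f] additive_add[OF g] G.a_ac)
qed

lemma formal_sum_hom:
  assumes "abelian_group G" "abelian_group G'" "additive G G' \<phi>"
    and c: "Poly_Mapping.keys c \<subseteq> S" and f: "f \<in> S \<rightarrow> carrier G"
  shows "\<phi> (formal_sum G f c) = formal_sum G' (\<lambda>p. \<phi> (f p)) c"
proof -
  interpret G: abelian_group G by fact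
  interpret G': abelian_group G' by fact
  have g: "(\<lambda>p. \<phi> (f p)) \<in> S \<rightarrow> carrier G'"
    using f additive_closed[OF assms(3)] by auto
  show ?thesis using c
  proof (induction c rule: free_Abelian_group_cases_induct)
    case zero
    then show ?case using additive_zero[OF assms(3,1,2)] by simp
  next
    case (diff x y)
    have fs: "formal_sum G f x \<in> carrier G" "formal_sum G f y \<in> carrier G"
      using diff f by (auto intro!: G.formal_sum_closed)
    show ?case
      using diff fs by (simp add: G.formal_sum_diff[OF _ _ f] G'.formal_sum_diff[OF _ _ g] a_minus_def
          additive_add[OF assms(3)] additive_minus[OF assms(3,1,2)])
  next
    case (frag a)
    then have "f a \<in> carrier G" "\<phi> (f a) \<in> carrier G'" using f g by auto
    then show ?case by simp
  qed
qed

lemma (in abelian_group) formal_sum_swap: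
  assumes c: "Poly_Mapping.keys c \<subseteq> S" and d: "Poly_Mapping.keys d \<subseteq> T"
    and f: "\<And>p q. p \<in> S \<Longrightarrow> q \<in> T \<Longrightarrow> f p q \<in> carrier G"
  shows "formal_sum G (\<lambda>p. formal_sum G (\<lambda>q. f p q) d) c =
    formal_sum G (\<lambda>q. formal_sum G (\<lambda>p. f p q) c) d"
  using c
proof (induction c rule: free_Abelian_group_cases_induct)
  case zero
  show ?case by (simp add: formal_sum_pointwise_zero)
next
  case (diff x y)
  have 1: "(\<lambda>p. formal_sum G (\<lambda>q. f p q) d) \<in> S \<rightarrow> carrier G"
    using f by (auto intro!: formal_sum_closed[OF d])
  have 2: "(\<lambda>q. formal_sum G (\<lambda>p. f p q) z) \<in> T \<rightarrow> carrier G" if "Poly_Mapping.keys z \<subseteq> S" for z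
    using f by (auto intro!: formal_sum_closed[OF that])
  have "formal_sum G (\<lambda>q. formal_sum G (\<lambda>p. f p q) (x - y)) d =
     formal_sum G (\<lambda>q. formal_sum G (\<lambda>p. f p q) x \<oplus> formal_sum G (\<lambda>p. f p q) (- y)) d"
    using diff f by (intro formal_sum_cong[OF d]) (simp add: formal_sum_add[where S = S, symmetric])
  also have "\<dots> = formal_sum G (\<lambda>q. formal_sum G (\<lambda>p. f p q) x) d \<oplus>
      formal_sum G (\<lambda>q. formal_sum G (\<lambda>p. f p q) (- y)) d"
    using diff by (intro formal_sum_pointwise_add[OF d] 2) auto
  also have "formal_sum G (\<lambda>q. formal_sum G (\<lambda>p. f p q) (- y)) d =
      formal_sum G (\<lambda>q. \<ominus> formal_sum G (\<lambda>p. f p q) y) d"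
    using diff f by (intro formal_sum_cong[OF d]) (simp add: formal_sum_minus[where S = S])
  also have "\<dots> = \<ominus> formal_sum G (\<lambda>q. formal_sum G (\<lambda>p. f p q) y) d"
  proof (rule formal_sum_hom[OF _ _ _ d, symmetric])
    show "additive G G (a_inv G)" by (rule additiveI) (auto simp: minus_add)
  qed (use diff 2 in \<open>auto intro: abelian_group_axioms\<close>)
  finally show ?case using diff
    by (simp add: formal_sum_diff[OF _ _ 1] a_minus_def)
next
  case (frag a)
  then have "formal_sum G (\<lambda>q. formal_sum G (\<lambda>p. f p q) (frag_of a)) d = formal_sum G (f a) d"
    using f by (intro formal_sum_cong[OF d]) auto
  moreover have "formal_sum G (f a) d \<in> carrier G" using frag f by (auto intro!: formal_sum_closed[OF d])
  ultimately show ?case by simp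
qed


subsection \<open>Abelian groups given by generators and relations\<close>

text \<open>The same choice as in \<open>tsum\<close>, which makes \<open>tsum\<close> a formal sum at \<open>rep X\<close>.\<close>

definition rep :: "('s \<Rightarrow>\<^sub>0 int) set \<Rightarrow> ('s \<Rightarrow>\<^sub>0 int)" where "rep X = (SOME c. c \<in> X)"

text \<open>The common pattern of tensor products and tensor powers: \<open>K\<close> is the subgroup generated by the relators.\<close>

locale presentation =
  fixes S :: "'s set" and Rel :: "('s \<Rightarrow>\<^sub>0 int) set" and K
  assumes Rel: "\<And>r. r \<in> Rel \<Longrightarrow> Poly_Mapping.keys r \<subseteq> S"
    and K: "K = generate (free_Abelian_group S) Rel"
begin

abbreviation "F \<equiv> free_Abelian_group S"
abbreviation "Q \<equiv> quotient_ab S K"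

lemma K_subgroup: "subgroup K F"
  unfolding K by (rule group.generate_is_subgroup) (use Rel in auto)

lemma K_normal: "K \<lhd> F"
  by (rule comm_group.subgroup_imp_normal[OF abelian_free_Abelian_group K_subgroup])

lemma comm_group_FK: "comm_group (F Mod K)"
  by (rule comm_group.abelian_FactGroup[OF abelian_free_Abelian_group K_subgroup])

lemma add_monoid_Q: "add_monoid Q = F Mod K"
  by (simp add: quotient_ab_def Let_def FactGroup_def)

lemma abelian_group_Q: "abelian_group Q"
  using comm_group_FK add_monoid_Q
  by (metis abelian_group_def abelian_group_axioms_def abelian_monoid_def comm_group_def)

lemma carrier_Q: "carrier Q = {K #>\<^bsub>F\<^esub> c | c. Poly_Mapping.keys c \<subseteq> S}"
  by (auto simp: quotient_ab_def Let_def FactGroup_def RCOSETS_def)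

lemma coset_add:
  assumes "Poly_Mapping.keys c \<subseteq> S" "Poly_Mapping.keys d \<subseteq> S"
  shows "(K #>\<^bsub>F\<^esub> c) \<oplus>\<^bsub>Q\<^esub> (K #>\<^bsub>F\<^esub> d) = K #>\<^bsub>F\<^esub> (c + d)"
  using normal.rcos_sum[OF K_normal, of c d] assms
  by (simp add: quotient_ab_def Let_def FactGroup_def)

lemma zero_Q: "\<zero>\<^bsub>Q\<^esub> = K #>\<^bsub>F\<^esub> 0"
proof -
  have "K #>\<^bsub>F\<^esub> \<one>\<^bsub>F\<^esub> = K"
    by (metis K_subgroup group.coset_mult_one group_free_Abelian_group subgroup.subset)
  then show ?thesis by (simp add: quotient_ab_def Let_def FactGroup_def)
qed

lemma coset_mem:
  assumes "X \<in> carrier Q" "c \<in> X"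
  shows "Poly_Mapping.keys c \<subseteq> S" "X = K #>\<^bsub>F\<^esub> c"
proof -
  obtain d where d: "X = K #>\<^bsub>F\<^esub> d" "Poly_Mapping.keys d \<subseteq> S" using assms(1) carrier_Q by auto
  have "c \<in> carrier F"
    using monoid.r_coset_subset_G[OF group.is_monoid[OF group_free_Abelian_group]
        subgroup.subset[OF K_subgroup], of d] d assms(2) carrier_free_Abelian_group_iff by (metis subsetD)
  then show "Poly_Mapping.keys c \<subseteq> S" by simp
  show "X = K #>\<^bsub>F\<^esub> c"
    using group.repr_independence[OF group_free_Abelian_group, of c S K d] d assms K_subgroup by auto
qed

lemma relator_coset:
  assumes "a - b \<in> Rel" "Poly_Mapping.keys b \<subseteq> S"
  shows "K #>\<^bsub>F\<^esub> a = K #>\<^bsub>F\<^esub> b"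
proof -
  interpret Q: abelian_group Q by (rule abelian_group_Q)
  have "K #>\<^bsub>F\<^esub> r = K" if "r \<in> K" for r
    by (rule subgroup.rcos_const[OF K_subgroup group_free_Abelian_group that])
  moreover have "a - b \<in> K" unfolding K using assms(1) by (rule generate.incl)
  ultimately have z: "K #>\<^bsub>F\<^esub> (a - b) = \<zero>\<^bsub>Q\<^esub>"
    using subgroup.one_closed[OF K_subgroup] by (simp add: zero_Q)
  have "K #>\<^bsub>F\<^esub> (a - b + b) = \<zero>\<^bsub>Q\<^esub> \<oplus>\<^bsub>Q\<^esub> (K #>\<^bsub>F\<^esub> b)"
    using coset_add[OF Rel[OF assms(1)] assms(2)] z by simp
  also have "\<dots> = K #>\<^bsub>F\<^esub> b"
    using assms(2) carrier_Q by (intro Q.l_zero) auto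
  finally show ?thesis by simp
qed

lemma coset_self: "Poly_Mapping.keys c \<subseteq> S \<Longrightarrow> c \<in> K #>\<^bsub>F\<^esub> c"
  by (simp add: group.rcos_self[OF group_free_Abelian_group _ K_subgroup])

lemma rep_mem: "X \<in> carrier Q \<Longrightarrow> rep X \<in> X"
  unfolding rep_def using carrier_Q coset_self by (metis (mono_tags, lifting) mem_Collect_eq someI_ex)

lemma rep_keys: "X \<in> carrier Q \<Longrightarrow> Poly_Mapping.keys (rep X) \<subseteq> S"
  using rep_mem coset_mem by blast

lemma Q_induct [consumes 1, case_names gen add minus zero]:
  assumes X: "X \<in> carrier Q"
    and gen: "\<And>s. s \<in> S \<Longrightarrow> P (K #>\<^bsub>F\<^esub> frag_of s)"
    and add: "\<And>X Y. X \<in> carrier Q \<Longrightarrow> Y \<in> carrier Q \<Longrightarrow> P X \<Longrightarrow> P Y \<Longrightarrow> P (X \<oplus>\<^bsub>Q\<^esub> Y)"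
    and minus: "\<And>X. X \<in> carrier Q \<Longrightarrow> P X \<Longrightarrow> P (\<ominus>\<^bsub>Q\<^esub> X)"
    and zero: "P \<zero>\<^bsub>Q\<^esub>"
  shows "P X"
proof -
  interpret Q: abelian_group Q by (rule abelian_group_Q)
  obtain c where c: "X = K #>\<^bsub>F\<^esub> c" "Poly_Mapping.keys c \<subseteq> S" using X carrier_Q by auto
  have "P (K #>\<^bsub>F\<^esub> c)" using c(2)
  proof (induction c rule: free_Abelian_group_cases_induct)
    case zero
    show ?case using \<open>P \<zero>\<^bsub>Q\<^esub>\<close> zero_Q by simp
  next
    case (diff x y)
    have in_Q: "K #>\<^bsub>F\<^esub> x \<in> carrier Q" "K #>\<^bsub>F\<^esub> y \<in> carrier Q" "K #>\<^bsub>F\<^esub> (- y) \<in> carrier Q"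
      using diff carrier_Q by force+
    have "(K #>\<^bsub>F\<^esub> (- y)) \<oplus>\<^bsub>Q\<^esub> (K #>\<^bsub>F\<^esub> y) = \<zero>\<^bsub>Q\<^esub>"
      using coset_add[of "- y" y] diff by (simp add: zero_Q)
    then have "K #>\<^bsub>F\<^esub> (- y) = \<ominus>\<^bsub>Q\<^esub> (K #>\<^bsub>F\<^esub> y)"
      using in_Q by (metis Q.minus_equality)
    then have "K #>\<^bsub>F\<^esub> (x - y) = (K #>\<^bsub>F\<^esub> x) \<oplus>\<^bsub>Q\<^esub> (\<ominus>\<^bsub>Q\<^esub> (K #>\<^bsub>F\<^esub> y))"
      using coset_add[of x "- y"] diff by simp
    then show ?case using add minus diff in_Q by simp
  next
    case (frag a)
    then show ?case using gen by blast
  qed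
  then show ?thesis using c by simp
qed

text \<open>A function on the generators that kills the relations extends to the quotient; the value of
  the extension can be computed at any representative.\<close>

lemma formal_sum_relations:
  assumes "abelian_group G" and f: "f \<in> S \<rightarrow> carrier G"
    and rel: "\<And>r. r \<in> Rel \<Longrightarrow> formal_sum G f r = \<zero>\<^bsub>G\<^esub>"
  shows "r \<in> K \<Longrightarrow> formal_sum G f r = \<zero>\<^bsub>G\<^esub>"
  unfolding K
proof -
  interpret G: abelian_group G by fact
  assume "r \<in> generate F Rel"
  then have "Poly_Mapping.keys r \<subseteq> S \<and> formal_sum G f r = \<zero>\<^bsub>G\<^esub>"
  proof (induction rule: generate.induct)
    case one
    then show ?case by simp
  next
    case (incl h)
    then show ?case using rel Rel by auto
  next
    case (inv h)
    then show ?case using rel Rel[of h] by (simp add: G.formal_sum_minus[OF _ f])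
  next
    case (eng h1 h2)
    then show ?case using keys_add[of h1 h2] by (auto simp: G.formal_sum_add[OF _ _ f])
  qed
  then show ?thesis by simp
qed

lemma formal_sum_rep:
  assumes "abelian_group G" and f: "f \<in> S \<rightarrow> carrier G"
    and rel: "\<And>r. r \<in> Rel \<Longrightarrow> formal_sum G f r = \<zero>\<^bsub>G\<^esub>"
    and c: "Poly_Mapping.keys c \<subseteq> S"
  shows "formal_sum G f (rep (K #>\<^bsub>F\<^esub> c)) = formal_sum G f c"
proof -
  interpret G: abelian_group G by fact
  have X: "K #>\<^bsub>F\<^esub> c \<in> carrier Q" using c carrier_Q by auto
  obtain r where r: "r \<in> K" "rep (K #>\<^bsub>F\<^esub> c) = r + c"
    using rep_mem[OF X] by (auto simp: r_coset_def)
  have "Poly_Mapping.keys r \<subseteq> S"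
    using subsetD[OF subgroup.subset[OF K_subgroup] r(1)] by simp
  then show ?thesis
    using r c formal_sum_relations[OF assms(1) f rel r(1)]
    by (simp add: G.formal_sum_add[OF _ _ f] G.formal_sum_closed[OF _ f])
qed

lemma formal_sum_rep_add:
  assumes "abelian_group G" and f: "f \<in> S \<rightarrow> carrier G"
    and rel: "\<And>r. r \<in> Rel \<Longrightarrow> formal_sum G f r = \<zero>\<^bsub>G\<^esub>"
    and "X \<in> carrier Q" "Y \<in> carrier Q"
  shows "formal_sum G f (rep (X \<oplus>\<^bsub>Q\<^esub> Y)) = formal_sum G f (rep X) \<oplus>\<^bsub>G\<^esub> formal_sum G f (rep Y)"
proof -
  interpret G: abelian_group G by fact
  obtain c d where c: "X = K #>\<^bsub>F\<^esub> c" "Poly_Mapping.keys c \<subseteq> S"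
    and d: "Y = K #>\<^bsub>F\<^esub> d" "Poly_Mapping.keys d \<subseteq> S"
    using assms carrier_Q by auto
  have cd: "Poly_Mapping.keys (c + d) \<subseteq> S" using c d keys_add[of c d] by auto
  show ?thesis
    unfolding c(1) d(1) coset_add[OF c(2) d(2)]
    by (simp add: formal_sum_rep[OF assms(1) f rel] c d cd G.formal_sum_add[OF _ _ f])
qed

end

lemma tsum_eq_formal_sum: "tsum G X F = formal_sum G (\<lambda>p. F (fst p) (snd p)) (rep X)"
  by (simp add: tsum_def formal_sum_def rep_def Let_def)

subsection \<open>Sums over a tensor\<close>

text \<open>A sum over \<open>X\<close> evaluates its terms on \<open>U \<times> V\<close> only. This is what is known about the chosen
  representative of \<open>X\<close>, and it suffices to move homomorphisms through sums that are not well defined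
  term by term.\<close>

definition over :: "'m set \<Rightarrow> 'n set \<Rightarrow> ('m, 'n) tens \<Rightarrow> bool" where
  "over U V X \<longleftrightarrow> Poly_Mapping.keys (rep X) \<subseteq> U \<times> V"

lemma tsum_cong:
  assumes "over U V X" "\<And>x y. x \<in> U \<Longrightarrow> y \<in> V \<Longrightarrow> F x y = F' x y"
  shows "tsum G X F = tsum G X F'"
  unfolding tsum_eq_formal_sum
  using assms by (intro formal_sum_cong[where S = "U \<times> V"]) (auto simp: over_def)

lemma tsum_closed:
  assumes "abelian_group G" "over U V X" "\<And>x y. x \<in> U \<Longrightarrow> y \<in> V \<Longrightarrow> F x y \<in> carrier G"
  shows "tsum G X F \<in> carrier G"
  unfolding tsum_eq_formal_sum
  using assms by (intro abelian_group.formal_sum_closed[where S = "U \<times> V"]) (auto simp: over_def)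

lemma tsum_add:
  assumes "abelian_group G" "over U V X" "\<And>x y. x \<in> U \<Longrightarrow> y \<in> V \<Longrightarrow> F x y \<in> carrier G"
    "\<And>x y. x \<in> U \<Longrightarrow> y \<in> V \<Longrightarrow> F' x y \<in> carrier G"
  shows "tsum G X (\<lambda>x y. F x y \<oplus>\<^bsub>G\<^esub> F' x y) = tsum G X F \<oplus>\<^bsub>G\<^esub> tsum G X F'"
  unfolding tsum_eq_formal_sum using assms
  by (intro abelian_group.formal_sum_pointwise_add[where S = "U \<times> V"]) (auto simp: over_def)

lemma tsum_hom:
  assumes "additive G G' \<phi>" "abelian_group G" "abelian_group G'" "over U V X"
    "\<And>x y. x \<in> U \<Longrightarrow> y \<in> V \<Longrightarrow> F x y \<in> carrier G"
  shows "\<phi> (tsum G X F) = tsum G' X (\<lambda>x y. \<phi> (F x y))"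
  unfolding tsum_eq_formal_sum using assms
  by (intro formal_sum_hom[where S = "U \<times> V"]) (auto simp: over_def)

lemma tsum_swap:
  assumes "abelian_group G" "over U V X" "over U' V' Y"
    "\<And>x y u v. x \<in> U \<Longrightarrow> y \<in> V \<Longrightarrow> u \<in> U' \<Longrightarrow> v \<in> V' \<Longrightarrow> F x y u v \<in> carrier G"
  shows "tsum G X (\<lambda>x y. tsum G Y (\<lambda>u v. F x y u v)) = tsum G Y (\<lambda>u v. tsum G X (\<lambda>x y. F x y u v))"
  unfolding tsum_eq_formal_sum using assms
  by (intro abelian_group.formal_sum_swap[where S = "U \<times> V" and T = "U' \<times> V'"]) (auto simp: over_def)

lemma tsum_same_add:
  assumes "add G = add G'" "zero G = zero G'" "carrier G = carrier G'"
  shows "tsum G X F = tsum G' X F"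
proof -
  have "m_inv (add_monoid G) x = m_inv (add_monoid G') x" for x
    using assms by (simp only: m_inv_def partial_object.simps monoid.simps)
  then have "[i] \<cdot>\<^bsub>G\<^esub> x = [i] \<cdot>\<^bsub>G'\<^esub> x" for i :: int and x
    using assms by (simp only: add_pow_def int_pow_def nat_pow_def partial_object.simps monoid.simps)
  then show ?thesis
    using assms by (simp only: tsum_def finsum_def finprod_def partial_object.simps monoid.simps)
qed

subsection \<open>Tensor products over a ring\<close>

definition balanced where
  "balanced R ra la M N G F \<longleftrightarrow>
    (\<forall>y\<in>carrier N. additive M G (\<lambda>x. F x y)) \<and> (\<forall>x\<in>carrier M. additive N G (F x)) \<and>
    (\<forall>x\<in>carrier M. \<forall>r\<in>R. \<forall>y\<in>carrier N. F (ra x r) y = F x (la r y))"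

lemma balancedI:
  assumes "\<And>y. y \<in> carrier N \<Longrightarrow> additive M G (\<lambda>x. F x y)"
    "\<And>x. x \<in> carrier M \<Longrightarrow> additive N G (F x)"
    "\<And>x r y. x \<in> carrier M \<Longrightarrow> r \<in> R \<Longrightarrow> y \<in> carrier N \<Longrightarrow> F (ra x r) y = F x (la r y)"
  shows "balanced R ra la M N G F"
  using assms by (auto simp: balanced_def)

locale bal_tensor =
  fixes R :: "'r set" and ra :: "'m \<Rightarrow> 'r \<Rightarrow> 'm" and la :: "'r \<Rightarrow> 'n \<Rightarrow> 'n"
    and M :: "('m, 'x) ring_scheme" and N :: "('n, 'y) ring_scheme"
  assumes abelian_M: "abelian_group M" and abelian_N: "abelian_group N"
    and ra_closed: "\<And>x r. x \<in> carrier M \<Longrightarrow> r \<in> R \<Longrightarrow> ra x r \<in> carrier M"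
    and la_closed: "\<And>y r. y \<in> carrier N \<Longrightarrow> r \<in> R \<Longrightarrow> la r y \<in> carrier N"
begin

abbreviation "T \<equiv> tensor R ra la M N"
abbreviation "te \<equiv> tensor_elem R ra la M N"
abbreviation "bal G F \<equiv> balanced R ra la M N G F"

definition relators :: "('m \<times> 'n \<Rightarrow>\<^sub>0 int) set" where
  "relators = {frag_of (x \<oplus>\<^bsub>M\<^esub> x', y) - (frag_of (x, y) + frag_of (x', y)) | x x' y.
         x \<in> carrier M \<and> x' \<in> carrier M \<and> y \<in> carrier N} \<union>
      {frag_of (x, y \<oplus>\<^bsub>N\<^esub> y') - (frag_of (x, y) + frag_of (x, y')) | x y y'.
         x \<in> carrier M \<and> y \<in> carrier N \<and> y' \<in> carrier N} \<union>
      {frag_of (ra x r, y) - frag_of (x, la r y) | x r y.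
         x \<in> carrier M \<and> r \<in> R \<and> y \<in> carrier N}"

sublocale M: abelian_group M by (rule abelian_M)
sublocale N: abelian_group N by (rule abelian_N)

lemma keys_relators: "r \<in> relators \<Longrightarrow> Poly_Mapping.keys r \<subseteq> carrier M \<times> carrier N"
  unfolding relators_def
  by (elim UnE CollectE exE conjE; hypsubst; (rule keys_relator3 | rule keys_relator2); simp add: ra_closed la_closed)

sublocale P: presentation "carrier M \<times> carrier N" relators "tensor_relations R ra la M N"
  by unfold_locales (use keys_relators in \<open>auto simp: tensor_relations_def relators_def\<close>)

lemma T_eq: "T = quotient_ab (carrier M \<times> carrier N) (tensor_relations R ra la M N)"
  by (simp add: tensor_def)

lemma abelian_T: "abelian_group T"
  unfolding T_eq by (rule P.abelian_group_Q)

sublocale T: abelian_group T by (rule abelian_T)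

lemma over_T: "X \<in> carrier T \<Longrightarrow> over (carrier M) (carrier N) X"
  unfolding T_eq over_def by (rule P.rep_keys)

lemma te_closed: "x \<in> carrier M \<Longrightarrow> y \<in> carrier N \<Longrightarrow> te x y \<in> carrier T"
  unfolding T_eq P.carrier_Q tensor_elem_def by force

lemma bal_relator:
  assumes "abelian_group G" "bal G F" "r \<in> relators"
  shows "formal_sum G (\<lambda>p. F (fst p) (snd p)) r = \<zero>\<^bsub>G\<^esub>"
proof -
  interpret G: abelian_group G by fact
  have F: "F x y \<in> carrier G" if "x \<in> carrier M" "y \<in> carrier N" for x y
    using assms(2) that by (auto simp: balanced_def additive_def additive_maps_def)
  let ?f = "\<lambda>p. F (fst p) (snd p)"
  have f: "?f \<in> carrier M \<times> carrier N \<rightarrow> carrier G" using F by auto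
  note relator = G.formal_sum_relator2[OF f] G.formal_sum_relator3[OF f]
  from assms(3) consider
    (a) x x' y where "r = frag_of (x \<oplus>\<^bsub>M\<^esub> x', y) - (frag_of (x, y) + frag_of (x', y))"
      "x \<in> carrier M" "x' \<in> carrier M" "y \<in> carrier N"
    | (b) x y y' where "r = frag_of (x, y \<oplus>\<^bsub>N\<^esub> y') - (frag_of (x, y) + frag_of (x, y'))"
      "x \<in> carrier M" "y \<in> carrier N" "y' \<in> carrier N"
    | (c) x s y where "r = frag_of (ra x s, y) - frag_of (x, la s y)"
      "x \<in> carrier M" "s \<in> R" "y \<in> carrier N"
    unfolding relators_def by blast
  then show ?thesis
  proof cases
    case a
    then have "F (x \<oplus>\<^bsub>M\<^esub> x') y = F x y \<oplus>\<^bsub>G\<^esub> F x' y"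
      using assms(2) by (auto simp: balanced_def additive_def additive_maps_def)
    then show ?thesis unfolding a(1) using a by (intro relator) simp_all
  next
    case b
    then have "F x (y \<oplus>\<^bsub>N\<^esub> y') = F x y \<oplus>\<^bsub>G\<^esub> F x y'"
      using assms(2) by (auto simp: balanced_def additive_def additive_maps_def)
    then show ?thesis unfolding b(1) using b by (intro relator) simp_all
  next
    case c
    then have "F (ra x s) y = F x (la s y)" using assms(2) by (auto simp: balanced_def)
    then show ?thesis unfolding c(1) using c ra_closed la_closed by (intro relator) simp_all
  qed
qed

lemma bal_closed: "bal G F \<Longrightarrow> x \<in> carrier M \<Longrightarrow> y \<in> carrier N \<Longrightarrow> F x y \<in> carrier G"
  by (auto simp: balanced_def additive_def additive_maps_def)

text \<open>Together with additivity this is the universal property: a balanced function factors through the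
  tensor product, and \<open>tsum\<close> computes the factorization.\<close>

lemma tsum_te:
  assumes "abelian_group G" "bal G F" "x \<in> carrier M" "y \<in> carrier N"
  shows "tsum G (te x y) F = F x y"
proof -
  interpret G: abelian_group G by fact
  have f: "(\<lambda>p. F (fst p) (snd p)) \<in> carrier M \<times> carrier N \<rightarrow> carrier G"
    using bal_closed[OF assms(2)] by auto
  show ?thesis
    unfolding tsum_eq_formal_sum tensor_elem_def
    using P.formal_sum_rep[OF assms(1) f bal_relator[OF assms(1,2)], of "frag_of (x, y)"] assms(3,4)
      bal_closed[OF assms(2)] by simp
qed

lemma tsum_additive:
  assumes "abelian_group G" "bal G F"
  shows "additive T G (\<lambda>X. tsum G X F)"
proof (rule additiveI)
  have f: "(\<lambda>p. F (fst p) (snd p)) \<in> carrier M \<times> carrier N \<rightarrow> carrier G"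
    using bal_closed[OF assms(2)] by auto
  show "tsum G X F \<in> carrier G" if "X \<in> carrier T" for X
    using tsum_closed[OF assms(1) over_T[OF that]] bal_closed[OF assms(2)] by blast
  show "tsum G (X \<oplus>\<^bsub>T\<^esub> Y) F = tsum G X F \<oplus>\<^bsub>G\<^esub> tsum G Y F" if "X \<in> carrier T" "Y \<in> carrier T" for X Y
    using P.formal_sum_rep_add[OF assms(1) f bal_relator[OF assms]] that
    unfolding tsum_eq_formal_sum T_eq by blast
qed

lemma te_add_left:
  assumes "x \<in> carrier M" "x' \<in> carrier M" "y \<in> carrier N"
  shows "te (x \<oplus>\<^bsub>M\<^esub> x') y = te x y \<oplus>\<^bsub>T\<^esub> te x' y"
proof -
  have "frag_of (x \<oplus>\<^bsub>M\<^esub> x', y) - (frag_of (x, y) + frag_of (x', y)) \<in> relators"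
    using assms unfolding relators_def by blast
  from P.relator_coset[OF this] show ?thesis
    unfolding tensor_elem_def T_eq using assms P.coset_add[of "frag_of (x, y)" "frag_of (x', y)"]
    by (simp add: keys_frag2)
qed

lemma te_add_right:
  assumes "x \<in> carrier M" "y \<in> carrier N" "y' \<in> carrier N"
  shows "te x (y \<oplus>\<^bsub>N\<^esub> y') = te x y \<oplus>\<^bsub>T\<^esub> te x y'"
proof -
  have "frag_of (x, y \<oplus>\<^bsub>N\<^esub> y') - (frag_of (x, y) + frag_of (x, y')) \<in> relators"
    using assms unfolding relators_def by blast
  from P.relator_coset[OF this] show ?thesis
    unfolding tensor_elem_def T_eq using assms P.coset_add[of "frag_of (x, y)" "frag_of (x, y')"]
    by (simp add: keys_frag2)
qed

lemma te_balanced: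
  assumes "x \<in> carrier M" "r \<in> R" "y \<in> carrier N"
  shows "te (ra x r) y = te x (la r y)"
proof -
  have "frag_of (ra x r, y) - frag_of (x, la r y) \<in> relators"
    using assms unfolding relators_def by blast
  from P.relator_coset[OF this] show ?thesis
    unfolding tensor_elem_def using assms la_closed by simp
qed

lemma bal_te: "bal T te"
  by (rule balancedI) (simp_all add: additiveI te_closed te_add_left te_add_right te_balanced)

lemma te_minus_left:
  assumes "x \<in> carrier M" "y \<in> carrier N"
  shows "te (\<ominus>\<^bsub>M\<^esub> x) y = \<ominus>\<^bsub>T\<^esub> te x y"
proof -
  have "additive M T (\<lambda>x. te x y)" using bal_te assms by (simp add: balanced_def)
  from additive_minus[OF this abelian_M abelian_T assms(1)] show ?thesis .
qed

lemma te_zero_left: "y \<in> carrier N \<Longrightarrow> te \<zero>\<^bsub>M\<^esub> y = \<zero>\<^bsub>T\<^esub>"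
  using bal_te additive_zero[OF _ abelian_M abelian_T] by (fastforce simp: balanced_def)

text \<open>Negatives of pure tensors are pure, so sums of pure tensors suffice.\<close>

lemma T_induct [consumes 1, case_names gen add]:
  assumes X: "X \<in> carrier T"
    and gen: "\<And>x y. x \<in> carrier M \<Longrightarrow> y \<in> carrier N \<Longrightarrow> P (te x y)"
    and add: "\<And>X Y. X \<in> carrier T \<Longrightarrow> Y \<in> carrier T \<Longrightarrow> P X \<Longrightarrow> P Y \<Longrightarrow> P (X \<oplus>\<^bsub>T\<^esub> Y)"
  shows "P X"
proof -
  have "X \<in> carrier P.Q" using X by (simp add: T_eq)
  then have "P X \<and> P (\<ominus>\<^bsub>T\<^esub> X)"
  proof (induction rule: P.Q_induct)
    case (gen s)
    obtain x y where s: "s = (x, y)" "x \<in> carrier M" "y \<in> carrier N" using gen by auto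
    then have "P (te x y)" "P (te (\<ominus>\<^bsub>M\<^esub> x) y)" using assms(2) by auto
    then show ?case using s by (simp add: te_minus_left) (simp add: tensor_elem_def)
  next
    case (add X Y)
    then show ?case using assms(3)[of X Y] assms(3)[of "\<ominus>\<^bsub>T\<^esub> X" "\<ominus>\<^bsub>T\<^esub> Y"]
      by (simp add: T_eq[symmetric] T.minus_add)
  next
    case (minus X)
    then show ?case by (simp add: T_eq[symmetric])
  next
    case zero
    have "P (te \<zero>\<^bsub>M\<^esub> \<zero>\<^bsub>N\<^esub>)" using assms(2) by simp
    then have "P \<zero>\<^bsub>T\<^esub>" using te_zero_left[of "\<zero>\<^bsub>N\<^esub>"] by simp
    moreover have "\<ominus>\<^bsub>T\<^esub> \<zero>\<^bsub>T\<^esub> = \<zero>\<^bsub>T\<^esub>" by (rule T.minus_equality) auto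
    ultimately show ?case unfolding T_eq by presburger
  qed
  then show ?thesis by simp
qed

lemma additive_eqI:
  assumes "additive T G f" "additive T G g" "X \<in> carrier T"
    and "\<And>x y. x \<in> carrier M \<Longrightarrow> y \<in> carrier N \<Longrightarrow> f (te x y) = g (te x y)"
  shows "f X = g X"
  using assms(3) by (induction rule: T_induct)
    (use assms additive_add[OF assms(1)] additive_add[OF assms(2)] in auto)

lemma tsum_self: "X \<in> carrier T \<Longrightarrow> tsum T X te = X"
  by (rule additive_eqI[of T "\<lambda>X. tsum T X te" "\<lambda>X. X"])
    (auto simp: tsum_additive[OF abelian_T bal_te] additive_id tsum_te[OF abelian_T bal_te])

text \<open>Endomorphisms of the first factor that commute with the right action act on the tensor product. All
  left actions on tensor products in the development arise in this way.\<close>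

lemma left_map:
  assumes f: "additive M M f" and fr: "\<And>x r. x \<in> carrier M \<Longrightarrow> r \<in> R \<Longrightarrow> f (ra x r) = ra (f x) r"
  shows "additive T T (\<lambda>Y. tsum T Y (\<lambda>x y. te (f x) y))"
    and "x \<in> carrier M \<Longrightarrow> y \<in> carrier N \<Longrightarrow> tsum T (te x y) (\<lambda>x y. te (f x) y) = te (f x) y"
proof -
  have b: "bal T (\<lambda>x y. te (f x) y)"
    by (rule balancedI)
      (simp_all add: additiveI te_closed additive_closed[OF f] additive_add[OF f] te_add_left te_add_right fr te_balanced)
  show "additive T T (\<lambda>Y. tsum T Y (\<lambda>x y. te (f x) y))" by (rule tsum_additive[OF abelian_T b])
  show "x \<in> carrier M \<Longrightarrow> y \<in> carrier N \<Longrightarrow> tsum T (te x y) (\<lambda>x y. te (f x) y) = te (f x) y"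
    by (rule tsum_te[OF abelian_T b])
qed

text \<open>The scalars of \<open>ktens\<close>, \<open>btens\<close> and \<open>sqtens\<close> all act through the first factor.\<close>

lemma left_module:
  fixes P :: "('k, ('m, 'n) tens, 'z) module_scheme"
  assumes k: "cring k" and f: "\<And>c. c \<in> carrier k \<Longrightarrow> additive M M (f c)"
    and distr: "\<And>c d x. c \<in> carrier k \<Longrightarrow> d \<in> carrier k \<Longrightarrow> x \<in> carrier M \<Longrightarrow> f (c \<oplus>\<^bsub>k\<^esub> d) x = f c x \<oplus>\<^bsub>M\<^esub> f d x"
    and mult: "\<And>c d x. c \<in> carrier k \<Longrightarrow> d \<in> carrier k \<Longrightarrow> x \<in> carrier M \<Longrightarrow> f (c \<otimes>\<^bsub>k\<^esub> d) x = f c (f d x)"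
    and one: "\<And>x. x \<in> carrier M \<Longrightarrow> f \<one>\<^bsub>k\<^esub> x = x"
    and fr: "\<And>c x r. c \<in> carrier k \<Longrightarrow> x \<in> carrier M \<Longrightarrow> r \<in> R \<Longrightarrow> f c (ra x r) = ra (f c x) r"
    and P: "carrier P = carrier T" "add P = add T" "zero P = zero T"
      "smult P = (\<lambda>c Y. tsum T Y (\<lambda>x y. te (f c x) y))"
  shows "module k P" and "c \<in> carrier k \<Longrightarrow> additive T T (smult P c)"
    and "c \<in> carrier k \<Longrightarrow> x \<in> carrier M \<Longrightarrow> y \<in> carrier N \<Longrightarrow> c \<odot>\<^bsub>P\<^esub> te x y = te (f c x) y"
proof -
  interpret k: cring k by fact
  show ad: "additive T T (smult P c)" if "c \<in> carrier k" for c
    unfolding P(4) by (rule left_map(1)[OF f[OF that] fr[OF that]])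
  show el: "c \<odot>\<^bsub>P\<^esub> te x y = te (f c x) y" if "c \<in> carrier k" "x \<in> carrier M" "y \<in> carrier N" for c x y
    unfolding P(4) by (rule left_map(2)[OF f[OF that(1)] fr[OF that(1)] that(2,3)])
  note fc = additive_closed[OF f]
  have ab: "abelian_group P" by (rule abelian_group_cong[OF abelian_T]) (simp_all add: P)
  show "module k P"
  proof (rule moduleI[OF k ab], unfold P(1,2))
    fix c d Y Y' assume c: "c \<in> carrier k" and Y: "Y \<in> carrier T"
    show "c \<odot>\<^bsub>P\<^esub> Y \<in> carrier T" by (rule additive_closed[OF ad[OF c] Y])
    show "c \<odot>\<^bsub>P\<^esub> (Y \<oplus>\<^bsub>T\<^esub> Y') = c \<odot>\<^bsub>P\<^esub> Y \<oplus>\<^bsub>T\<^esub> c \<odot>\<^bsub>P\<^esub> Y'" if "Y' \<in> carrier T"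
      by (rule additive_add[OF ad[OF c] Y that])
    assume d: "d \<in> carrier k"
    show "(c \<oplus>\<^bsub>k\<^esub> d) \<odot>\<^bsub>P\<^esub> Y = c \<odot>\<^bsub>P\<^esub> Y \<oplus>\<^bsub>T\<^esub> d \<odot>\<^bsub>P\<^esub> Y"
      by (rule additive_eqI[OF ad additive_plus[OF ad ad abelian_T] Y]) (simp_all add: c d el distr te_add_left fc)
    show "(c \<otimes>\<^bsub>k\<^esub> d) \<odot>\<^bsub>P\<^esub> Y = c \<odot>\<^bsub>P\<^esub> (d \<odot>\<^bsub>P\<^esub> Y)"
      by (rule additive_eqI[OF ad additive_comp[OF ad ad] Y]) (simp_all add: c d el mult fc)
  next
    show "\<one>\<^bsub>k\<^esub> \<odot>\<^bsub>P\<^esub> Y = Y" if "Y \<in> carrier T" for Y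
      by (rule additive_eqI[OF ad additive_id that]) (simp_all add: el one)
  qed
qed

text \<open>Sums whose terms depend on the tensor in an additive, balanced way can be computed after
  regrouping.\<close>

lemma tsum_tsum_te:
  assumes "abelian_group G" "bal G F" "over U V X"
    "\<And>u v. u \<in> U \<Longrightarrow> v \<in> V \<Longrightarrow> f u v \<in> carrier M" "\<And>u v. u \<in> U \<Longrightarrow> v \<in> V \<Longrightarrow> g u v \<in> carrier N"
  shows "tsum G (tsum T X (\<lambda>u v. te (f u v) (g u v))) F = tsum G X (\<lambda>u v. F (f u v) (g u v))"
proof -
  have "tsum G (tsum T X (\<lambda>u v. te (f u v) (g u v))) F = tsum G X (\<lambda>u v. tsum G (te (f u v) (g u v)) F)"
    by (rule tsum_hom[OF tsum_additive[OF assms(1,2)] abelian_T assms(1,3)]) (auto intro: te_closed assms)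
  also have "\<dots> = tsum G X (\<lambda>u v. F (f u v) (g u v))"
    by (rule tsum_cong[OF assms(3)]) (auto intro!: tsum_te assms)
  finally show ?thesis .
qed

end

subsection \<open>Modules over the ground field\<close>

lemma restrict_carrier_simps:
  "add (V\<lparr>carrier := S\<rparr>) = add V" "zero (V\<lparr>carrier := S\<rparr>) = zero V" "smult (V\<lparr>carrier := S\<rparr>) = smult V"
  "one (V\<lparr>carrier := S\<rparr>) = one V" "mult (V\<lparr>carrier := S\<rparr>) = mult V"
  by simp_all

locale ground = fixes k :: "'k ring" assumes field_k: "field k"
begin

sublocale k: field k by (rule field_k)

lemma cring_k: "cring k" ..

lemma module_cong:
  assumes V: "module k V" and eq: "carrier W = carrier V" "add W = add V" "zero W = zero V" "smult W = smult V"
  shows "module k W"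
proof -
  interpret V: module k V by fact
  have "abelian_group W" by (rule abelian_group_cong[OF V.abelian_group_axioms]) (simp_all add: eq)
  then show ?thesis
    by (rule moduleI[OF cring_k])
      (simp_all add: eq V.smult_l_distr V.smult_r_distr V.smult_assoc1)
qed

definition subspace where
  "subspace V S \<longleftrightarrow> S \<subseteq> carrier V \<and> \<zero>\<^bsub>V\<^esub> \<in> S \<and> (\<forall>x\<in>S. \<forall>y\<in>S. x \<oplus>\<^bsub>V\<^esub> y \<in> S) \<and>
    (\<forall>c\<in>carrier k. \<forall>x\<in>S. c \<odot>\<^bsub>V\<^esub> x \<in> S)"

lemma subspaceD:
  assumes "subspace V S"
  shows "x \<in> S \<Longrightarrow> x \<in> carrier V" "\<zero>\<^bsub>V\<^esub> \<in> S" "x \<in> S \<Longrightarrow> y \<in> S \<Longrightarrow> x \<oplus>\<^bsub>V\<^esub> y \<in> S"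
    "c \<in> carrier k \<Longrightarrow> x \<in> S \<Longrightarrow> c \<odot>\<^bsub>V\<^esub> x \<in> S"
  using assms by (auto simp: subspace_def)

lemma subspace_module:
  assumes V: "module k V" and S: "subspace V S"
  shows "module k (V\<lparr>carrier := S\<rparr>)"
proof -
  interpret V: module k V by fact
  let ?S = "V\<lparr>carrier := S\<rparr>"
  note sub = subspaceD[OF S]
  have minus: "\<exists>y\<in>S. x \<oplus>\<^bsub>V\<^esub> y = \<zero>\<^bsub>V\<^esub>" if x: "x \<in> S" for x
  proof -
    have "(\<ominus>\<^bsub>k\<^esub> \<one>\<^bsub>k\<^esub>) \<odot>\<^bsub>V\<^esub> x = \<ominus>\<^bsub>V\<^esub> x"
      using V.smult_l_minus[OF k.one_closed sub(1)[OF x]] sub(1)[OF x] by simp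
    then have "\<ominus>\<^bsub>V\<^esub> x \<in> S" using sub(4)[of "\<ominus>\<^bsub>k\<^esub> \<one>\<^bsub>k\<^esub>" x] x by simp
    moreover have "x \<oplus>\<^bsub>V\<^esub> \<ominus>\<^bsub>V\<^esub> x = \<zero>\<^bsub>V\<^esub>" using sub(1)[OF x] by (simp add: V.M.r_neg)
    ultimately show ?thesis by blast
  qed
  have ab: "abelian_group ?S"
    by (rule abelian_groupI) (simp_all add: sub minus V.M.a_ac)
  show ?thesis
    by (rule moduleI[OF cring_k ab]) (simp_all add: sub V.smult_l_distr V.smult_r_distr V.smult_assoc1)
qed

definition lin where "lin V W f \<longleftrightarrow> f \<in> linear_maps k V W"

definition bilin where
  "bilin M N G F \<longleftrightarrow> (\<forall>y\<in>carrier N. lin M G (\<lambda>x. F x y)) \<and> (\<forall>x\<in>carrier M. lin N G (\<lambda>y. F x y))"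

lemma linI:
  assumes "\<And>x. x \<in> carrier V \<Longrightarrow> f x \<in> carrier W"
    and "\<And>x y. x \<in> carrier V \<Longrightarrow> y \<in> carrier V \<Longrightarrow> f (x \<oplus>\<^bsub>V\<^esub> y) = f x \<oplus>\<^bsub>W\<^esub> f y"
    and "\<And>c x. c \<in> carrier k \<Longrightarrow> x \<in> carrier V \<Longrightarrow> f (c \<odot>\<^bsub>V\<^esub> x) = c \<odot>\<^bsub>W\<^esub> f x"
  shows "lin V W f"
  unfolding lin_def linear_maps_def additive_maps_def mem_Collect_eq
  by (intro conjI funcsetI ballI assms)

lemma lin_closed: "lin V W f \<Longrightarrow> x \<in> carrier V \<Longrightarrow> f x \<in> carrier W"
  by (auto simp: lin_def linear_maps_def additive_maps_def)

lemma lin_add: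
  "lin V W f \<Longrightarrow> x \<in> carrier V \<Longrightarrow> y \<in> carrier V \<Longrightarrow> f (x \<oplus>\<^bsub>V\<^esub> y) = f x \<oplus>\<^bsub>W\<^esub> f y"
  by (auto simp: lin_def linear_maps_def additive_maps_def)

lemma lin_smult: "lin V W f \<Longrightarrow> c \<in> carrier k \<Longrightarrow> x \<in> carrier V \<Longrightarrow> f (c \<odot>\<^bsub>V\<^esub> x) = c \<odot>\<^bsub>W\<^esub> f x"
  by (auto simp: lin_def linear_maps_def)

lemma lin_additive: "lin V W f \<Longrightarrow> additive V W f"
  by (auto simp: lin_def linear_maps_def additive_def)

lemma lin_of_additive:
  "additive V W f \<Longrightarrow> (\<And>c x. c \<in> carrier k \<Longrightarrow> x \<in> carrier V \<Longrightarrow> f (c \<odot>\<^bsub>V\<^esub> x) = c \<odot>\<^bsub>W\<^esub> f x) \<Longrightarrow> lin V W f"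
  by (auto simp: lin_def linear_maps_def additive_def)

lemma lin_cong:
  assumes "lin V W f" "\<And>x. x \<in> carrier V \<Longrightarrow> f x = g x" "module k V"
  shows "lin V W g"
proof -
  interpret V: module k V by fact
  show ?thesis
    using assms(1,2) lin_closed[OF assms(1)] lin_add[OF assms(1)] lin_smult[OF assms(1)]
    by (intro linI) (metis V.add.m_closed V.smult_closed)+
qed

lemma lin_id [simp]: "lin V V (\<lambda>x. x)"
  by (rule linI) auto

lemma lin_comp: "lin W U g \<Longrightarrow> lin V W f \<Longrightarrow> lin V U (\<lambda>x. g (f x))"
  by (auto simp: lin_def linear_maps_def additive_maps_def Pi_def)

lemma lin_smultR:
  assumes "module k W" "lin V W f" "c \<in> carrier k"
  shows "lin V W (\<lambda>v. c \<odot>\<^bsub>W\<^esub> f v)"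
proof -
  interpret W: module k W by fact
  show ?thesis using assms(2,3) lin_closed[OF assms(2)] lin_add[OF assms(2)] lin_smult[OF assms(2)]
    by (intro linI) (auto simp: W.smult_r_distr k.m_comm simp flip: W.smult_assoc1)
qed

lemma base_simps [simp]:
  "carrier (base_module k) = carrier k" "add (base_module k) = add k" "zero (base_module k) = zero k"
  "smult (base_module k) = mult k" "mult (base_module k) = mult k" "one (base_module k) = one k"
  by (auto simp: base_module_def fun_eq_iff)

lemma module_base: "module k (base_module k)"
proof (rule moduleI[OF cring_k])
  show "abelian_group (base_module k)"
    by (rule abelian_group_cong[OF k.abelian_group_axioms]) auto
qed (auto simp: k.l_distr k.r_distr k.m_assoc)

lemma lin_scalar:
  assumes "module k W" "lin V (base_module k) f" "w \<in> carrier W"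
  shows "lin V W (\<lambda>v. f v \<odot>\<^bsub>W\<^esub> w)"
proof -
  interpret W: module k W by fact
  show ?thesis
    using assms(2,3) lin_closed[OF assms(2)] lin_add[OF assms(2)] lin_smult[OF assms(2)]
    by (intro linI) (auto simp: W.smult_l_distr W.smult_assoc1)
qed

lemma lin_plus:
  assumes "module k W" "lin V W f" "lin V W g"
  shows "lin V W (\<lambda>v. f v \<oplus>\<^bsub>W\<^esub> g v)"
proof -
  interpret W: module k W by fact
  show ?thesis
    using lin_closed[OF assms(2)] lin_add[OF assms(2)] lin_smult[OF assms(2)]
      lin_closed[OF assms(3)] lin_add[OF assms(3)] lin_smult[OF assms(3)]
    by (intro linI) (auto simp: W.smult_r_distr W.a_ac)
qed

lemma bilinI:
  "(\<And>y. y \<in> carrier N \<Longrightarrow> lin M G (\<lambda>x. F x y)) \<Longrightarrow> (\<And>x. x \<in> carrier M \<Longrightarrow> lin N G (\<lambda>y. F x y))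
    \<Longrightarrow> bilin M N G F"
  by (auto simp: bilin_def)

lemma bilin1: "bilin M N G F \<Longrightarrow> y \<in> carrier N \<Longrightarrow> lin M G (\<lambda>x. F x y)"
  and bilin2: "bilin M N G F \<Longrightarrow> x \<in> carrier M \<Longrightarrow> lin N G (F x)"
  by (auto simp: bilin_def)

lemma bilin_balanced:
  assumes "bilin M N G F"
  shows "balanced (carrier k) (\<lambda>x c. c \<odot>\<^bsub>M\<^esub> x) (\<lambda>c y. c \<odot>\<^bsub>N\<^esub> y) M N G F"
  by (intro balancedI lin_additive bilin1[OF assms] bilin2[OF assms])
    (auto simp: lin_smult[OF bilin1[OF assms]] lin_smult[OF bilin2[OF assms]])

end

locale ktensor = ground + fixes M N assumes module_M: "module k M" and module_N: "module k N"
begin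

sublocale M: module k M by (rule module_M)
sublocale N: module k N by (rule module_N)

sublocale bt: bal_tensor "carrier k" "\<lambda>x c. c \<odot>\<^bsub>M\<^esub> x" "\<lambda>c y. c \<odot>\<^bsub>N\<^esub> y" M N
  by unfold_locales auto

abbreviation "MN \<equiv> ktens k M N"
abbreviation "el \<equiv> ktens_elem k M N"

lemma carrier_MN: "carrier MN = carrier bt.T" and add_MN: "add MN = add bt.T"
  and zero_MN: "zero MN = zero bt.T"
  by (auto simp: ktens_def Let_def fun_eq_iff)

lemma el_def: "el = bt.te"
  by (simp add: fun_eq_iff ktens_elem_def)

lemma tsum_MN: "tsum MN = tsum bt.T"
  by (intro ext tsum_same_add) (auto simp: carrier_MN add_MN zero_MN)

lemma smult_MN: "smult MN = (\<lambda>c X. tsum bt.T X (\<lambda>x y. bt.te (c \<odot>\<^bsub>M\<^esub> x) y))"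
  by (simp add: ktens_def Let_def fun_eq_iff ktens_elem_def)

lemma abelian_MN: "abelian_group MN"
  by (rule abelian_group_cong[OF bt.abelian_T]) (auto simp: carrier_MN add_MN zero_MN)

lemma additive_MN_source: "additive MN G f \<longleftrightarrow> additive bt.T G f"
  by (auto simp: additive_def additive_maps_def carrier_MN add_MN)

lemma smult_balanced:
  "c \<in> carrier k \<Longrightarrow> x \<in> carrier M \<Longrightarrow> r \<in> carrier k \<Longrightarrow> c \<odot>\<^bsub>M\<^esub> (r \<odot>\<^bsub>M\<^esub> x) = r \<odot>\<^bsub>M\<^esub> (c \<odot>\<^bsub>M\<^esub> x)"
  by (simp add: k.m_comm M.smult_assoc1[symmetric])

lemmas MN_module = bt.left_module[OF cring_k additiveI M.smult_l_distr M.smult_assoc1 M.smult_one smult_balanced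
  carrier_MN add_MN zero_MN smult_MN]

lemma module_MN: "module k MN"
  by (rule MN_module) (simp_all add: M.smult_r_distr)

lemma smult_el: "c \<in> carrier k \<Longrightarrow> x \<in> carrier M \<Longrightarrow> y \<in> carrier N \<Longrightarrow> c \<odot>\<^bsub>MN\<^esub> el x y = el (c \<odot>\<^bsub>M\<^esub> x) y"
  unfolding el_def by (rule MN_module) (simp_all add: M.smult_r_distr)

lemma el_closed [simp]: "x \<in> carrier M \<Longrightarrow> y \<in> carrier N \<Longrightarrow> el x y \<in> carrier MN"
  by (simp add: el_def carrier_MN bt.te_closed)

sublocale MN: module k MN by (rule module_MN)

lemma el_smult_right: "c \<in> carrier k \<Longrightarrow> x \<in> carrier M \<Longrightarrow> y \<in> carrier N \<Longrightarrow> el x (c \<odot>\<^bsub>N\<^esub> y) = c \<odot>\<^bsub>MN\<^esub> el x y"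
  using bt.te_balanced[of x c y] by (simp add: smult_el) (simp add: el_def)

lemma bilin_el: "bilin M N MN el"
  by (intro bilinI linI)
    (simp_all add: el_smult_right smult_el, simp_all add: el_def add_MN bt.te_add_left bt.te_add_right)

lemma tsum_el:
  assumes "abelian_group G" "bilin M N G F" "x \<in> carrier M" "y \<in> carrier N"
  shows "tsum G (el x y) F = F x y"
  using bt.tsum_te[OF assms(1) bilin_balanced[OF assms(2)] assms(3,4)] by (simp add: el_def)

lemma MN_induct [consumes 1, case_names gen add]:
  assumes "X \<in> carrier MN"
    and "\<And>x y. x \<in> carrier M \<Longrightarrow> y \<in> carrier N \<Longrightarrow> P (el x y)"
    and "\<And>X Y. X \<in> carrier MN \<Longrightarrow> Y \<in> carrier MN \<Longrightarrow> P X \<Longrightarrow> P Y \<Longrightarrow> P (X \<oplus>\<^bsub>MN\<^esub> Y)"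
  shows "P X"
proof -
  have "X \<in> carrier bt.T" using assms(1) by (simp only: carrier_MN)
  then show ?thesis
  proof (induction X rule: bt.T_induct)
    case (gen x y)
    then show ?case using assms(2)[of x y] by (simp only: el_def)
  next
    case (add X Y)
    then show ?case using assms(3)[of X Y] by (simp only: carrier_MN add_MN)
  qed
qed

lemma over_MN: "X \<in> carrier MN \<Longrightarrow> over (carrier M) (carrier N) X"
  using bt.over_T by (simp add: carrier_MN)

lemma lin_tsum:
  assumes "module k G" "bilin M N G F"
  shows "lin MN G (\<lambda>X. tsum G X F)"
proof -
  interpret G: module k G by fact
  have add: "additive MN G (\<lambda>X. tsum G X F)"
    using bt.tsum_additive[OF G.abelian_group_axioms bilin_balanced[OF assms(2)]]
    by (simp add: additive_MN_source)
  show ?thesis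
  proof (rule lin_of_additive[OF add])
    fix c X assume c: "c \<in> carrier k" and "X \<in> carrier MN"
    from this(2) show "tsum G (c \<odot>\<^bsub>MN\<^esub> X) F = c \<odot>\<^bsub>G\<^esub> tsum G X F"
    proof (induction X rule: MN_induct)
      case (gen x y)
      then show ?case using c
        by (simp add: smult_el tsum_el[OF G.abelian_group_axioms assms(2)] lin_smult[OF bilin1[OF assms(2)]])
    next
      case (add X Y)
      then show ?case using c additive_closed[OF \<open>additive MN G (\<lambda>X. tsum G X F)\<close>]
        by (simp add: MN.smult_r_distr additive_add[OF \<open>additive MN G (\<lambda>X. tsum G X F)\<close>] G.smult_r_distr)
    qed
  qed
qed

lemma tsum_self_MN: "X \<in> carrier MN \<Longrightarrow> tsum MN X el = X"
  using bt.tsum_self by (simp add: carrier_MN tsum_MN el_def)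

end

context ground
begin

lemma ktensorI: "module k M \<Longrightarrow> module k N \<Longrightarrow> ktensor k M N"
  by (rule ktensor.intro[OF ground_axioms ktensor_axioms.intro])

lemmas module_ktens [intro, simp] = ktensor.module_MN[OF ktensorI]
lemmas ktens_elem_closed [intro, simp] = ktensor.el_closed[OF ktensorI]
lemmas over_ktens = ktensor.over_MN[OF ktensorI]
lemmas tsum_ktens_elem = ktensor.tsum_el[OF ktensorI]
lemmas lin_tsum = ktensor.lin_tsum[OF ktensorI]
lemmas bilin_ktens_elem = ktensor.bilin_el[OF ktensorI]

lemma module_abelian [intro, simp]: "module k V \<Longrightarrow> abelian_group V"
  using module.axioms(2) by auto

text \<open>Rules that establish linearity of a composite expression by following its syntax.\<close>

lemma lin_elemL:
  "module k M \<Longrightarrow> module k N \<Longrightarrow> y \<in> carrier N \<Longrightarrow> lin V M f \<Longrightarrow> lin V (ktens k M N) (\<lambda>v. ktens_elem k M N (f v) y)"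
  by (rule lin_comp[OF bilin1[OF bilin_ktens_elem]])

lemma lin_elemR:
  "module k M \<Longrightarrow> module k N \<Longrightarrow> x \<in> carrier M \<Longrightarrow> lin V N f \<Longrightarrow> lin V (ktens k M N) (\<lambda>v. ktens_elem k M N x (f v))"
  by (rule lin_comp[OF bilin2[OF bilin_ktens_elem]])

lemma lin_tsum_arg:
  "module k M \<Longrightarrow> module k N \<Longrightarrow> module k G \<Longrightarrow> lin V (ktens k M N) f \<Longrightarrow> bilin M N G F \<Longrightarrow> lin V G (\<lambda>v. tsum G (f v) F)"
  by (rule lin_comp[OF lin_tsum])

lemma lin_tsum_fun:
  assumes "module k G" "over U W X" "\<And>x y. x \<in> U \<Longrightarrow> y \<in> W \<Longrightarrow> lin V G (\<lambda>v. F v x y)" 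
  shows "lin V G (\<lambda>v. tsum G X (F v))"
proof -
  interpret G: module k G by fact
  note ab = G.abelian_group_axioms
  show ?thesis
  proof (rule linI)
    show "tsum G X (F v) \<in> carrier G" if "v \<in> carrier V" for v
      by (rule tsum_closed[OF ab assms(2)]) (rule lin_closed[OF assms(3) that])
    show "tsum G X (F (v \<oplus>\<^bsub>V\<^esub> w)) = tsum G X (F v) \<oplus>\<^bsub>G\<^esub> tsum G X (F w)"
      if "v \<in> carrier V" "w \<in> carrier V" for v w
    proof -
      have "tsum G X (F (v \<oplus>\<^bsub>V\<^esub> w)) = tsum G X (\<lambda>x y. F v x y \<oplus>\<^bsub>G\<^esub> F w x y)"
        by (rule tsum_cong[OF assms(2)]) (rule lin_add[OF assms(3) that])
      also have "\<dots> = tsum G X (F v) \<oplus>\<^bsub>G\<^esub> tsum G X (F w)"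
        by (rule tsum_add[OF ab assms(2)]) (rule lin_closed[OF assms(3)], auto simp: that)+
      finally show ?thesis .
    qed
    show "tsum G X (F (c \<odot>\<^bsub>V\<^esub> v)) = c \<odot>\<^bsub>G\<^esub> tsum G X (F v)" if "c \<in> carrier k" "v \<in> carrier V" for c v
    proof -
      have "additive G G (\<lambda>g. c \<odot>\<^bsub>G\<^esub> g)" using that by (auto intro!: additiveI simp: G.smult_r_distr)
      then show ?thesis
        using tsum_hom[OF \<open>additive G G _\<close> ab ab assms(2), of "F v"] tsum_cong[OF assms(2) lin_smult[OF assms(3) that]]
          lin_closed[OF assms(3) that(2)] by simp
    qed
  qed
qed

lemma lin_tsum_ktens:
  "module k M \<Longrightarrow> module k N \<Longrightarrow> X \<in> carrier (ktens k M N) \<Longrightarrow> module k G \<Longrightarrow>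
    (\<And>x y. x \<in> carrier M \<Longrightarrow> y \<in> carrier N \<Longrightarrow> lin V G (\<lambda>v. F v x y)) \<Longrightarrow>
    lin V G (\<lambda>v. tsum G X (F v))"
  by (rule lin_tsum_fun[OF _ over_ktens])

lemma tsum_lin:
  assumes "lin G G' \<phi>" "module k G" "module k G'" "over U V X"
    "\<And>x y. x \<in> U \<Longrightarrow> y \<in> V \<Longrightarrow> F x y \<in> carrier G"
  shows "\<phi> (tsum G X F) = tsum G' X (\<lambda>x y. \<phi> (F x y))"
  by (rule tsum_hom[OF lin_additive[OF assms(1)] module_abelian[OF assms(2)] module_abelian[OF assms(3)] assms(4)])
    (rule assms(5))

subsection \<open>Algebras over the ground field\<close>

lemma k_algebra_module [simp]: "k_algebra k A \<Longrightarrow> module k A"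
  and k_algebra_ring: "k_algebra k A \<Longrightarrow> ring A"
  by (auto simp: k_algebra_def)

lemma k_algebra_smult:
  assumes "k_algebra k A" "c \<in> carrier k" "x \<in> carrier A" "y \<in> carrier A"
  shows "(c \<odot>\<^bsub>A\<^esub> x) \<otimes>\<^bsub>A\<^esub> y = c \<odot>\<^bsub>A\<^esub> (x \<otimes>\<^bsub>A\<^esub> y)" "x \<otimes>\<^bsub>A\<^esub> (c \<odot>\<^bsub>A\<^esub> y) = c \<odot>\<^bsub>A\<^esub> (x \<otimes>\<^bsub>A\<^esub> y)"
  using assms by (auto simp: k_algebra_def)

lemma lin_multL:
  assumes "k_algebra k A" "a \<in> carrier A" "lin V A f"
  shows "lin V A (\<lambda>v. f v \<otimes>\<^bsub>A\<^esub> a)"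
proof -
  interpret A: ring A by (rule k_algebra_ring[OF assms(1)])
  show ?thesis
    by (rule linI) (simp_all add: lin_closed[OF assms(3)] lin_add[OF assms(3)] lin_smult[OF assms(3)]
        assms(2) A.l_distr k_algebra_smult[OF assms(1)])
qed

lemma lin_multR:
  assumes "k_algebra k A" "a \<in> carrier A" "lin V A f"
  shows "lin V A (\<lambda>v. a \<otimes>\<^bsub>A\<^esub> f v)"
proof -
  interpret A: ring A by (rule k_algebra_ring[OF assms(1)])
  note cl = lin_closed[OF assms(3)]
  show ?thesis
  proof (rule linI)
    fix x assume "x \<in> carrier V"
    from cl[OF this] show "a \<otimes>\<^bsub>A\<^esub> f x \<in> carrier A" using assms(2) by simp
  next
    fix x y assume xy: "x \<in> carrier V" "y \<in> carrier V"
    show "a \<otimes>\<^bsub>A\<^esub> f (x \<oplus>\<^bsub>V\<^esub> y) = a \<otimes>\<^bsub>A\<^esub> f x \<oplus>\<^bsub>A\<^esub> a \<otimes>\<^bsub>A\<^esub> f y"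
      unfolding lin_add[OF assms(3) xy] by (rule A.r_distr[OF cl[OF xy(1)] cl[OF xy(2)] assms(2)])
  next
    fix c x assume cx: "c \<in> carrier k" "x \<in> carrier V"
    show "a \<otimes>\<^bsub>A\<^esub> f (c \<odot>\<^bsub>V\<^esub> x) = c \<odot>\<^bsub>A\<^esub> (a \<otimes>\<^bsub>A\<^esub> f x)"
      unfolding lin_smult[OF assms(3) cx] by (rule k_algebra_smult(2)[OF assms(1) cx(1) assms(2) cl[OF cx(2)]])
  qed
qed

lemmas lin_intros = lin_id lin_elemL lin_elemR lin_tsum_ktens lin_tsum_arg lin_multL lin_multR
  lin_smultR lin_scalar bilinI

end

locale ktensor_alg = ground + fixes A B assumes alg_A: "k_algebra k A" and alg_B: "k_algebra k B"
begin

sublocale A: ring A by (rule k_algebra_ring[OF alg_A])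
sublocale B: ring B by (rule k_algebra_ring[OF alg_B])
sublocale AB: ktensor k A B by (rule ktensorI[OF k_algebra_module[OF alg_A] k_algebra_module[OF alg_B]])

lemma mult_AB: "X \<otimes>\<^bsub>AB.MN\<^esub> Y = tsum AB.MN X (\<lambda>x y. tsum AB.MN Y (\<lambda>x' y'. AB.el (x \<otimes>\<^bsub>A\<^esub> x') (y \<otimes>\<^bsub>B\<^esub> y')))"
  unfolding AB.tsum_MN by (simp add: ktens_def Let_def)

lemma one_AB: "\<one>\<^bsub>AB.MN\<^esub> = AB.el \<one>\<^bsub>A\<^esub> \<one>\<^bsub>B\<^esub>"
  by (simp add: ktens_def Let_def)

lemma bilin_mult_gen: "x \<in> carrier A \<Longrightarrow> y \<in> carrier B \<Longrightarrow>
   bilin A B AB.MN (\<lambda>x' y'. AB.el (x \<otimes>\<^bsub>A\<^esub> x') (y \<otimes>\<^bsub>B\<^esub> y'))"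
  by (intro lin_intros) (auto simp: alg_A alg_B)

lemma lin_mult_right: "X \<in> carrier AB.MN \<Longrightarrow> lin AB.MN AB.MN (\<lambda>Y. X \<otimes>\<^bsub>AB.MN\<^esub> Y)"
  unfolding mult_AB by (intro lin_intros) (auto simp: alg_A alg_B)

lemma lin_mult_left: "Y \<in> carrier AB.MN \<Longrightarrow> lin AB.MN AB.MN (\<lambda>X. X \<otimes>\<^bsub>AB.MN\<^esub> Y)"
  unfolding mult_AB by (intro lin_intros) (auto simp: alg_A alg_B)

lemma mult_el:
  assumes "x \<in> carrier A" "y \<in> carrier B" "x' \<in> carrier A" "y' \<in> carrier B"
  shows "AB.el x y \<otimes>\<^bsub>AB.MN\<^esub> AB.el x' y' = AB.el (x \<otimes>\<^bsub>A\<^esub> x') (y \<otimes>\<^bsub>B\<^esub> y')"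
proof -
  have "bilin A B AB.MN (\<lambda>x y. tsum AB.MN (AB.el x' y') (\<lambda>x' y'. AB.el (x \<otimes>\<^bsub>A\<^esub> x') (y \<otimes>\<^bsub>B\<^esub> y')))"
    using assms by (intro lin_intros) (auto simp: alg_A alg_B)
  then show ?thesis unfolding mult_AB using assms bilin_mult_gen
    by (simp add: AB.tsum_el[OF AB.abelian_MN])
qed

lemma mult_closed: "X \<in> carrier AB.MN \<Longrightarrow> Y \<in> carrier AB.MN \<Longrightarrow> X \<otimes>\<^bsub>AB.MN\<^esub> Y \<in> carrier AB.MN"
  using lin_closed[OF lin_mult_left] by blast

lemma mult_distl: "X \<in> carrier AB.MN \<Longrightarrow> Y \<in> carrier AB.MN \<Longrightarrow> Z \<in> carrier AB.MN \<Longrightarrow>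
    (X \<oplus>\<^bsub>AB.MN\<^esub> Y) \<otimes>\<^bsub>AB.MN\<^esub> Z = X \<otimes>\<^bsub>AB.MN\<^esub> Z \<oplus>\<^bsub>AB.MN\<^esub> Y \<otimes>\<^bsub>AB.MN\<^esub> Z"
  by (rule lin_add[OF lin_mult_left])

lemma mult_distr: "X \<in> carrier AB.MN \<Longrightarrow> Y \<in> carrier AB.MN \<Longrightarrow> Z \<in> carrier AB.MN \<Longrightarrow>
    Z \<otimes>\<^bsub>AB.MN\<^esub> (X \<oplus>\<^bsub>AB.MN\<^esub> Y) = Z \<otimes>\<^bsub>AB.MN\<^esub> X \<oplus>\<^bsub>AB.MN\<^esub> Z \<otimes>\<^bsub>AB.MN\<^esub> Y"
  by (rule lin_add[OF lin_mult_right])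

lemma mult_assoc_el:
  assumes "X \<in> carrier AB.MN" "y \<in> carrier A" "y' \<in> carrier B" "z \<in> carrier A" "z' \<in> carrier B"
  shows "(X \<otimes>\<^bsub>AB.MN\<^esub> AB.el y y') \<otimes>\<^bsub>AB.MN\<^esub> AB.el z z' = X \<otimes>\<^bsub>AB.MN\<^esub> (AB.el y y' \<otimes>\<^bsub>AB.MN\<^esub> AB.el z z')"
  using assms(1)
proof (induction X rule: AB.MN_induct)
  case (gen x x')
  then show ?case using assms by (simp add: mult_el A.m_assoc B.m_assoc)
next
  case (add X Y)
  then show ?case using assms by (simp add: mult_distl mult_closed)
qed

lemma mult_assoc_el2:
  assumes "X \<in> carrier AB.MN" "Y \<in> carrier AB.MN" "z \<in> carrier A" "z' \<in> carrier B"
  shows "(X \<otimes>\<^bsub>AB.MN\<^esub> Y) \<otimes>\<^bsub>AB.MN\<^esub> AB.el z z' = X \<otimes>\<^bsub>AB.MN\<^esub> (Y \<otimes>\<^bsub>AB.MN\<^esub> AB.el z z')"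
  using assms(2)
proof (induction Y rule: AB.MN_induct)
  case (gen x x')
  then show ?case using assms by (simp add: mult_assoc_el)
next
  case (add U V)
  then show ?case using assms by (simp add: mult_distl mult_distr mult_closed)
qed

lemma mult_assoc:
  assumes "X \<in> carrier AB.MN" "Y \<in> carrier AB.MN" "Z \<in> carrier AB.MN"
  shows "(X \<otimes>\<^bsub>AB.MN\<^esub> Y) \<otimes>\<^bsub>AB.MN\<^esub> Z = X \<otimes>\<^bsub>AB.MN\<^esub> (Y \<otimes>\<^bsub>AB.MN\<^esub> Z)"
  using assms(3)
proof (induction Z rule: AB.MN_induct)
  case (gen x x')
  then show ?case using assms by (simp add: mult_assoc_el2)
next
  case (add U V)
  then show ?case using assms by (simp add: mult_distl mult_distr mult_closed)
qed

lemma mult_one_left: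
  assumes "X \<in> carrier AB.MN" shows "\<one>\<^bsub>AB.MN\<^esub> \<otimes>\<^bsub>AB.MN\<^esub> X = X"
  using assms by (induction X rule: AB.MN_induct) (simp_all add: one_AB mult_el mult_distr)

lemma mult_one_right:
  assumes "X \<in> carrier AB.MN" shows "X \<otimes>\<^bsub>AB.MN\<^esub> \<one>\<^bsub>AB.MN\<^esub> = X"
  using assms by (induction X rule: AB.MN_induct) (simp_all add: one_AB mult_el mult_distl)

lemma ring_AB: "ring AB.MN"
proof (rule ringI[OF AB.abelian_MN])
  show "monoid AB.MN"
    by (rule monoidI) (simp_all add: mult_closed mult_assoc mult_one_left mult_one_right, simp add: one_AB)
qed (simp_all add: mult_distl mult_distr)

lemma alg_AB: "k_algebra k AB.MN"
  unfolding k_algebra_def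
  by (intro conjI ballI ring_AB AB.module_MN lin_smult[OF lin_mult_left] lin_smult[OF lin_mult_right])

end

section \<open>Sweedler calculus in a cocommutative Hopf algebra\<close>

locale cocomm_hopf = ground k for k :: "'k ring" +
  fixes H :: "('k, 'h) hopf"
  assumes hopf: "hopf_algebra k H" and cocomm: "cocommutative k H"
begin

abbreviation mult_H (infixl "\<star>" 70) where "g \<star> h \<equiv> g \<otimes>\<^bsub>H\<^esub> h"

abbreviation "HH \<equiv> ktens k H H"

text \<open>In Sweedler notation, \<open>sw G h F\<close> is the sum of the \<open>F h\<^sub>1 h\<^sub>2\<close>.\<close>

abbreviation sw where "sw G h F \<equiv> tsum G (comult H h) F"

lemma alg_H: "k_algebra k H"
  using hopf by (simp only: hopf_algebra_def)

lemma module_H [simp]: "module k H"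
  by (rule k_algebra_module[OF alg_H])

sublocale H: ring H by (rule k_algebra_ring[OF alg_H])
sublocale H: module k H by (rule module_H)
sublocale HH: ktensor_alg k H H
  by (rule ktensor_alg.intro[OF ground_axioms ktensor_alg_axioms.intro[OF alg_H alg_H]])

lemma lin_comult0: "lin H HH (comult H)"
  using hopf by (simp add: hopf_algebra_def lin_def)

lemma lin_counit0: "lin H (base_module k) (counit H)"
  using hopf by (simp add: hopf_algebra_def lin_def)

lemma lin_antipode0: "lin H H (antipode H)"
  using hopf by (simp add: hopf_algebra_def lin_def)

lemmas lin_comult = lin_comp[OF lin_comult0] and lin_counit = lin_comp[OF lin_counit0]
  and lin_antipode = lin_comp[OF lin_antipode0]

lemma comult_closed [simp]: "h \<in> carrier H \<Longrightarrow> comult H h \<in> carrier HH"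
  by (rule lin_closed[OF lin_comult0])

lemma counit_closed [simp]: "h \<in> carrier H \<Longrightarrow> counit H h \<in> carrier k"
  using lin_closed[OF lin_counit0] by simp

lemma antipode_closed [simp]: "h \<in> carrier H \<Longrightarrow> antipode H h \<in> carrier H"
  by (rule lin_closed[OF lin_antipode0])

lemma over_comult: "h \<in> carrier H \<Longrightarrow> over (carrier H) (carrier H) (comult H h)"
  by (rule over_ktens) simp_all

lemma lin_sw_fun:
  "h \<in> carrier H \<Longrightarrow> module k G \<Longrightarrow>
    (\<And>x y. x \<in> carrier H \<Longrightarrow> y \<in> carrier H \<Longrightarrow> lin V G (\<lambda>v. F v x y)) \<Longrightarrow> lin V G (\<lambda>v. sw G h (F v))"
  by (rule lin_tsum_fun[OF _ over_comult])

lemma lin_sw_arg: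
  "module k G \<Longrightarrow> lin V H f \<Longrightarrow> bilin H H G F \<Longrightarrow> lin V G (\<lambda>v. sw G (f v) F)"
  by (rule lin_tsum_arg[OF module_H module_H _ lin_comult])

lemmas hlin = lin_id lin_elemL lin_elemR lin_sw_fun lin_sw_arg lin_multL lin_multR
  lin_smultR lin_scalar bilinI lin_comult lin_counit lin_antipode

lemma sw_cong:
  "h \<in> carrier H \<Longrightarrow> (\<And>x y. x \<in> carrier H \<Longrightarrow> y \<in> carrier H \<Longrightarrow> F x y = F' x y) \<Longrightarrow> sw G h F = sw G h F'"
  by (rule tsum_cong[OF over_comult])

lemma sw_closed:
  "module k G \<Longrightarrow> h \<in> carrier H \<Longrightarrow> (\<And>x y. x \<in> carrier H \<Longrightarrow> y \<in> carrier H \<Longrightarrow> F x y \<in> carrier G) \<Longrightarrow>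
    sw G h F \<in> carrier G"
  by (rule tsum_closed[OF module_abelian over_comult])

lemma sw_lin:
  assumes "lin G G' \<phi>" "module k G" "module k G'" "h \<in> carrier H"
    "\<And>x y. x \<in> carrier H \<Longrightarrow> y \<in> carrier H \<Longrightarrow> F x y \<in> carrier G"
  shows "\<phi> (sw G h F) = sw G' h (\<lambda>x y. \<phi> (F x y))"
  by (rule tsum_lin[OF assms(1-3) over_comult[OF assms(4)] assms(5)])

lemma sw_swap:
  assumes "module k G" "g \<in> carrier H" "over U V X"
    "\<And>x y u v. x \<in> carrier H \<Longrightarrow> y \<in> carrier H \<Longrightarrow> u \<in> U \<Longrightarrow> v \<in> V \<Longrightarrow> F x y u v \<in> carrier G"
  shows "sw G g (\<lambda>x y. tsum G X (\<lambda>u v. F x y u v)) = tsum G X (\<lambda>u v. sw G g (\<lambda>x y. F x y u v))"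
  by (rule tsum_swap[OF module_abelian[OF assms(1)] over_comult[OF assms(2)] assms(3,4)])

text \<open>Rules for a comodule over \<open>H\<close>, used for \<open>H\<close> itself and for the comodule algebra \<open>A\<close>.\<close>

lemma coaction_coassoc:
  assumes V: "module k V" and \<rho>: "\<And>a. a \<in> carrier V \<Longrightarrow> \<rho> a \<in> carrier (ktens k V H)"
    and co: "\<And>a. a \<in> carrier V \<Longrightarrow>
      (let VH = ktens k V H; VHH = ktens k VH H in
        tsum VHH (\<rho> a) (\<lambda>x h. ktens_elem k VH H (\<rho> x) h) =
        tsum VHH (\<rho> a) (\<lambda>x h. sw VHH h (\<lambda>h' h''. ktens_elem k VH H (ktens_elem k V H x h') h'')))"
    and G: "module k G" and a: "a \<in> carrier V"
    and F1: "\<And>y z. y \<in> carrier H \<Longrightarrow> z \<in> carrier H \<Longrightarrow> lin V G (\<lambda>x. F x y z)"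
    and F2: "\<And>x z. x \<in> carrier V \<Longrightarrow> z \<in> carrier H \<Longrightarrow> lin H G (\<lambda>y. F x y z)"
    and F3: "\<And>x y. x \<in> carrier V \<Longrightarrow> y \<in> carrier H \<Longrightarrow> lin H G (\<lambda>z. F x y z)"
  shows "tsum G (\<rho> a) (\<lambda>x z. tsum G (\<rho> x) (\<lambda>u v. F u v z)) = tsum G (\<rho> a) (\<lambda>u y. sw G y (\<lambda>v w. F u v w))"
proof -
  let ?VH = "ktens k V H"
  let ?T = "ktens k ?VH H"
  let ?\<Phi> = "\<lambda>T. tsum G T (\<lambda>X z. tsum G X (\<lambda>u v. F u v z))"
  note ov = over_ktens[OF V module_H \<rho>]
  have VH: "module k ?VH" and T: "module k ?T" using V by simp_all
  have B2: "bilin V H G (\<lambda>u v. F u v z)" if "z \<in> carrier H" for z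
    using that by (intro bilinI F1 F2)
  have B: "bilin ?VH H G (\<lambda>X z. tsum G X (\<lambda>u v. F u v z))"
    by (intro bilinI lin_tsum[OF V module_H G B2] lin_tsum_fun[OF G over_ktens[OF V module_H]] F3)
  have L: "lin ?T G ?\<Phi>" by (rule lin_tsum[OF VH module_H G B])
  note el = tsum_ktens_elem[OF VH module_H module_abelian[OF G] B] and el2 = tsum_ktens_elem[OF V module_H module_abelian[OF G] B2]
  have "?\<Phi> (tsum ?T (\<rho> a) (\<lambda>x y. ktens_elem k ?VH H (\<rho> x) y)) =
      tsum G (\<rho> a) (\<lambda>x y. ?\<Phi> (ktens_elem k ?VH H (\<rho> x) y))"
    using VH by (intro tsum_lin[OF L T G ov[OF a]]) (simp add: \<rho>)
  also have "\<dots> = tsum G (\<rho> a) (\<lambda>x z. tsum G (\<rho> x) (\<lambda>u v. F u v z))"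
    by (rule tsum_cong[OF ov[OF a]]) (simp add: el \<rho>)
  finally have 1: "?\<Phi> (tsum ?T (\<rho> a) (\<lambda>x y. ktens_elem k ?VH H (\<rho> x) y)) = \<dots>" .
  have "?\<Phi> (tsum ?T (\<rho> a) (\<lambda>x y. sw ?T y (\<lambda>y' y''. ktens_elem k ?VH H (ktens_elem k V H x y') y''))) =
      tsum G (\<rho> a) (\<lambda>x y. ?\<Phi> (sw ?T y (\<lambda>y' y''. ktens_elem k ?VH H (ktens_elem k V H x y') y'')))"
    using V by (intro tsum_lin[OF L T G ov[OF a]]) (simp add: sw_closed[OF T])
  also have "\<dots> = tsum G (\<rho> a) (\<lambda>u y. sw G y (\<lambda>v w. F u v w))"
  proof (rule tsum_cong[OF ov[OF a]])
    fix x y assume x: "x \<in> carrier V" and y: "y \<in> carrier H"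
    have "?\<Phi> (sw ?T y (\<lambda>y' y''. ktens_elem k ?VH H (ktens_elem k V H x y') y'')) =
        sw G y (\<lambda>y' y''. ?\<Phi> (ktens_elem k ?VH H (ktens_elem k V H x y') y''))"
      using x V by (intro sw_lin[OF L T G y]) simp
    also have "\<dots> = sw G y (\<lambda>v w. F x v w)"
      using x V by (intro sw_cong[OF y]) (simp add: el el2)
    finally show "?\<Phi> (sw ?T y (\<lambda>y' y''. ktens_elem k ?VH H (ktens_elem k V H x y') y'')) = \<dots>" .
  qed
  finally show ?thesis using co[OF a] 1 by (simp add: Let_def)
qed

lemma coaction_counit:
  assumes V: "module k V" and \<rho>: "\<rho> a \<in> carrier (ktens k V H)" and a: "tsum V (\<rho> a) (\<lambda>x y. counit H y \<odot>\<^bsub>V\<^esub> x) = a"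
    and f: "lin V G f" and G: "module k G"
  shows "tsum G (\<rho> a) (\<lambda>x y. counit H y \<odot>\<^bsub>G\<^esub> f x) = f a"
proof -
  interpret V: module k V by fact
  note ov = over_ktens[OF V module_H \<rho>]
  have "f a = f (tsum V (\<rho> a) (\<lambda>x y. counit H y \<odot>\<^bsub>V\<^esub> x))" by (simp only: a)
  also have "\<dots> = tsum G (\<rho> a) (\<lambda>x y. f (counit H y \<odot>\<^bsub>V\<^esub> x))" by (rule tsum_lin[OF f V G ov]) simp
  also have "\<dots> = tsum G (\<rho> a) (\<lambda>x y. counit H y \<odot>\<^bsub>G\<^esub> f x)"
    by (rule tsum_cong[OF ov]) (simp add: lin_smult[OF f])
  finally show ?thesis ..
qed

lemma coaction_mult:
  assumes V: "k_algebra k V" and \<rho>: "\<rho> a \<in> carrier (ktens k V H)" "\<rho> b \<in> carrier (ktens k V H)"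
    and ab: "\<rho> (a \<otimes>\<^bsub>V\<^esub> b) = \<rho> a \<otimes>\<^bsub>ktens k V H\<^esub> \<rho> b" and F: "bilin V H G F" and G: "module k G"
  shows "tsum G (\<rho> (a \<otimes>\<^bsub>V\<^esub> b)) F = tsum G (\<rho> a) (\<lambda>x g. tsum G (\<rho> b) (\<lambda>y h. F (x \<otimes>\<^bsub>V\<^esub> y) (g \<star> h)))"
proof -
  interpret VH: ktensor_alg k V H
    by (rule ktensor_alg.intro[OF ground_axioms ktensor_alg_axioms.intro[OF V alg_H]])
  note mV = k_algebra_module[OF V]
  let ?VH = "ktens k V H" and ?el = "ktens_elem k V H"
  have L: "lin ?VH G (\<lambda>X. tsum G X F)" by (rule lin_tsum[OF mV module_H G F])
  note T = VH.AB.module_MN and oa = over_ktens[OF mV module_H \<rho>(1)] and ob = over_ktens[OF mV module_H \<rho>(2)]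
  have el: "?el (x \<otimes>\<^bsub>V\<^esub> y) (g \<star> h) \<in> carrier ?VH"
    if "x \<in> carrier V" "y \<in> carrier V" "g \<in> carrier H" "h \<in> carrier H" for x y g h using that by simp
  have "tsum G (\<rho> (a \<otimes>\<^bsub>V\<^esub> b)) F = tsum G (tsum ?VH (\<rho> a) (\<lambda>x g. tsum ?VH (\<rho> b) (\<lambda>y h. ?el (x \<otimes>\<^bsub>V\<^esub> y) (g \<star> h)))) F"
    by (simp only: ab VH.mult_AB)
  also have "\<dots> = tsum G (\<rho> a) (\<lambda>x g. tsum G (tsum ?VH (\<rho> b) (\<lambda>y h. ?el (x \<otimes>\<^bsub>V\<^esub> y) (g \<star> h))) F)"
    by (rule tsum_lin[OF L T G oa]) (rule tsum_closed[OF module_abelian[OF T] ob], rule el)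
  also have "\<dots> = tsum G (\<rho> a) (\<lambda>x g. tsum G (\<rho> b) (\<lambda>y h. tsum G (?el (x \<otimes>\<^bsub>V\<^esub> y) (g \<star> h)) F))"
    by (rule tsum_cong[OF oa], rule tsum_lin[OF L T G ob], rule el)
  also have "\<dots> = tsum G (\<rho> a) (\<lambda>x g. tsum G (\<rho> b) (\<lambda>y h. F (x \<otimes>\<^bsub>V\<^esub> y) (g \<star> h)))"
    by (rule tsum_cong[OF oa], rule tsum_cong[OF ob], rule tsum_ktens_elem[OF mV module_H module_abelian[OF G] F]) simp_all
  finally show ?thesis .
qed

lemma sw_coassoc:
  assumes G: "module k G" and h: "h \<in> carrier H"
    and F1: "\<And>y z. y \<in> carrier H \<Longrightarrow> z \<in> carrier H \<Longrightarrow> lin H G (\<lambda>x. F x y z)"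
    and F2: "\<And>x z. x \<in> carrier H \<Longrightarrow> z \<in> carrier H \<Longrightarrow> lin H G (\<lambda>y. F x y z)"
    and F3: "\<And>x y. x \<in> carrier H \<Longrightarrow> y \<in> carrier H \<Longrightarrow> lin H G (\<lambda>z. F x y z)"
  shows "sw G h (\<lambda>x z. sw G x (\<lambda>u v. F u v z)) = sw G h (\<lambda>u y. sw G y (\<lambda>v w. F u v w))"
  by (rule coaction_coassoc[OF module_H comult_closed _ G h F1 F2 F3])
    (use hopf in \<open>simp_all add: hopf_algebra_def Let_def\<close>)

lemma sw_counit_left:
  assumes "lin H G f" "module k G" "h \<in> carrier H"
  shows "sw G h (\<lambda>x y. counit H x \<odot>\<^bsub>G\<^esub> f y) = f h"
proof -
  have "f h = f (sw H h (\<lambda>x y. counit H x \<odot>\<^bsub>H\<^esub> y))"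
    using hopf assms(3) by (simp add: hopf_algebra_def)
  also have "\<dots> = sw G h (\<lambda>x y. f (counit H x \<odot>\<^bsub>H\<^esub> y))"
    using assms by (intro sw_lin) simp_all
  also have "\<dots> = sw G h (\<lambda>x y. counit H x \<odot>\<^bsub>G\<^esub> f y)"
    by (rule sw_cong[OF assms(3)]) (simp add: lin_smult[OF assms(1)])
  finally show ?thesis ..
qed

lemma sw_counit_right:
  assumes "lin H G f" "module k G" "h \<in> carrier H"
  shows "sw G h (\<lambda>x y. counit H y \<odot>\<^bsub>G\<^esub> f x) = f h"
  by (rule coaction_counit[OF module_H _ _ assms(1,2)]) (use hopf assms(3) in \<open>simp_all add: hopf_algebra_def\<close>)

lemma sw_antipode_left:
  assumes "lin H G f" "module k G" "h \<in> carrier H"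
  shows "sw G h (\<lambda>x y. f (antipode H x \<star> y)) = counit H h \<odot>\<^bsub>G\<^esub> f \<one>\<^bsub>H\<^esub>"
proof -
  have "sw G h (\<lambda>x y. f (antipode H x \<star> y)) = f (sw H h (\<lambda>x y. antipode H x \<star> y))"
    using assms by (intro sw_lin[symmetric]) simp_all
  also have "\<dots> = f (counit H h \<odot>\<^bsub>H\<^esub> \<one>\<^bsub>H\<^esub>)"
    using hopf assms(3) by (simp add: hopf_algebra_def)
  finally show ?thesis using assms by (simp add: lin_smult[OF assms(1)])
qed

lemma sw_antipode_right:
  assumes "lin H G f" "module k G" "h \<in> carrier H"
  shows "sw G h (\<lambda>x y. f (x \<star> antipode H y)) = counit H h \<odot>\<^bsub>G\<^esub> f \<one>\<^bsub>H\<^esub>"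
proof -
  have "sw G h (\<lambda>x y. f (x \<star> antipode H y)) = f (sw H h (\<lambda>x y. x \<star> antipode H y))"
    using assms by (intro sw_lin[symmetric]) simp_all
  also have "\<dots> = f (counit H h \<odot>\<^bsub>H\<^esub> \<one>\<^bsub>H\<^esub>)"
    using hopf assms(3) by (simp add: hopf_algebra_def)
  finally show ?thesis using assms by (simp add: lin_smult[OF assms(1)])
qed

lemma sw_cocomm:
  assumes "bilin H H G F" "module k G" "h \<in> carrier H"
  shows "sw G h F = sw G h (\<lambda>x y. F y x)"
proof -
  have "sw G h F = tsum G (sw HH h (\<lambda>x y. ktens_elem k H H y x)) F"
    using cocomm assms(3) by (simp add: cocommutative_def)
  also have "\<dots> = sw G h (\<lambda>x y. tsum G (ktens_elem k H H y x) F)"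
    using assms by (intro sw_lin[OF lin_tsum]) simp_all
  also have "\<dots> = sw G h (\<lambda>x y. F y x)"
    using assms by (intro sw_cong tsum_ktens_elem) simp_all
  finally show ?thesis .
qed

lemma comult_mult: "g \<in> carrier H \<Longrightarrow> h \<in> carrier H \<Longrightarrow> comult H (g \<star> h) = comult H g \<otimes>\<^bsub>HH\<^esub> comult H h"
  and comult_one: "comult H \<one>\<^bsub>H\<^esub> = ktens_elem k H H \<one>\<^bsub>H\<^esub> \<one>\<^bsub>H\<^esub>"
  using hopf by (simp_all add: hopf_algebra_def ring_hom_def HH.one_AB)

lemma counit_mult: "g \<in> carrier H \<Longrightarrow> h \<in> carrier H \<Longrightarrow> counit H (g \<star> h) = counit H g \<otimes>\<^bsub>k\<^esub> counit H h"
  and counit_one [simp]: "counit H \<one>\<^bsub>H\<^esub> = \<one>\<^bsub>k\<^esub>"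
  using hopf by (simp_all add: hopf_algebra_def ring_hom_def)

lemma sw_mult:
  assumes F: "bilin H H G F" and G: "module k G" and g: "g \<in> carrier H" and h: "h \<in> carrier H"
  shows "sw G (g \<star> h) F = sw G g (\<lambda>x y. sw G h (\<lambda>u v. F (x \<star> u) (y \<star> v)))"
  by (rule coaction_mult[OF alg_H _ _ comult_mult[OF g h] F G]) (simp_all add: g h)

subsection \<open>The antipode of a cocommutative Hopf algebra\<close>

definition SS :: "'h \<Rightarrow> ('h, 'h) tens" where
  "SS h = sw HH h (\<lambda>x y. ktens_elem k H H (antipode H x) (antipode H y))"

lemma lin_SS: "lin H HH SS"
  unfolding SS_def by (intro hlin) simp_all

lemma SS_closed [simp]: "h \<in> carrier H \<Longrightarrow> SS h \<in> carrier HH"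
  by (rule lin_closed[OF lin_SS])

text \<open>\<open>(S \<otimes> S) \<circ> \<Delta>\<close> is a right convolution inverse of \<open>\<Delta>\<close>: by cocommutativity the product is
  \<open>h\<^sub>1 S(h\<^sub>4) \<otimes> h\<^sub>2 S(h\<^sub>3)\<close>, which collapses from the inside.\<close>

lemma comult_conv_SS:
  assumes h: "h \<in> carrier H"
  shows "sw HH h (\<lambda>x y. comult H x \<otimes>\<^bsub>HH\<^esub> SS y) = counit H h \<odot>\<^bsub>HH\<^esub> \<one>\<^bsub>HH\<^esub>"
proof -
  let ?el = "ktens_elem k H H" and ?S = "antipode H"
  have T: "module k HH" by simp
  note [simp] = alg_H HH.alg_AB sw_closed[OF T] HH.mult_el
  define \<Psi> where "\<Psi> a b y = sw HH y (\<lambda>c d. ?el (a \<star> ?S d) (b \<star> ?S c))" for a b y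
  have "sw HH h (\<lambda>x y. comult H x \<otimes>\<^bsub>HH\<^esub> SS y) = sw HH h (\<lambda>x y. sw HH x (\<lambda>a b. \<Psi> a b y))"
  proof (rule sw_cong[OF h])
    fix x y assume x: "x \<in> carrier H" and y: "y \<in> carrier H"
    have "comult H x \<otimes>\<^bsub>HH\<^esub> SS y = sw HH x (\<lambda>a b. tsum HH (SS y) (\<lambda>c d. ?el (a \<star> c) (b \<star> d)))"
      by (simp only: HH.mult_AB)
    also have "\<dots> = sw HH x (\<lambda>a b. \<Psi> a b y)"
    proof (rule sw_cong[OF x])
      fix a b assume ab: "a \<in> carrier H" "b \<in> carrier H"
      have L: "lin HH HH (\<lambda>X. tsum HH X (\<lambda>c d. ?el (a \<star> c) (b \<star> d)))"
        using ab by (intro lin_tsum hlin) simp_all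
      have "tsum HH (SS y) (\<lambda>c d. ?el (a \<star> c) (b \<star> d)) =
          sw HH y (\<lambda>c d. tsum HH (?el (?S c) (?S d)) (\<lambda>c d. ?el (a \<star> c) (b \<star> d)))"
        unfolding SS_def by (rule sw_lin[OF L T T y]) simp
      also have "\<dots> = sw HH y (\<lambda>c d. ?el (a \<star> ?S c) (b \<star> ?S d))"
        using ab by (intro sw_cong[OF y] tsum_ktens_elem hlin) simp_all
      also have "\<dots> = \<Psi> a b y"
        unfolding \<Psi>_def using ab by (intro sw_cocomm[OF _ T y] hlin) simp_all
      finally show "tsum HH (SS y) (\<lambda>c d. ?el (a \<star> c) (b \<star> d)) = \<Psi> a b y" .
    qed
    finally show "comult H x \<otimes>\<^bsub>HH\<^esub> SS y = \<dots>" .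
  qed
  also have "\<dots> = sw HH h (\<lambda>a z. sw HH z (\<lambda>b y. \<Psi> a b y))"
    unfolding \<Psi>_def by (intro sw_coassoc T h hlin) simp_all
  also have "\<dots> = sw HH h (\<lambda>a z. ?el (a \<star> ?S z) \<one>\<^bsub>H\<^esub>)"
  proof (rule sw_cong[OF h])
    fix a z assume a: "a \<in> carrier H" and z: "z \<in> carrier H"
    have "sw HH z (\<lambda>b y. \<Psi> a b y) = sw HH z (\<lambda>e d. sw HH e (\<lambda>b c. ?el (a \<star> ?S d) (b \<star> ?S c)))"
      unfolding \<Psi>_def using a by (intro sw_coassoc[symmetric] T z hlin) simp_all
    also have "\<dots> = sw HH z (\<lambda>e d. counit H e \<odot>\<^bsub>HH\<^esub> ?el (a \<star> ?S d) \<one>\<^bsub>H\<^esub>)"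
      using a by (intro sw_cong[OF z] sw_antipode_right[where f = "\<lambda>u. ?el _ u"] hlin) simp_all
    also have "\<dots> = ?el (a \<star> ?S z) \<one>\<^bsub>H\<^esub>"
      using a by (intro sw_counit_left T z hlin) simp_all
    finally show "sw HH z (\<lambda>b y. \<Psi> a b y) = \<dots>" .
  qed
  also have "\<dots> = counit H h \<odot>\<^bsub>HH\<^esub> ?el \<one>\<^bsub>H\<^esub> \<one>\<^bsub>H\<^esub>"
    by (intro sw_antipode_right[where f = "\<lambda>u. ?el u \<one>\<^bsub>H\<^esub>"] T h hlin) simp_all
  finally show ?thesis by (simp only: HH.one_AB)
qed

text \<open>Convolution inverses are unique, and \<open>\<Delta> \<circ> S\<close> is a left inverse of \<open>\<Delta>\<close>.\<close>

lemma comult_antipode: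
  assumes h: "h \<in> carrier H"
  shows "comult H (antipode H h) = SS h"
proof -
  let ?S = "antipode H"
  have T: "module k HH" by simp
  note [simp] = alg_H HH.alg_AB sw_closed[OF T] HH.mult_closed
  have one: "\<one>\<^bsub>HH\<^esub> \<in> carrier HH" unfolding HH.one_AB by simp
  have "comult H (?S h) = sw HH h (\<lambda>x y. counit H y \<odot>\<^bsub>HH\<^esub> comult H (?S x))"
    by (intro sw_counit_right[symmetric] T h hlin)
  also have "\<dots> = sw HH h (\<lambda>x y. sw HH y (\<lambda>u v. comult H (?S x) \<otimes>\<^bsub>HH\<^esub> (comult H u \<otimes>\<^bsub>HH\<^esub> SS v)))"
  proof (rule sw_cong[OF h])
    fix x y assume x: "x \<in> carrier H" and y: "y \<in> carrier H"
    have "counit H y \<odot>\<^bsub>HH\<^esub> comult H (?S x) = comult H (?S x) \<otimes>\<^bsub>HH\<^esub> (counit H y \<odot>\<^bsub>HH\<^esub> \<one>\<^bsub>HH\<^esub>)"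
      using x y one by (simp add: k_algebra_smult[OF HH.alg_AB] HH.mult_one_right)
    also have "\<dots> = comult H (?S x) \<otimes>\<^bsub>HH\<^esub> sw HH y (\<lambda>u v. comult H u \<otimes>\<^bsub>HH\<^esub> SS v)"
      by (simp only: comult_conv_SS[OF y])
    also have "\<dots> = sw HH y (\<lambda>u v. comult H (?S x) \<otimes>\<^bsub>HH\<^esub> (comult H u \<otimes>\<^bsub>HH\<^esub> SS v))"
      using x by (intro sw_lin[OF HH.lin_mult_right T T y]) simp_all
    finally show "counit H y \<odot>\<^bsub>HH\<^esub> comult H (?S x) = \<dots>" .
  qed
  also have "\<dots> = sw HH h (\<lambda>x v. sw HH x (\<lambda>x u. comult H (?S x) \<otimes>\<^bsub>HH\<^esub> (comult H u \<otimes>\<^bsub>HH\<^esub> SS v)))"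
    by (intro sw_coassoc[symmetric] T h hlin lin_SS) simp_all
  also have "\<dots> = sw HH h (\<lambda>x v. counit H x \<odot>\<^bsub>HH\<^esub> SS v)"
  proof (rule sw_cong[OF h])
    fix x v assume x: "x \<in> carrier H" and v: "v \<in> carrier H"
    have "sw HH x (\<lambda>x u. comult H (?S x) \<otimes>\<^bsub>HH\<^esub> (comult H u \<otimes>\<^bsub>HH\<^esub> SS v)) =
        sw HH x (\<lambda>x u. comult H (?S x \<star> u) \<otimes>\<^bsub>HH\<^esub> SS v)"
      using v by (intro sw_cong[OF x]) (simp add: comult_mult HH.mult_assoc)
    also have "\<dots> = counit H x \<odot>\<^bsub>HH\<^esub> (comult H \<one>\<^bsub>H\<^esub> \<otimes>\<^bsub>HH\<^esub> SS v)"
      using v by (intro sw_antipode_left[where f = "\<lambda>u. comult H u \<otimes>\<^bsub>HH\<^esub> SS v"] T x hlin) simp_all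
    also have "comult H \<one>\<^bsub>H\<^esub> \<otimes>\<^bsub>HH\<^esub> SS v = SS v"
      using v by (simp add: comult_one HH.one_AB[symmetric] HH.mult_one_left)
    finally show "sw HH x (\<lambda>x u. comult H (?S x) \<otimes>\<^bsub>HH\<^esub> (comult H u \<otimes>\<^bsub>HH\<^esub> SS v)) = counit H x \<odot>\<^bsub>HH\<^esub> SS v" .
  qed
  also have "\<dots> = SS h"
    by (intro sw_counit_left T h lin_SS)
  finally show ?thesis .
qed

lemma sw_antipode:
  assumes F: "bilin H H G F" and G: "module k G" and h: "h \<in> carrier H"
  shows "sw G (antipode H h) F = sw G h (\<lambda>x y. F (antipode H x) (antipode H y))"
proof -
  have "sw G (antipode H h) F = sw G h (\<lambda>x y. tsum G (ktens_elem k H H (antipode H x) (antipode H y)) F)"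
    unfolding comult_antipode[OF h] SS_def using F G h by (intro sw_lin[OF lin_tsum]) simp_all
  also have "\<dots> = sw G h (\<lambda>x y. F (antipode H x) (antipode H y))"
    using F G by (intro sw_cong[OF h] tsum_ktens_elem) simp_all
  finally show ?thesis .
qed

lemma counit_antipode:
  assumes h: "h \<in> carrier H"
  shows "counit H (antipode H h) = counit H h"
proof -
  let ?k = "base_module k"
  note [simp] = module_base
  have "counit H h = sw ?k h (\<lambda>x y. counit H (antipode H x \<star> y))"
    using sw_antipode_left[OF lin_counit0 module_base h] h by simp
  also have "\<dots> = sw ?k h (\<lambda>x y. counit H y \<odot>\<^bsub>?k\<^esub> counit H (antipode H x))"
    by (intro sw_cong[OF h]) (simp add: counit_mult k.m_comm)
  also have "\<dots> = counit H (antipode H h)"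
    by (intro sw_counit_right h hlin) simp_all
  finally show ?thesis ..
qed

text \<open>The map \<open>S \<circ> S\<close> is a right convolution inverse of \<open>S\<close>, because \<open>S\<close> is comultiplicative, and the
  identity is a left inverse.\<close>

lemma antipode_antipode [simp]:
  assumes h: "h \<in> carrier H"
  shows "antipode H (antipode H h) = h"
proof -
  let ?S = "antipode H"
  note [simp] = alg_H sw_closed[OF module_H]
  have "h = sw H h (\<lambda>x y. counit H y \<odot>\<^bsub>H\<^esub> x)"
    by (intro sw_counit_right[symmetric] h hlin) simp_all
  also have "\<dots> = sw H h (\<lambda>x y. sw H y (\<lambda>u v. x \<star> (?S u \<star> ?S (?S v))))"
  proof (rule sw_cong[OF h])
    fix x y assume x: "x \<in> carrier H" and y: "y \<in> carrier H"
    have "sw H y (\<lambda>u v. ?S u \<star> ?S (?S v)) = sw H (?S y) (\<lambda>u v. u \<star> ?S v)"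
      by (intro sw_antipode[symmetric] hlin y) simp_all
    also have "\<dots> = counit H y \<odot>\<^bsub>H\<^esub> \<one>\<^bsub>H\<^esub>"
      using sw_antipode_right[of H "\<lambda>u. u" "?S y"] y by (simp add: counit_antipode)
    finally have "x \<star> sw H y (\<lambda>u v. ?S u \<star> ?S (?S v)) = counit H y \<odot>\<^bsub>H\<^esub> x"
      using x y by (simp add: k_algebra_smult[OF alg_H])
    moreover have "x \<star> sw H y (\<lambda>u v. ?S u \<star> ?S (?S v)) =
        sw H y (\<lambda>u v. x \<star> (?S u \<star> ?S (?S v)))"
      using x y by (intro sw_lin[where \<phi> = "\<lambda>u. x \<star> u"] hlin) simp_all
    ultimately show "counit H y \<odot>\<^bsub>H\<^esub> x = sw H y (\<lambda>u v. x \<star> (?S u \<star> ?S (?S v)))" by simp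
  qed
  also have "\<dots> = sw H h (\<lambda>x v. sw H x (\<lambda>x u. x \<star> (?S u \<star> ?S (?S v))))"
    by (intro sw_coassoc[symmetric] h hlin) simp_all
  also have "\<dots> = sw H h (\<lambda>x v. counit H x \<odot>\<^bsub>H\<^esub> ?S (?S v))"
  proof (rule sw_cong[OF h])
    fix x v assume x: "x \<in> carrier H" and v: "v \<in> carrier H"
    have "sw H x (\<lambda>x u. x \<star> (?S u \<star> ?S (?S v))) = sw H x (\<lambda>x u. (x \<star> ?S u) \<star> ?S (?S v))"
      using v by (intro sw_cong[OF x]) (simp add: H.m_assoc)
    also have "\<dots> = counit H x \<odot>\<^bsub>H\<^esub> (\<one>\<^bsub>H\<^esub> \<star> ?S (?S v))"
      using v by (intro sw_antipode_right[where f = "\<lambda>u. u \<star> ?S (?S v)"] x hlin) simp_all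
    finally show "sw H x (\<lambda>x u. x \<star> (?S u \<star> ?S (?S v))) = counit H x \<odot>\<^bsub>H\<^esub> ?S (?S v)"
      using v by simp
  qed
  also have "\<dots> = ?S (?S h)"
    by (intro sw_counit_left h hlin) simp_all
  finally show ?thesis ..
qed

lemma inv_antipode: "h \<in> carrier H \<Longrightarrow> inv_into (carrier H) (antipode H) h = antipode H h"
  by (rule inv_into_f_eq) (simp_all add: inj_on_inverseI[where g = "antipode H"])

end

section \<open>Hopf-Galois extensions and the Miyashita-Ulbrich action\<close>

lemma (in ground) subalgebra:
  assumes A: "k_algebra k A" and S: "S \<subseteq> carrier A"
    and one: "\<one>\<^bsub>A\<^esub> \<in> S" and add: "\<And>x y. x \<in> S \<Longrightarrow> y \<in> S \<Longrightarrow> x \<oplus>\<^bsub>A\<^esub> y \<in> S"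
    and smult: "\<And>c x. c \<in> carrier k \<Longrightarrow> x \<in> S \<Longrightarrow> c \<odot>\<^bsub>A\<^esub> x \<in> S"
    and mult: "\<And>x y. x \<in> S \<Longrightarrow> y \<in> S \<Longrightarrow> x \<otimes>\<^bsub>A\<^esub> y \<in> S"
  shows "k_algebra k (A\<lparr>carrier := S\<rparr>)"
proof -
  interpret A: ring A by (rule k_algebra_ring[OF A])
  interpret A: module k A by (rule k_algebra_module[OF A])
  let ?B = "A\<lparr>carrier := S\<rparr>"
  have sub: "x \<in> carrier A" if "x \<in> S" for x using that S by auto
  have "\<zero>\<^bsub>A\<^esub> \<in> S" using smult[OF k.zero_closed one] by simp
  then have mod: "module k ?B"
    by (intro subspace_module[OF k_algebra_module[OF A]]) (simp add: subspace_def S add smult)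
  note ab = module_abelian[OF mod]
  have ring: "ring ?B"
  proof (rule ringI[OF ab])
    show "monoid ?B" by (rule monoidI) (simp_all add: mult one sub A.m_assoc)
  qed (simp_all add: sub A.l_distr A.r_distr)
  show ?thesis
    unfolding k_algebra_def using ring mod sub k_algebra_smult[OF A] by simp
qed

lemma (in ground) center_algebra:
  assumes B: "k_algebra k B"
  shows "k_algebra k (center B)"
  unfolding center_def
proof (rule subalgebra[OF B])
  interpret B: ring B by (rule k_algebra_ring[OF B])
  interpret B: module k B by (rule k_algebra_module[OF B])
  let ?Z = "{x \<in> carrier B. \<forall>b\<in>carrier B. x \<otimes>\<^bsub>B\<^esub> b = b \<otimes>\<^bsub>B\<^esub> x}"
  show "\<one>\<^bsub>B\<^esub> \<in> ?Z" by simp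
  show "c \<odot>\<^bsub>B\<^esub> x \<in> ?Z" if "c \<in> carrier k" "x \<in> ?Z" for c x
    using that by (auto simp: k_algebra_smult[OF B])
  fix x y assume x: "x \<in> ?Z" and y: "y \<in> ?Z"
  then have xy: "x \<in> carrier B" "y \<in> carrier B" by blast+
  have c: "x \<otimes>\<^bsub>B\<^esub> b = b \<otimes>\<^bsub>B\<^esub> x" "y \<otimes>\<^bsub>B\<^esub> b = b \<otimes>\<^bsub>B\<^esub> y" if "b \<in> carrier B" for b
    using x y that by blast+
  have "(x \<oplus>\<^bsub>B\<^esub> y) \<otimes>\<^bsub>B\<^esub> b = b \<otimes>\<^bsub>B\<^esub> (x \<oplus>\<^bsub>B\<^esub> y)" if b: "b \<in> carrier B" for b
    using xy b by (simp only: B.l_distr B.r_distr c[OF b])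
  then show "x \<oplus>\<^bsub>B\<^esub> y \<in> ?Z" using xy B.a_closed by blast
  have "x \<otimes>\<^bsub>B\<^esub> y \<otimes>\<^bsub>B\<^esub> b = b \<otimes>\<^bsub>B\<^esub> (x \<otimes>\<^bsub>B\<^esub> y)" if b: "b \<in> carrier B" for b
  proof -
    have "x \<otimes>\<^bsub>B\<^esub> y \<otimes>\<^bsub>B\<^esub> b = x \<otimes>\<^bsub>B\<^esub> (b \<otimes>\<^bsub>B\<^esub> y)" by (simp only: B.m_assoc[OF xy b] c(2)[OF b])
    also have "\<dots> = b \<otimes>\<^bsub>B\<^esub> x \<otimes>\<^bsub>B\<^esub> y" by (simp only: B.m_assoc[OF xy(1) b xy(2), symmetric] c(1)[OF b])
    finally show ?thesis by (simp only: B.m_assoc[OF b xy])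
  qed
  then show "x \<otimes>\<^bsub>B\<^esub> y \<in> ?Z" using xy B.m_closed by blast
qed blast

lemma regular_simps [simp]:
  "carrier (regular_bimod X) = carrier X" "add (regular_bimod X) = add X" "zero (regular_bimod X) = zero X"
  "lact (regular_bimod X) = mult X" "ract (regular_bimod X) = mult X" "smult (regular_bimod X) = smult X"
  by (simp_all add: regular_bimod_def make_bimod_def fun_eq_iff)

locale galois = cocomm_hopf k H for k :: "'k ring" and H :: "('k, 'h) hopf" +
  fixes A :: "('k, 'a, 'h) comod_alg" (structure)
  assumes galois: "ff_galois k H A"
begin

abbreviation "AH \<equiv> ktens k A H"
abbreviation "el \<equiv> ktens_elem k A H"
abbreviation "B \<equiv> coinv k H A"
abbreviation "Z \<equiv> ZB k H A"
abbreviation co where "co G a F \<equiv> tsum G (coact A a) F"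

lemma comodule: "comodule_algebra k H A"
  using galois by (simp add: ff_galois_def)

lemma alg_A: "k_algebra k A"
  using comodule by (simp add: comodule_algebra_def)

lemma module_A [simp]: "module k A"
  by (rule k_algebra_module[OF alg_A])

sublocale A: ring A by (rule k_algebra_ring[OF alg_A])
sublocale A: module k A by (rule module_A)
sublocale AH: ktensor_alg k A H
  by (rule ktensor_alg.intro[OF ground_axioms ktensor_alg_axioms.intro[OF alg_A alg_H]])

lemma module_AH: "module k AH" by simp

lemma lin_coact0: "lin A AH (coact A)"
  using comodule by (simp add: comodule_algebra_def lin_def)

lemmas lin_coact = lin_comp[OF lin_coact0]

lemma coact_closed [simp]: "a \<in> carrier A \<Longrightarrow> coact A a \<in> carrier AH"
  by (rule lin_closed[OF lin_coact0])

lemma coact_mult: "a \<in> carrier A \<Longrightarrow> b \<in> carrier A \<Longrightarrow> coact A (a \<otimes> b) = coact A a \<otimes>\<^bsub>AH\<^esub> coact A b"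
  and coact_one: "coact A \<one> = el \<one> \<one>\<^bsub>H\<^esub>"
  using comodule by (simp_all add: comodule_algebra_def ring_hom_def AH.one_AB)

lemma over_coact: "a \<in> carrier A \<Longrightarrow> over (carrier A) (carrier H) (coact A a)"
  by (rule over_ktens) simp_all

lemma lin_co_fun:
  "a \<in> carrier A \<Longrightarrow> module k G \<Longrightarrow>
    (\<And>x y. x \<in> carrier A \<Longrightarrow> y \<in> carrier H \<Longrightarrow> lin V G (\<lambda>v. F v x y)) \<Longrightarrow> lin V G (\<lambda>v. co G a (F v))"
  by (rule lin_tsum_fun[OF _ over_coact])

lemma lin_co_arg:
  "module k G \<Longrightarrow> lin V A f \<Longrightarrow> bilin A H G F \<Longrightarrow> lin V G (\<lambda>v. co G (f v) F)"
  by (rule lin_tsum_arg[OF module_A module_H _ lin_coact])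

lemmas glin = lin_id lin_elemL lin_elemR lin_sw_fun lin_sw_arg lin_co_fun lin_co_arg lin_multL lin_multR
  lin_smultR lin_scalar bilinI lin_comult lin_counit lin_antipode lin_coact

lemma co_cong:
  "a \<in> carrier A \<Longrightarrow> (\<And>x y. x \<in> carrier A \<Longrightarrow> y \<in> carrier H \<Longrightarrow> F x y = F' x y) \<Longrightarrow> co G a F = co G a F'"
  by (rule tsum_cong[OF over_coact])

lemma co_closed:
  "module k G \<Longrightarrow> a \<in> carrier A \<Longrightarrow> (\<And>x y. x \<in> carrier A \<Longrightarrow> y \<in> carrier H \<Longrightarrow> F x y \<in> carrier G) \<Longrightarrow>
    co G a F \<in> carrier G"
  by (rule tsum_closed[OF module_abelian over_coact])

lemma co_lin:
  assumes "lin G G' \<phi>" "module k G" "module k G'" "a \<in> carrier A"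
    "\<And>x y. x \<in> carrier A \<Longrightarrow> y \<in> carrier H \<Longrightarrow> F x y \<in> carrier G"
  shows "\<phi> (co G a F) = co G' a (\<lambda>x y. \<phi> (F x y))"
  by (rule tsum_lin[OF assms(1-3) over_coact[OF assms(4)] assms(5)])

lemma co_coassoc:
  assumes G: "module k G" and a: "a \<in> carrier A"
    and F1: "\<And>y z. y \<in> carrier H \<Longrightarrow> z \<in> carrier H \<Longrightarrow> lin A G (\<lambda>x. F x y z)"
    and F2: "\<And>x z. x \<in> carrier A \<Longrightarrow> z \<in> carrier H \<Longrightarrow> lin H G (\<lambda>y. F x y z)"
    and F3: "\<And>x y. x \<in> carrier A \<Longrightarrow> y \<in> carrier H \<Longrightarrow> lin H G (\<lambda>z. F x y z)"
  shows "co G a (\<lambda>x z. co G x (\<lambda>u v. F u v z)) = co G a (\<lambda>u y. sw G y (\<lambda>v w. F u v w))"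
  by (rule coaction_coassoc[OF module_A coact_closed _ G a F1 F2 F3])
    (use comodule in \<open>simp_all add: comodule_algebra_def Let_def\<close>)

lemma co_counit:
  assumes "lin A G f" "module k G" "a \<in> carrier A"
  shows "co G a (\<lambda>x y. counit H y \<odot>\<^bsub>G\<^esub> f x) = f a"
  by (rule coaction_counit[OF module_A _ _ assms(1,2)]) (use comodule assms(3) in \<open>simp_all add: comodule_algebra_def\<close>)

lemma co_mult:
  assumes F: "bilin A H G F" and G: "module k G" and a: "a \<in> carrier A" and b: "b \<in> carrier A"
  shows "co G (a \<otimes> b) F = co G a (\<lambda>x g. co G b (\<lambda>y h. F (x \<otimes> y) (g \<star> h)))"
  by (rule coaction_mult[OF alg_A _ _ coact_mult[OF a b] F G]) (simp_all add: a b)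

lemma coact_self: "a \<in> carrier A \<Longrightarrow> co AH a el = coact A a"
  by (rule AH.AB.tsum_self_MN) simp

subsection \<open>Coinvariants and their center\<close>

lemma B_simps [simp]:
  "mult B = mult A" "add B = add A" "one B = one A" "zero B = zero A" "smult B = smult A"
  by (simp_all add: coinv_def)

lemma Z_simps [simp]:
  "mult Z = mult A" "add Z = add A" "one Z = one A" "zero Z = zero A" "smult Z = smult A"
  by (simp_all add: ZB_def center_def coinv_def)

lemma B_mem: "b \<in> carrier B \<longleftrightarrow> b \<in> carrier A \<and> coact A b = el b \<one>\<^bsub>H\<^esub>"
  by (auto simp: coinv_def)

lemma Z_mem: "x \<in> carrier Z \<longleftrightarrow> x \<in> carrier B \<and> (\<forall>b\<in>carrier B. x \<otimes> b = b \<otimes> x)"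
  by (auto simp: ZB_def center_def)

lemma B_in_A [simp]: "b \<in> carrier B \<Longrightarrow> b \<in> carrier A"
  by (simp add: B_mem)

lemma Z_in_B: "x \<in> carrier Z \<Longrightarrow> x \<in> carrier B"
  by (simp add: Z_mem)

lemma Z_in_A [simp]: "x \<in> carrier Z \<Longrightarrow> x \<in> carrier A"
  by (simp add: Z_mem)

lemma Z_comm: "x \<in> carrier Z \<Longrightarrow> b \<in> carrier B \<Longrightarrow> x \<otimes> b = b \<otimes> x"
  by (simp add: Z_mem)

lemma alg_B: "k_algebra k B"
  unfolding coinv_def
proof (rule subalgebra[OF alg_A])
  show "\<one> \<in> {a \<in> carrier A. coact A a = el a \<one>\<^bsub>H\<^esub>}" by (simp add: coact_one)
  fix x y assume x: "x \<in> {a \<in> carrier A. coact A a = el a \<one>\<^bsub>H\<^esub>}" and y: "y \<in> {a \<in> carrier A. coact A a = el a \<one>\<^bsub>H\<^esub>}"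
  show "x \<oplus> y \<in> {a \<in> carrier A. coact A a = el a \<one>\<^bsub>H\<^esub>}"
    using x y by (simp add: lin_add[OF lin_coact0] lin_add[OF bilin1[OF bilin_ktens_elem]])
  show "x \<otimes> y \<in> {a \<in> carrier A. coact A a = el a \<one>\<^bsub>H\<^esub>}"
    using x y by (simp add: coact_mult AH.mult_el)
next
  fix c x assume "c \<in> carrier k" "x \<in> {a \<in> carrier A. coact A a = el a \<one>\<^bsub>H\<^esub>}"
  then show "c \<odot> x \<in> {a \<in> carrier A. coact A a = el a \<one>\<^bsub>H\<^esub>}"
    by (simp add: lin_smult[OF lin_coact0] lin_smult[OF bilin1[OF bilin_ktens_elem]])
qed blast

lemma module_B [simp]: "module k B" by (rule k_algebra_module[OF alg_B])

sublocale B: ring B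
  rewrites "mult B = mult A" and "add B = add A" and "one B = one A" and "zero B = zero A"
  by (rule k_algebra_ring[OF alg_B]) simp_all

lemma alg_Z: "k_algebra k Z"
  unfolding ZB_def by (rule center_algebra[OF alg_B])

lemma module_Z [simp]: "module k Z" by (rule k_algebra_module[OF alg_Z])

sublocale Z: ring Z
  rewrites "mult Z = mult A" and "add Z = add A" and "one Z = one A" and "zero Z = zero A"
  by (rule k_algebra_ring[OF alg_Z]) simp_all

lemma Z_smult [simp]: "c \<in> carrier k \<Longrightarrow> b \<in> carrier Z \<Longrightarrow> c \<odot> b \<in> carrier Z"
  using module.smult_closed[OF module_Z, of c b] by simp

lemma co_B:
  assumes "bilin A H G F" "module k G" "b \<in> carrier B"
  shows "co G b F = F b \<one>\<^bsub>H\<^esub>"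
  using assms by (simp add: B_mem tsum_ktens_elem)

lemma co_mult_B_right:
  assumes F: "bilin A H G F" and G: "module k G" and a: "a \<in> carrier A" and b: "b \<in> carrier B"
  shows "co G (a \<otimes> b) F = co G a (\<lambda>x g. F (x \<otimes> b) g)"
proof -
  have "co G (a \<otimes> b) F = co G a (\<lambda>x g. co G b (\<lambda>y h. F (x \<otimes> y) (g \<star> h)))"
    using b by (intro co_mult F G a) simp
  also have "\<dots> = co G a (\<lambda>x g. F (x \<otimes> b) g)"
  proof (rule co_cong[OF a])
    fix x g assume xg: "x \<in> carrier A" "g \<in> carrier H"
    have "bilin A H G (\<lambda>y h. F (x \<otimes> y) (g \<star> h))"
      using xg by (intro bilinI lin_comp[OF bilin1[OF F]] lin_comp[OF bilin2[OF F]] glin alg_A alg_H) simp_all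
    from co_B[OF this G b] xg show "co G b (\<lambda>y h. F (x \<otimes> y) (g \<star> h)) = F (x \<otimes> b) g" by simp
  qed
  finally show ?thesis .
qed

lemma co_mult_B_left:
  assumes F: "bilin A H G F" and G: "module k G" and a: "a \<in> carrier A" and b: "b \<in> carrier B"
  shows "co G (b \<otimes> a) F = co G a (\<lambda>x g. F (b \<otimes> x) g)"
proof -
  have "co G (b \<otimes> a) F = co G b (\<lambda>y h. co G a (\<lambda>x g. F (y \<otimes> x) (h \<star> g)))"
    using b by (intro co_mult F G a) simp
  also have "\<dots> = co G a (\<lambda>x g. F (b \<otimes> x) (\<one>\<^bsub>H\<^esub> \<star> g))"
    by (intro co_B[OF _ G b] bilinI lin_co_fun[OF a G] lin_comp[OF bilin1[OF F]] lin_comp[OF bilin2[OF F]]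
        glin alg_A alg_H) simp_all
  also have "\<dots> = co G a (\<lambda>x g. F (b \<otimes> x) g)"
    by (rule co_cong[OF a]) simp
  finally show ?thesis .
qed

subsection \<open>The translation map\<close>

abbreviation "RA \<equiv> regular_bimod A"

lemma abelian_regular: "ring X \<Longrightarrow> abelian_group (regular_bimod X)"
  by (rule abelian_group_cong[OF ring.axioms(1)]) simp_all

sublocale AA: bal_tensor "carrier B" "mult A" "mult A" RA RA
  by (rule bal_tensor.intro) (simp_all add: abelian_regular A.ring_axioms)

lemma AA_carrier: "carrier (A_tens_A k H A) = carrier AA.T"
  by (simp add: A_tens_A_def btens_def Let_def make_bimod_def)

lemma over_AA: "X \<in> carrier AA.T \<Longrightarrow> over (carrier A) (carrier A) X"
  using AA.over_T by simp

definition can_term where "can_term a b = co AH b (\<lambda>b' h. el (a \<otimes> b') h)"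

lemma can_term_linL: "b \<in> carrier A \<Longrightarrow> lin A AH (\<lambda>a. can_term a b)"
  unfolding can_term_def by (intro glin) (simp_all add: alg_A)

lemma can_term_linR: "a \<in> carrier A \<Longrightarrow> lin A AH (\<lambda>b. can_term a b)"
  unfolding can_term_def by (intro glin) (simp_all add: alg_A)

lemma additive_regular:
  "additive (regular_bimod X) G f \<longleftrightarrow> additive X G f"
  by (simp add: additive_def additive_maps_def)

lemma bal_can: "AA.bal AH can_term"
proof (rule balancedI)
  fix x r y assume *: "x \<in> carrier RA" "r \<in> carrier B" "y \<in> carrier RA"
  have "can_term x (r \<otimes> y) = co AH y (\<lambda>b' h. el (x \<otimes> (r \<otimes> b')) h)"
    unfolding can_term_def using * by (intro co_mult_B_left glin) (simp_all add: alg_A)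
  also have "\<dots> = co AH y (\<lambda>b' h. el (x \<otimes> r \<otimes> b') h)"
    using * by (intro co_cong) (simp_all add: A.m_assoc)
  finally show "can_term (x \<otimes> r) y = can_term x (r \<otimes> y)"
    by (simp add: can_term_def)
qed (simp_all add: additive_regular lin_additive[OF can_term_linL] lin_additive[OF can_term_linR])

lemma can_eq: "can k H A X = tsum AH X can_term"
proof -
  have "can_term = (\<lambda>a b. co AH b (\<lambda>b' h. el (a \<otimes> b') h))"
    by (intro ext) (simp add: can_term_def)
  then show ?thesis by (simp only: can_def)
qed

lemma additive_can: "additive AA.T AH (can k H A)"
  unfolding can_eq by (rule AA.tsum_additive[OF AH.AB.abelian_MN bal_can])

lemma can_te: "a \<in> carrier A \<Longrightarrow> b \<in> carrier A \<Longrightarrow> can k H A (AA.te a b) = can_term a b"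
  unfolding can_eq using AA.tsum_te[OF AH.AB.abelian_MN bal_can] by simp

lemma bij_can: "bij_betw (can k H A) (carrier AA.T) (carrier AH)"
  using galois by (simp add: ff_galois_def AA_carrier)

text \<open>Identities for the translation map are proved by comparing images under the canonical map.\<close>

lemma can_inj: "X \<in> carrier AA.T \<Longrightarrow> Y \<in> carrier AA.T \<Longrightarrow> can k H A X = can k H A Y \<Longrightarrow> X = Y"
  using bij_can by (simp add: bij_betw_def inj_on_def)

abbreviation "trl \<equiv> transl k H A"

lemma transl_closed [simp]: "h \<in> carrier H \<Longrightarrow> trl h \<in> carrier AA.T"
  and can_transl: "h \<in> carrier H \<Longrightarrow> can k H A (trl h) = el \<one> h"
proof -
  assume h: "h \<in> carrier H"
  have "el \<one> h \<in> can k H A ` carrier AA.T"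
    using h bij_can by (simp add: bij_betw_def)
  then show "trl h \<in> carrier AA.T" "can k H A (trl h) = el \<one> h"
    unfolding transl_def AA_carrier by (auto intro: inv_into_into simp: f_inv_into_f)
qed

lemma over_transl: "h \<in> carrier H \<Longrightarrow> over (carrier A) (carrier A) (trl h)"
  by (intro over_AA transl_closed)

text \<open>The defining property \<open>l\<^sub>i(h) r\<^sub>i(h)\<^sub>[\<^sub>0\<^sub>] \<otimes> r\<^sub>i(h)\<^sub>[\<^sub>1\<^sub>] = 1 \<otimes> h\<close>, with a bilinear map applied.\<close>

lemma transl_coact:
  assumes \<Phi>: "bilin A H G \<Phi>" and G: "module k G" and h: "h \<in> carrier H"
  shows "tsum G (trl h) (\<lambda>l r. co G r (\<lambda>r0 r1. \<Phi> (l \<otimes> r0) r1)) = \<Phi> \<one> h"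
proof -
  have L: "lin AH G (\<lambda>X. tsum G X \<Phi>)" using \<Phi> G by (intro lin_tsum) simp_all
  have "\<Phi> \<one> h = tsum G (can k H A (trl h)) \<Phi>"
    unfolding can_transl[OF h] using \<Phi> G h by (intro tsum_ktens_elem[symmetric]) simp_all
  also have "\<dots> = tsum G (trl h) (\<lambda>l r. tsum G (can_term l r) \<Phi>)"
    unfolding can_eq using lin_closed[OF can_term_linL]
    by (intro tsum_lin[OF L module_AH G over_transl[OF h]]) simp
  also have "\<dots> = tsum G (trl h) (\<lambda>l r. co G r (\<lambda>r0 r1. \<Phi> (l \<otimes> r0) r1))"
  proof (rule tsum_cong[OF over_transl[OF h]])
    fix l r assume lr: "l \<in> carrier A" "r \<in> carrier A"
    have "tsum G (can_term l r) \<Phi> = co G r (\<lambda>r0 r1. tsum G (el (l \<otimes> r0) r1) \<Phi>)"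
      unfolding can_term_def using lr by (intro co_lin[OF L module_AH G]) simp_all
    also have "\<dots> = co G r (\<lambda>r0 r1. \<Phi> (l \<otimes> r0) r1)"
      using lr \<Phi> G by (intro co_cong tsum_ktens_elem) simp_all
    finally show "tsum G (can_term l r) \<Phi> = \<dots>" .
  qed
  finally show ?thesis ..
qed

lemma coact_transl_te:
  assumes a: "a \<in> carrier A"
  shows "co AA.T a (\<lambda>b h. tsum AA.T (trl h) (\<lambda>l r. AA.te (b \<otimes> l) r)) = AA.te \<one> a"
proof (rule can_inj)
  note ab = AA.abelian_T AH.AB.abelian_MN
  have cl: "tsum AA.T (trl h) (\<lambda>l r. AA.te (b \<otimes> l) r) \<in> carrier AA.T" if "b \<in> carrier A" "h \<in> carrier H" for b h
    using that by (intro tsum_closed[OF AA.abelian_T over_transl] AA.te_closed) simp_all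
  then show "co AA.T a (\<lambda>b h. tsum AA.T (trl h) (\<lambda>l r. AA.te (b \<otimes> l) r)) \<in> carrier AA.T"
    by (intro tsum_closed[OF AA.abelian_T over_coact[OF a]])
  show "AA.te \<one> a \<in> carrier AA.T" using a by (intro AA.te_closed) simp_all
  have "can k H A (co AA.T a (\<lambda>b h. tsum AA.T (trl h) (\<lambda>l r. AA.te (b \<otimes> l) r))) =
      co AH a (\<lambda>b h. can k H A (tsum AA.T (trl h) (\<lambda>l r. AA.te (b \<otimes> l) r)))"
    by (rule tsum_hom[OF additive_can ab over_coact[OF a] cl])
  also have "\<dots> = co AH a el"
  proof (rule co_cong[OF a])
    fix b h assume b: "b \<in> carrier A" and h: "h \<in> carrier H"
    have "can k H A (tsum AA.T (trl h) (\<lambda>l r. AA.te (b \<otimes> l) r)) =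
        tsum AH (trl h) (\<lambda>l r. can k H A (AA.te (b \<otimes> l) r))"
      using b by (intro tsum_hom[OF additive_can ab over_transl[OF h]] AA.te_closed) simp_all
    also have "\<dots> = tsum AH (trl h) (\<lambda>l r. co AH r (\<lambda>r0 r1. el (b \<otimes> (l \<otimes> r0)) r1))"
    proof (rule tsum_cong[OF over_transl[OF h]])
      fix l r assume lr: "l \<in> carrier A" "r \<in> carrier A"
      then show "can k H A (AA.te (b \<otimes> l) r) = co AH r (\<lambda>r0 r1. el (b \<otimes> (l \<otimes> r0)) r1)"
        using b unfolding can_te[OF A.m_closed[OF b lr(1)] lr(2)] can_term_def
        by (intro co_cong) (simp_all add: A.m_assoc)
    qed
    also have "\<dots> = el (b \<otimes> \<one>) h"
      using b by (intro transl_coact[where \<Phi> = "\<lambda>u h. el (b \<otimes> u) h"] h glin) (simp_all add: alg_A)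
    finally show "can k H A (tsum AA.T (trl h) (\<lambda>l r. AA.te (b \<otimes> l) r)) = el b h" using b by simp
  qed
  also have "\<dots> = coact A a" by (rule coact_self[OF a])
  also have "\<dots> = can_term \<one> a"
    unfolding can_term_def using a by (subst coact_self[OF a, symmetric]) (intro co_cong, simp_all)
  finally show "can k H A (co AA.T a (\<lambda>b h. tsum AA.T (trl h) (\<lambda>l r. AA.te (b \<otimes> l) r))) =
      can k H A (AA.te \<one> a)"
    using a by (simp add: can_te)
qed

text \<open>The identity \<open>a\<^sub>[\<^sub>0\<^sub>] l\<^sub>i(a\<^sub>[\<^sub>1\<^sub>]) \<otimes> r\<^sub>i(a\<^sub>[\<^sub>1\<^sub>]) = 1 \<otimes> a\<close>, with a balanced map applied.\<close>

lemma coact_transl: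
  assumes F: "AA.bal G F" and G: "abelian_group G" and a: "a \<in> carrier A"
  shows "co G a (\<lambda>b h. tsum G (trl h) (\<lambda>l r. F (b \<otimes> l) r)) = F \<one> a"
proof -
  note ab = AA.abelian_T G
  have cl: "tsum AA.T (trl h) (\<lambda>l r. AA.te (b \<otimes> l) r) \<in> carrier AA.T" if "b \<in> carrier A" "h \<in> carrier H" for b h
    using that by (intro tsum_closed[OF AA.abelian_T over_transl] AA.te_closed) simp_all
  have "F \<one> a = tsum G (AA.te \<one> a) F"
    using AA.tsum_te[OF G F] a by simp
  also have "\<dots> = co G a (\<lambda>b h. tsum G (tsum AA.T (trl h) (\<lambda>l r. AA.te (b \<otimes> l) r)) F)"
    unfolding coact_transl_te[OF a, symmetric]
    by (rule tsum_hom[OF AA.tsum_additive[OF G F] ab over_coact[OF a] cl])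
  also have "\<dots> = co G a (\<lambda>b h. tsum G (trl h) (\<lambda>l r. F (b \<otimes> l) r))"
    by (intro co_cong[OF a] AA.tsum_tsum_te[OF G F over_transl]) simp_all
  finally show ?thesis ..
qed

lemma lin_transl:
  assumes F: "AA.bal G F" and G: "module k G"
    and c: "\<And>c l r. c \<in> carrier k \<Longrightarrow> l \<in> carrier A \<Longrightarrow> r \<in> carrier A \<Longrightarrow> F (c \<odot> l) r = c \<odot>\<^bsub>G\<^esub> F l r"
  shows "lin H G (\<lambda>h. tsum G (trl h) F)"
proof -
  interpret G: module k G by fact
  note L = AA.tsum_additive[OF G.abelian_group_axioms F]
  note ab = AA.abelian_T AH.AB.abelian_MN
  have Fc: "F l r \<in> carrier G" if "l \<in> carrier A" "r \<in> carrier A" for l r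
    using AA.bal_closed[OF F] that by simp
  show ?thesis
  proof (rule linI)
    fix h assume h: "h \<in> carrier H"
    show "tsum G (trl h) F \<in> carrier G" by (rule additive_closed[OF L transl_closed[OF h]])
  next
    fix g h assume gh: "g \<in> carrier H" "h \<in> carrier H"
    have "trl (g \<oplus>\<^bsub>H\<^esub> h) = trl g \<oplus>\<^bsub>AA.T\<^esub> trl h"
      using gh by (intro can_inj)
        (simp_all add: additive_add[OF additive_can] can_transl lin_add[OF bilin2[OF bilin_ktens_elem]])
    then show "tsum G (trl (g \<oplus>\<^bsub>H\<^esub> h)) F = tsum G (trl g) F \<oplus>\<^bsub>G\<^esub> tsum G (trl h) F"
      using gh by (simp add: additive_add[OF L])
  next
    fix d h assume d: "d \<in> carrier k" and h: "h \<in> carrier H"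
    let ?Y = "tsum AA.T (trl h) (\<lambda>l r. AA.te (d \<odot> l) r)"
    have "trl (d \<odot>\<^bsub>H\<^esub> h) = ?Y"
    proof (rule can_inj)
      show "?Y \<in> carrier AA.T"
        using d by (intro tsum_closed[OF AA.abelian_T over_transl[OF h]] AA.te_closed) simp_all
      have "can k H A ?Y = tsum AH (trl h) (\<lambda>l r. can k H A (AA.te (d \<odot> l) r))"
        using d by (intro tsum_hom[OF additive_can ab over_transl[OF h]] AA.te_closed) simp_all
      also have "\<dots> = tsum AH (trl h) (\<lambda>l r. d \<odot>\<^bsub>AH\<^esub> can_term l r)"
        using d by (intro tsum_cong[OF over_transl[OF h]]) (simp add: can_te lin_smult[OF can_term_linL])
      also have "\<dots> = d \<odot>\<^bsub>AH\<^esub> tsum AH (trl h) can_term"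
        using d lin_closed[OF can_term_linL]
        by (intro
            tsum_lin[OF lin_smultR[OF module_AH lin_id d] module_AH module_AH over_transl[OF h], symmetric]) simp_all
      also have "\<dots> = el \<one> (d \<odot>\<^bsub>H\<^esub> h)"
        using d h by (simp add: can_eq[symmetric] can_transl lin_smult[OF bilin2[OF bilin_ktens_elem]])
      finally show "can k H A (trl (d \<odot>\<^bsub>H\<^esub> h)) = can k H A ?Y" using d h by (simp add: can_transl)
    qed (use d h in simp)
    then have "tsum G (trl (d \<odot>\<^bsub>H\<^esub> h)) F = tsum G (trl h) (\<lambda>l r. F (d \<odot> l) r)"
      using d by (simp add: AA.tsum_tsum_te[OF G.abelian_group_axioms F over_transl[OF h]])
    also have "\<dots> = tsum G (trl h) (\<lambda>l r. d \<odot>\<^bsub>G\<^esub> F l r)"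
      using d c by (intro tsum_cong[OF over_transl[OF h]]) simp
    also have "\<dots> = d \<odot>\<^bsub>G\<^esub> tsum G (trl h) F"
      by (rule tsum_lin[OF lin_smultR[OF G lin_id d] G G over_transl[OF h] Fc, symmetric])
    finally show "tsum G (trl (d \<odot>\<^bsub>H\<^esub> h)) F = d \<odot>\<^bsub>G\<^esub> tsum G (trl h) F" .
  qed
qed

end

subsection \<open>The Miyashita-Ulbrich action\<close>

context galois
begin

text \<open>The right-handed variant of the action; \<open>h\<close> acts as \<open>mu\<close> at the inverse antipode of \<open>h\<close>, which is
  the antipode itself.\<close>

definition mu :: "'a \<Rightarrow> 'h \<Rightarrow> 'a" where
  "mu x h = tsum A (trl h) (\<lambda>l r. l \<otimes> x \<otimes> r)"

lemma bal_mu: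
  assumes x: "x \<in> carrier Z"
  shows "AA.bal A (\<lambda>l r. l \<otimes> x \<otimes> r)"
proof (rule balancedI)
  fix l b r assume *: "l \<in> carrier RA" "b \<in> carrier B" "r \<in> carrier RA"
  have "l \<otimes> b \<otimes> x \<otimes> r = l \<otimes> (b \<otimes> x) \<otimes> r"
    using * x by (simp add: A.m_assoc)
  also have "\<dots> = l \<otimes> x \<otimes> (b \<otimes> r)"
    unfolding Z_comm[OF x *(2), symmetric] using * x by (simp add: A.m_assoc)
  finally show "l \<otimes> b \<otimes> x \<otimes> r = \<dots>" .
qed (use x in \<open>simp_all add: additive_regular additiveI A.l_distr A.r_distr\<close>)

lemma mu_linH: "x \<in> carrier Z \<Longrightarrow> lin H A (\<lambda>h. mu x h)"
  unfolding mu_def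
  by (rule lin_transl[OF bal_mu module_A]) (simp_all add: k_algebra_smult[OF alg_A])

lemmas lin_mu = lin_comp[OF mu_linH]

lemma mu_in_A [simp]: "x \<in> carrier Z \<Longrightarrow> h \<in> carrier H \<Longrightarrow> mu x h \<in> carrier A"
  by (rule lin_closed[OF mu_linH])

lemma lin_Z_A: "lin Z A (\<lambda>x. x)"
  by (rule linI) simp_all

lemma mu_linZ: "h \<in> carrier H \<Longrightarrow> lin Z A (\<lambda>x. mu x h)"
  unfolding mu_def
  by (intro lin_tsum_fun[OF module_A over_transl] lin_multL lin_multR alg_A lin_Z_A) simp_all

text \<open>An element of the center moves past \<open>a\<close> at the expense of being acted upon by \<open>a\<^sub>[\<^sub>1\<^sub>]\<close>; and
  this rule determines the action.\<close>

lemma mu_commute: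
  assumes x: "x \<in> carrier Z" and a: "a \<in> carrier A"
  shows "x \<otimes> a = co A a (\<lambda>b h. b \<otimes> mu x h)"
proof -
  have "co A a (\<lambda>b h. b \<otimes> mu x h) =
      co A a (\<lambda>b h. tsum A (trl h) (\<lambda>l r. (b \<otimes> l) \<otimes> x \<otimes> r))"
  proof (rule co_cong[OF a])
    fix b h assume b: "b \<in> carrier A" and h: "h \<in> carrier H"
    have "b \<otimes> mu x h = tsum A (trl h) (\<lambda>l r. b \<otimes> (l \<otimes> x \<otimes> r))"
      unfolding mu_def using b x
      by (intro tsum_lin[OF lin_multR[OF alg_A b lin_id] _ _ over_transl[OF h]]) simp_all
    also have "\<dots> = tsum A (trl h) (\<lambda>l r. (b \<otimes> l) \<otimes> x \<otimes> r)"
      using b x by (intro tsum_cong[OF over_transl[OF h]]) (simp add: A.m_assoc)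
    finally show "b \<otimes> mu x h = \<dots>" .
  qed
  also have "\<dots> = \<one> \<otimes> x \<otimes> a"
    by (rule coact_transl[OF bal_mu[OF x] _ a]) simp
  finally show ?thesis using x by simp
qed

text \<open>Multiply the commutation rule for \<open>r\<^sub>i(h)\<close> by \<open>l\<^sub>i(h)\<close> from the left and collapse the right-hand side.\<close>

lemma mu_unique:
  assumes z: "z \<in> carrier Z" and W: "lin H A W"
    and zW: "\<And>a. a \<in> carrier A \<Longrightarrow> z \<otimes> a = co A a (\<lambda>b h. b \<otimes> W h)" and h: "h \<in> carrier H"
  shows "mu z h = W h"
proof -
  note [simp] = lin_closed[OF W]
  have "mu z h = tsum A (trl h) (\<lambda>l r. co A r (\<lambda>b g. (l \<otimes> b) \<otimes> W g))"
    unfolding mu_def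
  proof (rule tsum_cong[OF over_transl[OF h]])
    fix l r assume l: "l \<in> carrier A" and r: "r \<in> carrier A"
    have "l \<otimes> z \<otimes> r = l \<otimes> co A r (\<lambda>b h. b \<otimes> W h)"
      using l r z by (simp add: A.m_assoc zW)
    also have "\<dots> = co A r (\<lambda>b g. l \<otimes> (b \<otimes> W g))"
      using l by (intro co_lin[OF lin_multR[OF alg_A l lin_id] _ _ r]) simp_all
    also have "\<dots> = co A r (\<lambda>b g. (l \<otimes> b) \<otimes> W g)"
      using l by (intro co_cong[OF r]) (simp add: A.m_assoc)
    finally show "l \<otimes> z \<otimes> r = \<dots>" .
  qed
  also have "\<dots> = \<one> \<otimes> W h"
    by (intro transl_coact[where \<Phi> = "\<lambda>b g. b \<otimes> W g"] glin alg_A lin_comp[OF W] h) simp_all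
  finally show ?thesis using h by simp
qed

lemma mu_mult:
  assumes x: "x \<in> carrier Z" and y: "y \<in> carrier Z" and h: "h \<in> carrier H"
  shows "mu (x \<otimes> y) h = sw A h (\<lambda>u v. mu x u \<otimes> mu y v)"
proof (rule mu_unique[OF _ _ _ h])
  show "x \<otimes> y \<in> carrier Z" using x y by simp
  show "lin H A (\<lambda>h. sw A h (\<lambda>u v. mu x u \<otimes> mu y v))"
    using x y by (intro glin lin_mu alg_A) simp_all
  fix a assume a: "a \<in> carrier A"
  have "x \<otimes> y \<otimes> a = x \<otimes> co A a (\<lambda>b v. b \<otimes> mu y v)"
    using x y a by (simp add: A.m_assoc mu_commute[symmetric])
  also have "\<dots> = co A a (\<lambda>b v. x \<otimes> (b \<otimes> mu y v))"
    using x y by (intro co_lin[OF lin_multR[OF alg_A _ lin_id] _ _ a]) simp_all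
  also have "\<dots> = co A a (\<lambda>b v. co A b (\<lambda>c u. c \<otimes> mu x u \<otimes> mu y v))"
  proof (rule co_cong[OF a])
    fix b v assume b: "b \<in> carrier A" and v: "v \<in> carrier H"
    have "x \<otimes> (b \<otimes> mu y v) = co A b (\<lambda>c u. c \<otimes> mu x u) \<otimes> mu y v"
      using x y b v by (simp add: A.m_assoc[symmetric] mu_commute[symmetric])
    also have "\<dots> = co A b (\<lambda>c u. c \<otimes> mu x u \<otimes> mu y v)"
      using x y v by (intro co_lin[OF lin_multL[OF alg_A _ lin_id] _ _ b]) simp_all
    finally show "x \<otimes> (b \<otimes> mu y v) = \<dots>" .
  qed
  also have "\<dots> = co A a (\<lambda>c g. sw A g (\<lambda>u v. c \<otimes> mu x u \<otimes> mu y v))"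
    using x y by (intro co_coassoc a glin lin_mu alg_A) simp_all
  also have "\<dots> = co A a (\<lambda>c g. c \<otimes> sw A g (\<lambda>u v. mu x u \<otimes> mu y v))"
  proof (rule co_cong[OF a])
    fix c g assume c: "c \<in> carrier A" and g: "g \<in> carrier H"
    have "sw A g (\<lambda>u v. c \<otimes> mu x u \<otimes> mu y v) = sw A g (\<lambda>u v. c \<otimes> (mu x u \<otimes> mu y v))"
      using x y c by (intro sw_cong[OF g]) (simp add: A.m_assoc)
    also have "\<dots> = c \<otimes> sw A g (\<lambda>u v. mu x u \<otimes> mu y v)"
      using x y by (intro sw_lin[OF lin_multR[OF alg_A c lin_id] _ _ g, symmetric]) simp_all
    finally show "sw A g (\<lambda>u v. c \<otimes> mu x u \<otimes> mu y v) = \<dots>" .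
  qed
  finally show "x \<otimes> y \<otimes> a = \<dots>" .
qed

lemma mu_one: "h \<in> carrier H \<Longrightarrow> mu \<one> h = counit H h \<odot> \<one>"
proof (rule mu_unique)
  show "lin H A (\<lambda>h. counit H h \<odot> \<one>)" by (intro glin) simp_all
  fix a assume a: "a \<in> carrier A"
  have "a = co A a (\<lambda>b h. counit H h \<odot> b)"
    using co_counit[OF lin_id module_A a] ..
  also have "\<dots> = co A a (\<lambda>b h. b \<otimes> (counit H h \<odot> \<one>))"
    by (intro co_cong[OF a]) (simp add: k_algebra_smult[OF alg_A])
  finally show "\<one> \<otimes> a = \<dots>" using a by simp
qed simp_all

lemma mu_unit: "x \<in> carrier Z \<Longrightarrow> mu x \<one>\<^bsub>H\<^esub> = x"
proof -
  assume x: "x \<in> carrier Z"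
  have "bilin A H A (\<lambda>b h. b \<otimes> mu x h)" using x by (intro glin lin_mu alg_A) simp_all
  from co_B[OF this module_A B.one_closed] have "co A \<one> (\<lambda>b h. b \<otimes> mu x h) = mu x \<one>\<^bsub>H\<^esub>"
    using x by simp
  then show ?thesis using mu_commute[OF x A.one_closed] x by simp
qed

text \<open>Compute \<open>\<rho>(x r)\<close> from the commutation rule. By cocommutativity the two factors of the coaction of \<open>r\<close>
  that occur can be exchanged, which gives \<open>\<rho>(x r) = \<rho>(r\<^sub>[\<^sub>0\<^sub>]) (mu x r\<^sub>[\<^sub>1\<^sub>] \<otimes> 1)\<close>; then multiply by
  \<open>\<rho>(l)\<close> and collapse.\<close>

lemma mu_in_B:
  assumes x: "x \<in> carrier Z" and h: "h \<in> carrier H"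
  shows "mu x h \<in> carrier B"
proof -
  note [simp] = x AH.mult_closed
  note L = lin_mu alg_A AH.alg_AB
  have xr: "coact A (x \<otimes> r) = co AH r (\<lambda>c g. coact A c \<otimes>\<^bsub>AH\<^esub> el (mu x g) \<one>\<^bsub>H\<^esub>)" if r: "r \<in> carrier A" for r
  proof -
    have "coact A (x \<otimes> r) = co AH (x \<otimes> r) el"
      using r by (intro coact_self[symmetric]) simp
    also have "\<dots> = co AH r (\<lambda>c g. el (x \<otimes> c) g)"
      by (intro co_mult_B_left[OF bilin_ktens_elem _ r]) (simp_all add: Z_in_B)
    also have "\<dots> = co AH r (\<lambda>c g. co AH c (\<lambda>d u. el (d \<otimes> mu x u) g))"
    proof (rule co_cong[OF r])
      fix c g assume c: "c \<in> carrier A" and g: "g \<in> carrier H"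
      show "el (x \<otimes> c) g = co AH c (\<lambda>d u. el (d \<otimes> mu x u) g)"
        unfolding mu_commute[OF x c] using g
        by (intro co_lin[where \<phi> = "\<lambda>w. el w g"] c glin) simp_all
    qed
    also have "\<dots> = co AH r (\<lambda>d g. sw AH g (\<lambda>u v. el (d \<otimes> mu x u) v))"
      by (intro co_coassoc r glin L) simp_all
    also have "\<dots> = co AH r (\<lambda>d g. sw AH g (\<lambda>v u. el (d \<otimes> mu x u) v))"
      by (intro co_cong[OF r] sw_cocomm glin L) simp_all
    also have "\<dots> = co AH r (\<lambda>c g. co AH c (\<lambda>d v. el (d \<otimes> mu x g) v))"
      by (intro co_coassoc[symmetric] r glin L) simp_all
    also have "\<dots> = co AH r (\<lambda>c g. coact A c \<otimes>\<^bsub>AH\<^esub> el (mu x g) \<one>\<^bsub>H\<^esub>)"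
    proof (rule co_cong[OF r])
      fix c g assume c: "c \<in> carrier A" and g: "g \<in> carrier H"
      have "coact A c \<otimes>\<^bsub>AH\<^esub> el (mu x g) \<one>\<^bsub>H\<^esub> = co AH c (\<lambda>d v. el d v \<otimes>\<^bsub>AH\<^esub> el (mu x g) \<one>\<^bsub>H\<^esub>)"
        using g by (subst coact_self[OF c, symmetric], intro co_lin[OF AH.lin_mult_left _ _ c]) simp_all
      also have "\<dots> = co AH c (\<lambda>d v. el (d \<otimes> mu x g) v)"
        using g by (intro co_cong[OF c]) (simp add: AH.mult_el)
      finally show "co AH c (\<lambda>d v. el (d \<otimes> mu x g) v) = coact A c \<otimes>\<^bsub>AH\<^esub> el (mu x g) \<one>\<^bsub>H\<^esub>" ..
    qed
    finally show ?thesis .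
  qed
  have "coact A (mu x h) = tsum AH (trl h) (\<lambda>l r. coact A (l \<otimes> x \<otimes> r))"
    unfolding mu_def by (intro tsum_lin[OF lin_coact0 _ _ over_transl[OF h]]) simp_all
  also have "\<dots> = tsum AH (trl h) (\<lambda>l r. co AH r (\<lambda>c g. coact A (l \<otimes> c) \<otimes>\<^bsub>AH\<^esub> el (mu x g) \<one>\<^bsub>H\<^esub>))"
  proof (rule tsum_cong[OF over_transl[OF h]])
    fix l r assume l: "l \<in> carrier A" and r: "r \<in> carrier A"
    have "coact A (l \<otimes> x \<otimes> r) = coact A l \<otimes>\<^bsub>AH\<^esub> co AH r (\<lambda>c g. coact A c \<otimes>\<^bsub>AH\<^esub> el (mu x g) \<one>\<^bsub>H\<^esub>)"
      using l r by (simp add: A.m_assoc coact_mult[OF l] xr)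
    also have "\<dots> = co AH r (\<lambda>c g. coact A l \<otimes>\<^bsub>AH\<^esub> (coact A c \<otimes>\<^bsub>AH\<^esub> el (mu x g) \<one>\<^bsub>H\<^esub>))"
      using l by (intro co_lin[OF AH.lin_mult_right _ _ r]) simp_all
    also have "\<dots> = co AH r (\<lambda>c g. coact A (l \<otimes> c) \<otimes>\<^bsub>AH\<^esub> el (mu x g) \<one>\<^bsub>H\<^esub>)"
      using l by (intro co_cong[OF r]) (simp add: AH.mult_assoc coact_mult)
    finally show "coact A (l \<otimes> x \<otimes> r) = \<dots>" .
  qed
  also have "\<dots> = coact A \<one> \<otimes>\<^bsub>AH\<^esub> el (mu x h) \<one>\<^bsub>H\<^esub>"
    by (intro transl_coact[where \<Phi> = "\<lambda>b g. coact A b \<otimes>\<^bsub>AH\<^esub> el (mu x g) \<one>\<^bsub>H\<^esub>"] h glin L) simp_all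
  also have "\<dots> = el (mu x h) \<one>\<^bsub>H\<^esub>"
    using h by (simp add: coact_one AH.mult_el)
  finally show ?thesis using h by (simp add: B_mem)
qed

lemma mu_in_Z [simp]:
  assumes x: "x \<in> carrier Z" and h: "h \<in> carrier H"
  shows "mu x h \<in> carrier Z"
proof -
  note [simp] = x
  have "mu x h \<otimes> b = b \<otimes> mu x h" if b: "b \<in> carrier B" for b
  proof -
    note [simp] = B_in_A[OF b]
    have "mu x h \<otimes> b = tsum A (trl h) (\<lambda>l r. l \<otimes> x \<otimes> r \<otimes> b)"
      unfolding mu_def by (intro tsum_lin[OF lin_multL[OF alg_A _ lin_id] _ _ over_transl[OF h]]) simp_all
    also have "\<dots> = tsum A (trl h) (\<lambda>l r. co A r (\<lambda>c g. (l \<otimes> c) \<otimes> b \<otimes> mu x g))"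
    proof (rule tsum_cong[OF over_transl[OF h]])
      fix l r assume l: "l \<in> carrier A" and r: "r \<in> carrier A"
      have "l \<otimes> x \<otimes> r \<otimes> b = l \<otimes> (x \<otimes> (r \<otimes> b))"
        using l r by (simp add: A.m_assoc)
      also have "x \<otimes> (r \<otimes> b) = co A (r \<otimes> b) (\<lambda>c g. c \<otimes> mu x g)"
        using r by (intro mu_commute) simp_all
      also have "\<dots> = co A r (\<lambda>c g. c \<otimes> b \<otimes> mu x g)"
        by (intro co_mult_B_right r b glin lin_mu alg_A) simp_all
      also have "l \<otimes> \<dots> = co A r (\<lambda>c g. l \<otimes> (c \<otimes> b \<otimes> mu x g))"
        by (intro co_lin[OF lin_multR[OF alg_A l lin_id] _ _ r]) simp_all
      also have "\<dots> = co A r (\<lambda>c g. (l \<otimes> c) \<otimes> b \<otimes> mu x g)"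
        using l by (intro co_cong[OF r]) (simp add: A.m_assoc)
      finally show "l \<otimes> x \<otimes> r \<otimes> b = \<dots>" .
    qed
    also have "\<dots> = \<one> \<otimes> b \<otimes> mu x h"
      by (intro transl_coact[where \<Phi> = "\<lambda>c g. c \<otimes> b \<otimes> mu x g"] h glin lin_mu alg_A) simp_all
    finally show ?thesis by simp
  qed
  then show ?thesis using mu_in_B[OF x h] by (simp add: Z_mem)
qed

lemma sw_antipode_twisted:
  assumes f: "lin H G f" and G: "module k G" and h: "h \<in> carrier H"
  shows "sw G h (\<lambda>x y. f (antipode H y \<star> x)) = counit H h \<odot>\<^bsub>G\<^esub> f \<one>\<^bsub>H\<^esub>"
proof -
  have "sw G h (\<lambda>x y. f (antipode H y \<star> x)) = sw G h (\<lambda>x y. f (antipode H x \<star> y))"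
    using G h by (intro sw_cocomm bilinI lin_comp[OF f] hlin alg_H) simp_all
  also have "\<dots> = counit H h \<odot>\<^bsub>G\<^esub> f \<one>\<^bsub>H\<^esub>" by (rule sw_antipode_left[OF f G h])
  finally show ?thesis .
qed

text \<open>The commutation rule solved for the other side: the antipode cancels the factor that arises when
  \<open>mu y\<close> is moved past \<open>b\<close>.\<close>

lemma mu_antipode_commute:
  assumes y: "y \<in> carrier Z" and a: "a \<in> carrier A"
  shows "co A a (\<lambda>b h. mu y (antipode H h) \<otimes> b) = a \<otimes> y"
proof -
  let ?S = "antipode H"
  note [simp] = y alg_H
  note L = lin_mu alg_A alg_H
  have "co A a (\<lambda>b h. mu y (?S h) \<otimes> b) = co A a (\<lambda>b h. co A b (\<lambda>d g. d \<otimes> mu y (?S h \<star> g)))"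
  proof (rule co_cong[OF a])
    fix b h assume b: "b \<in> carrier A" and h: "h \<in> carrier H"
    then have Sh: "?S h \<in> carrier H" by simp
    have "mu y (?S h) \<otimes> b = tsum A (trl (?S h)) (\<lambda>l r. l \<otimes> y \<otimes> r \<otimes> b)"
      unfolding mu_def using b by (intro tsum_lin[OF lin_multL[OF alg_A _ lin_id] _ _ over_transl[OF Sh]]) simp_all
    also have "\<dots> = tsum A (trl (?S h)) (\<lambda>l r. co A r (\<lambda>c u. co A b (\<lambda>d g. (l \<otimes> c) \<otimes> d \<otimes> mu y (u \<star> g))))"
    proof (rule tsum_cong[OF over_transl[OF Sh]])
      fix l r assume l: "l \<in> carrier A" and r: "r \<in> carrier A"
      have "l \<otimes> y \<otimes> r \<otimes> b = l \<otimes> (y \<otimes> (r \<otimes> b))"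
        using l r b by (simp add: A.m_assoc)
      also have "y \<otimes> (r \<otimes> b) = co A (r \<otimes> b) (\<lambda>c g. c \<otimes> mu y g)"
        using r b by (intro mu_commute) simp_all
      also have "\<dots> = co A r (\<lambda>c u. co A b (\<lambda>d g. c \<otimes> d \<otimes> mu y (u \<star> g)))"
        using r b by (intro co_mult glin L) simp_all
      also have "l \<otimes> \<dots> = co A r (\<lambda>c u. l \<otimes> co A b (\<lambda>d g. c \<otimes> d \<otimes> mu y (u \<star> g)))"
        by (intro co_lin[OF lin_multR[OF alg_A l lin_id] _ _ r] co_closed b) simp_all
      also have "\<dots> = co A r (\<lambda>c u. co A b (\<lambda>d g. (l \<otimes> c) \<otimes> d \<otimes> mu y (u \<star> g)))"
      proof (rule co_cong[OF r])
        fix c u assume c: "c \<in> carrier A" and u: "u \<in> carrier H"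
        have "l \<otimes> co A b (\<lambda>d g. c \<otimes> d \<otimes> mu y (u \<star> g)) =
            co A b (\<lambda>d g. l \<otimes> (c \<otimes> d \<otimes> mu y (u \<star> g)))"
          using c u by (intro co_lin[OF lin_multR[OF alg_A l lin_id] _ _ b]) simp_all
        also have "\<dots> = co A b (\<lambda>d g. (l \<otimes> c) \<otimes> d \<otimes> mu y (u \<star> g))"
          using l c u by (intro co_cong[OF b]) (simp add: A.m_assoc)
        finally show "l \<otimes> co A b (\<lambda>d g. c \<otimes> d \<otimes> mu y (u \<star> g)) = \<dots>" .
      qed
      finally show "l \<otimes> y \<otimes> r \<otimes> b = \<dots>" .
    qed
    also have "\<dots> = co A b (\<lambda>d g. \<one> \<otimes> d \<otimes> mu y (?S h \<star> g))"
      using b by (intro transl_coact[where \<Phi> = "\<lambda>c u. co A b (\<lambda>d g. c \<otimes> d \<otimes> mu y (u \<star> g))"] Sh glin L) simp_all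
    also have "\<dots> = co A b (\<lambda>d g. d \<otimes> mu y (?S h \<star> g))"
      using h by (intro co_cong[OF b]) simp
    finally show "mu y (?S h) \<otimes> b = \<dots>" .
  qed
  also have "\<dots> = co A a (\<lambda>d u. sw A u (\<lambda>g h. d \<otimes> mu y (?S h \<star> g)))"
    by (intro co_coassoc a glin L) simp_all
  also have "\<dots> = co A a (\<lambda>d u. counit H u \<odot> (d \<otimes> y))"
  proof (rule co_cong[OF a])
    fix d u assume d: "d \<in> carrier A" and u: "u \<in> carrier H"
    have "sw A u (\<lambda>g h. d \<otimes> mu y (?S h \<star> g)) = counit H u \<odot> (d \<otimes> mu y \<one>\<^bsub>H\<^esub>)"
      using d by (intro sw_antipode_twisted[where f = "\<lambda>w. d \<otimes> mu y w"] u glin L) simp_all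
    then show "sw A u (\<lambda>g h. d \<otimes> mu y (?S h \<star> g)) = counit H u \<odot> (d \<otimes> y)"
      by (simp add: mu_unit)
  qed
  also have "\<dots> = a \<otimes> y"
    by (intro co_counit[where f = "\<lambda>d. d \<otimes> y"] a glin alg_A) simp_all
  finally show ?thesis .
qed

abbreviation act :: "'h \<Rightarrow> 'a \<Rightarrow> 'a" where "act \<equiv> miyashita_ulbrich k H A"

lemma act_mu: "h \<in> carrier H \<Longrightarrow> act h x = mu x (antipode H h)"
  by (simp add: miyashita_ulbrich_def mu_def inv_antipode)

lemma act_closed [simp]: "h \<in> carrier H \<Longrightarrow> x \<in> carrier Z \<Longrightarrow> act h x \<in> carrier Z"
  by (simp add: act_mu)

lemma lin_A_to_Z: "lin V A f \<Longrightarrow> (\<And>x. x \<in> carrier V \<Longrightarrow> f x \<in> carrier Z) \<Longrightarrow> lin V Z f"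
  by (rule linI) (simp_all add: lin_add lin_smult)

lemma act_linH: "x \<in> carrier Z \<Longrightarrow> lin H Z (\<lambda>h. act h x)"
proof -
  assume x: "x \<in> carrier Z"
  have "lin H A (\<lambda>h. act h x)"
    by (rule lin_cong[OF lin_comp[OF mu_linH[OF x] lin_antipode0]]) (simp_all add: act_mu)
  then show ?thesis using x by (intro lin_A_to_Z) simp_all
qed

lemma act_linZ: "h \<in> carrier H \<Longrightarrow> lin Z Z (\<lambda>x. act h x)"
  by (rule lin_A_to_Z) (simp_all add: act_mu mu_linZ)

lemma tsum_Z:
  assumes "over U V X" "\<And>x y. x \<in> U \<Longrightarrow> y \<in> V \<Longrightarrow> F x y \<in> carrier Z"
  shows "tsum Z X F = tsum A X F"
  by (rule tsum_lin[OF lin_Z_A module_Z module_A assms])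

lemma act_mult:
  assumes h: "h \<in> carrier H" and x: "x \<in> carrier Z" and y: "y \<in> carrier Z"
  shows "act h (x \<otimes> y) = sw A h (\<lambda>u v. act u x \<otimes> act v y)"
proof -
  have "act h (x \<otimes> y) = sw A (antipode H h) (\<lambda>u v. mu x u \<otimes> mu y v)"
    using assms by (simp add: act_mu mu_mult)
  also have "\<dots> = sw A h (\<lambda>u v. mu x (antipode H u) \<otimes> mu y (antipode H v))"
    using x y by (intro sw_antipode glin lin_mu alg_A h) simp_all
  also have "\<dots> = sw A h (\<lambda>u v. act u x \<otimes> act v y)"
    by (intro sw_cong[OF h]) (simp add: act_mu)
  finally show ?thesis .
qed

lemma act_mult_Z:
  assumes h: "h \<in> carrier H" and x: "x \<in> carrier Z" and y: "y \<in> carrier Z"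
  shows "act h (x \<otimes> y) = sw Z h (\<lambda>u v. act u x \<otimes> act v y)"
  unfolding act_mult[OF assms] using x y by (intro tsum_Z[OF over_comult[OF h], symmetric]) simp

lemma act_one: "h \<in> carrier H \<Longrightarrow> act h \<one> = counit H h \<odot> \<one>"
  by (simp add: act_mu mu_one counit_antipode)

lemma act_commute_left:
  assumes "y \<in> carrier Z" "a \<in> carrier A"
  shows "co A a (\<lambda>b h. act h y \<otimes> b) = a \<otimes> y"
  unfolding mu_antipode_commute[OF assms, symmetric]
  by (intro co_cong assms) (simp add: act_mu)

lemma act_commute_right:
  assumes "y \<in> carrier Z" "a \<in> carrier A"
  shows "co A a (\<lambda>b h. b \<otimes> act (antipode H h) y) = y \<otimes> a"
  unfolding mu_commute[OF assms]
  by (intro co_cong assms) (simp add: act_mu)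

end

section \<open>Multilinear maps and tensor powers\<close>

context cocomm_hopf
begin

definition vecs :: "nat \<Rightarrow> 'h list set" where
  "vecs n = {hs. length hs = n \<and> set hs \<subseteq> carrier H}"

lemma vecs_0 [simp]: "hs \<in> vecs 0 \<longleftrightarrow> hs = []"
  by (auto simp: vecs_def)

lemma vecs_Suc: "hs \<in> vecs (Suc n) \<longleftrightarrow> (\<exists>x xs. hs = x # xs \<and> x \<in> carrier H \<and> xs \<in> vecs n)"
  by (cases hs) (auto simp: vecs_def)

lemma vecs_Cons [simp]: "x # xs \<in> vecs (Suc n) \<longleftrightarrow> x \<in> carrier H \<and> xs \<in> vecs n"
  by (auto simp: vecs_def)

lemma vecs_induct [consumes 1, case_names Nil Cons]:
  assumes "hs \<in> vecs n" "P 0 []" "\<And>n h hs. h \<in> carrier H \<Longrightarrow> hs \<in> vecs n \<Longrightarrow> P n hs \<Longrightarrow> P (Suc n) (h # hs)"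
  shows "P n hs"
  using assms(1) by (induction n arbitrary: hs) (auto simp: vecs_Suc assms(2,3))

lemma vecs_length: "hs \<in> vecs n \<Longrightarrow> length hs = n"
  by (simp add: vecs_def)

lemma vecs_update: "hs \<in> vecs n \<Longrightarrow> x \<in> carrier H \<Longrightarrow> hs[i := x] \<in> vecs n"
  unfolding vecs_def using set_update_subset_insert[of hs i x] by auto

lemma vecs_nth: "hs \<in> vecs n \<Longrightarrow> i < n \<Longrightarrow> hs ! i \<in> carrier H"
  unfolding vecs_def using nth_mem by auto

text \<open>Multilinearity by recursion on the number of arguments, parallel to the recursion of Sweedler sums;
  \<open>mlin_of_update\<close> and \<open>mlin_update\<close> relate it to linearity in each entry.\<close>

primrec mlin where
  "mlin G 0 F \<longleftrightarrow> F [] \<in> carrier G"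
| "mlin G (Suc n) F \<longleftrightarrow> (\<forall>x\<in>carrier H. mlin G n (\<lambda>hs. F (x # hs))) \<and>
     (\<forall>hs\<in>vecs n. lin H G (\<lambda>x. F (x # hs)))"

lemma mlin_closed: "mlin G n F \<Longrightarrow> hs \<in> vecs n \<Longrightarrow> F hs \<in> carrier G"
proof (induction n arbitrary: F hs)
  case (Suc n)
  obtain x xs where x: "hs = x # xs" "x \<in> carrier H" "xs \<in> vecs n" using Suc.prems vecs_Suc by blast
  have "mlin G n (\<lambda>hs. F (x # hs))" using Suc.prems(1) x(2) by simp
  from Suc.IH[OF this x(3)] show ?case by (simp add: x(1))
qed simp

lemma mlin_update:
  "mlin G n F \<Longrightarrow> hs \<in> vecs n \<Longrightarrow> i < n \<Longrightarrow> lin H G (\<lambda>x. F (hs[i := x]))"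
proof (induction n arbitrary: F hs i)
  case (Suc n)
  obtain x xs where x: "hs = x # xs" "x \<in> carrier H" "xs \<in> vecs n" using Suc.prems vecs_Suc by blast
  show ?case
  proof (cases i)
    case 0
    then show ?thesis using Suc.prems(1) x by simp
  next
    case (Suc j)
    have "mlin G n (\<lambda>hs. F (x # hs))" using Suc.prems(1) x(2) by simp
    from Suc.IH[OF this x(3), of j] Suc.prems(3) Suc show ?thesis by (simp add: x(1))
  qed
qed simp

lemma mlin_of_update:
  assumes "\<And>hs. hs \<in> vecs n \<Longrightarrow> F hs \<in> carrier G"
    and "\<And>hs i. hs \<in> vecs n \<Longrightarrow> i < n \<Longrightarrow> lin H G (\<lambda>x. F (hs[i := x]))"
  shows "mlin G n F"
  using assms
proof (induction n arbitrary: F)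
  case (Suc n)
  have "mlin G n (\<lambda>hs. F (x # hs))" if x: "x \<in> carrier H" for x
  proof (rule Suc.IH)
    fix hs assume hs: "hs \<in> vecs n"
    then show "F (x # hs) \<in> carrier G" using x by (intro Suc.prems(1)) simp
    fix i assume "i < n"
    then show "lin H G (\<lambda>y. F (x # hs[i := y]))"
      using Suc.prems(2)[of "x # hs" "Suc i"] x hs by simp
  qed
  moreover have "lin H G (\<lambda>x. F (x # hs))" if "hs \<in> vecs n" for hs
    using Suc.prems(2)[of "\<zero>\<^bsub>H\<^esub> # hs" 0] that by simp
  ultimately show ?case by simp
qed simp

lemma mlin_cong:
  "mlin G n F \<Longrightarrow> (\<And>hs. hs \<in> vecs n \<Longrightarrow> F hs = F' hs) \<Longrightarrow> mlin G n F'"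
proof (induction n arbitrary: F F')
  case (Suc n)
  have "mlin G n (\<lambda>hs. F' (x # hs))" if x: "x \<in> carrier H" for x
    by (rule Suc.IH[of "\<lambda>hs. F (x # hs)"]) (use Suc.prems x in simp_all)
  moreover have "lin H G (\<lambda>x. F' (x # hs))" if "hs \<in> vecs n" for hs
    by (rule lin_cong[of _ _ "\<lambda>x. F (x # hs)"]) (use Suc.prems that in simp_all)
  ultimately show ?case by simp
qed simp

lemma mlin_comp: "lin G G' \<phi> \<Longrightarrow> mlin G n F \<Longrightarrow> mlin G' n (\<lambda>hs. \<phi> (F hs))"
proof (induction n arbitrary: F)
  case 0
  then show ?case by (simp add: lin_closed)
next
  case (Suc n)
  have "mlin G' n (\<lambda>hs. \<phi> (F (x # hs)))" if x: "x \<in> carrier H" for x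
    using Suc.prems x by (intro Suc.IH) simp_all
  moreover have "lin H G' (\<lambda>x. \<phi> (F (x # hs)))" if "hs \<in> vecs n" for hs
    using Suc.prems that by (intro lin_comp[OF Suc.prems(1)]) simp_all
  ultimately show ?case by simp
qed

lemma mlin_tsum:
  assumes G: "module k G" and X: "over U V X" and F: "\<And>x y. x \<in> U \<Longrightarrow> y \<in> V \<Longrightarrow> mlin G n (F x y)"
  shows "mlin G n (\<lambda>hs. tsum G X (\<lambda>x y. F x y hs))"
  using F
proof (induction n arbitrary: F)
  case 0
  then show ?case using tsum_closed[OF module_abelian[OF G] X, of "\<lambda>x y. F x y []"] by simp
next
  case (Suc n)
  have "mlin G n (\<lambda>hs. tsum G X (\<lambda>u v. F u v (x # hs)))" if x: "x \<in> carrier H" for x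
    by (rule Suc.IH) (use Suc.prems x in simp)
  moreover have "lin H G (\<lambda>x. tsum G X (\<lambda>u v. F u v (x # hs)))" if "hs \<in> vecs n" for hs
    by (rule lin_tsum_fun[OF G X]) (use Suc.prems that in simp)
  ultimately show ?case by simp
qed

subsection \<open>Sweedler sums over lists\<close>

abbreviation SW where "SW G hs F \<equiv> sweedler_sum H G hs F"

lemma SW_cong:
  "hs \<in> vecs n \<Longrightarrow> (\<And>xs ys. xs \<in> vecs n \<Longrightarrow> ys \<in> vecs n \<Longrightarrow> F xs ys = F' xs ys) \<Longrightarrow> SW G hs F = SW G hs F'"
proof (induction n hs arbitrary: F F' rule: vecs_induct)
  case (Cons n h hs)
  show ?case
    unfolding sweedler_sum.simps
    by (rule sw_cong[OF Cons.hyps(1)], rule Cons.IH) (use Cons.prems in simp)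
qed simp

lemma SW_closed:
  assumes G: "module k G" and "hs \<in> vecs n" "\<And>xs ys. xs \<in> vecs n \<Longrightarrow> ys \<in> vecs n \<Longrightarrow> F xs ys \<in> carrier G"
  shows "SW G hs F \<in> carrier G"
  using assms(2,3)
proof (induction n hs arbitrary: F rule: vecs_induct)
  case (Cons n h hs)
  show ?case
    unfolding sweedler_sum.simps
    by (rule sw_closed[OF G Cons.hyps(1)], rule Cons.IH) (use Cons.prems in simp)
qed simp

lemma lin_SW_fun:
  assumes G: "module k G" and "hs \<in> vecs n" "\<And>xs ys. xs \<in> vecs n \<Longrightarrow> ys \<in> vecs n \<Longrightarrow> lin V G (\<lambda>v. F v xs ys)"
  shows "lin V G (\<lambda>v. SW G hs (F v))"
  using assms(2,3)
proof (induction n hs arbitrary: F rule: vecs_induct)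
  case (Cons n h hs)
  show ?case
    unfolding sweedler_sum.simps
    by (rule lin_sw_fun[OF Cons.hyps(1) G], rule Cons.IH) (use Cons.prems in simp)
qed simp

lemma SW_lin:
  assumes L: "lin G G' \<phi>" and G: "module k G" and G': "module k G'" and "hs \<in> vecs n"
    and "\<And>xs ys. xs \<in> vecs n \<Longrightarrow> ys \<in> vecs n \<Longrightarrow> F xs ys \<in> carrier G"
  shows "\<phi> (SW G hs F) = SW G' hs (\<lambda>xs ys. \<phi> (F xs ys))"
  using assms(4,5)
proof (induction n hs arbitrary: F rule: vecs_induct)
  case (Cons n h hs)
  note h = Cons.hyps(1)
  have F: "F (x # xs) (y # ys) \<in> carrier G"
    if "x \<in> carrier H" "y \<in> carrier H" "xs \<in> vecs n" "ys \<in> vecs n" for x y xs ys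
    using Cons.prems[of "x # xs" "y # ys"] that by simp
  have "\<phi> (SW G (h # hs) F) = sw G' h (\<lambda>x y. \<phi> (SW G hs (\<lambda>xs ys. F (x # xs) (y # ys))))"
    unfolding sweedler_sum.simps
    by (rule sw_lin[OF L G G' h], rule SW_closed[OF G Cons.hyps(2)], rule F)
  also have "\<dots> = SW G' (h # hs) (\<lambda>xs ys. \<phi> (F xs ys))"
    unfolding sweedler_sum.simps by (rule sw_cong[OF h], rule Cons.IH, rule F)
  finally show ?case .
qed simp

text \<open>In this and the next lemmas, Sweedler sums over lists inherit the rules of \<open>sw\<close> entry by entry.\<close>

lemma SW_swap:
  assumes G: "module k G" and "hs \<in> vecs n" and X: "over U V X"
    and "\<And>xs ys u v. xs \<in> vecs n \<Longrightarrow> ys \<in> vecs n \<Longrightarrow> u \<in> U \<Longrightarrow> v \<in> V \<Longrightarrow> F u v xs ys \<in> carrier G"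
  shows "SW G hs (\<lambda>xs ys. tsum G X (\<lambda>u v. F u v xs ys)) = tsum G X (\<lambda>u v. SW G hs (F u v))"
  using assms(2,4)
proof (induction n hs arbitrary: F rule: vecs_induct)
  case (Cons n h hs)
  note h = Cons.hyps(1)
  have F: "F u v (x # xs) (y # ys) \<in> carrier G"
    if "x \<in> carrier H" "y \<in> carrier H" "xs \<in> vecs n" "ys \<in> vecs n" "u \<in> U" "v \<in> V" for u v x y xs ys
    using Cons.prems[of "x # xs" "y # ys"] that by simp
  have "SW G (h # hs) (\<lambda>xs ys. tsum G X (\<lambda>u v. F u v xs ys)) =
      sw G h (\<lambda>x y. tsum G X (\<lambda>u v. SW G hs (\<lambda>xs ys. F u v (x # xs) (y # ys))))"
    unfolding sweedler_sum.simps by (rule sw_cong[OF h], rule Cons.IH, rule F)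
  also have "\<dots> = tsum G X (\<lambda>u v. sw G h (\<lambda>x y. SW G hs (\<lambda>xs ys. F u v (x # xs) (y # ys))))"
    by (rule sw_swap[OF G h X], rule SW_closed[OF G Cons.hyps(2)], rule F)
  finally show ?case by simp
qed simp

definition bimlin where
  "bimlin G n F \<longleftrightarrow> (\<forall>ys\<in>vecs n. mlin G n (\<lambda>xs. F xs ys)) \<and> (\<forall>xs\<in>vecs n. mlin G n (F xs))"

lemma bimlinI:
  "(\<And>ys. ys \<in> vecs n \<Longrightarrow> mlin G n (\<lambda>xs. F xs ys)) \<Longrightarrow> (\<And>xs. xs \<in> vecs n \<Longrightarrow> mlin G n (F xs)) \<Longrightarrow> bimlin G n F"
  by (simp add: bimlin_def)

lemma bimlin_closed: "bimlin G n F \<Longrightarrow> xs \<in> vecs n \<Longrightarrow> ys \<in> vecs n \<Longrightarrow> F xs ys \<in> carrier G"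
  unfolding bimlin_def using mlin_closed[of G n "F xs" ys] by simp

lemma bimlin_Cons:
  "bimlin G (Suc n) F \<Longrightarrow> x \<in> carrier H \<Longrightarrow> y \<in> carrier H \<Longrightarrow> bimlin G n (\<lambda>xs ys. F (x # xs) (y # ys))"
  by (simp add: bimlin_def)

lemma bimlin_heads:
  assumes F: "bimlin G (Suc n) F" and G: "module k G" and hs: "hs \<in> vecs n"
  shows "bilin H H G (\<lambda>x y. SW G hs (\<lambda>xs ys. F (x # xs) (y # ys)))"
  by (intro bilinI lin_SW_fun[OF G hs]) (use F in \<open>simp_all add: bimlin_def\<close>)

lemma mlin_SW: "bimlin G n F \<Longrightarrow> module k G \<Longrightarrow> mlin G n (\<lambda>hs. SW G hs F)"
proof (induction n arbitrary: F)
  case 0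
  then show ?case by (simp add: bimlin_def)
next
  case (Suc n)
  have "mlin G n (\<lambda>hs. SW G (x # hs) F)" if x: "x \<in> carrier H" for x
    unfolding sweedler_sum.simps
    by (rule mlin_tsum[OF Suc.prems(2) over_comult[OF x]], rule Suc.IH[OF bimlin_Cons[OF Suc.prems(1)] Suc.prems(2)])
  moreover have "lin H G (\<lambda>x. SW G (x # hs) F)" if "hs \<in> vecs n" for hs
    unfolding sweedler_sum.simps
    by (rule lin_sw_arg[OF Suc.prems(2) lin_id bimlin_heads[OF Suc.prems that]])
  ultimately show ?case by simp
qed

lemma SW_comm: "hs \<in> vecs n \<Longrightarrow> bimlin G n F \<Longrightarrow> module k G \<Longrightarrow> SW G hs F = SW G hs (\<lambda>xs ys. F ys xs)"
proof (induction n hs arbitrary: F rule: vecs_induct)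
  case (Cons m h hs)
  note h = Cons.hyps(1) and hs = Cons.hyps(2) and F = Cons.prems(1)
  have "SW G (h # hs) F = sw G h (\<lambda>x y. SW G hs (\<lambda>xs ys. F (y # xs) (x # ys)))"
    unfolding sweedler_sum.simps
    by (rule sw_cocomm[OF bimlin_heads[OF F Cons.prems(2) hs] Cons.prems(2) h])
  also have "\<dots> = SW G (h # hs) (\<lambda>xs ys. F ys xs)"
    unfolding sweedler_sum.simps
    by (rule sw_cong[OF h], rule Cons.IH[OF bimlin_Cons[OF F] Cons.prems(2)])
  finally show ?case .
qed simp_all

lemma SW_assoc:
  "hs \<in> vecs n \<Longrightarrow> module k G \<Longrightarrow>
    (\<And>ys zs. ys \<in> vecs n \<Longrightarrow> zs \<in> vecs n \<Longrightarrow> mlin G n (\<lambda>xs. F xs ys zs)) \<Longrightarrow>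
    (\<And>xs zs. xs \<in> vecs n \<Longrightarrow> zs \<in> vecs n \<Longrightarrow> mlin G n (\<lambda>ys. F xs ys zs)) \<Longrightarrow>
    (\<And>xs ys. xs \<in> vecs n \<Longrightarrow> ys \<in> vecs n \<Longrightarrow> mlin G n (\<lambda>zs. F xs ys zs)) \<Longrightarrow>
    SW G hs (\<lambda>xs zs. SW G xs (\<lambda>us vs. F us vs zs)) = SW G hs (\<lambda>us ys. SW G ys (\<lambda>vs ws. F us vs ws))"
proof (induction n hs arbitrary: F rule: vecs_induct)
  case (Cons m h hs)
  note h = Cons.hyps(1) and hs = Cons.hyps(2) and G = Cons.prems(1) and F = Cons.prems(2-4)
  have Fc: "F (u # us) (v # vs) (w # ws) \<in> carrier G"
    if "u \<in> carrier H" "v \<in> carrier H" "w \<in> carrier H" "us \<in> vecs m" "vs \<in> vecs m" "ws \<in> vecs m" for u v w us vs ws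
    using mlin_closed[OF F(3), of "u # us" "v # vs" "w # ws"] that by simp
  let ?L = "\<lambda>u v w. SW G hs (\<lambda>xs zs. SW G xs (\<lambda>us vs. F (u # us) (v # vs) (w # zs)))"
  let ?R = "\<lambda>u v w. SW G hs (\<lambda>us ys. SW G ys (\<lambda>vs ws. F (u # us) (v # vs) (w # ws)))"
  have "SW G (h # hs) (\<lambda>xs zs. SW G xs (\<lambda>us vs. F us vs zs)) =
      sw G h (\<lambda>x z. SW G hs (\<lambda>xs zs. sw G x (\<lambda>u v. SW G xs (\<lambda>us vs. F (u # us) (v # vs) (z # zs)))))"
    by simp
  also have "\<dots> = sw G h (\<lambda>x z. sw G x (\<lambda>u v. ?L u v z))"
    by (rule sw_cong[OF h], rule SW_swap[OF G hs over_comult]) (auto intro!: SW_closed[OF G] Fc)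
  also have "\<dots> = sw G h (\<lambda>u y. sw G y (\<lambda>v w. ?L u v w))"
  proof (rule sw_coassoc[OF G h])
    show "lin H G (\<lambda>u. ?L u v w)" if "v \<in> carrier H" "w \<in> carrier H" for v w
      by (intro lin_SW_fun[OF G]) (use hs F(1) that in auto)
    show "lin H G (\<lambda>v. ?L u v w)" if "u \<in> carrier H" "w \<in> carrier H" for u w
      by (intro lin_SW_fun[OF G]) (use hs F(2) that in auto)
    show "lin H G (\<lambda>w. ?L u v w)" if "u \<in> carrier H" "v \<in> carrier H" for u v
      by (intro lin_SW_fun[OF G]) (use hs F(3) that in auto)
  qed
  also have "\<dots> = sw G h (\<lambda>u y. sw G y (\<lambda>v w. ?R u v w))"
  proof (intro sw_cong)
    fix u y v w assume *: "u \<in> carrier H" "v \<in> carrier H" "w \<in> carrier H"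
    show "?L u v w = ?R u v w"
      by (rule Cons.IH[OF G]) (use F * in auto)
  qed (use h in auto)
  also have "\<dots> = sw G h (\<lambda>u y. SW G hs (\<lambda>us ys. sw G y (\<lambda>v w. SW G ys (\<lambda>vs ws. F (u # us) (v # vs) (w # ws)))))"
    by (rule sw_cong[OF h], rule SW_swap[OF G hs over_comult, symmetric]) (auto intro!: SW_closed[OF G] Fc)
  finally show ?case by simp
qed simp_all

definition eps :: "'h list \<Rightarrow> 'k" where
  "eps hs = foldr (\<lambda>h c. counit H h \<otimes>\<^bsub>k\<^esub> c) hs \<one>\<^bsub>k\<^esub>"

lemma eps_simps [simp]: "eps [] = \<one>\<^bsub>k\<^esub>" "eps (h # hs) = counit H h \<otimes>\<^bsub>k\<^esub> eps hs"
  by (simp_all add: eps_def)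

lemma eps_closed: "hs \<in> vecs n \<Longrightarrow> eps hs \<in> carrier k"
  by (induction hs arbitrary: n) (auto simp: vecs_def)

lemma mlin_eps: "module k G \<Longrightarrow> g \<in> carrier G \<Longrightarrow> mlin G n (\<lambda>hs. eps hs \<odot>\<^bsub>G\<^esub> g)"
proof (induction n arbitrary: g)
  case 0
  interpret G: module k G by fact
  show ?case using 0 by simp
next
  case (Suc n)
  interpret G: module k G by fact
  have "mlin G n (\<lambda>hs. eps (x # hs) \<odot>\<^bsub>G\<^esub> g)" if x: "x \<in> carrier H" for x
    by (rule mlin_cong[OF Suc.IH[OF Suc.prems(1), of "counit H x \<odot>\<^bsub>G\<^esub> g"]])
      (use x Suc.prems in \<open>simp_all add: eps_closed G.smult_assoc1[symmetric] k.m_comm\<close>)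
  moreover have "lin H G (\<lambda>x. eps (x # hs) \<odot>\<^bsub>G\<^esub> g)" if hs: "hs \<in> vecs n" for hs
    by (rule lin_cong[of _ _ "\<lambda>x. counit H x \<odot>\<^bsub>G\<^esub> (eps hs \<odot>\<^bsub>G\<^esub> g)"], intro hlin)
      (use hs eps_closed[OF hs] Suc.prems in \<open>simp_all add: G.smult_assoc1[symmetric]\<close>)
  ultimately show ?case by simp
qed

lemma SW_counit:
  "hs \<in> vecs n \<Longrightarrow> mlin G n F \<Longrightarrow> module k G \<Longrightarrow> SW G hs (\<lambda>xs ys. eps xs \<odot>\<^bsub>G\<^esub> F ys) = F hs"
proof (induction n hs arbitrary: F rule: vecs_induct)
  case Nil
  interpret G: module k G by fact
  show ?case using Nil by simp
next
  case (Cons m h hs)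
  interpret G: module k G by fact
  note h = Cons.hyps(1) and hs = Cons.hyps(2) and F = Cons.prems(1) and G = Cons.prems(2)
  have F': "mlin G m (\<lambda>hs. F (y # hs))" if "y \<in> carrier H" for y using F that by simp
  have "SW G (h # hs) (\<lambda>xs ys. eps xs \<odot>\<^bsub>G\<^esub> F ys) = sw G h (\<lambda>x y. counit H x \<odot>\<^bsub>G\<^esub> F (y # hs))"
    unfolding sweedler_sum.simps
  proof (rule sw_cong[OF h])
    fix x y assume x: "x \<in> carrier H" and y: "y \<in> carrier H"
    have "SW G hs (\<lambda>xs ys. eps (x # xs) \<odot>\<^bsub>G\<^esub> F (y # ys)) =
        SW G hs (\<lambda>xs ys. counit H x \<odot>\<^bsub>G\<^esub> (eps xs \<odot>\<^bsub>G\<^esub> F (y # ys)))"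
      by (rule SW_cong[OF hs]) (simp add: x G.smult_assoc1 eps_closed mlin_closed[OF F'[OF y]])
    also have "\<dots> = counit H x \<odot>\<^bsub>G\<^esub> SW G hs (\<lambda>xs ys. eps xs \<odot>\<^bsub>G\<^esub> F (y # ys))"
      using x y by (intro SW_lin[OF lin_smultR[OF G lin_id] G G hs, symmetric])
        (simp_all add: eps_closed mlin_closed[OF F'])
    also have "\<dots> = counit H x \<odot>\<^bsub>G\<^esub> F (y # hs)"
      by (simp only: Cons.IH[OF F'[OF y] G])
    finally show "SW G hs (\<lambda>xs ys. eps (x # xs) \<odot>\<^bsub>G\<^esub> F (y # ys)) = \<dots>" .
  qed
  also have "\<dots> = F (h # hs)"
    using F hs by (intro sw_counit_left[OF _ G h]) simp
  finally show ?case .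
qed

subsection \<open>Faces of multilinear maps\<close>

fun merge :: "nat \<Rightarrow> 'h list \<Rightarrow> 'h list" where
  "merge 0 (x # y # zs) = (x \<star> y) # zs"
| "merge (Suc j) (x # xs) = x # merge j xs"
| "merge j xs = xs"

lemma merge_eq: "Suc j < length hs \<Longrightarrow>
    take j hs @ (hs ! j \<star> hs ! Suc j) # drop (Suc (Suc j)) hs = merge j hs"
proof (induction j arbitrary: hs)
  case 0
  then obtain x y zs where "hs = x # y # zs" by (cases hs rule: list.exhaust; cases "List.tl hs") auto
  then show ?case by simp
next
  case (Suc j)
  then obtain x xs where "hs = x # xs" by (cases hs) auto
  then show ?case using Suc by simp
qed

lemma merge_vecs: "hs \<in> vecs (Suc n) \<Longrightarrow> j < n \<Longrightarrow> merge j hs \<in> vecs n"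
proof (induction j arbitrary: hs n)
  case 0
  then obtain m where "n = Suc m" by (cases n) auto
  then show ?case using 0 by (auto simp: vecs_Suc)
next
  case (Suc j)
  then obtain m where "n = Suc m" by (cases n) auto
  then show ?case using Suc by (auto simp: vecs_Suc)
qed

lemma mlin_merge: "mlin G n F \<Longrightarrow> j < n \<Longrightarrow> mlin G (Suc n) (\<lambda>hs. F (merge j hs))"
proof (induction j arbitrary: n F)
  case 0
  then obtain m where n: "n = Suc m" by (cases n) auto
  have F: "mlin G m (\<lambda>hs. F (x # hs))" "hs \<in> vecs m \<Longrightarrow> lin H G (\<lambda>x. F (x # hs))" if "x \<in> carrier H" for x hs
    using 0 n that by simp_all
  show ?case
    unfolding n mlin.simps
  proof (intro conjI ballI)
    show "mlin G m (\<lambda>hs. F (merge 0 (x # y # hs)))" if "x \<in> carrier H" "y \<in> carrier H" for x y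
      using F that by simp
    show "lin H G (\<lambda>y. F (merge 0 (x # y # hs)))" if "x \<in> carrier H" "hs \<in> vecs m" for x hs
      using that lin_comp[OF F(2)[OF that] lin_multR[OF alg_H that(1) lin_id]] by simp
    show "lin H G (\<lambda>x. F (merge 0 (x # hs)))" if "hs \<in> vecs (Suc m)" for hs
    proof -
      obtain y ys where ys: "hs = y # ys" "y \<in> carrier H" "ys \<in> vecs m" using \<open>hs \<in> vecs (Suc m)\<close> vecs_Suc by blast
      show ?thesis using lin_comp[OF F(2)[OF ys(2,3)] lin_multL[OF alg_H ys(2) lin_id]] by (simp add: ys(1))
    qed
  qed
next
  case (Suc j)
  then obtain m where n: "n = Suc m" by (cases n) auto
  have F: "\<And>x. x \<in> carrier H \<Longrightarrow> mlin G m (\<lambda>hs. F (x # hs))" "\<And>hs. hs \<in> vecs m \<Longrightarrow> lin H G (\<lambda>x. F (x # hs))"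
    using Suc n by simp_all
  have jm: "j < m" using Suc n by simp
  have "mlin G (Suc m) (\<lambda>hs. F (x # merge j hs))" if "x \<in> carrier H" for x
    by (rule Suc.IH[OF F(1)[OF that] jm])
  moreover have "lin H G (\<lambda>x. F (x # merge j hs))" if "hs \<in> vecs (Suc m)" for hs
    by (rule F(2)[OF merge_vecs[OF that jm]])
  ultimately show ?case unfolding n mlin.simps(2)[of G "Suc m"] by simp
qed

lemma SW_merge:
  "hs \<in> vecs (Suc n) \<Longrightarrow> j < n \<Longrightarrow> bimlin G n F \<Longrightarrow> module k G \<Longrightarrow>
    SW G (merge j hs) F = SW G hs (\<lambda>xs ys. F (merge j xs) (merge j ys))"
proof (induction j arbitrary: n hs F)
  case 0
  note G = 0(4)
  obtain m where n: "n = Suc m" using 0 by (cases n) auto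
  obtain g h zs where hs: "hs = g # h # zs" "g \<in> carrier H" "h \<in> carrier H" "zs \<in> vecs m"
    using 0(1) n by (auto simp: vecs_Suc)
  have "SW G (merge 0 hs) F = sw G (g \<star> h) (\<lambda>x y. SW G zs (\<lambda>xs ys. F (x # xs) (y # ys)))"
    by (simp add: hs(1))
  also have "\<dots> = sw G g (\<lambda>x y. sw G h (\<lambda>u v. SW G zs (\<lambda>xs ys. F ((x \<star> u) # xs) ((y \<star> v) # ys))))"
    by (rule sw_mult[OF bimlin_heads[OF 0(3)[unfolded n] G hs(4)] G hs(2,3)])
  finally show ?case by (simp add: hs(1))
next
  case (Suc j)
  obtain m where n: "n = Suc m" using Suc.prems by (cases n) auto
  obtain h zs where hs: "hs = h # zs" "h \<in> carrier H" "zs \<in> vecs (Suc m)"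
    using Suc.prems(1) unfolding n vecs_Suc[of _ "Suc m"] by blast
  have jm: "j < m" using Suc.prems n by simp
  have "SW G (merge (Suc j) hs) F = sw G h (\<lambda>x y. SW G (merge j zs) (\<lambda>xs ys. F (x # xs) (y # ys)))"
    by (simp add: hs(1))
  also have "\<dots> = sw G h (\<lambda>x y. SW G zs (\<lambda>xs ys. F (x # merge j xs) (y # merge j ys)))"
    by (rule sw_cong[OF hs(2)], rule Suc.IH[OF hs(3) jm bimlin_Cons[OF Suc.prems(3)[unfolded n]] Suc.prems(4)])
  finally show ?case by (simp add: hs(1))
qed

lemma eps_merge: "hs \<in> vecs (Suc n) \<Longrightarrow> j < n \<Longrightarrow> eps (merge j hs) = eps hs"
proof (induction j arbitrary: n hs)
  case 0
  obtain m where n: "n = Suc m" using 0 by (cases n) auto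
  obtain g h zs where hs: "hs = g # h # zs" "g \<in> carrier H" "h \<in> carrier H" "zs \<in> vecs m"
    using 0(1) n by (auto simp: vecs_Suc)
  then show ?case by (simp add: counit_mult k.m_assoc eps_closed)
next
  case (Suc j)
  obtain m where n: "n = Suc m" using Suc.prems by (cases n) auto
  obtain h zs where hs: "hs = h # zs" "h \<in> carrier H" "zs \<in> vecs (Suc m)"
    using Suc.prems(1) unfolding n vecs_Suc[of _ "Suc m"] by blast
  then show ?case using Suc.IH[OF hs(3), of] Suc.prems n by simp
qed

lemma take_vecs: "hs \<in> vecs (Suc n) \<Longrightarrow> take n hs \<in> vecs n"
  unfolding vecs_def using set_take_subset[of n hs] by auto

lemma mlin_drop_last: "module k G \<Longrightarrow> mlin G n F \<Longrightarrow> mlin G (Suc n) (\<lambda>hs. counit H (hs ! n) \<odot>\<^bsub>G\<^esub> F (take n hs))"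
proof (induction n arbitrary: F)
  case 0
  interpret G: module k G by fact
  have "lin H G (\<lambda>x. counit H x \<odot>\<^bsub>G\<^esub> F [])" using 0 by (intro hlin) simp_all
  then show ?case using 0 by simp
next
  case (Suc n)
  have F: "\<And>x. x \<in> carrier H \<Longrightarrow> mlin G n (\<lambda>hs. F (x # hs))" "\<And>hs. hs \<in> vecs n \<Longrightarrow> lin H G (\<lambda>x. F (x # hs))"
    using Suc.prems by simp_all
  have "mlin G (Suc n) (\<lambda>hs. counit H (hs ! n) \<odot>\<^bsub>G\<^esub> F (x # take n hs))" if "x \<in> carrier H" for x
    by (rule Suc.IH[OF Suc.prems(1) F(1)[OF that]])
  moreover have "lin H G (\<lambda>x. counit H (hs ! n) \<odot>\<^bsub>G\<^esub> F (x # take n hs))" if "hs \<in> vecs (Suc n)" for hs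
    by (rule lin_smultR[OF Suc.prems(1) F(2)[OF take_vecs[OF that]]]) (simp add: vecs_nth[OF that])
  ultimately show ?case unfolding mlin.simps(2)[of G "Suc n"] by simp
qed

lemma SW_drop_last:
  "hs \<in> vecs (Suc n) \<Longrightarrow> bimlin G n F \<Longrightarrow> module k G \<Longrightarrow>
    SW G hs (\<lambda>xs ys. counit H (xs ! n) \<odot>\<^bsub>G\<^esub> (counit H (ys ! n) \<odot>\<^bsub>G\<^esub> F (take n xs) (take n ys))) =
    counit H (hs ! n) \<odot>\<^bsub>G\<^esub> SW G (take n hs) F"
proof (induction n arbitrary: hs F)
  case 0
  note G = 0(3)
  obtain h where hs: "hs = [h]" "h \<in> carrier H" using 0(1) by (auto simp: vecs_Suc)
  have "F [] [] \<in> carrier G" using 0(2) by (simp add: bimlin_def)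
  then have "sw G h (\<lambda>x y. counit H x \<odot>\<^bsub>G\<^esub> (counit H y \<odot>\<^bsub>G\<^esub> F [] [])) = counit H h \<odot>\<^bsub>G\<^esub> F [] []"
    using G hs(2) by (intro sw_counit_left hlin) simp_all
  then show ?case by (simp add: hs(1))
next
  case (Suc n)
  note G = Suc.prems(3)
  interpret G: module k G by fact
  obtain h zs where hs: "hs = h # zs" "h \<in> carrier H" "zs \<in> vecs (Suc n)"
    using Suc.prems(1) unfolding vecs_Suc[of _ "Suc n"] by blast
  have F: "bimlin G n (\<lambda>xs ys. F (x # xs) (y # ys))" if "x \<in> carrier H" "y \<in> carrier H" for x y
    by (rule bimlin_Cons[OF Suc.prems(2) that])
  have "SW G hs (\<lambda>xs ys. counit H (xs ! Suc n) \<odot>\<^bsub>G\<^esub> (counit H (ys ! Suc n) \<odot>\<^bsub>G\<^esub> F (take (Suc n) xs) (take (Suc n) ys))) =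
      sw G h (\<lambda>x y. counit H (zs ! n) \<odot>\<^bsub>G\<^esub> SW G (take n zs) (\<lambda>xs ys. F (x # xs) (y # ys)))"
    unfolding hs(1) sweedler_sum.simps
    by (rule sw_cong[OF hs(2)]) (simp add: Suc.IH[OF hs(3) F G])
  also have "\<dots> = counit H (zs ! n) \<odot>\<^bsub>G\<^esub> sw G h (\<lambda>x y. SW G (take n zs) (\<lambda>xs ys. F (x # xs) (y # ys)))"
    by (rule sw_lin[OF lin_smultR[OF G lin_id] G G hs(2), symmetric])
      (simp_all add: vecs_nth[OF hs(3)] SW_closed[OF G take_vecs[OF hs(3)]] bimlin_closed[OF F])
  finally show ?case by (simp add: hs(1))
qed

lemma eps_drop_last: "hs \<in> vecs (Suc n) \<Longrightarrow> counit H (hs ! n) \<otimes>\<^bsub>k\<^esub> eps (take n hs) = eps hs"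
proof (induction n arbitrary: hs)
  case 0
  then show ?case by (auto simp: vecs_Suc)
next
  case (Suc n)
  obtain h zs where hs: "hs = h # zs" "h \<in> carrier H" "zs \<in> vecs (Suc n)"
    using Suc.prems(1) unfolding vecs_Suc[of _ "Suc n"] by blast
  have "counit H (zs ! n) \<in> carrier k" "eps (take n zs) \<in> carrier k"
    using vecs_nth[OF hs(3)] eps_closed[OF take_vecs[OF hs(3)]] by simp_all
  then show ?case using Suc.IH[OF hs(3), symmetric] hs by (simp add: k.m_lcomm)
qed

subsection \<open>The universal property of tensor powers\<close>

definition tpow_relators :: "nat \<Rightarrow> ('k, 'h list) tens" where
  "tpow_relators n = {frag_of (c \<oplus>\<^bsub>k\<^esub> d, hs) - (frag_of (c, hs) + frag_of (d, hs)) | c d hs.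
         (c, hs) \<in> tpow_gens k H n \<and> d \<in> carrier k} \<union>
      {frag_of (c, hs[i := x \<oplus>\<^bsub>H\<^esub> y]) - (frag_of (c, hs[i := x]) + frag_of (c, hs[i := y])) | c hs i x y.
         (c, hs) \<in> tpow_gens k H n \<and> i < n \<and> x \<in> carrier H \<and> y \<in> carrier H} \<union>
      {frag_of (c, hs[i := d \<odot>\<^bsub>H\<^esub> x]) - frag_of (c \<otimes>\<^bsub>k\<^esub> d, hs[i := x]) | c hs i d x.
         (c, hs) \<in> tpow_gens k H n \<and> i < n \<and> d \<in> carrier k \<and> x \<in> carrier H}"

lemma tpow_gens_eq: "tpow_gens k H n = carrier k \<times> vecs n"
  by (simp add: tpow_gens_def vecs_def)

lemma keys_tpow_relators: "r \<in> tpow_relators n \<Longrightarrow> Poly_Mapping.keys r \<subseteq> carrier k \<times> vecs n"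
  unfolding tpow_relators_def tpow_gens_eq
  by (elim UnE CollectE exE conjE; hypsubst; (rule keys_relator3 | rule keys_relator2); simp add: vecs_update)

lemma tpow_presentation: "presentation (carrier k \<times> vecs n) (tpow_relators n) (tpow_relations k H n)"
  by (rule presentation.intro[OF keys_tpow_relators])
    (simp_all add: tpow_relations_def tpow_relators_def tpow_gens_eq)

definition te :: "nat \<Rightarrow> 'k \<Rightarrow> 'h list \<Rightarrow> ('k, 'h list) tens" where
  "te n c hs = tpow_relations k H n #>\<^bsub>free_Abelian_group (carrier k \<times> vecs n)\<^esub> frag_of (c, hs)"

abbreviation "TQ n \<equiv> quotient_ab (carrier k \<times> vecs n) (tpow_relations k H n)"

lemma tpow_carrier: "carrier (tpow k H n) = carrier (TQ n)" and tpow_add: "add (tpow k H n) = add (TQ n)"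
  and tpow_zero: "zero (tpow k H n) = zero (TQ n)"
  by (simp_all add: tpow_def Let_def tpow_gens_eq fun_eq_iff)

lemma tpow_smult: "d \<odot>\<^bsub>tpow k H n\<^esub> X = tsum (TQ n) X (\<lambda>c hs. te n (d \<otimes>\<^bsub>k\<^esub> c) hs)"
  by (simp add: tpow_def Let_def tpow_gens_eq te_def)

lemma tpow_elem_te: "hs \<in> vecs n \<Longrightarrow> tpow_elem k H hs = te n \<one>\<^bsub>k\<^esub> hs"
  by (simp add: tpow_elem_def te_def tpow_gens_eq vecs_length)

lemma te_in: "c \<in> carrier k \<Longrightarrow> hs \<in> vecs n \<Longrightarrow> te n c hs \<in> carrier (TQ n)"
  unfolding presentation.carrier_Q[OF tpow_presentation] te_def by force

lemma tpow_elem_closed [simp]: "hs \<in> vecs n \<Longrightarrow> tpow_elem k H hs \<in> carrier (tpow k H n)"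
  by (simp add: tpow_elem_te tpow_carrier te_in)

lemma over_tpow: "X \<in> carrier (tpow k H n) \<Longrightarrow> over (carrier k) (vecs n) X"
  unfolding tpow_carrier over_def by (rule presentation.rep_keys[OF tpow_presentation])

lemma te_smult_entry:
  assumes "c \<in> carrier k" "hs \<in> vecs n" "i < n" "d \<in> carrier k" "x \<in> carrier H"
  shows "te n c (hs[i := d \<odot>\<^bsub>H\<^esub> x]) = te n (c \<otimes>\<^bsub>k\<^esub> d) (hs[i := x])"
  unfolding te_def
proof (rule presentation.relator_coset[OF tpow_presentation])
  show "frag_of (c, hs[i := d \<odot>\<^bsub>H\<^esub> x]) - frag_of (c \<otimes>\<^bsub>k\<^esub> d, hs[i := x]) \<in> tpow_relators n"
    unfolding tpow_relators_def tpow_gens_eq using assms by blast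
qed (use assms in \<open>simp add: vecs_update\<close>)

lemma coset_frag2:
  assumes "p \<in> carrier k \<times> vecs n" "q \<in> carrier k \<times> vecs n"
  shows "tpow_relations k H n #>\<^bsub>free_Abelian_group (carrier k \<times> vecs n)\<^esub> (frag_of p + frag_of q) =
    te n (fst p) (snd p) \<oplus>\<^bsub>TQ n\<^esub> te n (fst q) (snd q)"
  unfolding te_def using assms by (subst presentation.coset_add[OF tpow_presentation]) auto

lemma te_add_entry:
  assumes "c \<in> carrier k" "hs \<in> vecs n" "i < n" "x \<in> carrier H" "y \<in> carrier H"
  shows "te n c (hs[i := x \<oplus>\<^bsub>H\<^esub> y]) = te n c (hs[i := x]) \<oplus>\<^bsub>TQ n\<^esub> te n c (hs[i := y])"
proof -
  have *: "frag_of (c, hs[i := x \<oplus>\<^bsub>H\<^esub> y]) - (frag_of (c, hs[i := x]) + frag_of (c, hs[i := y])) \<in> tpow_relators n"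
    unfolding tpow_relators_def tpow_gens_eq using assms by blast
  show ?thesis
    using presentation.relator_coset[OF tpow_presentation *] coset_frag2[of "(c, hs[i := x])" n "(c, hs[i := y])"] assms
    by (simp add: te_def keys_frag2 vecs_update)
qed

text \<open>The three properties of \<open>f\<close> are exactly the vanishing on the three families of relators.\<close>

lemma tpow_kills:
  assumes G: "abelian_group G" and f: "f \<in> carrier k \<times> vecs n \<rightarrow> carrier G"
    and scalar: "\<And>c d hs. c \<in> carrier k \<Longrightarrow> d \<in> carrier k \<Longrightarrow> hs \<in> vecs n \<Longrightarrow> f (c \<oplus>\<^bsub>k\<^esub> d, hs) = f (c, hs) \<oplus>\<^bsub>G\<^esub> f (d, hs)"
    and add: "\<And>c hs i x y. c \<in> carrier k \<Longrightarrow> hs \<in> vecs n \<Longrightarrow> i < n \<Longrightarrow> x \<in> carrier H \<Longrightarrow> y \<in> carrier H \<Longrightarrow>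
      f (c, hs[i := x \<oplus>\<^bsub>H\<^esub> y]) = f (c, hs[i := x]) \<oplus>\<^bsub>G\<^esub> f (c, hs[i := y])"
    and smult: "\<And>c hs i d x. c \<in> carrier k \<Longrightarrow> hs \<in> vecs n \<Longrightarrow> i < n \<Longrightarrow> d \<in> carrier k \<Longrightarrow> x \<in> carrier H \<Longrightarrow>
      f (c, hs[i := d \<odot>\<^bsub>H\<^esub> x]) = f (c \<otimes>\<^bsub>k\<^esub> d, hs[i := x])"
    and r: "r \<in> tpow_relators n"
  shows "formal_sum G f r = \<zero>\<^bsub>G\<^esub>"
proof -
  interpret G: abelian_group G by fact
  note relator = G.formal_sum_relator2[OF f] G.formal_sum_relator3[OF f]
  show ?thesis
    using r unfolding tpow_relators_def tpow_gens_eq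
    by (elim UnE CollectE exE conjE; hypsubst; intro relator) (auto simp: vecs_update scalar add smult)
qed

lemma mlin_kills:
  assumes G: "module k G" and F: "mlin G n F" and r: "r \<in> tpow_relators n"
  shows "formal_sum G (\<lambda>p. fst p \<odot>\<^bsub>G\<^esub> F (snd p)) r = \<zero>\<^bsub>G\<^esub>"
proof -
  interpret G: module k G by fact
  note [simp] = mlin_closed[OF F] vecs_update
  show ?thesis
  proof (rule tpow_kills[OF G.abelian_group_axioms _ _ _ _ r])
    fix c hs i assume c: "c \<in> carrier k" and hs: "hs \<in> vecs n" "i < n"
    note L = mlin_update[OF F hs]
    show "fst (c, hs[i := x \<oplus>\<^bsub>H\<^esub> y]) \<odot>\<^bsub>G\<^esub> F (snd (c, hs[i := x \<oplus>\<^bsub>H\<^esub> y])) =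
        fst (c, hs[i := x]) \<odot>\<^bsub>G\<^esub> F (snd (c, hs[i := x])) \<oplus>\<^bsub>G\<^esub> fst (c, hs[i := y]) \<odot>\<^bsub>G\<^esub> F (snd (c, hs[i := y]))"
      if "x \<in> carrier H" "y \<in> carrier H" for x y
      using that c hs by (simp add: lin_add[OF L] G.smult_r_distr)
    show "fst (c, hs[i := d \<odot>\<^bsub>H\<^esub> x]) \<odot>\<^bsub>G\<^esub> F (snd (c, hs[i := d \<odot>\<^bsub>H\<^esub> x])) =
        fst (c \<otimes>\<^bsub>k\<^esub> d, hs[i := x]) \<odot>\<^bsub>G\<^esub> F (snd (c \<otimes>\<^bsub>k\<^esub> d, hs[i := x]))"
      if "d \<in> carrier k" "x \<in> carrier H" for d x
      using that c hs by (simp add: lin_smult[OF L] G.smult_assoc1)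
  qed (auto simp: G.smult_l_distr)
qed

text \<open>The universal property of the tensor power.\<close>

lemma tpow_map_facts:
  assumes G: "module k G" and F: "mlin G n F"
  shows tpow_map_additive: "additive (tpow k H n) G (tpow_map k H n G F)"
    and tpow_map_te: "c \<in> carrier k \<Longrightarrow> hs \<in> vecs n \<Longrightarrow> tpow_map k H n G F (te n c hs) = c \<odot>\<^bsub>G\<^esub> F hs"
    and tpow_map_lin: "lin (tpow k H n) G (tpow_map k H n G F)"
proof -
  interpret G: module k G by fact
  interpret P: presentation "carrier k \<times> vecs n" "tpow_relators n" "tpow_relations k H n"
    by (rule tpow_presentation)
  interpret Q: abelian_group P.Q by (rule P.abelian_group_Q)
  let ?f = "\<lambda>p. fst p \<odot>\<^bsub>G\<^esub> F (snd p)" and ?T = "tpow k H n"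
  have f: "?f \<in> carrier k \<times> vecs n \<rightarrow> carrier G" using mlin_closed[OF F] by auto
  have eq: "tpow_map k H n G F X = formal_sum G ?f (rep X)" if "X \<in> carrier ?T" for X
    using that by (simp add: tpow_map_def tsum_eq_formal_sum)
  note kills = mlin_kills[OF G F]
  show add: "additive ?T G (tpow_map k H n G F)"
  proof (rule additiveI)
    show "tpow_map k H n G F X \<in> carrier G" if "X \<in> carrier ?T" for X
      unfolding eq[OF that]
      by (rule G.formal_sum_closed[OF _ f]) (use over_tpow[OF that] in \<open>simp add: over_def\<close>)
    show "tpow_map k H n G F (X \<oplus>\<^bsub>?T\<^esub> Y) = tpow_map k H n G F X \<oplus>\<^bsub>G\<^esub> tpow_map k H n G F Y"
      if "X \<in> carrier ?T" "Y \<in> carrier ?T" for X Y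
      using P.formal_sum_rep_add[OF G.abelian_group_axioms f kills] that
      by (simp add: eq tpow_carrier tpow_add)
  qed
  show gen: "tpow_map k H n G F (te n c hs) = c \<odot>\<^bsub>G\<^esub> F hs" if "c \<in> carrier k" "hs \<in> vecs n" for c hs
  proof -
    have "te n c hs \<in> carrier ?T" using that by (simp add: te_in tpow_carrier)
    then show ?thesis
      using P.formal_sum_rep[OF G.abelian_group_axioms f kills, of "frag_of (c, hs)"] that mlin_closed[OF F]
      by (simp add: eq te_def)
  qed
  show "lin ?T G (tpow_map k H n G F)"
  proof (rule lin_of_additive[OF add])
    fix d X assume d: "d \<in> carrier k" and X: "X \<in> carrier ?T"
    have aQ: "additive P.Q G (tpow_map k H n G F)"
      using add by (simp add: additive_def additive_maps_def tpow_carrier tpow_add)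
    have "tpow_map k H n G F (d \<odot>\<^bsub>?T\<^esub> X) = tsum G X (\<lambda>c hs. tpow_map k H n G F (te n (d \<otimes>\<^bsub>k\<^esub> c) hs))"
      unfolding tpow_smult
      by (rule tsum_hom[OF aQ Q.abelian_group_axioms G.abelian_group_axioms over_tpow[OF X]]) (simp add: d te_in)
    also have "\<dots> = tsum G X (\<lambda>c hs. d \<odot>\<^bsub>G\<^esub> (c \<odot>\<^bsub>G\<^esub> F hs))"
      by (rule tsum_cong[OF over_tpow[OF X]]) (simp add: d gen G.smult_assoc1 mlin_closed[OF F])
    also have "\<dots> = d \<odot>\<^bsub>G\<^esub> tsum G X (\<lambda>c hs. c \<odot>\<^bsub>G\<^esub> F hs)"
      by (rule tsum_lin[OF lin_smultR[OF G lin_id d] G G over_tpow[OF X], symmetric]) (simp add: mlin_closed[OF F])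
    also have "tsum G X (\<lambda>c hs. c \<odot>\<^bsub>G\<^esub> F hs) = tpow_map k H n G F X"
      using X by (simp add: tpow_map_def)
    finally show "tpow_map k H n G F (d \<odot>\<^bsub>?T\<^esub> X) = d \<odot>\<^bsub>G\<^esub> tpow_map k H n G F X" .
  qed
qed

lemma tpow_map_elem: "module k G \<Longrightarrow> mlin G n F \<Longrightarrow> hs \<in> vecs n \<Longrightarrow> tpow_map k H n G F (tpow_elem k H hs) = F hs"
  using tpow_map_te[of G n F "\<one>\<^bsub>k\<^esub>" hs] module.smult_one[of k G "F hs"] mlin_closed[of G n F hs]
  by (simp add: tpow_elem_te)

lemma tpow_smult_te:
  assumes d: "d \<in> carrier k" and c: "c \<in> carrier k" and hs: "hs \<in> vecs n"
  shows "d \<odot>\<^bsub>tpow k H n\<^esub> te n c hs = te n (d \<otimes>\<^bsub>k\<^esub> c) hs"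
proof -
  interpret P: presentation "carrier k \<times> vecs n" "tpow_relators n" "tpow_relations k H n"
    by (rule tpow_presentation)
  interpret Q: abelian_group P.Q by (rule P.abelian_group_Q)
  let ?f = "\<lambda>p. te n (d \<otimes>\<^bsub>k\<^esub> fst p) (snd p)"
  have f: "?f \<in> carrier k \<times> vecs n \<rightarrow> carrier P.Q" using d by (auto intro: te_in)
  have scalar: "te n (a \<oplus>\<^bsub>k\<^esub> b) hs = te n a hs \<oplus>\<^bsub>P.Q\<^esub> te n b hs"
    if "a \<in> carrier k" "b \<in> carrier k" "hs \<in> vecs n" for a b hs
  proof -
    have "frag_of (a \<oplus>\<^bsub>k\<^esub> b, hs) - (frag_of (a, hs) + frag_of (b, hs)) \<in> tpow_relators n"
      unfolding tpow_relators_def tpow_gens_eq using that by blast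
    from P.relator_coset[OF this] show ?thesis
      using coset_frag2[of "(a, hs)" n "(b, hs)"] that by (simp add: te_def keys_frag2)
  qed
  have kills: "formal_sum P.Q ?f r = \<zero>\<^bsub>P.Q\<^esub>" if "r \<in> tpow_relators n" for r
    by (rule tpow_kills[OF Q.abelian_group_axioms f _ _ _ that])
      (simp_all add: d scalar k.r_distr te_add_entry te_smult_entry k.m_assoc)
  show ?thesis
    using P.formal_sum_rep[OF Q.abelian_group_axioms f kills, of "frag_of (c, hs)"] c hs d
    by (simp add: tpow_smult tsum_eq_formal_sum te_def[of n c] te_in)
qed

lemma tpow_ext:
  assumes G: "module k G" and f: "lin (tpow k H n) G f" and g: "lin (tpow k H n) G g"
    and eq: "\<And>hs. hs \<in> vecs n \<Longrightarrow> f (tpow_elem k H hs) = g (tpow_elem k H hs)"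
    and X: "X \<in> carrier (tpow k H n)"
  shows "f X = g X"
proof -
  interpret G: module k G by fact
  interpret P: presentation "carrier k \<times> vecs n" "tpow_relators n" "tpow_relations k H n"
    by (rule tpow_presentation)
  interpret Q: abelian_group P.Q by (rule P.abelian_group_Q)
  have aQ: "additive P.Q G f" "additive P.Q G g"
    using lin_additive[OF f] lin_additive[OF g] by (simp_all add: additive_def additive_maps_def tpow_carrier tpow_add)
  have "X \<in> carrier P.Q" using X by (simp add: tpow_carrier)
  then show ?thesis
  proof (induction X rule: P.Q_induct)
    case (gen s)
    then obtain c hs where s: "s = (c, hs)" "c \<in> carrier k" "hs \<in> vecs n" by auto
    have e: "te n c hs = c \<odot>\<^bsub>tpow k H n\<^esub> tpow_elem k H hs"
      using s by (simp add: tpow_elem_te tpow_smult_te)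
    have "f (te n c hs) = g (te n c hs)"
      unfolding e lin_smult[OF f s(2) tpow_elem_closed[OF s(3)]] lin_smult[OF g s(2) tpow_elem_closed[OF s(3)]] eq[OF s(3)] ..
    then show ?case by (simp add: s te_def)
  next
    case (add X Y)
    then show ?case by (simp only: additive_add[OF aQ(1)] additive_add[OF aQ(2)])
  next
    case (minus X)
    then show ?case
      by (simp only: additive_minus[OF aQ(1) Q.abelian_group_axioms G.abelian_group_axioms]
          additive_minus[OF aQ(2) Q.abelian_group_axioms G.abelian_group_axioms])
  next
    case zero
    show ?case
      by (simp only: additive_zero[OF aQ(1) Q.abelian_group_axioms G.abelian_group_axioms]
          additive_zero[OF aQ(2) Q.abelian_group_axioms G.abelian_group_axioms])
  qed
qed

lemma tpow_mlin:
  assumes f: "lin (tpow k H n) G f"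
  shows "mlin G n (\<lambda>hs. f (tpow_elem k H hs))"
proof (rule mlin_of_update)
  show "f (tpow_elem k H hs) \<in> carrier G" if "hs \<in> vecs n" for hs
    by (rule lin_closed[OF f tpow_elem_closed[OF that]])
  fix hs i assume hs: "hs \<in> vecs n" and i: "i < n"
  note E = tpow_elem_te[OF vecs_update[OF hs]]
  show "lin H G (\<lambda>x. f (tpow_elem k H (hs[i := x])))"
  proof (rule linI)
    fix x y assume x: "x \<in> carrier H" and y: "y \<in> carrier H"
    have "tpow_elem k H (hs[i := x \<oplus>\<^bsub>H\<^esub> y]) = tpow_elem k H (hs[i := x]) \<oplus>\<^bsub>tpow k H n\<^esub> tpow_elem k H (hs[i := y])"
      using te_add_entry[OF k.one_closed hs i x y] x y by (simp add: E tpow_add)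
    then show "f (tpow_elem k H (hs[i := x \<oplus>\<^bsub>H\<^esub> y])) = f (tpow_elem k H (hs[i := x])) \<oplus>\<^bsub>G\<^esub> f (tpow_elem k H (hs[i := y]))"
      using x y vecs_update[OF hs] by (simp add: lin_add[OF f])
  next
    fix c x assume c: "c \<in> carrier k" and x: "x \<in> carrier H"
    have "tpow_elem k H (hs[i := c \<odot>\<^bsub>H\<^esub> x]) = c \<odot>\<^bsub>tpow k H n\<^esub> tpow_elem k H (hs[i := x])"
      using te_smult_entry[OF k.one_closed hs i c x] c x vecs_update[OF hs]
      by (simp add: E tpow_smult_te)
    then show "f (tpow_elem k H (hs[i := c \<odot>\<^bsub>H\<^esub> x])) = c \<odot>\<^bsub>G\<^esub> f (tpow_elem k H (hs[i := x]))"
      using c x vecs_update[OF hs] by (simp add: lin_smult[OF f])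
  qed (use vecs_update[OF hs] lin_closed[OF f tpow_elem_closed] in blast)
qed

end

section \<open>Sweedler cohomology\<close>

context galois
begin

abbreviation "CM n \<equiv> conv_monoid k H A n"
abbreviation "TP n \<equiv> tpow k H n"
abbreviation "tp \<equiv> tpow_elem k H"
abbreviation "RG n \<equiv> Reg k H A n"

lemma conv_mem: "f \<in> carrier (CM n) \<longleftrightarrow> lin (TP n) Z f \<and> f \<in> extensional (carrier (TP n))"
  by (simp add: conv_monoid_def Let_def lin_def)

lemma conv_mult: "f \<otimes>\<^bsub>CM n\<^esub> g = tpow_map k H n Z (\<lambda>hs. SW Z hs (\<lambda>xs ys. f (tp xs) \<otimes> g (tp ys)))"
  by (simp add: conv_monoid_def Let_def)

lemma conv_one: "\<one>\<^bsub>CM n\<^esub> = tpow_map k H n Z (\<lambda>hs. eps hs \<odot>\<^bsub>Z\<^esub> \<one>)"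
  by (simp add: conv_monoid_def Let_def eps_def)

lemma conv_lin: "f \<in> carrier (CM n) \<Longrightarrow> lin (TP n) Z f"
  by (simp add: conv_mem)

lemma conv_mlin: "f \<in> carrier (CM n) \<Longrightarrow> mlin Z n (\<lambda>hs. f (tp hs))"
  by (rule tpow_mlin[OF conv_lin])

lemma conv_value [simp]: "f \<in> carrier (CM n) \<Longrightarrow> hs \<in> vecs n \<Longrightarrow> f (tp hs) \<in> carrier Z"
  by (rule lin_closed[OF conv_lin tpow_elem_closed])

lemma conv_eqI:
  assumes "f \<in> carrier (CM n)" "g \<in> carrier (CM n)" "\<And>hs. hs \<in> vecs n \<Longrightarrow> f (tp hs) = g (tp hs)"
  shows "f = g"
proof (rule extensionalityI)
  show "f \<in> extensional (carrier (TP n))" "g \<in> extensional (carrier (TP n))"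
    using assms(1,2) by (simp_all add: conv_mem)
  show "f X = g X" if "X \<in> carrier (TP n)" for X
    by (rule tpow_ext[OF module_Z conv_lin[OF assms(1)] conv_lin[OF assms(2)] assms(3) that])
qed

lemma tpow_map_mem: "mlin Z n F \<Longrightarrow> tpow_map k H n Z F \<in> carrier (CM n)"
  unfolding conv_mem by (simp add: tpow_map_lin[OF module_Z]) (simp add: tpow_map_def)

lemma tpow_map_cong:
  assumes "\<And>hs. hs \<in> vecs n \<Longrightarrow> F hs = F' hs"
  shows "tpow_map k H n Z F = tpow_map k H n Z F'"
  unfolding tpow_map_def
proof (rule restrict_ext)
  fix X assume X: "X \<in> carrier (TP n)"
  show "tsum Z X (\<lambda>c hs. c \<odot>\<^bsub>Z\<^esub> F hs) = tsum Z X (\<lambda>c hs. c \<odot>\<^bsub>Z\<^esub> F' hs)"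
    by (rule tsum_cong[OF over_tpow[OF X]]) (simp only: assms)
qed

lemma Z_comm': "x \<in> carrier Z \<Longrightarrow> y \<in> carrier Z \<Longrightarrow> x \<otimes> y = y \<otimes> x"
  by (rule Z_comm[OF _ Z_in_B])

lemmas lin_multL_Z = lin_multL[OF alg_Z, unfolded Z_simps]
  and lin_multR_Z = lin_multR[OF alg_Z, unfolded Z_simps]

lemma bimlin_prod:
  assumes "mlin Z n F" "mlin Z n G"
  shows "bimlin Z n (\<lambda>xs ys. F xs \<otimes> G ys)"
  by (intro bimlinI mlin_comp[OF lin_multL_Z[OF _ lin_id] assms(1)] mlin_comp[OF lin_multR_Z[OF _ lin_id] assms(2)]
      mlin_closed[OF assms(1)] mlin_closed[OF assms(2)])

lemmas mlin_conv = mlin_SW[OF bimlin_prod module_Z]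

lemma conv_mult_closed: "f \<in> carrier (CM n) \<Longrightarrow> g \<in> carrier (CM n) \<Longrightarrow> f \<otimes>\<^bsub>CM n\<^esub> g \<in> carrier (CM n)"
  unfolding conv_mult by (intro tpow_map_mem mlin_conv conv_mlin)

lemma conv_mult_value:
  assumes "f \<in> carrier (CM n)" "g \<in> carrier (CM n)" "hs \<in> vecs n"
  shows "(f \<otimes>\<^bsub>CM n\<^esub> g) (tp hs) = SW Z hs (\<lambda>xs ys. f (tp xs) \<otimes> g (tp ys))"
  unfolding conv_mult using assms by (intro tpow_map_elem[OF module_Z] mlin_conv conv_mlin)

lemma conv_one_closed: "\<one>\<^bsub>CM n\<^esub> \<in> carrier (CM n)"
  unfolding conv_one by (intro tpow_map_mem mlin_eps) simp_all

lemma conv_one_value: "hs \<in> vecs n \<Longrightarrow> \<one>\<^bsub>CM n\<^esub> (tp hs) = eps hs \<odot>\<^bsub>Z\<^esub> \<one>"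
  unfolding conv_one by (intro tpow_map_elem[OF module_Z] mlin_eps) simp_all

text \<open>Commutative because \<open>H\<close> is cocommutative and \<open>Z(B)\<close> is commutative.\<close>

lemma conv_comm_monoid: "comm_monoid (CM n)"
proof (rule comm_monoidI)
  note [simp] = conv_mult_closed conv_one_closed
  show "f \<otimes>\<^bsub>CM n\<^esub> g \<in> carrier (CM n)" if "f \<in> carrier (CM n)" "g \<in> carrier (CM n)" for f g
    using that by simp
  show "\<one>\<^bsub>CM n\<^esub> \<in> carrier (CM n)" by simp
  show "f \<otimes>\<^bsub>CM n\<^esub> g = g \<otimes>\<^bsub>CM n\<^esub> f" if f: "f \<in> carrier (CM n)" and g: "g \<in> carrier (CM n)" for f g
  proof (rule conv_eqI)
    fix hs assume hs: "hs \<in> vecs n"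
    have "SW Z hs (\<lambda>xs ys. f (tp xs) \<otimes> g (tp ys)) = SW Z hs (\<lambda>xs ys. f (tp ys) \<otimes> g (tp xs))"
      by (rule SW_comm[OF hs bimlin_prod[OF conv_mlin[OF f] conv_mlin[OF g]] module_Z])
    also have "\<dots> = SW Z hs (\<lambda>xs ys. g (tp xs) \<otimes> f (tp ys))"
      by (rule SW_cong[OF hs], rule Z_comm') (simp_all add: conv_value[OF f] conv_value[OF g])
    finally show "(f \<otimes>\<^bsub>CM n\<^esub> g) (tp hs) = (g \<otimes>\<^bsub>CM n\<^esub> f) (tp hs)"
      by (simp add: conv_mult_value f g hs)
  qed (simp_all add: f g)
  show "\<one>\<^bsub>CM n\<^esub> \<otimes>\<^bsub>CM n\<^esub> f = f" if f: "f \<in> carrier (CM n)" for f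
  proof (rule conv_eqI)
    fix hs assume hs: "hs \<in> vecs n"
    have "SW Z hs (\<lambda>xs ys. \<one>\<^bsub>CM n\<^esub> (tp xs) \<otimes> f (tp ys)) = SW Z hs (\<lambda>xs ys. eps xs \<odot>\<^bsub>Z\<^esub> f (tp ys))"
      by (rule SW_cong[OF hs])
        (simp add: conv_one_value f k_algebra_smult[OF alg_A] eps_closed Z_in_A[OF conv_value[OF f]])
    also have "\<dots> = f (tp hs)"
      by (rule SW_counit[OF hs conv_mlin[OF f] module_Z])
    finally show "(\<one>\<^bsub>CM n\<^esub> \<otimes>\<^bsub>CM n\<^esub> f) (tp hs) = f (tp hs)"
      by (simp add: conv_mult_value f hs)
  qed (simp_all add: f)
  show "f \<otimes>\<^bsub>CM n\<^esub> g \<otimes>\<^bsub>CM n\<^esub> h = f \<otimes>\<^bsub>CM n\<^esub> (g \<otimes>\<^bsub>CM n\<^esub> h)"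
    if f: "f \<in> carrier (CM n)" and g: "g \<in> carrier (CM n)" and h: "h \<in> carrier (CM n)" for f g h
  proof (rule conv_eqI)
    fix hs assume hs: "hs \<in> vecs n"
    have "SW Z hs (\<lambda>xs zs. (f \<otimes>\<^bsub>CM n\<^esub> g) (tp xs) \<otimes> h (tp zs)) =
        SW Z hs (\<lambda>xs zs. SW Z xs (\<lambda>us vs. f (tp us) \<otimes> g (tp vs) \<otimes> h (tp zs)))"
    proof (rule SW_cong[OF hs])
      fix xs zs assume xs: "xs \<in> vecs n" and zs: "zs \<in> vecs n"
      show "(f \<otimes>\<^bsub>CM n\<^esub> g) (tp xs) \<otimes> h (tp zs) =
          SW Z xs (\<lambda>us vs. f (tp us) \<otimes> g (tp vs) \<otimes> h (tp zs))"
        unfolding conv_mult_value[OF f g xs]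
        by (rule SW_lin[OF lin_multL_Z[OF _ lin_id] module_Z module_Z xs])
          (simp_all add: conv_value[OF f] conv_value[OF g] conv_value[OF h] zs)
    qed
    also have "\<dots> = SW Z hs (\<lambda>us ys. SW Z ys (\<lambda>vs ws. f (tp us) \<otimes> g (tp vs) \<otimes> h (tp ws)))"
    proof (rule SW_assoc[OF hs module_Z])
      show "mlin Z n (\<lambda>xs. f (tp xs) \<otimes> g (tp ys) \<otimes> h (tp zs))" if "ys \<in> vecs n" "zs \<in> vecs n" for ys zs
        by (rule mlin_comp[OF lin_multL_Z[OF _ lin_multL_Z[OF _ lin_id]] conv_mlin[OF f]]) (simp_all add: conv_value[OF g] conv_value[OF h] that)
      show "mlin Z n (\<lambda>ys. f (tp xs) \<otimes> g (tp ys) \<otimes> h (tp zs))" if "xs \<in> vecs n" "zs \<in> vecs n" for xs zs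
        by (rule mlin_comp[OF lin_multL_Z[OF _ lin_multR_Z[OF _ lin_id]] conv_mlin[OF g]]) (simp_all add: conv_value[OF f] conv_value[OF h] that)
      show "mlin Z n (\<lambda>zs. f (tp xs) \<otimes> g (tp ys) \<otimes> h (tp zs))" if "xs \<in> vecs n" "ys \<in> vecs n" for xs ys
        by (rule mlin_comp[OF lin_multR_Z[OF _ lin_id] conv_mlin[OF h]]) (simp_all add: conv_value[OF f] conv_value[OF g] that)
    qed
    also have "\<dots> = SW Z hs (\<lambda>us ys. f (tp us) \<otimes> (g \<otimes>\<^bsub>CM n\<^esub> h) (tp ys))"
    proof (rule SW_cong[OF hs])
      fix us ys assume us: "us \<in> vecs n" and ys: "ys \<in> vecs n"
      have "SW Z ys (\<lambda>vs ws. f (tp us) \<otimes> g (tp vs) \<otimes> h (tp ws)) =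
          SW Z ys (\<lambda>vs ws. f (tp us) \<otimes> (g (tp vs) \<otimes> h (tp ws)))"
        by (rule SW_cong[OF ys])
          (simp add: A.m_assoc Z_in_A[OF conv_value[OF f us]] Z_in_A[OF conv_value[OF g]] Z_in_A[OF conv_value[OF h]])
      also have "\<dots> = f (tp us) \<otimes> (g \<otimes>\<^bsub>CM n\<^esub> h) (tp ys)"
        unfolding conv_mult_value[OF g h ys]
        by (rule SW_lin[OF lin_multR_Z[OF _ lin_id] module_Z module_Z ys, symmetric])
          (simp_all add: conv_value[OF f] conv_value[OF g] conv_value[OF h] us)
      finally show "SW Z ys (\<lambda>vs ws. f (tp us) \<otimes> g (tp vs) \<otimes> h (tp ws)) = \<dots>" .
    qed
    finally show "(f \<otimes>\<^bsub>CM n\<^esub> g \<otimes>\<^bsub>CM n\<^esub> h) (tp hs) = (f \<otimes>\<^bsub>CM n\<^esub> (g \<otimes>\<^bsub>CM n\<^esub> h)) (tp hs)"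
      by (simp add: conv_mult_value f g h hs)
  qed (simp_all add: f g h)
qed

lemma Reg_comm_group: "comm_group (RG n)"
  unfolding Reg_def by (rule comm_monoid.units_comm_group[OF conv_comm_monoid])

lemma Reg_simps: "carrier (RG n) = Units (CM n)" "mult (RG n) = mult (CM n)" "one (RG n) = one (CM n)"
  by (simp_all add: Reg_def units_of_def)

lemma Reg_in_conv: "f \<in> carrier (RG n) \<Longrightarrow> f \<in> carrier (CM n)"
  by (simp add: Reg_simps Units_def)

subsection \<open>The faces are homomorphisms\<close>

text \<open>The faces on tuples instead of on tensors.\<close>

definition face_fun :: "nat \<Rightarrow> nat \<Rightarrow> ('h list \<Rightarrow> 'a) \<Rightarrow> 'h list \<Rightarrow> 'a" where
  "face_fun n i F hs = (if i = 0 then act (hd hs) (F (tl hs))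
      else if i \<le> n then F (merge (i - 1) hs) else counit H (hs ! n) \<odot> F (take n hs))"

lemma face_eq: "face k H A n i f = tpow_map k H (Suc n) Z (face_fun n i (\<lambda>hs. f (tp hs)))"
  unfolding face_def
proof (rule tpow_map_cong)
  fix hs assume hs: "hs \<in> vecs (Suc n)"
  have "f (tp (take (i - 1) hs @ (hs ! (i - 1) \<star> hs ! i) # drop (i + 1) hs)) = f (tp (merge (i - 1) hs))"
    if "0 < i" "i \<le> n"
    using merge_eq[of "i - 1" hs] that vecs_length[OF hs] by simp
  then show "(if i = 0 then act (hd hs) (f (tp (tl hs)))
      else if i \<le> n then f (tp (take (i - 1) hs @ (hs ! (i - 1) \<star> hs ! i) # drop (i + 1) hs))
      else counit H (hs ! n) \<odot> f (tp (take n hs))) = face_fun n i (\<lambda>hs. f (tp hs)) hs"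
    by (simp add: face_fun_def)
qed

lemma mlin_face_fun:
  assumes F: "mlin Z n F"
  shows "mlin Z (Suc n) (face_fun n i F)"
proof -
  consider "i = 0" | "0 < i" "i \<le> n" | "0 < i" "\<not> i \<le> n" by linarith
  then show ?thesis
  proof cases
    case 1
    have "mlin Z (Suc n) (\<lambda>hs. act (hd hs) (F (tl hs)))"
      using mlin_comp[OF act_linZ F] act_linH[OF mlin_closed[OF F]] by simp
    then show ?thesis by (rule mlin_cong) (simp add: face_fun_def 1)
  next
    case 2
    have "mlin Z (Suc n) (\<lambda>hs. F (merge (i - 1) hs))" using 2 by (intro mlin_merge F) simp
    then show ?thesis by (rule mlin_cong) (use 2 in \<open>simp add: face_fun_def\<close>)
  next
    case 3
    show ?thesis
      by (rule mlin_cong[OF mlin_drop_last[OF module_Z F]]) (use 3 in \<open>simp add: face_fun_def\<close>)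
  qed
qed

lemma face_closed: "f \<in> carrier (CM n) \<Longrightarrow> face k H A n i f \<in> carrier (CM (Suc n))"
  unfolding face_eq by (intro tpow_map_mem mlin_face_fun conv_mlin)

lemma face_value:
  "f \<in> carrier (CM n) \<Longrightarrow> hs \<in> vecs (Suc n) \<Longrightarrow> face k H A n i f (tp hs) = face_fun n i (\<lambda>hs. f (tp hs)) hs"
  unfolding face_eq by (intro tpow_map_elem mlin_face_fun conv_mlin) simp_all

text \<open>The action is a module algebra action, and multiplication and counit of \<open>H\<close> are comultiplicative;
  these are the three kinds of faces.\<close>

lemma face_fun_SW:
  assumes F: "mlin Z n F" and G: "mlin Z n G" and hs: "hs \<in> vecs (Suc n)"
  shows "face_fun n i (\<lambda>hs. SW Z hs (\<lambda>xs ys. F xs \<otimes> G ys)) hs =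
    SW Z hs (\<lambda>xs ys. face_fun n i F xs \<otimes> face_fun n i G ys)"
proof -
  note Fc [simp] = mlin_closed[OF F] and Gc [simp] = mlin_closed[OF G]
  consider "i = 0" | "0 < i" "i \<le> n" | "0 < i" "\<not> i \<le> n" by linarith
  then show ?thesis
  proof cases
    case 1
    obtain h zs where h: "hs = h # zs" "h \<in> carrier H" "zs \<in> vecs n" using hs vecs_Suc by blast
    have "act h (SW Z zs (\<lambda>xs ys. F xs \<otimes> G ys)) = SW Z zs (\<lambda>xs ys. act h (F xs \<otimes> G ys))"
      by (rule SW_lin[OF act_linZ[OF h(2)] module_Z module_Z h(3)]) simp
    also have "\<dots> = SW Z zs (\<lambda>xs ys. sw Z h (\<lambda>u v. act u (F xs) \<otimes> act v (G ys)))"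
      by (rule SW_cong[OF h(3)]) (simp add: act_mult_Z h)
    also have "\<dots> = sw Z h (\<lambda>u v. SW Z zs (\<lambda>xs ys. act u (F xs) \<otimes> act v (G ys)))"
      by (rule SW_swap[OF module_Z h(3) over_comult[OF h(2)]]) simp
    finally show ?thesis by (simp add: face_fun_def 1 h(1))
  next
    case 2
    then show ?thesis
      using SW_merge[OF hs _ bimlin_prod[OF F G] module_Z, of "i - 1"] by (simp add: face_fun_def)
  next
    case 3
    have "counit H (hs ! n) \<odot>\<^bsub>Z\<^esub> SW Z (take n hs) (\<lambda>xs ys. F xs \<otimes> G ys) =
        SW Z hs (\<lambda>xs ys. counit H (xs ! n) \<odot>\<^bsub>Z\<^esub> (counit H (ys ! n) \<odot>\<^bsub>Z\<^esub> (F (take n xs) \<otimes> G (take n ys))))"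
      by (rule SW_drop_last[OF hs bimlin_prod[OF F G] module_Z, symmetric])
    also have "\<dots> = SW Z hs (\<lambda>xs ys. (counit H (xs ! n) \<odot>\<^bsub>Z\<^esub> F (take n xs)) \<otimes> (counit H (ys ! n) \<odot>\<^bsub>Z\<^esub> G (take n ys)))"
      by (rule SW_cong[OF hs])
        (simp add: k_algebra_smult[OF alg_A] vecs_nth take_vecs Z_in_A[OF Fc] Z_in_A[OF Gc],
         simp add: A.smult_assoc1[symmetric] k.m_comm vecs_nth take_vecs Z_in_A[OF Fc] Z_in_A[OF Gc])
    finally show ?thesis using 3 by (simp add: face_fun_def)
  qed
qed

lemma face_mult:
  assumes f: "f \<in> carrier (CM n)" and g: "g \<in> carrier (CM n)"
  shows "face k H A n i (f \<otimes>\<^bsub>CM n\<^esub> g) = face k H A n i f \<otimes>\<^bsub>CM (Suc n)\<^esub> face k H A n i g"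
proof (rule conv_eqI)
  note [simp] = face_closed conv_mult_closed f g
  show "face k H A n i (f \<otimes>\<^bsub>CM n\<^esub> g) \<in> carrier (CM (Suc n))" by simp
  show "face k H A n i f \<otimes>\<^bsub>CM (Suc n)\<^esub> face k H A n i g \<in> carrier (CM (Suc n))" by simp
  fix hs assume hs: "hs \<in> vecs (Suc n)"
  let ?F = "\<lambda>hs. f (tp hs)" and ?G = "\<lambda>hs. g (tp hs)"
  have "face k H A n i (f \<otimes>\<^bsub>CM n\<^esub> g) (tp hs) = face_fun n i (\<lambda>hs. SW Z hs (\<lambda>xs ys. ?F xs \<otimes> ?G ys)) hs"
  proof -
    have "face k H A n i (f \<otimes>\<^bsub>CM n\<^esub> g) (tp hs) = face_fun n i (\<lambda>hs. (f \<otimes>\<^bsub>CM n\<^esub> g) (tp hs)) hs"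
      by (rule face_value) (simp_all add: hs)
    also have "\<dots> = face_fun n i (\<lambda>hs. SW Z hs (\<lambda>xs ys. ?F xs \<otimes> ?G ys)) hs"
    proof -
      have "tl hs \<in> vecs n" using hs by (auto simp: vecs_Suc)
      moreover have "0 < i \<Longrightarrow> i \<le> n \<Longrightarrow> merge (i - 1) hs \<in> vecs n" by (rule merge_vecs[OF hs]) simp
      ultimately show ?thesis
        using take_vecs[OF hs] by (simp add: face_fun_def conv_mult_value)
    qed
    finally show ?thesis .
  qed
  also have "\<dots> = SW Z hs (\<lambda>xs ys. face_fun n i ?F xs \<otimes> face_fun n i ?G ys)"
    by (rule face_fun_SW[OF conv_mlin[OF f] conv_mlin[OF g] hs])
  also have "\<dots> = (face k H A n i f \<otimes>\<^bsub>CM (Suc n)\<^esub> face k H A n i g) (tp hs)"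
    by (simp add: conv_mult_value hs) (rule SW_cong[OF hs], simp add: face_value)
  finally show "face k H A n i (f \<otimes>\<^bsub>CM n\<^esub> g) (tp hs) = \<dots>" .
qed

lemma face_one: "face k H A n i \<one>\<^bsub>CM n\<^esub> = \<one>\<^bsub>CM (Suc n)\<^esub>"
proof (rule conv_eqI)
  show "face k H A n i \<one>\<^bsub>CM n\<^esub> \<in> carrier (CM (Suc n))" by (intro face_closed conv_one_closed)
  show "\<one>\<^bsub>CM (Suc n)\<^esub> \<in> carrier (CM (Suc n))" by (rule conv_one_closed)
  fix hs assume hs: "hs \<in> vecs (Suc n)"
  have tk: "take n hs \<in> vecs n" "hs ! n \<in> carrier H" using take_vecs[OF hs] vecs_nth[OF hs] by simp_all
  have mg: "0 < i \<Longrightarrow> i \<le> n \<Longrightarrow> merge (i - 1) hs \<in> vecs n" by (rule merge_vecs[OF hs]) simp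
  obtain h zs where h: "hs = h # zs" "h \<in> carrier H" "zs \<in> vecs n" using hs vecs_Suc by blast
  have "face k H A n i \<one>\<^bsub>CM n\<^esub> (tp hs) = face_fun n i (\<lambda>hs. \<one>\<^bsub>CM n\<^esub> (tp hs)) hs"
    by (rule face_value[OF conv_one_closed hs])
  also have "\<dots> = eps hs \<odot> \<one>"
  proof -
    consider "i = 0" | "0 < i" "i \<le> n" | "0 < i" "\<not> i \<le> n" by linarith
    then show ?thesis
    proof cases
      case 1
      have "act h (eps zs \<odot> \<one>) = eps zs \<odot> (counit H h \<odot> \<one>)"
        using lin_smult[OF act_linZ[OF h(2)], of "eps zs" "\<one>"] h by (simp add: eps_closed act_one)
      then show ?thesis
        using h 1 by (simp add: face_fun_def conv_one_value eps_closed A.smult_assoc1[symmetric] k.m_comm)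
    next
      case 2
      then show ?thesis using mg eps_merge[OF hs, of "i - 1"] by (simp add: face_fun_def conv_one_value)
    next
      case 3
      then show ?thesis using tk eps_drop_last[OF hs, symmetric]
        by (simp add: face_fun_def conv_one_value eps_closed A.smult_assoc1)
    qed
  qed
  also have "\<dots> = \<one>\<^bsub>CM (Suc n)\<^esub> (tp hs)" using hs by (simp add: conv_one_value)
  finally show "face k H A n i \<one>\<^bsub>CM n\<^esub> (tp hs) = \<dots>" .
qed

lemma Units_image:
  assumes h: "\<And>x. x \<in> carrier G \<Longrightarrow> h x \<in> carrier G'"
    "\<And>x y. x \<in> carrier G \<Longrightarrow> y \<in> carrier G \<Longrightarrow> h (x \<otimes>\<^bsub>G\<^esub> y) = h x \<otimes>\<^bsub>G'\<^esub> h y" "h \<one>\<^bsub>G\<^esub> = \<one>\<^bsub>G'\<^esub>"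
    and x: "x \<in> Units G"
  shows "h x \<in> Units G'"
proof -
  obtain y where y: "y \<in> carrier G" "y \<otimes>\<^bsub>G\<^esub> x = \<one>\<^bsub>G\<^esub>" "x \<otimes>\<^bsub>G\<^esub> y = \<one>\<^bsub>G\<^esub>" and x: "x \<in> carrier G"
    using x by (auto simp: Units_def)
  have "h y \<otimes>\<^bsub>G'\<^esub> h x = \<one>\<^bsub>G'\<^esub>" "h x \<otimes>\<^bsub>G'\<^esub> h y = \<one>\<^bsub>G'\<^esub>"
    using h(2)[OF y(1) x] h(2)[OF x y(1)] y h(3) by simp_all
  then show ?thesis using h(1) x y(1) unfolding Units_def by blast
qed

lemma face_hom: "face k H A n i \<in> hom (RG n) (RG (Suc n))"
proof (rule homI)
  show "face k H A n i f \<in> carrier (RG (Suc n))" if "f \<in> carrier (RG n)" for f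
    unfolding Reg_simps
    by (rule Units_image[where G = "CM n"])
      (use that in \<open>simp_all add: Reg_simps face_closed face_mult face_one\<close>)
  show "face k H A n i (f \<otimes>\<^bsub>RG n\<^esub> g) = face k H A n i f \<otimes>\<^bsub>RG (Suc n)\<^esub> face k H A n i g"
    if "f \<in> carrier (RG n)" "g \<in> carrier (RG n)" for f g
    using face_mult[OF that[THEN Reg_in_conv]] by (simp add: Reg_simps)
qed

text \<open>The differential is an alternating product of faces, and in a commutative group products of
  homomorphisms are homomorphisms.\<close>

lemma (in comm_group) hom_foldr:
  assumes "\<And>i. d i \<in> hom K G"
  shows "(\<lambda>f. foldr (\<lambda>i g. d i f \<otimes> g) js \<one>) \<in> hom K G"
proof (induction js)
  case Nil
  show ?case by (rule homI) simp_all
next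
  case (Cons j js)
  show ?case
  proof (rule homI)
    show "foldr (\<lambda>i g. d i f \<otimes> g) (j # js) \<one> \<in> carrier G" if "f \<in> carrier K" for f
      using hom_in_carrier[OF assms[of j] that] hom_in_carrier[OF Cons that] by simp
    fix f g assume fg: "f \<in> carrier K" "g \<in> carrier K"
    note [simp] = hom_in_carrier[OF assms[of j] fg(1)] hom_in_carrier[OF assms[of j] fg(2)]
      hom_in_carrier[OF Cons fg(1)] hom_in_carrier[OF Cons fg(2)]
    show "foldr (\<lambda>i h. d i (f \<otimes>\<^bsub>K\<^esub> g) \<otimes> h) (j # js) \<one> =
        foldr (\<lambda>i h. d i f \<otimes> h) (j # js) \<one> \<otimes> foldr (\<lambda>i h. d i g \<otimes> h) (j # js) \<one>"
      using hom_mult[OF assms[of j] fg] hom_mult[OF Cons fg] by (simp add: m_ac)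
  qed
qed

abbreviation "dD n \<equiv> sweedler_D k H A n"

lemma D_hom: "dD n \<in> hom (RG n) (RG (Suc n))"
proof -
  interpret R: comm_group "RG (Suc n)" by (rule Reg_comm_group)
  let ?d = "\<lambda>i f. if even i then face k H A n i f else inv\<^bsub>RG (Suc n)\<^esub> face k H A n i f"
  have d: "?d i \<in> hom (RG n) (RG (Suc n))" for i
  proof (rule homI)
    note fc = hom_in_carrier[OF face_hom[of n i]]
    show "?d i f \<in> carrier (RG (Suc n))" if "f \<in> carrier (RG n)" for f
      using fc[OF that] by simp
    show "?d i (f \<otimes>\<^bsub>RG n\<^esub> g) = ?d i f \<otimes>\<^bsub>RG (Suc n)\<^esub> ?d i g" if "f \<in> carrier (RG n)" "g \<in> carrier (RG n)" for f g
      using fc[OF that(1)] fc[OF that(2)] hom_mult[OF face_hom[of n i] that] by (simp add: R.inv_mult)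
  qed
  have "dD n = (\<lambda>f. foldr (\<lambda>i g. ?d i f \<otimes>\<^bsub>RG (Suc n)\<^esub> g) [0..<n + 2] \<one>\<^bsub>RG (Suc n)\<^esub>)"
    by (rule ext) (simp only: sweedler_D_def Let_def)
  then show ?thesis by (simp only: R.hom_foldr[of ?d, OF d])
qed

lemma coboundaries_subgroup: "subgroup (carrier (coboundaries k H A n)) (RG n)"
proof (cases n)
  case 0
  interpret R: comm_group "RG 0" by (rule Reg_comm_group)
  show ?thesis using R.triv_subgroup 0 by (simp add: coboundaries_def)
next
  case (Suc m)
  interpret D: group_hom "RG m" "RG n" "dD m"
    unfolding group_hom_def group_hom_axioms_def Suc
    using Reg_comm_group comm_group.axioms(2) D_hom by blast
  show ?thesis using D.img_is_subgroup Suc by (simp add: coboundaries_def)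
qed

lemma cocycles_mult: "mult (cocycles k H A n) = mult (RG n)"
  and coboundaries_mult: "mult (coboundaries k H A n) = mult (RG n)"
  by (simp_all add: cocycles_def coboundaries_def)

lemma cocycles_carrier: "f \<in> carrier (cocycles k H A n) \<longleftrightarrow> f \<in> carrier (RG n) \<and> dD n f = \<one>\<^bsub>RG (Suc n)\<^esub>"
  by (simp add: cocycles_def)

subsection \<open>Equivariant automorphisms of the coefficients\<close>

text \<open>The maps of coefficients that induce automorphisms of the Sweedler complex.\<close>

definition equivariant :: "('a \<Rightarrow> 'a) \<Rightarrow> bool" where
  "equivariant \<phi> \<longleftrightarrow> bij_betw \<phi> (carrier Z) (carrier Z) \<and> lin Z Z \<phi> \<and> \<phi> \<one> = \<one> \<and>
    (\<forall>x\<in>carrier Z. \<forall>y\<in>carrier Z. \<phi> (x \<otimes> y) = \<phi> x \<otimes> \<phi> y) \<and>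
    (\<forall>h\<in>carrier H. \<forall>x\<in>carrier Z. \<phi> (act h x) = act h (\<phi> x))"

definition push :: "nat \<Rightarrow> ('a \<Rightarrow> 'a) \<Rightarrow> (('k, 'h list) tens \<Rightarrow> 'a) \<Rightarrow> ('k, 'h list) tens \<Rightarrow> 'a" where
  "push n \<phi> f = compose (carrier (TP n)) \<phi> f"

lemma equivariantD:
  assumes "equivariant \<phi>"
  shows "bij_betw \<phi> (carrier Z) (carrier Z)" "lin Z Z \<phi>" "\<phi> \<one> = \<one>"
    "\<And>x y. x \<in> carrier Z \<Longrightarrow> y \<in> carrier Z \<Longrightarrow> \<phi> (x \<otimes> y) = \<phi> x \<otimes> \<phi> y"
    "\<And>h x. h \<in> carrier H \<Longrightarrow> x \<in> carrier Z \<Longrightarrow> \<phi> (act h x) = act h (\<phi> x)"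
    "\<And>x. x \<in> carrier Z \<Longrightarrow> \<phi> x \<in> carrier Z"
  using assms by (auto simp: equivariant_def lin_closed)

lemma equivariant_inverse:
  assumes \<phi>: "equivariant \<phi>"
  shows "equivariant (inv_into (carrier Z) \<phi>)"
proof -
  let ?\<psi> = "inv_into (carrier Z) \<phi>"
  note bij = equivariantD(1)[OF \<phi>]
  have c: "?\<psi> x \<in> carrier Z" if "x \<in> carrier Z" for x
    using bij that by (metis bij_betw_def inv_into_into)
  have r: "\<phi> (?\<psi> x) = x" if "x \<in> carrier Z" for x
    by (rule bij_betw_inv_into_right[OF bij that])
  have l: "?\<psi> x = y" if "y \<in> carrier Z" "\<phi> y = x" for x y
    using bij_betw_inv_into_left[OF bij that(1)] that(2) by simp
  show ?thesis
    unfolding equivariant_def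
  proof (intro conjI ballI)
    show "bij_betw ?\<psi> (carrier Z) (carrier Z)" by (rule bij_betw_inv_into[OF bij])
    show "lin Z Z ?\<psi>"
    proof (rule linI)
      show "?\<psi> (x \<oplus>\<^bsub>Z\<^esub> y) = ?\<psi> x \<oplus>\<^bsub>Z\<^esub> ?\<psi> y" if "x \<in> carrier Z" "y \<in> carrier Z" for x y
        using that by (intro l) (simp_all add: c r lin_add[OF equivariantD(2)[OF \<phi>], unfolded Z_simps])
      show "?\<psi> (a \<odot>\<^bsub>Z\<^esub> x) = a \<odot>\<^bsub>Z\<^esub> ?\<psi> x" if "a \<in> carrier k" "x \<in> carrier Z" for a x
        using that by (intro l) (simp_all add: c r lin_smult[OF equivariantD(2)[OF \<phi>], unfolded Z_simps])
    qed (rule c)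
    show "?\<psi> \<one> = \<one>" by (rule l) (simp_all add: equivariantD(3)[OF \<phi>])
    show "?\<psi> (x \<otimes> y) = ?\<psi> x \<otimes> ?\<psi> y" if "x \<in> carrier Z" "y \<in> carrier Z" for x y
      using that by (intro l) (simp_all add: c r equivariantD(4)[OF \<phi>])
    show "?\<psi> (act h x) = act h (?\<psi> x)" if "h \<in> carrier H" "x \<in> carrier Z" for h x
      using that by (intro l) (simp_all add: c r equivariantD(5)[OF \<phi>])
  qed
qed

lemma push_closed:
  assumes \<phi>: "equivariant \<phi>" and f: "f \<in> carrier (CM n)"
  shows "push n \<phi> f \<in> carrier (CM n)"
proof -
  have "lin (TP n) Z (\<lambda>X. \<phi> (f X))" by (rule lin_comp[OF equivariantD(2)[OF \<phi>] conv_lin[OF f]])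
  moreover have "mlin Z n (\<lambda>hs. \<phi> (f (tp hs)))"
    by (rule tpow_mlin[OF \<open>lin (TP n) Z (\<lambda>X. \<phi> (f X))\<close>])
  ultimately have "push n \<phi> f = tpow_map k H n Z (\<lambda>hs. \<phi> (f (tp hs)))"
    unfolding push_def compose_def
    by (subst tpow_map_def, intro restrict_ext)
      (subst tpow_ext[where g = "tpow_map k H n Z (\<lambda>hs. \<phi> (f (tp hs)))" and n = n and G = Z],
       simp_all add: tpow_map_lin[OF module_Z] tpow_map_elem[OF module_Z], simp add: tpow_map_def)
  then show ?thesis using \<open>mlin Z n (\<lambda>hs. \<phi> (f (tp hs)))\<close> by (simp add: tpow_map_mem)
qed

lemma push_value: "hs \<in> vecs n \<Longrightarrow> push n \<phi> f (tp hs) = \<phi> (f (tp hs))"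
  by (simp add: push_def compose_def)

lemma push_mult:
  assumes \<phi>: "equivariant \<phi>" and f: "f \<in> carrier (CM n)" and g: "g \<in> carrier (CM n)"
  shows "push n \<phi> (f \<otimes>\<^bsub>CM n\<^esub> g) = push n \<phi> f \<otimes>\<^bsub>CM n\<^esub> push n \<phi> g"
proof (rule conv_eqI)
  note [simp] = push_closed[OF \<phi>] conv_mult_closed f g
  show "push n \<phi> (f \<otimes>\<^bsub>CM n\<^esub> g) \<in> carrier (CM n)" "push n \<phi> f \<otimes>\<^bsub>CM n\<^esub> push n \<phi> g \<in> carrier (CM n)" by simp_all
  fix hs assume hs: "hs \<in> vecs n"
  have "push n \<phi> (f \<otimes>\<^bsub>CM n\<^esub> g) (tp hs) = \<phi> (SW Z hs (\<lambda>xs ys. f (tp xs) \<otimes> g (tp ys)))"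
    by (simp add: push_value hs conv_mult_value)
  also have "\<dots> = SW Z hs (\<lambda>xs ys. \<phi> (f (tp xs) \<otimes> g (tp ys)))"
    by (rule SW_lin[OF equivariantD(2)[OF \<phi>] module_Z module_Z hs]) (simp add: conv_value[OF f] conv_value[OF g])
  also have "\<dots> = SW Z hs (\<lambda>xs ys. push n \<phi> f (tp xs) \<otimes> push n \<phi> g (tp ys))"
    by (rule SW_cong[OF hs]) (simp add: push_value equivariantD(4)[OF \<phi>] conv_value[OF f] conv_value[OF g])
  also have "\<dots> = (push n \<phi> f \<otimes>\<^bsub>CM n\<^esub> push n \<phi> g) (tp hs)" by (simp add: conv_mult_value hs)
  finally show "push n \<phi> (f \<otimes>\<^bsub>CM n\<^esub> g) (tp hs) = \<dots>" .
qed

lemma push_one: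
  assumes \<phi>: "equivariant \<phi>"
  shows "push n \<phi> \<one>\<^bsub>CM n\<^esub> = \<one>\<^bsub>CM n\<^esub>"
proof (rule conv_eqI[OF push_closed[OF \<phi> conv_one_closed] conv_one_closed])
  fix hs assume hs: "hs \<in> vecs n"
  show "push n \<phi> \<one>\<^bsub>CM n\<^esub> (tp hs) = \<one>\<^bsub>CM n\<^esub> (tp hs)"
    using lin_smult[OF equivariantD(2)[OF \<phi>] eps_closed[OF hs], of "\<one>"]
    by (simp add: push_value hs conv_one_value equivariantD(3)[OF \<phi>])
qed

lemma push_face:
  assumes \<phi>: "equivariant \<phi>" and f: "f \<in> carrier (CM n)"
  shows "face k H A n i (push n \<phi> f) = push (Suc n) \<phi> (face k H A n i f)"
proof (rule conv_eqI)
  note [simp] = push_closed[OF \<phi>] face_closed f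
  show "face k H A n i (push n \<phi> f) \<in> carrier (CM (Suc n))" by simp
  show "push (Suc n) \<phi> (face k H A n i f) \<in> carrier (CM (Suc n))" by simp
  fix hs assume hs: "hs \<in> vecs (Suc n)"
  have tk: "take n hs \<in> vecs n" "hs ! n \<in> carrier H" using take_vecs[OF hs] vecs_nth[OF hs] by simp_all
  have mg: "0 < i \<Longrightarrow> i \<le> n \<Longrightarrow> merge (i - 1) hs \<in> vecs n" by (rule merge_vecs[OF hs]) simp
  obtain h zs where h: "hs = h # zs" "h \<in> carrier H" "zs \<in> vecs n" using hs vecs_Suc by blast
  have "face_fun n i (\<lambda>hs. push n \<phi> f (tp hs)) hs = \<phi> (face_fun n i (\<lambda>hs. f (tp hs)) hs)"
  proof -
    consider "i = 0" | "0 < i" "i \<le> n" | "0 < i" "\<not> i \<le> n" by linarith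
    then show ?thesis
    proof cases
      case 1
      then show ?thesis using h by (simp add: face_fun_def push_value equivariantD(5)[OF \<phi>] conv_value[OF f])
    next
      case 2
      then show ?thesis using mg by (simp add: face_fun_def push_value)
    next
      case 3
      then show ?thesis using tk lin_smult[OF equivariantD(2)[OF \<phi>], of "counit H (hs ! n)" "f (tp (take n hs))"]
        by (simp add: face_fun_def push_value conv_value[OF f])
    qed
  qed
  then show "face k H A n i (push n \<phi> f) (tp hs) = push (Suc n) \<phi> (face k H A n i f) (tp hs)"
    by (simp add: face_value hs push_value)
qed

lemma push_hom:
  assumes \<phi>: "equivariant \<phi>"
  shows "push n \<phi> \<in> hom (RG n) (RG n)"
proof (rule homI)
  show "push n \<phi> f \<in> carrier (RG n)" if "f \<in> carrier (RG n)" for f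
    unfolding Reg_simps
    by (rule Units_image[where G = "CM n"])
      (use that in \<open>simp_all add: Reg_simps push_closed[OF \<phi>] push_mult[OF \<phi>] push_one[OF \<phi>]\<close>)
  show "push n \<phi> (f \<otimes>\<^bsub>RG n\<^esub> g) = push n \<phi> f \<otimes>\<^bsub>RG n\<^esub> push n \<phi> g"
    if "f \<in> carrier (RG n)" "g \<in> carrier (RG n)" for f g
    using push_mult[OF \<phi> that[THEN Reg_in_conv]] by (simp add: Reg_simps)
qed

lemma push_group_hom: "equivariant \<phi> \<Longrightarrow> group_hom (RG n) (RG n) (push n \<phi>)"
  unfolding group_hom_def group_hom_axioms_def
  using Reg_comm_group comm_group.axioms(2) push_hom by blast

lemma push_D:
  assumes \<phi>: "equivariant \<phi>" and f: "f \<in> carrier (RG n)"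
  shows "dD n (push n \<phi> f) = push (Suc n) \<phi> (dD n f)"
proof -
  interpret R: comm_group "RG (Suc n)" by (rule Reg_comm_group)
  interpret P: group_hom "RG (Suc n)" "RG (Suc n)" "push (Suc n) \<phi>" by (rule push_group_hom[OF \<phi>])
  let ?d = "\<lambda>f i g. (if even i then face k H A n i f else inv\<^bsub>RG (Suc n)\<^esub> face k H A n i f) \<otimes>\<^bsub>RG (Suc n)\<^esub> g"
  note fc = hom_in_carrier[OF face_hom f]
  have step: "foldr (?d (push n \<phi> f)) js \<one>\<^bsub>RG (Suc n)\<^esub> = push (Suc n) \<phi> (foldr (?d f) js \<one>\<^bsub>RG (Suc n)\<^esub>) \<and>
      foldr (?d f) js \<one>\<^bsub>RG (Suc n)\<^esub> \<in> carrier (RG (Suc n))" for js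
    by (induction js) (simp_all add: fc push_face[OF \<phi> Reg_in_conv[OF f]])
  then show ?thesis by (simp only: sweedler_D_def Let_def)
qed

lemma push_inverse:
  assumes \<phi>: "equivariant \<phi>" and f: "f \<in> carrier (CM n)"
  shows "push n (inv_into (carrier Z) \<phi>) (push n \<phi> f) = f" "push n \<phi> (push n (inv_into (carrier Z) \<phi>) f) = f"
proof -
  note \<psi> = equivariant_inverse[OF \<phi>] and bij = equivariantD(1)[OF \<phi>]
  show "push n (inv_into (carrier Z) \<phi>) (push n \<phi> f) = f"
    by (rule conv_eqI[where n = n])
      (simp_all add: f push_closed[OF \<phi>] push_closed[OF \<psi>] push_value bij_betw_inv_into_left[OF bij] conv_value[OF f])
  show "push n \<phi> (push n (inv_into (carrier Z) \<phi>) f) = f"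
    by (rule conv_eqI[where n = n])
      (simp_all add: f push_closed[OF \<phi>] push_closed[OF \<psi>] push_value bij_betw_inv_into_right[OF bij] conv_value[OF f])
qed

lemma push_cocycle:
  assumes \<phi>: "equivariant \<phi>" and f: "f \<in> carrier (cocycles k H A n)"
  shows "push n \<phi> f \<in> carrier (cocycles k H A n)"
  using f push_D[OF \<phi>] hom_in_carrier[OF push_hom[OF \<phi>]] push_one[OF \<phi>, of "Suc n"]
  by (simp add: cocycles_carrier Reg_simps)

lemma push_coboundary:
  assumes \<phi>: "equivariant \<phi>" and f: "f \<in> carrier (coboundaries k H A n)"
  shows "push n \<phi> f \<in> carrier (coboundaries k H A n)"
proof (cases n)
  case 0
  then show ?thesis using f push_one[OF \<phi>, of 0] by (simp add: coboundaries_def Reg_simps)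
next
  case (Suc m)
  then obtain g where g: "g \<in> carrier (RG m)" "f = dD m g" using f by (auto simp: coboundaries_def)
  have "push n \<phi> f = dD m (push m \<phi> g)" using push_D[OF \<phi> g(1)] g(2) Suc by simp
  then show ?thesis using hom_in_carrier[OF push_hom[OF \<phi>] g(1)] Suc by (simp add: coboundaries_def)
qed

lemma autoI:
  assumes "\<And>x. x \<in> carrier E \<Longrightarrow> h x \<in> carrier E" "\<And>x. x \<in> carrier E \<Longrightarrow> h' x \<in> carrier E"
    and "\<And>x. x \<in> carrier E \<Longrightarrow> h' (h x) = x" "\<And>x. x \<in> carrier E \<Longrightarrow> h (h' x) = x"
    and "\<And>x y. x \<in> carrier E \<Longrightarrow> y \<in> carrier E \<Longrightarrow> x \<otimes>\<^bsub>E\<^esub> y \<in> carrier E"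
    and "\<And>x y. x \<in> carrier E \<Longrightarrow> y \<in> carrier E \<Longrightarrow> h (x \<otimes>\<^bsub>E\<^esub> y) = h x \<otimes>\<^bsub>E\<^esub> h y"
  shows "restrict h (carrier E) \<in> auto E"
proof -
  have "bij_betw h (carrier E) (carrier E)"
    by (rule bij_betwI[where g = h']) (use assms(1-4) in auto)
  then have "restrict h (carrier E) \<in> Bij (carrier E)"
    unfolding Bij_def by (simp cong: bij_betw_cong)
  moreover have "restrict h (carrier E) \<in> hom E E"
    by (rule homI) (simp_all add: assms)
  ultimately show ?thesis by (simp add: auto_def)
qed

lemma push_auto_cocycles:
  assumes \<phi>: "equivariant \<phi>"
  shows "restrict (push n \<phi>) (carrier (cocycles k H A n)) \<in> auto (cocycles k H A n)"
proof (rule autoI[where h' = "push n (inv_into (carrier Z) \<phi>)"])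
  interpret R: comm_group "RG n" by (rule Reg_comm_group)
  interpret R': comm_group "RG (Suc n)" by (rule Reg_comm_group)
  note \<psi> = equivariant_inverse[OF \<phi>]
  have c: "f \<in> carrier (RG n)" "f \<in> carrier (CM n)" if "f \<in> carrier (cocycles k H A n)" for f
    using that Reg_in_conv by (auto simp: cocycles_carrier)
  fix x assume x: "x \<in> carrier (cocycles k H A n)"
  show "push n \<phi> x \<in> carrier (cocycles k H A n)" by (rule push_cocycle[OF \<phi> x])
  show "push n (inv_into (carrier Z) \<phi>) x \<in> carrier (cocycles k H A n)" by (rule push_cocycle[OF \<psi> x])
  show "push n (inv_into (carrier Z) \<phi>) (push n \<phi> x) = x" "push n \<phi> (push n (inv_into (carrier Z) \<phi>) x) = x"
    by (rule push_inverse[OF \<phi> c(2)[OF x]])+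
  fix y assume y: "y \<in> carrier (cocycles k H A n)"
  show "x \<otimes>\<^bsub>cocycles k H A n\<^esub> y \<in> carrier (cocycles k H A n)"
    using x y hom_mult[OF D_hom c(1)[OF x] c(1)[OF y]] by (simp add: cocycles_carrier cocycles_mult)
  show "push n \<phi> (x \<otimes>\<^bsub>cocycles k H A n\<^esub> y) = push n \<phi> x \<otimes>\<^bsub>cocycles k H A n\<^esub> push n \<phi> y"
    unfolding cocycles_mult by (rule hom_mult[OF push_hom[OF \<phi>] c(1)[OF x] c(1)[OF y]])
qed

lemma push_auto_coboundaries:
  assumes \<phi>: "equivariant \<phi>"
  shows "restrict (push n \<phi>) (carrier (coboundaries k H A n)) \<in> auto (coboundaries k H A n)"
proof (rule autoI[where h' = "push n (inv_into (carrier Z) \<phi>)"])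
  note \<psi> = equivariant_inverse[OF \<phi>]
  have c: "f \<in> carrier (RG n)" if "f \<in> carrier (coboundaries k H A n)" for f
    using subgroup.mem_carrier[OF coboundaries_subgroup that] .
  fix x assume x: "x \<in> carrier (coboundaries k H A n)"
  show "push n \<phi> x \<in> carrier (coboundaries k H A n)" by (rule push_coboundary[OF \<phi> x])
  show "push n (inv_into (carrier Z) \<phi>) x \<in> carrier (coboundaries k H A n)" by (rule push_coboundary[OF \<psi> x])
  show "push n (inv_into (carrier Z) \<phi>) (push n \<phi> x) = x" "push n \<phi> (push n (inv_into (carrier Z) \<phi>) x) = x"
    by (rule push_inverse[OF \<phi> Reg_in_conv[OF c[OF x]]])+
  fix y assume y: "y \<in> carrier (coboundaries k H A n)"
  show "x \<otimes>\<^bsub>coboundaries k H A n\<^esub> y \<in> carrier (coboundaries k H A n)"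
    unfolding coboundaries_mult by (rule subgroup.m_closed[OF coboundaries_subgroup x y])
  show "push n \<phi> (x \<otimes>\<^bsub>coboundaries k H A n\<^esub> y) = push n \<phi> x \<otimes>\<^bsub>coboundaries k H A n\<^esub> push n \<phi> y"
    unfolding coboundaries_mult by (rule hom_mult[OF push_hom[OF \<phi>] c[OF x] c[OF y]])
qed

abbreviation "Bn n \<equiv> carrier (coboundaries k H A n)"

lemma push_coset:
  assumes \<phi>: "equivariant \<phi>" and f: "f \<in> carrier (RG n)"
  shows "push n \<phi> ` (Bn n #>\<^bsub>RG n\<^esub> f) = Bn n #>\<^bsub>RG n\<^esub> push n \<phi> f"
proof -
  have m: "push n \<phi> (x \<otimes>\<^bsub>RG n\<^esub> f) = push n \<phi> x \<otimes>\<^bsub>RG n\<^esub> push n \<phi> f" if "x \<in> Bn n" for x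
    by (rule hom_mult[OF push_hom[OF \<phi>] subgroup.mem_carrier[OF coboundaries_subgroup that] f])
  have surj: "\<exists>y\<in>Bn n. x = push n \<phi> y" if x: "x \<in> Bn n" for x
    using push_inverse(2)[OF \<phi> Reg_in_conv[OF subgroup.mem_carrier[OF coboundaries_subgroup x]]]
      push_coboundary[OF equivariant_inverse[OF \<phi>] x] by metis
  show ?thesis
  proof
    show "push n \<phi> ` (Bn n #>\<^bsub>RG n\<^esub> f) \<subseteq> Bn n #>\<^bsub>RG n\<^esub> push n \<phi> f"
      using m push_coboundary[OF \<phi>] by (fastforce simp: r_coset_def)
    show "Bn n #>\<^bsub>RG n\<^esub> push n \<phi> f \<subseteq> push n \<phi> ` (Bn n #>\<^bsub>RG n\<^esub> f)"
    proof
      fix z assume "z \<in> Bn n #>\<^bsub>RG n\<^esub> push n \<phi> f"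
      then obtain x where x: "x \<in> Bn n" "z = x \<otimes>\<^bsub>RG n\<^esub> push n \<phi> f" by (auto simp: r_coset_def)
      obtain y where y: "y \<in> Bn n" "x = push n \<phi> y" using surj[OF x(1)] by blast
      have "z = push n \<phi> (y \<otimes>\<^bsub>RG n\<^esub> f)" using m[OF y(1)] x y by simp
      moreover have "y \<otimes>\<^bsub>RG n\<^esub> f \<in> Bn n #>\<^bsub>RG n\<^esub> f" using y by (auto simp: r_coset_def)
      ultimately show "z \<in> push n \<phi> ` (Bn n #>\<^bsub>RG n\<^esub> f)" by blast
    qed
  qed
qed

lemma cohomology_carrier:
  "carrier (cohomology k H A n) = {Bn n #>\<^bsub>RG n\<^esub> f | f. f \<in> carrier (cocycles k H A n)}"
  by (auto simp: cohomology_def FactGroup_def RCOSETS_def r_coset_def cocycles_mult)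

lemma cohomology_mult:
  assumes "f \<in> carrier (RG n)" "g \<in> carrier (RG n)"
  shows "(Bn n #>\<^bsub>RG n\<^esub> f) \<otimes>\<^bsub>cohomology k H A n\<^esub> (Bn n #>\<^bsub>RG n\<^esub> g) = Bn n #>\<^bsub>RG n\<^esub> (f \<otimes>\<^bsub>RG n\<^esub> g)"
proof -
  have "Bn n \<lhd> RG n"
    by (rule comm_group.subgroup_imp_normal[OF Reg_comm_group coboundaries_subgroup])
  from normal.rcos_sum[OF this assms] show ?thesis
    by (simp add: cohomology_def FactGroup_def set_mult_def cocycles_mult)
qed

lemma push_auto_cohomology:
  assumes \<phi>: "equivariant \<phi>"
  shows "restrict (image (push n \<phi>)) (carrier (cohomology k H A n)) \<in> auto (cohomology k H A n)"
proof (rule autoI[where h' = "image (push n (inv_into (carrier Z) \<phi>))"])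
  interpret R: comm_group "RG n" by (rule Reg_comm_group)
  interpret R': comm_group "RG (Suc n)" by (rule Reg_comm_group)
  note \<psi> = equivariant_inverse[OF \<phi>]
  have c: "f \<in> carrier (RG n)" "f \<in> carrier (CM n)" if "f \<in> carrier (cocycles k H A n)" for f
    using that Reg_in_conv by (auto simp: cocycles_carrier)
  fix X assume "X \<in> carrier (cohomology k H A n)"
  then obtain f where f: "f \<in> carrier (cocycles k H A n)" "X = Bn n #>\<^bsub>RG n\<^esub> f" by (auto simp: cohomology_carrier)
  note p = push_cocycle[OF \<phi> f(1)] push_cocycle[OF \<psi> f(1)]
  show "push n \<phi> ` X \<in> carrier (cohomology k H A n)"
    "push n (inv_into (carrier Z) \<phi>) ` X \<in> carrier (cohomology k H A n)"
    using p unfolding f(2) push_coset[OF \<phi> c(1)[OF f(1)]] push_coset[OF \<psi> c(1)[OF f(1)]] cohomology_carrier by blast+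
  show "push n (inv_into (carrier Z) \<phi>) ` push n \<phi> ` X = X"
    unfolding f(2) push_coset[OF \<phi> c(1)[OF f(1)]] push_coset[OF \<psi> c(1)[OF p(1)]] push_inverse[OF \<phi> c(2)[OF f(1)]] ..
  show "push n \<phi> ` push n (inv_into (carrier Z) \<phi>) ` X = X"
    unfolding f(2) push_coset[OF \<psi> c(1)[OF f(1)]] push_coset[OF \<phi> c(1)[OF p(2)]] push_inverse[OF \<phi> c(2)[OF f(1)]] ..
  fix Y assume "Y \<in> carrier (cohomology k H A n)"
  then obtain g where g: "g \<in> carrier (cocycles k H A n)" "Y = Bn n #>\<^bsub>RG n\<^esub> g" by (auto simp: cohomology_carrier)
  have fg: "f \<otimes>\<^bsub>RG n\<^esub> g \<in> carrier (cocycles k H A n)"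
    using f g hom_mult[OF D_hom c(1)[OF f(1)] c(1)[OF g(1)]] by (simp add: cocycles_carrier)
  have XY: "X \<otimes>\<^bsub>cohomology k H A n\<^esub> Y = Bn n #>\<^bsub>RG n\<^esub> (f \<otimes>\<^bsub>RG n\<^esub> g)"
    unfolding f(2) g(2) by (rule cohomology_mult[OF c(1)[OF f(1)] c(1)[OF g(1)]])
  show "X \<otimes>\<^bsub>cohomology k H A n\<^esub> Y \<in> carrier (cohomology k H A n)"
    unfolding XY cohomology_carrier using fg by blast
  show "push n \<phi> ` (X \<otimes>\<^bsub>cohomology k H A n\<^esub> Y) = push n \<phi> ` X \<otimes>\<^bsub>cohomology k H A n\<^esub> push n \<phi> ` Y"
    unfolding XY push_coset[OF \<phi> c(1)[OF fg]] hom_mult[OF push_hom[OF \<phi>] c(1)[OF f(1)] c(1)[OF g(1)]]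
    unfolding f(2) g(2) push_coset[OF \<phi> c(1)[OF f(1)]] push_coset[OF \<phi> c(1)[OF g(1)]]
    by (rule cohomology_mult[OF c(1)[OF p(1)] c(1)[OF push_cocycle[OF \<phi> g(1)]], symmetric])
qed

end

section \<open>Strict Morita contexts\<close>

lemma make_bimod_simps [simp]:
  "carrier (make_bimod T s l r) = carrier T" "add (make_bimod T s l r) = add T" "zero (make_bimod T s l r) = zero T"
  "lact (make_bimod T s l r) = l" "ract (make_bimod T s l r) = r" "smult (make_bimod T s l r) = s"
  by (simp_all add: make_bimod_def fun_eq_iff)

lemma opposite_simps [simp]:
  "carrier (op_alg X) = carrier X" "add (op_alg X) = add X" "one (op_alg X) = one X" "zero (op_alg X) = zero X"
  "mult (op_alg X) = (\<lambda>x y. y \<otimes>\<^bsub>X\<^esub> x)" "smult (op_alg X) = smult X"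
  by (simp_all add: op_alg_def)

locale kalg = ground k for k :: "'k ring" + fixes B :: "('k, 'b, 'y) module_scheme" (structure)
  assumes alg: "k_algebra k B"
begin

sublocale B: ring B by (rule k_algebra_ring[OF alg])
sublocale B: module k B by (rule k_algebra_module[OF alg])

abbreviation "bim M \<equiv> bimodule k B M"

lemma bim_module: "bim M \<Longrightarrow> module k M"
  and bim_right: "bim M \<Longrightarrow> right_module B M (ract M)"
  and bim_left: "bim M \<Longrightarrow> right_module (op_alg B) M (\<lambda>x b. lact M b x)"
  by (simp_all only: bimodule_def)

lemma bim_abelian [simp]: "bim M \<Longrightarrow> abelian_group M"
  by (rule module_abelian[OF bim_module])

lemma ract_closed [simp]: "bim M \<Longrightarrow> x \<in> carrier M \<Longrightarrow> b \<in> carrier B \<Longrightarrow> ract M x b \<in> carrier M"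
  and ract_add: "bim M \<Longrightarrow> x \<in> carrier M \<Longrightarrow> y \<in> carrier M \<Longrightarrow> b \<in> carrier B \<Longrightarrow>
      ract M (x \<oplus>\<^bsub>M\<^esub> y) b = ract M x b \<oplus>\<^bsub>M\<^esub> ract M y b"
  and ract_add_ring: "bim M \<Longrightarrow> x \<in> carrier M \<Longrightarrow> b \<in> carrier B \<Longrightarrow> c \<in> carrier B \<Longrightarrow>
      ract M x (b \<oplus> c) = ract M x b \<oplus>\<^bsub>M\<^esub> ract M x c"
  and ract_mult: "bim M \<Longrightarrow> x \<in> carrier M \<Longrightarrow> b \<in> carrier B \<Longrightarrow> c \<in> carrier B \<Longrightarrow>
      ract M x (b \<otimes> c) = ract M (ract M x b) c"
  and ract_one [simp]: "bim M \<Longrightarrow> x \<in> carrier M \<Longrightarrow> ract M x \<one> = x"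
  by (drule bim_right, unfold right_module_def, blast)+

lemma lact_closed [simp]: "bim M \<Longrightarrow> b \<in> carrier B \<Longrightarrow> x \<in> carrier M \<Longrightarrow> lact M b x \<in> carrier M"
  and lact_add: "bim M \<Longrightarrow> b \<in> carrier B \<Longrightarrow> x \<in> carrier M \<Longrightarrow> y \<in> carrier M \<Longrightarrow>
      lact M b (x \<oplus>\<^bsub>M\<^esub> y) = lact M b x \<oplus>\<^bsub>M\<^esub> lact M b y"
  and lact_add_ring: "bim M \<Longrightarrow> x \<in> carrier M \<Longrightarrow> b \<in> carrier B \<Longrightarrow> c \<in> carrier B \<Longrightarrow>
      lact M (b \<oplus> c) x = lact M b x \<oplus>\<^bsub>M\<^esub> lact M c x"
  and lact_mult: "bim M \<Longrightarrow> x \<in> carrier M \<Longrightarrow> b \<in> carrier B \<Longrightarrow> c \<in> carrier B \<Longrightarrow>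
      lact M (b \<otimes> c) x = lact M b (lact M c x)"
  and lact_one [simp]: "bim M \<Longrightarrow> x \<in> carrier M \<Longrightarrow> lact M \<one> x = x"
  by (drule bim_left, unfold right_module_def opposite_simps, blast)+

lemma lact_ract: "bim M \<Longrightarrow> b \<in> carrier B \<Longrightarrow> x \<in> carrier M \<Longrightarrow> c \<in> carrier B \<Longrightarrow>
    ract M (lact M b x) c = lact M b (ract M x c)"
  unfolding bimodule_def by blast

lemma smult_lact: "bim M \<Longrightarrow> c \<in> carrier k \<Longrightarrow> x \<in> carrier M \<Longrightarrow> c \<odot>\<^bsub>M\<^esub> x = lact M (c \<odot> \<one>) x"
  and smult_ract: "bim M \<Longrightarrow> c \<in> carrier k \<Longrightarrow> x \<in> carrier M \<Longrightarrow> c \<odot>\<^bsub>M\<^esub> x = ract M x (c \<odot> \<one>)"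
  unfolding bimodule_def by blast+

lemma additive_lact: "bim M \<Longrightarrow> b \<in> carrier B \<Longrightarrow> additive M M (lact M b)"
  by (rule additiveI) (simp_all add: lact_add)

lemma additive_ract: "bim M \<Longrightarrow> b \<in> carrier B \<Longrightarrow> additive M M (\<lambda>x. ract M x b)"
  by (rule additiveI) (simp_all add: ract_add)

lemma additive_lact_ring: "bim M \<Longrightarrow> x \<in> carrier M \<Longrightarrow> additive B M (\<lambda>b. lact M b x)"
  by (rule additiveI) (simp_all add: lact_add_ring)

lemma additive_ract_ring: "bim M \<Longrightarrow> x \<in> carrier M \<Longrightarrow> additive B M (\<lambda>b. ract M x b)"
  by (rule additiveI) (simp_all add: ract_add_ring)

lemma additive_mult_left: "b \<in> carrier B \<Longrightarrow> additive B B (\<lambda>x. b \<otimes> x)"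
  by (rule additiveI) (simp_all add: B.r_distr)

lemma additive_mult_right: "b \<in> carrier B \<Longrightarrow> additive B B (\<lambda>x. x \<otimes> b)"
  by (rule additiveI) (simp_all add: B.l_distr)

lemma bimoduleI:
  assumes "module k M"
    and "\<And>x b. x \<in> carrier M \<Longrightarrow> b \<in> carrier B \<Longrightarrow> ract M x b \<in> carrier M"
    and "\<And>x y b. x \<in> carrier M \<Longrightarrow> y \<in> carrier M \<Longrightarrow> b \<in> carrier B \<Longrightarrow> ract M (x \<oplus>\<^bsub>M\<^esub> y) b = ract M x b \<oplus>\<^bsub>M\<^esub> ract M y b"
    and "\<And>x b c. x \<in> carrier M \<Longrightarrow> b \<in> carrier B \<Longrightarrow> c \<in> carrier B \<Longrightarrow> ract M x (b \<oplus> c) = ract M x b \<oplus>\<^bsub>M\<^esub> ract M x c"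
    and "\<And>x b c. x \<in> carrier M \<Longrightarrow> b \<in> carrier B \<Longrightarrow> c \<in> carrier B \<Longrightarrow> ract M x (b \<otimes> c) = ract M (ract M x b) c"
    and "\<And>x. x \<in> carrier M \<Longrightarrow> ract M x \<one> = x"
    and "\<And>x b. x \<in> carrier M \<Longrightarrow> b \<in> carrier B \<Longrightarrow> lact M b x \<in> carrier M"
    and "\<And>x y b. x \<in> carrier M \<Longrightarrow> y \<in> carrier M \<Longrightarrow> b \<in> carrier B \<Longrightarrow> lact M b (x \<oplus>\<^bsub>M\<^esub> y) = lact M b x \<oplus>\<^bsub>M\<^esub> lact M b y"
    and "\<And>x b c. x \<in> carrier M \<Longrightarrow> b \<in> carrier B \<Longrightarrow> c \<in> carrier B \<Longrightarrow> lact M (b \<oplus> c) x = lact M b x \<oplus>\<^bsub>M\<^esub> lact M c x"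
    and "\<And>x b c. x \<in> carrier M \<Longrightarrow> b \<in> carrier B \<Longrightarrow> c \<in> carrier B \<Longrightarrow> lact M (b \<otimes> c) x = lact M b (lact M c x)"
    and "\<And>x. x \<in> carrier M \<Longrightarrow> lact M \<one> x = x"
    and "\<And>b x c. b \<in> carrier B \<Longrightarrow> x \<in> carrier M \<Longrightarrow> c \<in> carrier B \<Longrightarrow> ract M (lact M b x) c = lact M b (ract M x c)"
    and "\<And>c x. c \<in> carrier k \<Longrightarrow> x \<in> carrier M \<Longrightarrow> c \<odot>\<^bsub>M\<^esub> x = lact M (c \<odot> \<one>) x"
    and "\<And>c x. c \<in> carrier k \<Longrightarrow> x \<in> carrier M \<Longrightarrow> c \<odot>\<^bsub>M\<^esub> x = ract M x (c \<odot> \<one>)"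
  shows "bim M"
  unfolding bimodule_def right_module_def opposite_simps
  by (intro conjI ballI assms module_abelian[OF assms(1)])

end

locale bpair = kalg k B for k :: "'k ring" and B :: "('k, 'b, 'y) module_scheme" (structure) +
  fixes M :: "('k, 'm, 'b) bimod" and N :: "('k, 'n, 'b) bimod"
  assumes bim_M [simp]: "bimodule k B M" and bim_N [simp]: "bimodule k B N"
begin

sublocale bt: bal_tensor "carrier B" "ract M" "lact N" M N
  by (rule bal_tensor.intro) simp_all

abbreviation "MN \<equiv> btens B M N"

lemma MN_simps [simp]: "carrier MN = carrier bt.T" "add MN = add bt.T" "zero MN = zero bt.T"
  by (simp_all add: btens_def Let_def)

lemma btens_elem_eq [simp]: "btens_elem B M N = bt.te"
  by (simp add: btens_elem_def)

lemma tsum_MN: "tsum MN = tsum bt.T"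
  by (intro ext tsum_same_add) simp_all

lemma additive_MN [simp]: "additive MN G f \<longleftrightarrow> additive bt.T G f" "additive V MN g \<longleftrightarrow> additive V bt.T g"
  by (simp_all add: additive_def additive_maps_def)

lemma MN_acts:
  "smult MN = (\<lambda>c X. tsum bt.T X (\<lambda>x y. bt.te (c \<odot>\<^bsub>M\<^esub> x) y))"
  "lact MN = (\<lambda>b X. tsum bt.T X (\<lambda>x y. bt.te (lact M b x) y))"
  "ract MN = (\<lambda>X b. tsum bt.T X (\<lambda>x y. bt.te x (ract N y b)))"
  by (simp_all add: btens_def Let_def)

lemma bal_ract: "b \<in> carrier B \<Longrightarrow> bt.bal bt.T (\<lambda>x y. bt.te x (ract N y b))"
  by (rule balancedI)
    (simp_all add: additiveI bt.te_closed ract_add bt.te_add_left bt.te_add_right lact_ract bt.te_balanced)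

lemma lact_additive: "b \<in> carrier B \<Longrightarrow> additive bt.T bt.T (lact MN b)"
  and lact_te: "b \<in> carrier B \<Longrightarrow> x \<in> carrier M \<Longrightarrow> y \<in> carrier N \<Longrightarrow> lact MN b (bt.te x y) = bt.te (lact M b x) y"
  unfolding MN_acts by (rule bt.left_map, simp_all add: additive_lact lact_ract)+

lemma ract_additive: "b \<in> carrier B \<Longrightarrow> additive bt.T bt.T (\<lambda>X. ract MN X b)"
  unfolding MN_acts by (rule bt.tsum_additive[OF bt.abelian_T bal_ract])

lemma ract_te: "b \<in> carrier B \<Longrightarrow> x \<in> carrier M \<Longrightarrow> y \<in> carrier N \<Longrightarrow> ract MN (bt.te x y) b = bt.te x (ract N y b)"
  unfolding MN_acts by (rule bt.tsum_te[OF bt.abelian_T bal_ract])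

lemma module_MN: "module k MN"
  and smult_additive: "c \<in> carrier k \<Longrightarrow> additive bt.T bt.T (smult MN c)"
  and smult_te: "c \<in> carrier k \<Longrightarrow> x \<in> carrier M \<Longrightarrow> y \<in> carrier N \<Longrightarrow> c \<odot>\<^bsub>MN\<^esub> (bt.te x y) = bt.te (c \<odot>\<^bsub>M\<^esub> x) y"
proof -
  interpret M: module k M by (rule bim_module) simp
  note * = bt.left_module[where f = "smult M" and P = MN, OF cring_k additiveI M.smult_l_distr M.smult_assoc1 M.smult_one _ MN_simps MN_acts(1)]
  show "module k MN" by (rule *(1)) (simp_all add: smult_lact[of M] lact_add lact_ract)
  show "c \<in> carrier k \<Longrightarrow> additive bt.T bt.T (smult MN c)"
    by (rule *(2)) (simp_all add: smult_lact[of M] lact_add lact_ract)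
  show "c \<in> carrier k \<Longrightarrow> x \<in> carrier M \<Longrightarrow> y \<in> carrier N \<Longrightarrow> c \<odot>\<^bsub>MN\<^esub> (bt.te x y) = bt.te (c \<odot>\<^bsub>M\<^esub> x) y"
    by (rule *(3)) (simp_all add: smult_lact[of M] lact_add lact_ract)
qed

lemma bim_MN: "bim MN"
proof (rule bimoduleI)
  note A = lact_additive ract_additive smult_additive
  note C = additive_comp[OF lact_additive lact_additive] additive_comp[OF ract_additive ract_additive]
    additive_comp[OF lact_additive ract_additive] additive_comp[OF ract_additive lact_additive]
  note E = bt.additive_eqI
  note [simp] = lact_te ract_te smult_te bt.te_closed
  show "lact MN b X \<in> carrier MN" if "X \<in> carrier MN" "b \<in> carrier B" for b X
    using additive_closed[OF lact_additive] that by simp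
  show "ract MN X b \<in> carrier MN" if "X \<in> carrier MN" "b \<in> carrier B" for b X
    using additive_closed[OF ract_additive] that by simp
  show "lact MN b (X \<oplus>\<^bsub>MN\<^esub> Y) = lact MN b X \<oplus>\<^bsub>MN\<^esub> lact MN b Y"
    if "X \<in> carrier MN" "Y \<in> carrier MN" "b \<in> carrier B" for b X Y
    using additive_add[OF lact_additive] that by simp
  show "ract MN (X \<oplus>\<^bsub>MN\<^esub> Y) b = ract MN X b \<oplus>\<^bsub>MN\<^esub> ract MN Y b"
    if "X \<in> carrier MN" "Y \<in> carrier MN" "b \<in> carrier B" for b X Y
    using additive_add[OF ract_additive] that by simp
  show "lact MN (b \<oplus> c) X = lact MN b X \<oplus>\<^bsub>MN\<^esub> lact MN c X"
    if "X \<in> carrier MN" "b \<in> carrier B" "c \<in> carrier B" for b c X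
    unfolding MN_simps
    by (rule E[OF A(1) additive_plus[OF A(1) A(1) bt.abelian_T]])
      (use that in \<open>simp_all add: lact_add_ring bt.te_add_left\<close>)
  show "ract MN X (b \<oplus> c) = ract MN X b \<oplus>\<^bsub>MN\<^esub> ract MN X c"
    if "X \<in> carrier MN" "b \<in> carrier B" "c \<in> carrier B" for b c X
    unfolding MN_simps
    by (rule E[OF A(2) additive_plus[OF A(2) A(2) bt.abelian_T]])
      (use that in \<open>simp_all add: ract_add_ring bt.te_add_right\<close>)
  show "lact MN (b \<otimes> c) X = lact MN b (lact MN c X)"
    if "X \<in> carrier MN" "b \<in> carrier B" "c \<in> carrier B" for b c X
    by (rule E[OF A(1) C(1)]) (use that in \<open>simp_all add: lact_mult\<close>)
  show "ract MN X (b \<otimes> c) = ract MN (ract MN X b) c"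
    if "X \<in> carrier MN" "b \<in> carrier B" "c \<in> carrier B" for b c X
    by (rule E[OF A(2) C(2)]) (use that in \<open>simp_all add: ract_mult\<close>)
  show "lact MN \<one> X = X" if "X \<in> carrier MN" for X
    by (rule E[OF A(1) additive_id]) (use that in simp_all)
  show "ract MN X \<one> = X" if "X \<in> carrier MN" for X
    by (rule E[OF A(2) additive_id]) (use that in simp_all)
  show "ract MN (lact MN b X) c = lact MN b (ract MN X c)"
    if "b \<in> carrier B" "X \<in> carrier MN" "c \<in> carrier B" for b c X
    by (rule E[OF C(3) C(4)]) (use that in simp_all)
  show "c \<odot>\<^bsub>MN\<^esub> X = lact MN (c \<odot> \<one>) X" if "c \<in> carrier k" "X \<in> carrier MN" for c X
    by (rule E[OF A(3) A(1)]) (use that in \<open>simp_all add: smult_lact\<close>)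
  show "c \<odot>\<^bsub>MN\<^esub> X = ract MN X (c \<odot> \<one>)" if "c \<in> carrier k" "X \<in> carrier MN" for c X
    by (rule E[OF A(3) A(2)])
      (use that in \<open>simp_all add: smult_ract[of M] smult_lact[of N, symmetric] bt.te_balanced smult_ract[of N, symmetric]\<close>)
  show "module k MN" by (rule module_MN)
qed

end

context kalg
begin

lemma bpairI: "bim M \<Longrightarrow> bim N \<Longrightarrow> bpair k B M N"
  by (rule bpair.intro[OF kalg_axioms bpair_axioms.intro])

lemma regular_module: "module k (regular_bimod B)"
  by (rule moduleI[OF cring_k abelian_group_cong[OF B.abelian_group_axioms]])
    (simp_all add: B.smult_l_distr B.smult_r_distr B.smult_assoc1)

lemma regular_bim: "bim (regular_bimod B)"
  by (rule bimoduleI[OF regular_module])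
    (simp_all add: B.l_distr B.r_distr B.m_assoc k_algebra_smult[OF alg])

text \<open>A pairing of bimodules corresponds to a bimodule map from the tensor product to \<open>B\<close>.\<close>

definition pairing where
  "pairing M N a \<longleftrightarrow> balanced (carrier B) (ract M) (lact N) M N B a \<and>
    (\<forall>b\<in>carrier B. \<forall>x\<in>carrier M. \<forall>y\<in>carrier N.
       a (lact M b x) y = b \<otimes> a x y \<and> a x (ract N y b) = a x y \<otimes> b)"

lemma pairingD:
  assumes "pairing M N a"
  shows "balanced (carrier B) (ract M) (lact N) M N B a"
    and "y \<in> carrier N \<Longrightarrow> additive M B (\<lambda>x. a x y)" "x \<in> carrier M \<Longrightarrow> additive N B (a x)"
    and "x \<in> carrier M \<Longrightarrow> y \<in> carrier N \<Longrightarrow> a x y \<in> carrier B"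
    and "x \<in> carrier M \<Longrightarrow> b \<in> carrier B \<Longrightarrow> y \<in> carrier N \<Longrightarrow> a (ract M x b) y = a x (lact N b y)"
    and "b \<in> carrier B \<Longrightarrow> x \<in> carrier M \<Longrightarrow> y \<in> carrier N \<Longrightarrow> a (lact M b x) y = b \<otimes> a x y"
    and "b \<in> carrier B \<Longrightarrow> x \<in> carrier M \<Longrightarrow> y \<in> carrier N \<Longrightarrow> a x (ract N y b) = a x y \<otimes> b"
  using assms by (auto simp: pairing_def balanced_def intro: additive_closed)

end

text \<open>A strict Morita context, in terms of its pairings. The two elements whose images under the
  pairings are the unit determine everything.\<close>

locale context_pairings = kalg k B for k :: "'k ring" and B :: "('k, 'b, 'y) module_scheme" (structure) +
  fixes M :: "('k, 'm, 'b) bimod" and N :: "('k, 'n, 'b) bimod" and a b s t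
  assumes bim_M [simp]: "bimodule k B M" and bim_N [simp]: "bimodule k B N"
    and pa: "pairing M N a" and pb: "pairing N M b"
    and s: "s \<in> carrier (btens B M N)" "tsum B s a = \<one>"
    and t: "t \<in> carrier (btens B N M)" "tsum B t b = \<one>"
    and ab: "\<And>m n m'. m \<in> carrier M \<Longrightarrow> n \<in> carrier N \<Longrightarrow> m' \<in> carrier M \<Longrightarrow> lact M (a m n) m' = ract M m (b n m')"
    and ba: "\<And>n m n'. n \<in> carrier N \<Longrightarrow> m \<in> carrier M \<Longrightarrow> n' \<in> carrier N \<Longrightarrow> lact N (b n m) n' = ract N n (a m n')"
begin

sublocale MN: bpair k B M N by (rule bpairI) simp_all
sublocale NM: bpair k B N M by (rule bpairI) simp_all

lemma flip: "context_pairings k B N M b a t s"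
  by (intro context_pairings.intro[OF kalg_axioms] context_pairings_axioms.intro bim_M bim_N pa pb s t ab ba)

lemma a_closed [simp]: "m \<in> carrier M \<Longrightarrow> n \<in> carrier N \<Longrightarrow> a m n \<in> carrier B"
  by (rule pairingD(4)[OF pa])

lemma b_closed [simp]: "n \<in> carrier N \<Longrightarrow> m \<in> carrier M \<Longrightarrow> b n m \<in> carrier B"
  by (rule pairingD(4)[OF pb])

lemma over_s: "over (carrier M) (carrier N) s"
  using s(1) by (intro MN.bt.over_T) simp

lemma over_t: "over (carrier N) (carrier M) t"
  using t(1) by (intro NM.bt.over_T) simp

lemma tsum_a_additive: "additive MN.bt.T B (\<lambda>X. tsum B X a)"
  by (rule MN.bt.tsum_additive[OF B.abelian_group_axioms pairingD(1)[OF pa]])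

lemma tsum_a_te: "m \<in> carrier M \<Longrightarrow> n \<in> carrier N \<Longrightarrow> tsum B (MN.bt.te m n) a = a m n"
  by (rule MN.bt.tsum_te[OF B.abelian_group_axioms pairingD(1)[OF pa]])

lemma tsum_a_lact:
  assumes "X \<in> carrier MN.bt.T" "c \<in> carrier B"
  shows "tsum B (lact MN.MN c X) a = c \<otimes> tsum B X a"
  by (rule MN.bt.additive_eqI[OF additive_comp[OF MN.lact_additive tsum_a_additive]
        additive_comp[OF tsum_a_additive additive_mult_left]])
    (use assms in \<open>simp_all add: MN.lact_te tsum_a_te pairingD(6)[OF pa]\<close>)

lemma tsum_a_ract:
  assumes "X \<in> carrier MN.bt.T" "c \<in> carrier B"
  shows "tsum B (ract MN.MN X c) a = tsum B X a \<otimes> c"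
  by (rule MN.bt.additive_eqI[OF additive_comp[OF MN.ract_additive tsum_a_additive]
        additive_comp[OF tsum_a_additive additive_mult_right]])
    (use assms in \<open>simp_all add: MN.ract_te tsum_a_te pairingD(7)[OF pa]\<close>)

text \<open>The identity \<open>\<Sum> m\<^sub>i b(n\<^sub>i, m) = m\<close> for \<open>s = \<Sum> m\<^sub>i \<otimes> n\<^sub>i\<close>, and its mirror image.\<close>

lemma expand_M:
  assumes m: "m \<in> carrier M"
  shows "tsum M s (\<lambda>m' n'. ract M m' (b n' m)) = m"
proof -
  have "m = lact M (tsum B s a) m" using m by (simp add: s(2))
  also have "\<dots> = tsum M s (\<lambda>m' n'. lact M (a m' n') m)"
    by (rule tsum_hom[OF additive_lact_ring _ _ over_s]) (simp_all add: m B.abelian_group_axioms)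
  also have "\<dots> = tsum M s (\<lambda>m' n'. ract M m' (b n' m))"
    by (rule tsum_cong[OF over_s]) (simp add: ab m)
  finally show ?thesis ..
qed

lemma expand_M':
  assumes m: "m \<in> carrier M"
  shows "tsum M t (\<lambda>n' m'. lact M (a m n') m') = m"
proof -
  have "m = ract M m (tsum B t b)" using m by (simp add: t(2))
  also have "\<dots> = tsum M t (\<lambda>n' m'. ract M m (b n' m'))"
    by (rule tsum_hom[OF additive_ract_ring _ _ over_t]) (simp_all add: m B.abelian_group_axioms)
  also have "\<dots> = tsum M t (\<lambda>n' m'. lact M (a m n') m')"
    by (rule tsum_cong[OF over_t]) (simp add: ab m)
  finally show ?thesis ..
qed

text \<open>The unit of \<open>B\<close> is a sum of values of the pairing, so that \<open>z\<close> is a sum of values at \<open>z m\<^sub>i\<close>.\<close>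

lemma faithful_left:
  assumes x: "x \<in> carrier B" and y: "y \<in> carrier B" and eq: "\<And>m. m \<in> carrier M \<Longrightarrow> lact M x m = lact M y m"
  shows "x = y"
proof -
  have e: "tsum B s (\<lambda>m n. a (lact M z m) n) = z" if z: "z \<in> carrier B" for z
  proof -
    have "z = z \<otimes> tsum B s a" using z by (simp add: s(2))
    also have "\<dots> = tsum B s (\<lambda>m n. z \<otimes> a m n)"
      by (rule tsum_hom[OF additive_mult_left _ _ over_s]) (simp_all add: z B.abelian_group_axioms)
    also have "\<dots> = tsum B s (\<lambda>m n. a (lact M z m) n)"
      by (rule tsum_cong[OF over_s]) (simp add: z pairingD(6)[OF pa])
    finally show ?thesis ..
  qed
  have "tsum B s (\<lambda>m n. a (lact M x m) n) = tsum B s (\<lambda>m n. a (lact M y m) n)"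
    by (rule tsum_cong[OF over_s]) (simp add: eq)
  then show ?thesis using e x y by simp
qed

lemma faithful_right:
  assumes x: "x \<in> carrier B" and y: "y \<in> carrier B" and eq: "\<And>m. m \<in> carrier M \<Longrightarrow> ract M m x = ract M m y"
  shows "x = y"
proof -
  have e: "tsum B t (\<lambda>n m. b n (ract M m z)) = z" if z: "z \<in> carrier B" for z
  proof -
    have "z = tsum B t b \<otimes> z" using z by (simp add: t(2))
    also have "\<dots> = tsum B t (\<lambda>n m. b n m \<otimes> z)"
      by (rule tsum_hom[OF additive_mult_right _ _ over_t]) (simp_all add: z B.abelian_group_axioms)
    also have "\<dots> = tsum B t (\<lambda>n m. b n (ract M m z))"
      by (rule tsum_cong[OF over_t]) (simp add: z pairingD(7)[OF pb])
    finally show ?thesis ..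
  qed
  have "tsum B t (\<lambda>n m. b n (ract M m x)) = tsum B t (\<lambda>n m. b n (ract M m y))"
    by (rule tsum_cong[OF over_t]) (simp add: eq)
  then show ?thesis using e x y by simp
qed

text \<open>A surjective pairing in a Morita context is automatically injective: it has the inverse
  \<open>c \<mapsto> c s\<close>.\<close>

lemma tsum_a_inverse:
  assumes "X \<in> carrier MN.bt.T"
  shows "lact MN.MN (tsum B X a) s = X"
proof (rule MN.bt.additive_eqI[OF _ additive_id assms])
  have sT: "s \<in> carrier MN.bt.T" using s(1) by simp
  have "additive B MN.MN (\<lambda>c. lact MN.MN c s)"
    by (rule additive_lact_ring[OF MN.bim_MN s(1)])
  then show "additive MN.bt.T MN.bt.T (\<lambda>X. lact MN.MN (tsum B X a) s)"
    using additive_comp[OF tsum_a_additive, of MN.bt.T "\<lambda>c. lact MN.MN c s"] by simp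
  fix x y assume x: "x \<in> carrier M" and y: "y \<in> carrier N"
  have "MN.bt.te x y = MN.bt.te x (ract N y (tsum B s a))" using y by (simp add: s(2))
  also have "\<dots> = tsum MN.bt.T s (\<lambda>m n. MN.bt.te x (ract N y (a m n)))"
  proof (rule tsum_hom[OF _ _ MN.bt.abelian_T over_s])
    show "additive B MN.bt.T (\<lambda>c. MN.bt.te x (ract N y c))"
      by (rule additiveI) (simp_all add: x y MN.bt.te_closed ract_add_ring MN.bt.te_add_right)
  qed (simp_all add: B.abelian_group_axioms)
  also have "\<dots> = tsum MN.bt.T s (\<lambda>m n. MN.bt.te (lact M (a x y) m) n)"
    by (rule tsum_cong[OF over_s]) (simp add: x y ab ba[symmetric] MN.bt.te_balanced)
  also have "\<dots> = lact MN.MN (tsum B (MN.bt.te x y) a) s"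
    by (simp add: MN.MN_acts tsum_a_te x y)
  finally show "lact MN.MN (tsum B (MN.bt.te x y) a) s = MN.bt.te x y" ..
qed

lemma bimod_iso_a:
  assumes \<alpha>: "\<And>X. X \<in> carrier MN.bt.T \<Longrightarrow> \<alpha> X = tsum B X a"
  shows "\<alpha> \<in> bimod_iso k B MN.MN (regular_bimod B)"
proof -
  have c: "\<alpha> X \<in> carrier B" if "X \<in> carrier MN.bt.T" for X
    using additive_closed[OF tsum_a_additive that] by (simp add: \<alpha> that)
  have cl: "lact MN.MN c X \<in> carrier MN.bt.T" if "X \<in> carrier MN.bt.T" "c \<in> carrier B" for c X
    using additive_closed[OF MN.lact_additive] that by simp
  have cr: "ract MN.MN X c \<in> carrier MN.bt.T" if "X \<in> carrier MN.bt.T" "c \<in> carrier B" for c X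
    using additive_closed[OF MN.ract_additive] that by simp
  have l: "\<alpha> (lact MN.MN c X) = c \<otimes> \<alpha> X" if "X \<in> carrier MN.bt.T" "c \<in> carrier B" for c X
    using that by (simp add: \<alpha> cl tsum_a_lact)
  have r: "\<alpha> (ract MN.MN X c) = \<alpha> X \<otimes> c" if "X \<in> carrier MN.bt.T" "c \<in> carrier B" for c X
    using that by (simp add: \<alpha> cr tsum_a_ract)
  have sT: "s \<in> carrier MN.bt.T" using s(1) by simp
  have add: "\<alpha> (X \<oplus>\<^bsub>MN.bt.T\<^esub> Y) = \<alpha> X \<oplus> \<alpha> Y" if "X \<in> carrier MN.bt.T" "Y \<in> carrier MN.bt.T" for X Y
    using that additive_add[OF tsum_a_additive that] MN.bt.T.a_closed[OF that] by (simp add: \<alpha>)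
  have sm: "\<alpha> (c \<odot>\<^bsub>MN.MN\<^esub> X) = c \<odot> \<alpha> X" if "X \<in> carrier MN.bt.T" "c \<in> carrier k" for c X
    using that by (simp add: smult_lact[OF MN.bim_MN] l c k_algebra_smult[OF alg])
  have "\<alpha> (lact MN.MN c s) = c" if "c \<in> carrier B" for c
    using that by (simp add: l[OF sT] \<alpha>[OF sT] s(2))
  note inv = this
  have bij: "bij_betw \<alpha> (carrier MN.bt.T) (carrier B)"
    by (rule bij_betwI[where g = "\<lambda>c. lact MN.MN c s"])
      (use c cl sT tsum_a_inverse \<alpha> inv in auto)
  show ?thesis
    unfolding bimod_iso_def linear_maps_def additive_maps_def
    using c add sm bij l r by auto
qed

lemma strict:
  assumes "\<And>X. X \<in> carrier MN.bt.T \<Longrightarrow> \<alpha> X = tsum B X a" "\<And>X. X \<in> carrier NM.bt.T \<Longrightarrow> \<beta> X = tsum B X b"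
  shows "strict_morita k B \<lparr>modM = M, modN = N, alpha = \<alpha>, beta = \<beta>\<rparr>"
proof -
  interpret f: context_pairings k B N M b a t s by (rule flip)
  show ?thesis
    unfolding strict_morita_def Let_def
    using bimod_iso_a[of \<alpha>] f.bimod_iso_a[of \<beta>] assms
    by (simp add: MN.bt.te_closed NM.bt.te_closed tsum_a_te f.tsum_a_te ab ba)
qed

end

subsection \<open>The action on the center\<close>

lemma additive_tsum_fun:
  assumes G: "abelian_group G" and X: "over U W X"
    and F: "\<And>x y. x \<in> U \<Longrightarrow> y \<in> W \<Longrightarrow> additive V G (\<lambda>v. F v x y)"
  shows "additive V G (\<lambda>v. tsum G X (F v))"
proof (rule additiveI)
  show "tsum G X (F v) \<in> carrier G" if "v \<in> carrier V" for v
    by (rule tsum_closed[OF G X]) (rule additive_closed[OF F that])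
  fix v w assume vw: "v \<in> carrier V" "w \<in> carrier V"
  have "tsum G X (F (v \<oplus>\<^bsub>V\<^esub> w)) = tsum G X (\<lambda>x y. F v x y \<oplus>\<^bsub>G\<^esub> F w x y)"
    by (rule tsum_cong[OF X]) (rule additive_add[OF F vw])
  also have "\<dots> = tsum G X (F v) \<oplus>\<^bsub>G\<^esub> tsum G X (F w)"
    by (rule tsum_add[OF G X]) (rule additive_closed[OF F], auto simp: vw)+
  finally show "tsum G X (F (v \<oplus>\<^bsub>V\<^esub> w)) = tsum G X (F v) \<oplus>\<^bsub>G\<^esub> tsum G X (F w)" .
qed

context kalg
begin

abbreviation "ZC \<equiv> carrier (center B)"

lemma ZC_mem: "x \<in> ZC \<longleftrightarrow> x \<in> carrier B \<and> (\<forall>b\<in>carrier B. x \<otimes> b = b \<otimes> x)"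
  by (auto simp: center_def)

lemma ZC_B [simp]: "x \<in> ZC \<Longrightarrow> x \<in> carrier B"
  by (simp add: ZC_mem)

lemma ZC_comm: "x \<in> ZC \<Longrightarrow> b \<in> carrier B \<Longrightarrow> x \<otimes> b = b \<otimes> x"
  unfolding ZC_mem by blast

lemma ZC_I: "x \<in> carrier B \<Longrightarrow> (\<And>b. b \<in> carrier B \<Longrightarrow> x \<otimes> b = b \<otimes> x) \<Longrightarrow> x \<in> ZC"
  unfolding ZC_mem by blast

lemma ZC_closed: "\<one> \<in> ZC" "x \<in> ZC \<Longrightarrow> y \<in> ZC \<Longrightarrow> x \<oplus> y \<in> ZC"
  "c \<in> carrier k \<Longrightarrow> x \<in> ZC \<Longrightarrow> c \<odot> x \<in> ZC" "x \<in> ZC \<Longrightarrow> y \<in> ZC \<Longrightarrow> x \<otimes> y \<in> ZC"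
proof -
  note Z = center_algebra[OF alg]
  interpret Z: ring "center B" by (rule k_algebra_ring[OF Z])
  have eq: "one (center B) = one B" "add (center B) = add B" "smult (center B) = smult B" "mult (center B) = mult B"
    unfolding center_def by (rule restrict_carrier_simps)+
  show "\<one> \<in> ZC" "x \<in> ZC \<Longrightarrow> y \<in> ZC \<Longrightarrow> x \<oplus> y \<in> ZC"
    "c \<in> carrier k \<Longrightarrow> x \<in> ZC \<Longrightarrow> c \<odot> x \<in> ZC" "x \<in> ZC \<Longrightarrow> y \<in> ZC \<Longrightarrow> x \<otimes> y \<in> ZC"
    using Z.one_closed Z.a_closed[of x y] Z.m_closed[of x y] module.smult_closed[OF k_algebra_module[OF Z], of c x]
    by (simp_all only: eq)
qed


end

context context_pairings
begin

definition XI :: "'b \<Rightarrow> 'b" where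
  "XI x = (THE y. y \<in> ZC \<and> (\<forall>m\<in>carrier M. ract M m x = lact M y m))"

lemma xi_eq_XI: "modM X = M \<Longrightarrow> xi B X = XI"
  by (simp add: xi_def XI_def fun_eq_iff)

text \<open>With \<open>s = \<Sum> m\<^sub>i \<otimes> n\<^sub>i\<close>, the element \<open>\<Sum> a(m\<^sub>i x, n\<^sub>i)\<close> acts on the left as \<open>x\<close> acts on the right, by
  the associativity of the context; it is central because the right action of \<open>x\<close> is a bimodule map.\<close>

lemma XI_exists:
  assumes x: "x \<in> ZC"
  shows "\<exists>y. y \<in> ZC \<and> (\<forall>m\<in>carrier M. ract M m x = lact M y m)"
proof -
  note ab = bim_abelian[OF bim_M] B.abelian_group_axioms
  let ?y = "tsum B s (\<lambda>m n. a (ract M m x) n)"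
  have y: "?y \<in> carrier B" using x by (intro tsum_closed[OF _ over_s]) (simp_all add: ab)
  have eq: "lact M ?y m0 = ract M m0 x" if m0: "m0 \<in> carrier M" for m0
  proof -
    have "lact M ?y m0 = tsum M s (\<lambda>m n. lact M (a (ract M m x) n) m0)"
      by (rule tsum_hom[OF additive_lact_ring _ _ over_s]) (use x m0 in \<open>simp_all add: ab\<close>)
    also have "\<dots> = tsum M s (\<lambda>m n. ract M (ract M m (b n m0)) x)"
      by (rule tsum_cong[OF over_s])
        (simp add: x m0 context_pairings.ab[OF context_pairings_axioms] ract_mult[OF bim_M, symmetric] ZC_comm[OF x])
    also have "\<dots> = ract M (tsum M s (\<lambda>m n. ract M m (b n m0))) x"
      by (rule tsum_hom[OF additive_ract _ _ over_s, symmetric]) (use x m0 in \<open>simp_all add: ab\<close>)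
    also have "\<dots> = ract M m0 x" by (simp only: expand_M[OF m0])
    finally show ?thesis .
  qed
  have "?y \<otimes> c = c \<otimes> ?y" if c: "c \<in> carrier B" for c
  proof (rule faithful_left)
    fix m assume m: "m \<in> carrier M"
    show "lact M (?y \<otimes> c) m = lact M (c \<otimes> ?y) m"
      using c m x y by (simp add: lact_mult[OF bim_M] eq lact_ract)
  qed (use c y in simp_all)
  then have "?y \<in> ZC" by (intro ZC_I y)
  then show ?thesis using eq by (intro exI[of _ ?y]) simp
qed

lemma XI_unique:
  assumes "y \<in> ZC" "z \<in> ZC" "\<And>m. m \<in> carrier M \<Longrightarrow> lact M y m = lact M z m"
  shows "y = z"
  using faithful_left[of y z] assms by simp

lemma XI_eqI:
  assumes x: "x \<in> ZC" and y: "y \<in> ZC" and eq: "\<And>m. m \<in> carrier M \<Longrightarrow> ract M m x = lact M y m"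
  shows "XI x = y"
  unfolding XI_def
proof (rule the_equality)
  show "y \<in> ZC \<and> (\<forall>m\<in>carrier M. ract M m x = lact M y m)" using y eq by simp
  show "z = y" if "z \<in> ZC \<and> (\<forall>m\<in>carrier M. ract M m x = lact M z m)" for z
    using that eq by (intro XI_unique y) simp_all
qed

lemma XI_closed [simp]: "x \<in> ZC \<Longrightarrow> XI x \<in> ZC"
  and XI_act: "x \<in> ZC \<Longrightarrow> m \<in> carrier M \<Longrightarrow> ract M m x = lact M (XI x) m"
proof -
  assume x: "x \<in> ZC"
  obtain y where y: "y \<in> ZC" "\<forall>m\<in>carrier M. ract M m x = lact M y m" using XI_exists[OF x] by blast
  have "XI x = y" using y by (intro XI_eqI x) simp_all
  then show "XI x \<in> ZC" "m \<in> carrier M \<Longrightarrow> ract M m x = lact M (XI x) m" using y by simp_all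
qed

lemma XI_add: "x \<in> ZC \<Longrightarrow> y \<in> ZC \<Longrightarrow> XI (x \<oplus> y) = XI x \<oplus> XI y"
  by (rule XI_eqI) (simp_all add: ZC_closed ract_add_ring lact_add_ring XI_act[symmetric])

lemma XI_one: "XI \<one> = \<one>"
  by (rule XI_eqI) (simp_all add: ZC_closed)

lemma XI_mult:
  assumes x: "x \<in> ZC" and y: "y \<in> ZC"
  shows "XI (x \<otimes> y) = XI x \<otimes> XI y"
proof (rule XI_eqI)
  fix m assume m: "m \<in> carrier M"
  have "ract M m (x \<otimes> y) = lact M (XI x) (ract M m y)"
    using x y m by (simp add: ract_mult XI_act[OF x] lact_ract)
  also have "\<dots> = lact M (XI x \<otimes> XI y) m"
    using x y m by (simp add: lact_mult XI_act[OF y])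
  finally show "ract M m (x \<otimes> y) = \<dots>" .
qed (simp_all add: assms ZC_closed)

lemma XI_smult:
  assumes c: "c \<in> carrier k" and x: "x \<in> ZC"
  shows "XI (c \<odot> x) = c \<odot> XI x"
proof (rule XI_eqI)
  fix m assume m: "m \<in> carrier M"
  have "ract M m (c \<odot> x) = ract M (c \<odot>\<^bsub>M\<^esub> m) x"
  proof -
    have "c \<odot> x = (c \<odot> \<one>) \<otimes> x" using c x by (simp add: k_algebra_smult[OF alg])
    then show ?thesis using c x m by (simp add: ract_mult smult_ract[OF bim_M])
  qed
  also have "\<dots> = lact M (XI x \<otimes> (c \<odot> \<one>)) m"
    using c x m by (simp add: XI_act smult_lact[OF bim_M] lact_mult)
  also have "XI x \<otimes> (c \<odot> \<one>) = c \<odot> XI x"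
    using c x by (simp add: k_algebra_smult[OF alg])
  finally show "ract M m (c \<odot> x) = lact M (c \<odot> XI x) m" .
qed (simp_all add: assms ZC_closed)

lemma XI_inj: "x \<in> ZC \<Longrightarrow> y \<in> ZC \<Longrightarrow> XI x = XI y \<Longrightarrow> x = y"
  by (rule faithful_right) (simp_all add: XI_act)

text \<open>The mirror image of \<open>XI_exists\<close>, with \<open>t\<close> in place of \<open>s\<close>.\<close>

lemma XI_surj:
  assumes y: "y \<in> ZC"
  shows "\<exists>x\<in>ZC. XI x = y"
proof -
  note ab' = bim_abelian[OF bim_M] B.abelian_group_axioms
  let ?x = "tsum B t (\<lambda>n m. b n (lact M y m))"
  have x: "?x \<in> carrier B" using y by (intro tsum_closed[OF _ over_t]) (simp_all add: ab')
  have eq: "ract M m0 ?x = lact M y m0" if m0: "m0 \<in> carrier M" for m0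
  proof -
    have "ract M m0 ?x = tsum M t (\<lambda>n m. ract M m0 (b n (lact M y m)))"
      by (rule tsum_hom[OF additive_ract_ring _ _ over_t]) (use y m0 in \<open>simp_all add: ab'\<close>)
    also have "\<dots> = tsum M t (\<lambda>n m. lact M y (lact M (a m0 n) m))"
    proof (rule tsum_cong[OF over_t])
      fix n m assume n: "n \<in> carrier N" and m: "m \<in> carrier M"
      have "ract M m0 (b n (lact M y m)) = lact M (a m0 n \<otimes> y) m"
        using y m0 n m by (simp add: ab[symmetric] lact_mult)
      also have "a m0 n \<otimes> y = y \<otimes> a m0 n" using ZC_comm[OF y, of "a m0 n"] m0 n by simp
      finally show "ract M m0 (b n (lact M y m)) = lact M y (lact M (a m0 n) m)"
        using y m0 n m by (simp add: lact_mult)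
    qed
    also have "\<dots> = lact M y (tsum M t (\<lambda>n m. lact M (a m0 n) m))"
      by (rule tsum_hom[OF additive_lact _ _ over_t, symmetric]) (use y m0 in \<open>simp_all add: ab'\<close>)
    also have "\<dots> = lact M y m0" by (simp only: expand_M'[OF m0])
    finally show ?thesis .
  qed
  have "?x \<otimes> c = c \<otimes> ?x" if c: "c \<in> carrier B" for c
  proof (rule faithful_right)
    fix m assume m: "m \<in> carrier M"
    show "ract M m (?x \<otimes> c) = ract M m (c \<otimes> ?x)"
      using c m x y by (simp add: ract_mult[OF bim_M] eq lact_ract)
  qed (use c x in simp_all)
  then have xz: "?x \<in> ZC" by (intro ZC_I x)
  have "XI ?x = y" by (rule XI_eqI[OF xz y eq])
  then show ?thesis using xz by blast
qed

lemma XI_bij: "bij_betw XI ZC ZC"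
proof (rule bij_betw_imageI)
  show "inj_on XI ZC" by (rule inj_onI) (rule XI_inj)
  show "XI ` ZC = ZC"
  proof
    show "XI ` ZC \<subseteq> ZC" using XI_closed by blast
    show "ZC \<subseteq> XI ` ZC" using XI_surj by fast
  qed
qed

end

subsection \<open>Tensor products of Morita contexts\<close>

locale context_tensor = X: context_pairings k B M N a b s t + Y: context_pairings k B M' N' a' b' s' t'
  for k :: "'k ring" and B :: "('k, 'b, 'y) module_scheme" (structure)
    and M :: "('k, 'm, 'b) bimod" and N :: "('k, 'n, 'b) bimod" and a b s t
    and M' :: "('k, 'm2, 'b) bimod" and N' :: "('k, 'n2, 'b) bimod" and a' b' s' t'
begin

sublocale P: bpair k B M M' by (rule X.bpairI) simp_all
sublocale Q: bpair k B N' N by (rule X.bpairI) simp_all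

abbreviation "PP \<equiv> btens B M M'"
abbreviation "QQ \<equiv> btens B N' N"

definition term4 where "term4 m m' n' n = a m (lact N (a' m' n') n)"

definition pair2 where "pair2 U V = tsum B U (\<lambda>m m'. tsum B V (\<lambda>n' n. term4 m m' n' n))"

lemma abB: "abelian_group B" by (rule X.B.abelian_group_axioms)

lemma bal_inner:
  assumes m: "m \<in> carrier M" "m' \<in> carrier M'"
  shows "Q.bt.bal B (term4 m m')"
  unfolding term4_def
proof (rule balancedI)
  show "additive N' B (\<lambda>x. a m (lact N (a' m' x) y))" if "y \<in> carrier N" for y
    using that m by (intro additive_comp[OF X.pairingD(3)[OF Y.pa] additive_comp[OF X.additive_lact_ring X.pairingD(3)[OF X.pa]]]) simp_all
  show "additive N B (\<lambda>n. a m (lact N (a' m' x) n))" if "x \<in> carrier N'" for x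
    using that m by (intro additive_comp[OF X.additive_lact X.pairingD(3)[OF X.pa]]) simp_all
  show "a m (lact N (a' m' (ract N' x r)) y) = a m (lact N (a' m' x) (lact N r y))"
    if "x \<in> carrier N'" "r \<in> carrier B" "y \<in> carrier N" for x r y
    using that m by (simp add: X.pairingD(7)[OF Y.pa] X.lact_mult)
qed

lemma bal_outer:
  assumes V: "V \<in> carrier Q.bt.T"
  shows "P.bt.bal B (\<lambda>m m'. tsum B V (term4 m m'))"
proof (rule balancedI)
  note oV = Q.bt.over_T[OF V]
  show "additive M B (\<lambda>m. tsum B V (term4 m m'))" if "m' \<in> carrier M'" for m'
    unfolding term4_def using that by (intro additive_tsum_fun[OF abB oV] X.pairingD(2)[OF X.pa]) simp_all
  show "additive M' B (\<lambda>m'. tsum B V (term4 m m'))" if "m \<in> carrier M" for m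
    unfolding term4_def using that
    by (intro additive_tsum_fun[OF abB oV]
        additive_comp[OF X.pairingD(2)[OF Y.pa] additive_comp[OF X.additive_lact_ring X.pairingD(3)[OF X.pa]]]) simp_all
  show "tsum B V (term4 (ract M m r) m') = tsum B V (term4 m (lact M' r m'))"
    if "m \<in> carrier M" "r \<in> carrier B" "m' \<in> carrier M'" for m r m'
    unfolding term4_def
    by (rule tsum_cong[OF oV]) (use that in \<open>simp add: X.pairingD(5,6)[OF X.pa] X.pairingD(6)[OF Y.pa] X.lact_mult\<close>)
qed

lemma pair2_additive_left: "V \<in> carrier Q.bt.T \<Longrightarrow> additive P.bt.T B (\<lambda>U. pair2 U V)"
  unfolding pair2_def by (rule P.bt.tsum_additive[OF abB bal_outer])

lemma pair2_additive_right: "U \<in> carrier P.bt.T \<Longrightarrow> additive Q.bt.T B (\<lambda>V. pair2 U V)"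
  unfolding pair2_def
  by (rule additive_tsum_fun[OF abB P.bt.over_T], assumption) (rule Q.bt.tsum_additive[OF abB bal_inner])

lemma pair2_te:
  assumes "m \<in> carrier M" "m' \<in> carrier M'" "n' \<in> carrier N'" "n \<in> carrier N"
  shows "pair2 (P.bt.te m m') (Q.bt.te n' n) = term4 m m' n' n"
  unfolding pair2_def using assms
  by (simp add: P.bt.tsum_te[OF abB bal_outer[OF Q.bt.te_closed]] Q.bt.tsum_te[OF abB bal_inner])

text \<open>Biadditive maps on a product of two tensor products are determined on generators.\<close>

lemma biadditive_eqI:
  assumes "\<And>V. V \<in> carrier Q.bt.T \<Longrightarrow> additive P.bt.T G (\<lambda>U. f U V)" "\<And>U. U \<in> carrier P.bt.T \<Longrightarrow> additive Q.bt.T G (f U)"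
    and "\<And>V. V \<in> carrier Q.bt.T \<Longrightarrow> additive P.bt.T G (\<lambda>U. g U V)" "\<And>U. U \<in> carrier P.bt.T \<Longrightarrow> additive Q.bt.T G (g U)"
    and eq: "\<And>m m' n' n. m \<in> carrier M \<Longrightarrow> m' \<in> carrier M' \<Longrightarrow> n' \<in> carrier N' \<Longrightarrow> n \<in> carrier N \<Longrightarrow>
      f (P.bt.te m m') (Q.bt.te n' n) = g (P.bt.te m m') (Q.bt.te n' n)"
    and U: "U \<in> carrier P.bt.T" and V: "V \<in> carrier Q.bt.T"
  shows "f U V = g U V"
proof (rule P.bt.additive_eqI[OF assms(1)[OF V] assms(3)[OF V] U])
  fix m m' assume m: "m \<in> carrier M" "m' \<in> carrier M'"
  note c = P.bt.te_closed[OF m]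
  show "f (P.bt.te m m') V = g (P.bt.te m m') V"
    by (rule Q.bt.additive_eqI[OF assms(2)[OF c] assms(4)[OF c] V]) (rule eq[OF m])
qed

lemma pairing2: "X.pairing PP QQ pair2"
proof -
  note pl = pair2_additive_left and pr = pair2_additive_right
  note cl = additive_closed[OF P.lact_additive] additive_closed[OF P.ract_additive]
    additive_closed[OF Q.lact_additive] additive_closed[OF Q.ract_additive]
  have bal: "pair2 (ract PP U c) V = pair2 U (lact QQ c V)"
    if "U \<in> carrier P.bt.T" "c \<in> carrier B" "V \<in> carrier Q.bt.T" for U V c
    using that(1,3)
  proof (rule biadditive_eqI[rotated -2])
    show "additive P.bt.T B (\<lambda>U. pair2 (ract PP U c) V)" if "V \<in> carrier Q.bt.T" for V
      by (rule additive_comp[OF P.ract_additive pl]) (use that \<open>c \<in> carrier B\<close> in simp_all)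
    show "additive Q.bt.T B (pair2 (ract PP U c))" if "U \<in> carrier P.bt.T" for U
      by (rule pr) (rule cl(2)[OF \<open>c \<in> carrier B\<close> that])
    show "additive P.bt.T B (\<lambda>U. pair2 U (lact QQ c V))" if "V \<in> carrier Q.bt.T" for V
      by (rule pl) (rule cl(3)[OF \<open>c \<in> carrier B\<close> that])
    show "additive Q.bt.T B (\<lambda>V. pair2 U (lact QQ c V))" if "U \<in> carrier P.bt.T" for U
      by (rule additive_comp[OF Q.lact_additive pr]) (use that \<open>c \<in> carrier B\<close> in simp_all)
    fix m m' n' n assume *: "m \<in> carrier M" "m' \<in> carrier M'" "n' \<in> carrier N'" "n \<in> carrier N"
    show "pair2 (ract PP (P.bt.te m m') c) (Q.bt.te n' n) = pair2 (P.bt.te m m') (lact QQ c (Q.bt.te n' n))"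
      using * \<open>c \<in> carrier B\<close> by (simp add: P.ract_te Q.lact_te pair2_te term4_def X.pairingD(5)[OF Y.pa])
  qed
  have left: "pair2 (lact PP c U) V = c \<otimes> pair2 U V"
    if "U \<in> carrier P.bt.T" "c \<in> carrier B" "V \<in> carrier Q.bt.T" for U V c
    using that(1,3)
  proof (rule biadditive_eqI[rotated -2])
    show "additive P.bt.T B (\<lambda>U. pair2 (lact PP c U) V)" if "V \<in> carrier Q.bt.T" for V
      by (rule additive_comp[OF P.lact_additive pl]) (use that \<open>c \<in> carrier B\<close> in simp_all)
    show "additive Q.bt.T B (pair2 (lact PP c U))" if "U \<in> carrier P.bt.T" for U
      by (rule pr) (rule cl(1)[OF \<open>c \<in> carrier B\<close> that])
    show "additive P.bt.T B (\<lambda>U. c \<otimes> pair2 U V)" if "V \<in> carrier Q.bt.T" for V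
      by (rule additive_comp[OF pl[OF that] X.additive_mult_left[OF \<open>c \<in> carrier B\<close>]])
    show "additive Q.bt.T B (\<lambda>V. c \<otimes> pair2 U V)" if "U \<in> carrier P.bt.T" for U
      by (rule additive_comp[OF pr[OF that] X.additive_mult_left[OF \<open>c \<in> carrier B\<close>]])
    fix m m' n' n assume *: "m \<in> carrier M" "m' \<in> carrier M'" "n' \<in> carrier N'" "n \<in> carrier N"
    show "pair2 (lact PP c (P.bt.te m m')) (Q.bt.te n' n) = c \<otimes> pair2 (P.bt.te m m') (Q.bt.te n' n)"
      using * \<open>c \<in> carrier B\<close> by (simp add: P.lact_te pair2_te term4_def X.pairingD(6)[OF X.pa])
  qed
  have right: "pair2 U (ract QQ V c) = pair2 U V \<otimes> c"
    if "U \<in> carrier P.bt.T" "c \<in> carrier B" "V \<in> carrier Q.bt.T" for U V c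
    using that(1,3)
  proof (rule biadditive_eqI[rotated -2])
    show "additive P.bt.T B (\<lambda>U. pair2 U (ract QQ V c))" if "V \<in> carrier Q.bt.T" for V
      by (rule pl) (rule cl(4)[OF \<open>c \<in> carrier B\<close> that])
    show "additive Q.bt.T B (\<lambda>V. pair2 U (ract QQ V c))" if "U \<in> carrier P.bt.T" for U
      by (rule additive_comp[OF Q.ract_additive pr]) (use that \<open>c \<in> carrier B\<close> in simp_all)
    show "additive P.bt.T B (\<lambda>U. pair2 U V \<otimes> c)" if "V \<in> carrier Q.bt.T" for V
      by (rule additive_comp[OF pl[OF that] X.additive_mult_right[OF \<open>c \<in> carrier B\<close>]])
    show "additive Q.bt.T B (\<lambda>V. pair2 U V \<otimes> c)" if "U \<in> carrier P.bt.T" for U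
      by (rule additive_comp[OF pr[OF that] X.additive_mult_right[OF \<open>c \<in> carrier B\<close>]])
    fix m m' n' n assume *: "m \<in> carrier M" "m' \<in> carrier M'" "n' \<in> carrier N'" "n \<in> carrier N"
    show "pair2 (P.bt.te m m') (ract QQ (Q.bt.te n' n) c) = pair2 (P.bt.te m m') (Q.bt.te n' n) \<otimes> c"
      using * \<open>c \<in> carrier B\<close> by (simp add: Q.ract_te pair2_te term4_def X.lact_ract[symmetric] X.pairingD(7)[OF X.pa])
  qed
  show ?thesis
    unfolding X.pairing_def balanced_def using pl pr bal left right by simp
qed

sublocale R: bpair k B PP QQ by (rule X.bpairI[OF P.bim_MN Q.bim_MN])

definition unit2 where
  "unit2 = tsum R.bt.T s (\<lambda>m n. tsum R.bt.T s' (\<lambda>m' n'. R.bt.te (P.bt.te m m') (Q.bt.te n' n)))"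

lemma unit2_closed: "unit2 \<in> carrier R.bt.T"
  unfolding unit2_def
  by (intro tsum_closed[OF R.bt.abelian_T X.over_s] tsum_closed[OF R.bt.abelian_T Y.over_s] R.bt.te_closed)
    (simp_all add: P.bt.te_closed Q.bt.te_closed)

lemma unit2_value: "tsum B unit2 pair2 = \<one>"
proof -
  note bal = X.pairingD(1)[OF pairing2]
  note add = R.bt.tsum_additive[OF abB bal] and teq = R.bt.tsum_te[OF abB bal]
  have cl: "R.bt.te (P.bt.te m m') (Q.bt.te n' n) \<in> carrier R.bt.T"
    if "m \<in> carrier M" "m' \<in> carrier M'" "n' \<in> carrier N'" "n \<in> carrier N" for m m' n' n
    using that by (intro R.bt.te_closed) (simp_all add: P.bt.te_closed Q.bt.te_closed)
  have "tsum B unit2 pair2 = tsum B s (\<lambda>m n. tsum B (tsum R.bt.T s' (\<lambda>m' n'. R.bt.te (P.bt.te m m') (Q.bt.te n' n))) pair2)"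
    unfolding unit2_def
    by (rule tsum_hom[OF add R.bt.abelian_T abB X.over_s]) (rule tsum_closed[OF R.bt.abelian_T Y.over_s cl])
  also have "\<dots> = tsum B s a"
  proof (rule tsum_cong[OF X.over_s])
    fix m n assume m: "m \<in> carrier M" and n: "n \<in> carrier N"
    have "tsum B (tsum R.bt.T s' (\<lambda>m' n'. R.bt.te (P.bt.te m m') (Q.bt.te n' n))) pair2 =
        tsum B s' (\<lambda>m' n'. tsum B (R.bt.te (P.bt.te m m') (Q.bt.te n' n)) pair2)"
      by (rule tsum_hom[OF add R.bt.abelian_T abB Y.over_s]) (simp add: cl m n)
    also have "\<dots> = tsum B s' (\<lambda>m' n'. a m (lact N (a' m' n') n))"
      by (rule tsum_cong[OF Y.over_s]) (simp add: teq P.bt.te_closed Q.bt.te_closed m n pair2_te term4_def)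
    also have "\<dots> = a m (lact N (tsum B s' a') n)"
      by (rule tsum_hom[OF additive_comp[OF X.additive_lact_ring X.pairingD(3)[OF X.pa]] abB abB Y.over_s, symmetric])
        (simp_all add: m n)
    finally show "tsum B (tsum R.bt.T s' (\<lambda>m' n'. R.bt.te (P.bt.te m m') (Q.bt.te n' n))) pair2 = a m n"
      by (simp add: Y.s(2) n)
  qed
  finally show ?thesis by (simp add: X.s(2))
qed

text \<open>Exchanging the roles of the two modules reverses the order of the factors. It transfers every
  statement about one pairing of the product context to the other pairing.\<close>

lemma tensor_flip: "context_tensor k B N' M' b' a' t' s' N M b a t s"
  by (rule context_tensor.intro[OF Y.flip X.flip])

end

lemma (in context_tensor) pair2_assoc:
  assumes U: "U \<in> carrier P.bt.T" and V: "V \<in> carrier Q.bt.T" and W: "W \<in> carrier P.bt.T"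
  shows "lact PP (pair2 U V) W = ract PP U (context_tensor.pair2 B M' b' b V W)"
proof -
  interpret f: context_tensor k B N' M' b' a' t' s' N M b a t s by (rule tensor_flip)
  have pc: "pair2 U V \<in> carrier B" if "U \<in> carrier P.bt.T" "V \<in> carrier Q.bt.T" for U V
    using additive_closed[OF pair2_additive_left] that by simp
  have fc: "f.pair2 V U \<in> carrier B" if "U \<in> carrier P.bt.T" "V \<in> carrier Q.bt.T" for U V
    using additive_closed[OF f.pair2_additive_left] that by simp
  have ring_lact: "additive B P.bt.T (\<lambda>c. lact PP c W)" if "W \<in> carrier P.bt.T" for W
    using X.additive_lact_ring[OF P.bim_MN, of W] that by simp
  have ring_ract: "additive B P.bt.T (\<lambda>c. ract PP W c)" if "W \<in> carrier P.bt.T" for W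
    using X.additive_ract_ring[OF P.bim_MN, of W] that by simp
  have gen: "lact PP (pair2 (P.bt.te m m') (Q.bt.te n' n)) (P.bt.te p p') =
      ract PP (P.bt.te m m') (f.pair2 (Q.bt.te n' n) (P.bt.te p p'))"
    if "m \<in> carrier M" "m' \<in> carrier M'" "n' \<in> carrier N'" "n \<in> carrier N" "p \<in> carrier M" "p' \<in> carrier M'"
    for m m' n' n p p'
  proof -
    have "lact M (a m (lact N (a' m' n') n)) p = ract M m (a' m' n' \<otimes> b n p)"
      using that by (simp add: X.ab X.pairingD(6)[OF X.pb])
    then have "P.bt.te (lact M (a m (lact N (a' m' n') n)) p) p' = P.bt.te m (lact M' (a' m' n' \<otimes> b n p) p')"
      using that by (simp add: P.bt.te_balanced)
    also have "\<dots> = P.bt.te m (ract M' m' (b' n' (lact M' (b n p) p')))"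
      using that by (simp add: X.lact_mult[OF Y.bim_M] Y.ab)
    finally show ?thesis
      using that by (simp add: pair2_te f.pair2_te term4_def f.term4_def P.lact_te P.ract_te)
  qed
  have "lact PP (pair2 U V) (P.bt.te p p') = ract PP U (f.pair2 V (P.bt.te p p'))"
    if p: "p \<in> carrier M" "p' \<in> carrier M'" for p p'
    using U V
  proof (rule biadditive_eqI[rotated -2])
    note tc = P.bt.te_closed[OF p]
    show "additive P.bt.T P.bt.T (\<lambda>U. lact PP (pair2 U V) (P.bt.te p p'))" if "V \<in> carrier Q.bt.T" for V
      by (rule additive_comp[OF pair2_additive_left[OF that] ring_lact[OF tc]])
    show "additive Q.bt.T P.bt.T (\<lambda>V. lact PP (pair2 U V) (P.bt.te p p'))" if "U \<in> carrier P.bt.T" for U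
      by (rule additive_comp[OF pair2_additive_right[OF that] ring_lact[OF tc]])
    show "additive P.bt.T P.bt.T (\<lambda>U. ract PP U (f.pair2 V (P.bt.te p p')))" if "V \<in> carrier Q.bt.T" for V
      by (rule P.ract_additive[OF fc[OF tc that]])
    show "additive Q.bt.T P.bt.T (\<lambda>V. ract PP U (f.pair2 V (P.bt.te p p')))" if "U \<in> carrier P.bt.T" for U
      by (rule additive_comp[OF f.pair2_additive_left[OF tc] ring_ract[OF that]])
  qed (rule gen[OF _ _ _ _ p])
  then show ?thesis
    by (rule P.bt.additive_eqI[OF P.lact_additive[OF pc[OF U V]]
          additive_comp[OF f.pair2_additive_right[OF V] ring_ract[OF U]] W])
qed

context context_tensor
begin

lemma tensor_context:
  "context_pairings k B PP QQ pair2 (context_tensor.pair2 B M' b' b) unit2 (context_tensor.unit2 B N' M' t' N M t)"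
proof -
  interpret f: context_tensor k B N' M' b' a' t' s' N M b a t s by (rule tensor_flip)
  show ?thesis
  proof (intro context_pairings.intro[OF X.kalg_axioms] context_pairings_axioms.intro P.bim_MN Q.bim_MN pairing2 f.pairing2)
    show "unit2 \<in> carrier (btens B PP QQ)" by (simp add: unit2_closed)
    show "f.unit2 \<in> carrier (btens B QQ PP)" by (simp add: f.unit2_closed)
  qed (use unit2_value f.unit2_value pair2_assoc f.pair2_assoc in simp_all)
qed

lemma XI_tensor:
  assumes x: "x \<in> X.ZC"
  shows "context_pairings.XI B PP x = X.XI (Y.XI x)"
proof -
  interpret T: context_pairings k B PP QQ pair2 "context_tensor.pair2 B M' b' b" unit2 "context_tensor.unit2 B N' M' t' N M t"
    by (rule tensor_context)
  have c: "X.XI (Y.XI x) \<in> X.ZC" using x by simp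
  show ?thesis
  proof (rule T.XI_eqI[OF x c])
    fix U assume "U \<in> carrier PP"
    then have U: "U \<in> carrier P.bt.T" by simp
    show "ract PP U x = lact PP (X.XI (Y.XI x)) U"
    proof (rule P.bt.additive_eqI[OF P.ract_additive P.lact_additive U])
      fix m m' assume m: "m \<in> carrier M" "m' \<in> carrier M'"
      have "P.bt.te m (ract M' m' x) = P.bt.te (ract M m (Y.XI x)) m'"
        using m x by (simp add: Y.XI_act P.bt.te_balanced)
      then show "ract PP (P.bt.te m m') x = lact PP (X.XI (Y.XI x)) (P.bt.te m m')"
        using m x c by (simp add: P.ract_te P.lact_te X.XI_act)
    qed (use x c in simp_all)
  qed
qed

end

subsection \<open>Isomorphisms and representatives\<close>

context kalg
begin

lemma bimod_isoD:
  assumes "f \<in> bimod_iso k B M N"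
  shows "additive M N f" "bij_betw f (carrier M) (carrier N)"
    "\<And>b x. b \<in> carrier B \<Longrightarrow> x \<in> carrier M \<Longrightarrow> f (lact M b x) = lact N b (f x)"
    "\<And>b x. b \<in> carrier B \<Longrightarrow> x \<in> carrier M \<Longrightarrow> f (ract M x b) = ract N (f x) b"
    "\<And>c x. c \<in> carrier k \<Longrightarrow> x \<in> carrier M \<Longrightarrow> f (c \<odot>\<^bsub>M\<^esub> x) = c \<odot>\<^bsub>N\<^esub> f x"
  using assms by (simp_all add: bimod_iso_def linear_maps_def additive_def)

lemma bimod_isoI:
  assumes "additive M N f" "bij_betw f (carrier M) (carrier N)"
    "\<And>b x. b \<in> carrier B \<Longrightarrow> x \<in> carrier M \<Longrightarrow> f (lact M b x) = lact N b (f x)"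
    "\<And>b x. b \<in> carrier B \<Longrightarrow> x \<in> carrier M \<Longrightarrow> f (ract M x b) = ract N (f x) b"
    "\<And>c x. c \<in> carrier k \<Longrightarrow> x \<in> carrier M \<Longrightarrow> f (c \<odot>\<^bsub>M\<^esub> x) = c \<odot>\<^bsub>N\<^esub> f x"
  shows "f \<in> bimod_iso k B M N"
  using assms(1,2) unfolding bimod_iso_def linear_maps_def additive_def
  by (simp add: assms(3-5))

text \<open>The translation between the maps \<open>alpha\<close>, \<open>beta\<close> of a context and their pairings.\<close>

lemma pairing_of_map:
  assumes M: "bim M" and N: "bim N" and f: "f \<in> bimod_iso k B (btens B M N) (regular_bimod B)"
  shows "pairing M N (\<lambda>m n. f (btens_elem B M N m n))"
    and "\<And>X. X \<in> carrier (btens B M N) \<Longrightarrow> f X = tsum B X (\<lambda>m n. f (btens_elem B M N m n))"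
    and "\<exists>s\<in>carrier (btens B M N). f s = \<one>"
proof -
  interpret MN: bpair k B M N by (rule bpairI[OF M N])
  have fa: "additive MN.bt.T B f"
    using bimod_isoD(1)[OF f] by (simp add: additive_def additive_maps_def)
  have te: "additive M MN.bt.T (\<lambda>x. MN.bt.te x y)" if "y \<in> carrier N" for y
    using MN.bt.bal_te that by (simp add: balanced_def)
  have te': "additive N MN.bt.T (MN.bt.te x)" if "x \<in> carrier M" for x
    using MN.bt.bal_te that by (simp add: balanced_def)
  have bal: "MN.bt.bal B (\<lambda>m n. f (MN.bt.te m n))"
    by (rule balancedI)
      (simp_all add: additive_comp[OF te fa] additive_comp[OF te' fa] MN.bt.te_balanced)
  show "pairing M N (\<lambda>m n. f (btens_elem B M N m n))"
    unfolding pairing_def MN.btens_elem_eq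
  proof (intro conjI ballI bal)
    fix b x y assume *: "b \<in> carrier B" "x \<in> carrier M" "y \<in> carrier N"
    note c = MN.bt.te_closed[OF *(2,3)]
    show "f (MN.bt.te (lact M b x) y) = b \<otimes> f (MN.bt.te x y)"
      using bimod_isoD(3)[OF f *(1), of "MN.bt.te x y"] * c by (simp add: MN.lact_te)
    show "f (MN.bt.te x (ract N y b)) = f (MN.bt.te x y) \<otimes> b"
      using bimod_isoD(4)[OF f *(1), of "MN.bt.te x y"] * c by (simp add: MN.ract_te)
  qed
  show "f X = tsum B X (\<lambda>m n. f (btens_elem B M N m n))" if "X \<in> carrier (btens B M N)" for X
    by (rule MN.bt.additive_eqI[OF fa])
      (use that bal in \<open>simp_all add: MN.bt.tsum_additive[OF B.abelian_group_axioms] MN.bt.tsum_te[OF B.abelian_group_axioms]\<close>)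
  have "f ` carrier MN.MN = carrier B" using bimod_isoD(2)[OF f] by (simp add: bij_betw_def)
  then show "\<exists>s\<in>carrier (btens B M N). f s = \<one>" using B.one_closed by (metis imageE)
qed

abbreviation "pA X \<equiv> \<lambda>m n. alpha X (btens_elem B (modM X) (modN X) m n)"
abbreviation "pB X \<equiv> \<lambda>n m. beta X (btens_elem B (modN X) (modM X) n m)"

lemma strict_context:
  assumes X: "strict_morita k B X"
  obtains s t where "context_pairings k B (modM X) (modN X) (pA X) (pB X) s t"
proof -
  have M: "bim (modM X)" and N: "bim (modN X)"
    and f: "alpha X \<in> bimod_iso k B (btens B (modM X) (modN X)) (regular_bimod B)"
    and g: "beta X \<in> bimod_iso k B (btens B (modN X) (modM X)) (regular_bimod B)"
    using X unfolding strict_morita_def Let_def by blast+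
  obtain s t where st: "s \<in> carrier (btens B (modM X) (modN X))" "alpha X s = \<one>"
    "t \<in> carrier (btens B (modN X) (modM X))" "beta X t = \<one>"
    using pairing_of_map(3)[OF M N f] pairing_of_map(3)[OF N M g] by blast
  have "context_pairings k B (modM X) (modN X) (pA X) (pB X) s t"
  proof (intro context_pairings.intro[OF kalg_axioms] context_pairings_axioms.intro M N st(1,3)
      pairing_of_map(1)[OF M N f] pairing_of_map(1)[OF N M g])
    show "tsum B s (pA X) = \<one>" using pairing_of_map(2)[OF M N f st(1)] st(2) by simp
    show "tsum B t (pB X) = \<one>" using pairing_of_map(2)[OF N M g st(3)] st(4) by simp
  qed (use X in \<open>simp_all only: strict_morita_def Let_def\<close>)
  then show ?thesis by (rule that)
qed

lemma strict_alpha: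
  assumes "strict_morita k B X" "T \<in> carrier (btens B (modM X) (modN X))"
  shows "alpha X T = tsum B T (pA X)"
  using assms unfolding strict_morita_def Let_def by (intro pairing_of_map(2)) blast+

lemma strict_beta:
  assumes "strict_morita k B X" "T \<in> carrier (btens B (modN X) (modM X))"
  shows "beta X T = tsum B T (pB X)"
  using assms unfolding strict_morita_def Let_def by (intro pairing_of_map(2)) blast+

lemma morita_iso_refl:
  assumes X: "strict_morita k B X"
  shows "morita_iso k B X X"
proof -
  obtain s t where "context_pairings k B (modM X) (modN X) (pA X) (pB X) s t" by (rule strict_context[OF X])
  then interpret c: context_pairings k B "modM X" "modN X" "pA X" "pB X" s t .
  have id: "(\<lambda>x. x) \<in> bimod_iso k B M M" for M :: "('k, 'z, 'b) bimod"
    by (rule bimod_isoI) (simp_all add: additive_id bij_betw_def)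
  show ?thesis
    unfolding morita_iso_def
    by (intro bexI[OF _ id] conjI ballI)
      (simp_all add: c.MN.tsum_MN c.NM.tsum_MN c.MN.bt.tsum_self c.NM.bt.tsum_self)
qed

text \<open>An isomorphism intertwines the left and the right actions that define \<open>\<xi>\<close>.\<close>

lemma xi_iso:
  assumes X: "strict_morita k B X" and Y: "strict_morita k B Y" and iso: "morita_iso k B X Y" and x: "x \<in> ZC"
  shows "xi B X x = xi B Y x"
proof -
  obtain s t where "context_pairings k B (modM X) (modN X) (pA X) (pB X) s t" by (rule strict_context[OF X])
  then interpret c: context_pairings k B "modM X" "modN X" "pA X" "pB X" s t .
  obtain s' t' where "context_pairings k B (modM Y) (modN Y) (pA Y) (pB Y) s' t'" by (rule strict_context[OF Y])
  then interpret d: context_pairings k B "modM Y" "modN Y" "pA Y" "pB Y" s' t' .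
  obtain f where f: "f \<in> bimod_iso k B (modM X) (modM Y)" using iso unfolding morita_iso_def by blast
  have "d.XI x = c.XI x"
  proof (rule d.XI_eqI[OF x c.XI_closed[OF x]])
    fix m' assume "m' \<in> carrier (modM Y)"
    then obtain m where m: "m \<in> carrier (modM X)" "m' = f m"
      using bimod_isoD(2)[OF f] by (auto simp: bij_betw_def)
    show "ract (modM Y) m' x = lact (modM Y) (c.XI x) m'"
      using c.XI_act[OF x m(1)] bimod_isoD(4)[OF f ZC_B[OF x] m(1)]
        bimod_isoD(3)[OF f ZC_B[OF c.XI_closed[OF x]] m(1)] m(2) by simp
  qed
  then show ?thesis by (simp add: c.xi_eq_XI d.xi_eq_XI)
qed

lemma unit_context:
  "\<exists>s t. context_pairings k B (regular_bimod B) (regular_bimod B) (mult B) (mult B) s t"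
proof -
  interpret R: bpair k B "regular_bimod B" "regular_bimod B" by (rule bpairI[OF regular_bim regular_bim])
  have bal: "R.bt.bal B (mult B)"
    by (rule balancedI)
      (simp_all add: additive_def additive_maps_def Pi_def B.l_distr B.r_distr B.m_assoc)
  have p: "pairing (regular_bimod B) (regular_bimod B) (mult B)"
    unfolding pairing_def using bal by (simp add: B.m_assoc)
  have "tsum B (R.bt.te \<one> \<one>) (mult B) = \<one>"
    using R.bt.tsum_te[OF B.abelian_group_axioms bal, of "\<one>" "\<one>"] by simp
  moreover have "R.bt.te \<one> \<one> \<in> carrier R.MN" using R.bt.te_closed[of "\<one>" "\<one>"] by simp
  ultimately have "context_pairings k B (regular_bimod B) (regular_bimod B) (mult B) (mult B)
      (R.bt.te \<one> \<one>) (R.bt.te \<one> \<one>)"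
    by (intro context_pairings.intro[OF kalg_axioms] context_pairings_axioms.intro regular_bim p)
      (simp_all add: B.m_assoc)
  then show ?thesis by blast
qed

lemma strict_unit: "strict_morita k B (morita_unit B)"
  and xi_unit: "x \<in> ZC \<Longrightarrow> xi B (morita_unit B) x = x"
proof -
  obtain s t where "context_pairings k B (regular_bimod B) (regular_bimod B) (mult B) (mult B) s t"
    using unit_context by blast
  then interpret c: context_pairings k B "regular_bimod B" "regular_bimod B" "mult B" "mult B" s t .
  show "strict_morita k B (morita_unit B)"
    unfolding morita_unit_def by (rule c.strict) simp_all
  have m: "modM (morita_unit B) = regular_bimod B" by (simp add: morita_unit_def)
  show "xi B (morita_unit B) x = x" if x: "x \<in> ZC"
    unfolding c.xi_eq_XI[OF m] by (rule c.XI_eqI[OF x x]) (simp add: ZC_comm[OF x])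
qed

lemma strict_tensor:
  assumes X: "strict_morita k B X" and Y: "strict_morita k B Y"
  shows "strict_morita k B (morita_tensor B X Y)"
    and "x \<in> ZC \<Longrightarrow> xi B (morita_tensor B X Y) x = xi B X (xi B Y x)"
proof -
  obtain s t where c: "context_pairings k B (modM X) (modN X) (pA X) (pB X) s t" by (rule strict_context[OF X])
  obtain s' t' where d: "context_pairings k B (modM Y) (modN Y) (pA Y) (pB Y) s' t'" by (rule strict_context[OF Y])
  interpret T: context_tensor k B "modM X" "modN X" "pA X" "pB X" s t "modM Y" "modN Y" "pA Y" "pB Y" s' t'
    by (rule context_tensor.intro[OF c d])
  interpret f: context_tensor k B "modN Y" "modM Y" "pB Y" "pA Y" t' s' "modN X" "modM X" "pB X" "pA X" t s
    by (rule T.tensor_flip)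
  interpret S: context_pairings k B T.PP T.QQ T.pair2 f.pair2 T.unit2 f.unit2 by (rule T.tensor_context)
  have a: "alpha (morita_tensor B X Y) = (\<lambda>Z. tsum B Z T.pair2)"
    unfolding T.pair2_def[abs_def] T.term4_def[abs_def] by (simp only: morita_tensor_def Let_def morita.simps)
  have b: "beta (morita_tensor B X Y) = (\<lambda>Z. tsum B Z f.pair2)"
    unfolding f.pair2_def[abs_def] f.term4_def[abs_def] by (simp only: morita_tensor_def Let_def morita.simps)
  have m: "morita_tensor B X Y = \<lparr>modM = T.PP, modN = T.QQ, alpha = alpha (morita_tensor B X Y),
      beta = beta (morita_tensor B X Y)\<rparr>"
    by (simp add: morita_tensor_def Let_def)
  show "strict_morita k B (morita_tensor B X Y)"
    by (subst m, rule S.strict) (simp_all add: a b)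
  have "modM (morita_tensor B X Y) = T.PP" by (subst m) simp
  then show "xi B (morita_tensor B X Y) x = xi B X (xi B Y x)" if "x \<in> ZC"
    using T.XI_tensor[OF that] by (simp add: S.xi_eq_XI T.X.xi_eq_XI T.Y.xi_eq_XI)
qed

end

definition transport_bimod :: "('m \<Rightarrow> 'm2) \<Rightarrow> ('k, 'm, 'b) bimod \<Rightarrow> ('k, 'm2, 'b) bimod" where
  "transport_bimod j M = (let g = inv_into (carrier M) j in
    \<lparr>carrier = j ` carrier M, mult = undefined, one = undefined, zero = j \<zero>\<^bsub>M\<^esub>,
     add = (\<lambda>u v. j (g u \<oplus>\<^bsub>M\<^esub> g v)), smult = (\<lambda>c u. j (c \<odot>\<^bsub>M\<^esub> g u)),
     lact = (\<lambda>b u. j (lact M b (g u))), ract = (\<lambda>u b. j (ract M (g u) b))\<rparr>)"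

context kalg
begin

lemma transport:
  assumes M: "bim M" and j: "inj_on j (carrier M)"
  shows "bim (transport_bimod j M)" "j \<in> bimod_iso k B M (transport_bimod j M)"
    "carrier (transport_bimod j M) = j ` carrier M"
    "additive (transport_bimod j M) M (inv_into (carrier M) j)"
proof -
  interpret M: module k M by (rule bim_module[OF M])
  let ?M = "transport_bimod j M" and ?g = "inv_into (carrier M) j"
  have g [simp]: "?g (j x) = x" if "x \<in> carrier M" for x using j that by simp
  have c [simp]: "carrier ?M = j ` carrier M" and z: "\<zero>\<^bsub>?M\<^esub> = j \<zero>\<^bsub>M\<^esub>" by (simp_all add: transport_bimod_def Let_def)
  have ops: "u \<oplus>\<^bsub>?M\<^esub> v = j (?g u \<oplus>\<^bsub>M\<^esub> ?g v)" "a \<odot>\<^bsub>?M\<^esub> u = j (a \<odot>\<^bsub>M\<^esub> ?g u)"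
    "lact ?M e u = j (lact M e (?g u))" "ract ?M u e = j (ract M (?g u) e)" for u v a e
    by (simp_all add: transport_bimod_def Let_def)
  note [simp] = M lact_add[OF M] ract_add[OF M] lact_add_ring[OF M] ract_add_ring[OF M] lact_mult[OF M] ract_mult[OF M]
    lact_ract[OF M]
  have ab: "abelian_group ?M"
  proof (rule abelian_groupI)
    fix x assume "x \<in> carrier ?M"
    then obtain u where u: "x = j u" "u \<in> carrier M" by auto
    show "\<exists>y\<in>carrier ?M. y \<oplus>\<^bsub>?M\<^esub> x = \<zero>\<^bsub>?M\<^esub>"
    proof -
      from u have "j (\<ominus>\<^bsub>M\<^esub> u) \<oplus>\<^bsub>?M\<^esub> x = \<zero>\<^bsub>?M\<^esub>" by (simp add: ops z M.M.l_neg)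
      then show ?thesis using u by auto
    qed
  qed (auto simp: ops z M.M.a_ac)
  have mod: "module k ?M"
    by (rule moduleI[OF cring_k ab]) (auto simp: ops M.smult_l_distr M.smult_r_distr M.smult_assoc1)
  show "bim ?M"
    by (rule bimoduleI[OF mod]) (auto simp: ops smult_lact[OF M, symmetric] smult_ract[OF M, symmetric])
  show "carrier ?M = j ` carrier M" by simp
  show "j \<in> bimod_iso k B M ?M"
    by (rule bimod_isoI) (auto intro!: additiveI simp: ops j bij_betw_def)
  show "additive ?M M ?g"
    by (rule additiveI) (auto simp: ops)
qed

end

context context_pairings
begin

text \<open>An element \<open>m\<close> is determined by the finitely many values \<open>a(m, n\<^sub>i)\<close>, where \<open>t = \<Sum> n\<^sub>i \<otimes> m\<^sub>i\<close>.\<close>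

lemma embedding_exists: "\<exists>j :: 'm \<Rightarrow> nat \<Rightarrow> 'b. inj_on j (carrier M)"
proof -
  let ?K = "fst ` Poly_Mapping.keys (rep t)"
  obtain h where h: "bij_betw h {0..<card ?K} ?K"
    using ex_bij_betw_nat_finite[of ?K] by auto
  define j where "j = (\<lambda>m i. if i < card ?K then a m (h i) else undefined)"
  have "inj_on j (carrier M)"
  proof (rule inj_onI)
    fix m m' assume m: "m \<in> carrier M" "m' \<in> carrier M" and eq: "j m = j m'"
    have K: "a m n = a m' n" if n: "n \<in> ?K" for n
    proof -
      have "n \<in> h ` {0..<card ?K}" using h n by (simp only: bij_betw_def)
      then obtain i where i: "i < card ?K" "n = h i" by auto
      then show ?thesis using fun_cong[OF eq, of i] by (simp add: j_def)
    qed
    have ov: "over ?K (snd ` Poly_Mapping.keys (rep t)) t"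
      unfolding over_def by (auto simp: image_iff) force+
    have "tsum M t (\<lambda>n' m'. lact M (a m n') m') = tsum M t (\<lambda>n' m''. lact M (a m' n') m'')"
      by (rule tsum_cong[OF ov]) (simp only: K)
    then show "m = m'" using expand_M'[OF m(1)] expand_M'[OF m(2)] by simp
  qed
  then show ?thesis by blast
qed

lemma transported_context:
  assumes j: "inj_on j (carrier M)" and l: "inj_on l (carrier N)"
  shows "\<exists>s' t'. context_pairings k B (transport_bimod j M) (transport_bimod l N)
      (\<lambda>u v. a (inv_into (carrier M) j u) (inv_into (carrier N) l v))
      (\<lambda>v u. b (inv_into (carrier N) l v) (inv_into (carrier M) j u)) s' t'"
proof -
  let ?M = "transport_bimod j M" and ?N = "transport_bimod l N"
  let ?g = "inv_into (carrier M) j" and ?h = "inv_into (carrier N) l"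
  let ?a = "\<lambda>u v. a (?g u) (?h v)" and ?b = "\<lambda>v u. b (?h v) (?g u)"
  note tM = transport[OF bim_M j] and tN = transport[OF bim_N l]
  have g [simp]: "?g (j x) = x" if "x \<in> carrier M" for x using j that by simp
  have h [simp]: "?h (l x) = x" if "x \<in> carrier N" for x using l that by simp
  have opsM: "lact ?M e u = j (lact M e (?g u))" "ract ?M u e = j (ract M (?g u) e)" for e u
    by (simp_all add: transport_bimod_def Let_def)
  have opsN: "lact ?N e u = l (lact N e (?h u))" "ract ?N u e = l (ract N (?h u) e)" for e u
    by (simp_all add: transport_bimod_def Let_def)
  have gc [simp]: "?g u \<in> carrier M" if "u \<in> carrier ?M" for u using additive_closed[OF tM(4) that] .
  have hc [simp]: "?h u \<in> carrier N" if "u \<in> carrier ?N" for u using additive_closed[OF tN(4) that] .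
  interpret P: bpair k B ?M ?N by (rule bpairI[OF tM(1) tN(1)])
  interpret Q: bpair k B ?N ?M by (rule bpairI[OF tN(1) tM(1)])
  have jc [simp]: "j x \<in> carrier ?M" if "x \<in> carrier M" for x using that tM(3) by simp
  have lc [simp]: "l x \<in> carrier ?N" if "x \<in> carrier N" for x using that tN(3) by simp
  have pa': "pairing ?M ?N ?a"
    unfolding pairing_def
  proof (intro conjI ballI balancedI)
    show "additive ?M B (\<lambda>u. ?a u v)" if "v \<in> carrier ?N" for v
      by (rule additive_comp[OF tM(4) pairingD(2)[OF pa]]) (simp add: that)
    show "additive ?N B (?a u)" if "u \<in> carrier ?M" for u
      by (rule additive_comp[OF tN(4) pairingD(3)[OF pa]]) (simp add: that)
  qed (simp_all add: opsM opsN pairingD(5-7)[OF pa])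
  have pb': "pairing ?N ?M ?b"
    unfolding pairing_def
  proof (intro conjI ballI balancedI)
    show "additive ?M B (?b v)" if "v \<in> carrier ?N" for v
      by (rule additive_comp[OF tM(4) pairingD(3)[OF pb]]) (simp add: that)
    show "additive ?N B (\<lambda>v. ?b v u)" if "u \<in> carrier ?M" for u
      by (rule additive_comp[OF tN(4) pairingD(2)[OF pb]]) (simp add: that)
  qed (simp_all add: opsM opsN pairingD(5-7)[OF pb])
  let ?s = "tsum P.bt.T s (\<lambda>m n. P.bt.te (j m) (l n))" and ?t = "tsum Q.bt.T t (\<lambda>n m. Q.bt.te (l n) (j m))"
  have "?s \<in> carrier P.bt.T" by (rule tsum_closed[OF P.bt.abelian_T over_s]) (simp add: P.bt.te_closed)
  moreover have "?t \<in> carrier Q.bt.T" by (rule tsum_closed[OF Q.bt.abelian_T over_t]) (simp add: Q.bt.te_closed)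
  moreover have "tsum B ?s ?a = \<one>"
  proof -
    have "tsum B ?s ?a = tsum B s (\<lambda>m n. ?a (j m) (l n))"
      by (rule P.bt.tsum_tsum_te[OF B.abelian_group_axioms pairingD(1)[OF pa'] over_s]) simp_all
    also have "\<dots> = tsum B s a" by (rule tsum_cong[OF over_s]) simp
    finally show ?thesis by (simp add: s(2))
  qed
  moreover have "tsum B ?t ?b = \<one>"
  proof -
    have "tsum B ?t ?b = tsum B t (\<lambda>n m. ?b (l n) (j m))"
      by (rule Q.bt.tsum_tsum_te[OF B.abelian_group_axioms pairingD(1)[OF pb'] over_t]) simp_all
    also have "\<dots> = tsum B t b" by (rule tsum_cong[OF over_t]) simp
    finally show ?thesis by (simp add: t(2))
  qed
  ultimately have "context_pairings k B ?M ?N ?a ?b ?s ?t"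
    by (intro context_pairings.intro[OF kalg_axioms] context_pairings_axioms.intro tM(1) tN(1) pa' pb')
      (simp_all add: opsM opsN ab ba)
  then show ?thesis by blast
qed

end

context kalg
begin

text \<open>The modules of \<open>X\<close> may have elements of any type. Embed them into sequences and transport the
  structure.\<close>

lemma morita_class_nonempty:
  assumes X: "strict_morita k B X"
  shows "morita_class k B X \<noteq> {}"
proof -
  obtain s t where "context_pairings k B (modM X) (modN X) (pA X) (pB X) s t" by (rule strict_context[OF X])
  then interpret c: context_pairings k B "modM X" "modN X" "pA X" "pB X" s t .
  obtain j :: "_ \<Rightarrow> nat \<Rightarrow> 'b" where j: "inj_on j (carrier (modM X))" using c.embedding_exists by blast
  obtain l :: "_ \<Rightarrow> nat \<Rightarrow> 'b" where l: "inj_on l (carrier (modN X))"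
    using context_pairings.embedding_exists[OF c.flip] by blast
  let ?M = "transport_bimod j (modM X)" and ?N = "transport_bimod l (modN X)"
  let ?g = "inv_into (carrier (modM X)) j" and ?h = "inv_into (carrier (modN X)) l"
  let ?a = "\<lambda>u v. pA X (?g u) (?h v)" and ?b = "\<lambda>v u. pB X (?h v) (?g u)"
  obtain s' t' where "context_pairings k B ?M ?N ?a ?b s' t'" using c.transported_context[OF j l] by blast
  then interpret d: context_pairings k B ?M ?N ?a ?b s' t' .
  define Y where "Y = \<lparr>modM = ?M, modN = ?N, alpha = (\<lambda>T. tsum B T ?a), beta = (\<lambda>T. tsum B T ?b)\<rparr>"
  have Y: "strict_morita k B Y" unfolding Y_def by (rule d.strict) simp_all
  note tM = transport[OF c.bim_M j] and tN = transport[OF c.bim_N l]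
  have ba: "balanced (carrier B) (ract ?M) (lact ?N) ?M ?N B ?a" by (rule pairingD(1)[OF d.pa])
  have bb: "balanced (carrier B) (ract ?N) (lact ?M) ?N ?M B ?b" by (rule pairingD(1)[OF d.pb])
  have "morita_iso k B X Y"
    unfolding morita_iso_def
  proof (rule bexI[where x = j], rule bexI[where x = l], intro conjI ballI)
    show "j \<in> bimod_iso k B (modM X) (modM Y)" "l \<in> bimod_iso k B (modN X) (modN Y)"
      using tM(2) tN(2) by (simp_all add: Y_def)
    fix T assume T: "T \<in> carrier (btens B (modM X) (modN X))"
    then have ov: "over (carrier (modM X)) (carrier (modN X)) T" by (intro c.MN.bt.over_T) simp
    have "tsum B (tsum d.MN.bt.T T (\<lambda>m n. d.MN.bt.te (j m) (l n))) ?a = tsum B T (\<lambda>m n. ?a (j m) (l n))"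
      by (rule d.MN.bt.tsum_tsum_te[OF B.abelian_group_axioms ba ov]) (simp_all add: tM(3) tN(3))
    also have "\<dots> = tsum B T (pA X)" by (rule tsum_cong[OF ov]) (simp add: j l)
    also have "\<dots> = alpha X T" by (rule strict_alpha[OF X T, symmetric])
    finally show "alpha Y (tsum (btens B (modM Y) (modN Y)) T (\<lambda>m n. btens_elem B (modM Y) (modN Y) (j m) (l n))) = alpha X T"
      by (simp add: Y_def d.MN.tsum_MN)
  next
    fix T assume T: "T \<in> carrier (btens B (modN X) (modM X))"
    then have ov: "over (carrier (modN X)) (carrier (modM X)) T" by (intro c.NM.bt.over_T) simp
    have "tsum B (tsum d.NM.bt.T T (\<lambda>n m. d.NM.bt.te (l n) (j m))) ?b = tsum B T (\<lambda>n m. ?b (l n) (j m))"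
      by (rule d.NM.bt.tsum_tsum_te[OF B.abelian_group_axioms bb ov]) (simp_all add: tM(3) tN(3))
    also have "\<dots> = tsum B T (pB X)" by (rule tsum_cong[OF ov]) (simp add: j l)
    also have "\<dots> = beta X T" by (rule strict_beta[OF X T, symmetric])
    finally show "beta Y (tsum (btens B (modN Y) (modM Y)) T (\<lambda>n m. btens_elem B (modN Y) (modM Y) (l n) (j m))) = beta X T"
      by (simp add: Y_def d.NM.tsum_MN)
  qed
  then show ?thesis using Y by (auto simp: morita_class_def)
qed

lemma xi_class_eq:
  assumes X: "strict_morita k B X" and x: "x \<in> ZC"
  shows "xi_class B (morita_class k B X) x = xi B X x"
proof -
  define Y where "Y = (SOME Y. Y \<in> morita_class k B X)"
  have "Y \<in> morita_class k B X" unfolding Y_def using morita_class_nonempty[OF X] by (simp add: some_in_eq)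
  then have "strict_morita k B Y" "morita_iso k B X Y" by (simp_all add: morita_class_def)
  from xi_iso[OF X this x] show ?thesis by (simp add: xi_class_def Y_def)
qed

text \<open>Both sides are evaluated at representatives: the left one at a member \<open>W\<close> of the product class, which
  is isomorphic to a tensor product of members of the two classes.\<close>

lemma xi_class_mult:
  assumes X: "strict_morita k B (X :: ('k, 'b, nat \<Rightarrow> 'b, nat \<Rightarrow> 'b) morita)"
    and Y: "strict_morita k B (Y :: ('k, 'b, nat \<Rightarrow> 'b, nat \<Rightarrow> 'b) morita)" and x: "x \<in> ZC"
  shows "xi_class B (morita_class k B X \<otimes>\<^bsub>Pic k B\<^esub> morita_class k B Y) x = xi B X (xi B Y x)"
proof -
  let ?C = "morita_class k B X \<otimes>\<^bsub>Pic k B\<^esub> morita_class k B Y"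
  have C: "?C = (\<Union>X'\<in>morita_class k B X. \<Union>Y'\<in>morita_class k B Y. morita_class k B (morita_tensor B X' Y'))"
    by (simp add: Pic_def)
  have XY: "X \<in> morita_class k B X" "Y \<in> morita_class k B Y"
    using X Y by (simp_all add: morita_class_def morita_iso_refl)
  define W where "W = (SOME W. W \<in> ?C)"
  have "\<exists>W. W \<in> ?C"
    using morita_class_nonempty[OF strict_tensor(1)[OF X Y]] XY unfolding C by blast
  then have "W \<in> ?C" unfolding W_def by (rule someI_ex)
  then obtain X' Y' where X': "X' \<in> morita_class k B X" and Y': "Y' \<in> morita_class k B Y"
    and W: "W \<in> morita_class k B (morita_tensor B X' Y')" unfolding C by blast
  have sX: "strict_morita k B X'" "morita_iso k B X X'" and sY: "strict_morita k B Y'" "morita_iso k B Y Y'"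
    using X' Y' by (simp_all add: morita_class_def)
  have sW: "strict_morita k B W" "morita_iso k B (morita_tensor B X' Y') W"
    using W by (simp_all add: morita_class_def)
  obtain s t where "context_pairings k B (modM Y) (modN Y) (pA Y) (pB Y) s t" by (rule strict_context[OF Y])
  then interpret d: context_pairings k B "modM Y" "modN Y" "pA Y" "pB Y" s t .
  have c: "xi B Y x \<in> ZC" using x by (simp add: d.xi_eq_XI)
  have "xi_class B ?C x = xi B W x" by (simp add: xi_class_def W_def)
  also have "\<dots> = xi B (morita_tensor B X' Y') x"
    by (rule xi_iso[OF strict_tensor(1)[OF sX(1) sY(1)] sW x, symmetric])
  also have "\<dots> = xi B X' (xi B Y' x)" by (rule strict_tensor(2)[OF sX(1) sY(1) x])
  also have "\<dots> = xi B X (xi B Y x)"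
    using xi_iso[OF Y sY x] xi_iso[OF X sX c] by simp
  finally show ?thesis .
qed

lemma xi_class_one: "x \<in> ZC \<Longrightarrow> xi_class B \<one>\<^bsub>Pic k B\<^esub> x = x"
  using xi_class_eq[OF strict_unit] xi_unit by (simp add: Pic_def)

end

section \<open>Stable contexts act equivariantly\<close>

subsection \<open>Equalizers and tensor products over a field\<close>

context ground
begin

text \<open>Linear maps over a field have generalized inverses. The inverse is built by Zorn's lemma among
  the partial linear maps that are sections of \<open>d\<close> on the image of \<open>d\<close>: a maximal one is defined on that
  image, since otherwise it extends by \<open>d e \<mapsto> e\<close>, and then everywhere, since otherwise it
  extends by zero.\<close>

lemma generalized_inverse:
  assumes E: "module k E" and W: "module k W" and d: "lin E W d"
  obtains r where "lin W E r" "\<And>e. e \<in> carrier E \<Longrightarrow> d (r (d e)) = d e"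
proof -
  interpret E: module k E by fact
  interpret W: module k W by fact
  note [simp] = lin_closed[OF d] lin_add[OF d] lin_smult[OF d]
  define good where "good G \<longleftrightarrow> G \<subseteq> carrier W \<times> carrier E \<and> (\<zero>\<^bsub>W\<^esub>, \<zero>\<^bsub>E\<^esub>) \<in> G \<and>
      (\<forall>w e w' e'. (w, e) \<in> G \<longrightarrow> (w', e') \<in> G \<longrightarrow> (w \<oplus>\<^bsub>W\<^esub> w', e \<oplus>\<^bsub>E\<^esub> e') \<in> G) \<and>
      (\<forall>c\<in>carrier k. \<forall>w e. (w, e) \<in> G \<longrightarrow> (c \<odot>\<^bsub>W\<^esub> w, c \<odot>\<^bsub>E\<^esub> e) \<in> G) \<and>
      (\<forall>e. (\<zero>\<^bsub>W\<^esub>, e) \<in> G \<longrightarrow> e = \<zero>\<^bsub>E\<^esub>) \<and> (\<forall>w e. (w, e) \<in> G \<longrightarrow> w \<in> d ` carrier E \<longrightarrow> d e = w)" for G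
  have d0: "d \<zero>\<^bsub>E\<^esub> = \<zero>\<^bsub>W\<^esub>"
    by (rule additive_zero[OF lin_additive[OF d] E.abelian_group_axioms W.abelian_group_axioms])
  have "\<exists>G\<in>{G. good G}. \<forall>X\<in>{G. good G}. G \<subseteq> X \<longrightarrow> X = G"
  proof (rule subset_Zorn_nonempty)
    have "good {(\<zero>\<^bsub>W\<^esub>, \<zero>\<^bsub>E\<^esub>)}" unfolding good_def by (simp add: d0)
    then show "{G. good G} \<noteq> {}" by blast
    fix C assume ne: "C \<noteq> {}" and C: "subset.chain {G. good G} C"
    have g: "good G" if "G \<in> C" for G using that C by (auto simp: subset.chain_def)
    have ch: "\<exists>G\<in>C. p \<in> G \<and> q \<in> G" if "p \<in> \<Union>C" "q \<in> \<Union>C" for p q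
      using that C unfolding subset.chain_def by blast
    have "good (\<Union>C)"
      unfolding good_def
    proof (intro conjI allI ballI impI)
      show "\<Union>C \<subseteq> carrier W \<times> carrier E" using g unfolding good_def by blast
      show "(\<zero>\<^bsub>W\<^esub>, \<zero>\<^bsub>E\<^esub>) \<in> \<Union>C" using g ne unfolding good_def by blast
      show "(w \<oplus>\<^bsub>W\<^esub> w', e \<oplus>\<^bsub>E\<^esub> e') \<in> \<Union>C" if "(w, e) \<in> \<Union>C" "(w', e') \<in> \<Union>C" for w e w' e'
        using ch[OF that] g unfolding good_def by blast
      show "(c \<odot>\<^bsub>W\<^esub> w, c \<odot>\<^bsub>E\<^esub> e) \<in> \<Union>C" if "c \<in> carrier k" "(w, e) \<in> \<Union>C" for c w e
        using that g unfolding good_def by blast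
      show "e = \<zero>\<^bsub>E\<^esub>" if "(\<zero>\<^bsub>W\<^esub>, e) \<in> \<Union>C" for e
        using that g unfolding good_def by blast
      show "d e = w" if "(w, e) \<in> \<Union>C" "w \<in> d ` carrier E" for w e
        using that g unfolding good_def by blast
    qed
    then show "\<Union>C \<in> {G. good G}" by blast
  qed
  then obtain G where G: "good G" and max: "\<And>X. good X \<Longrightarrow> G \<subseteq> X \<Longrightarrow> X = G" by blast
  have cl: "(w, e) \<in> G \<Longrightarrow> w \<in> carrier W" "(w, e) \<in> G \<Longrightarrow> e \<in> carrier E" for w e
    using G unfolding good_def by blast+
  have zero: "(\<zero>\<^bsub>W\<^esub>, \<zero>\<^bsub>E\<^esub>) \<in> G" using G unfolding good_def by blast
  have add: "(w, e) \<in> G \<Longrightarrow> (w', e') \<in> G \<Longrightarrow> (w \<oplus>\<^bsub>W\<^esub> w', e \<oplus>\<^bsub>E\<^esub> e') \<in> G" for w e w' e'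
    using G unfolding good_def by blast
  have smult: "c \<in> carrier k \<Longrightarrow> (w, e) \<in> G \<Longrightarrow> (c \<odot>\<^bsub>W\<^esub> w, c \<odot>\<^bsub>E\<^esub> e) \<in> G" for c w e
    using G unfolding good_def by blast
  have sv: "(\<zero>\<^bsub>W\<^esub>, e) \<in> G \<Longrightarrow> e = \<zero>\<^bsub>E\<^esub>" and sec: "(w, e) \<in> G \<Longrightarrow> w \<in> d ` carrier E \<Longrightarrow> d e = w" for w e
    using G unfolding good_def by blast+
  have minus: "(\<ominus>\<^bsub>W\<^esub> w, \<ominus>\<^bsub>E\<^esub> e) \<in> G" if "(w, e) \<in> G" for w e
    using smult[OF k.a_inv_closed[OF k.one_closed] that] cl[OF that] by (simp add: E.smult_l_minus W.smult_l_minus)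
  have extend: "w0 \<in> Domain G" if w0: "w0 \<in> carrier W" and e0: "e0 \<in> carrier E"
    and alt: "w0 = d e0 \<or> d ` carrier E \<subseteq> Domain G" for w0 e0
  proof (rule ccontr)
    assume out: "w0 \<notin> Domain G"
    let ?G = "{(w \<oplus>\<^bsub>W\<^esub> c \<odot>\<^bsub>W\<^esub> w0, e \<oplus>\<^bsub>E\<^esub> c \<odot>\<^bsub>E\<^esub> e0) | w e c. (w, e) \<in> G \<and> c \<in> carrier k}"
    have indep: "c = \<zero>\<^bsub>k\<^esub>" if ind: "(w, e) \<in> G" "c \<in> carrier k" "w \<oplus>\<^bsub>W\<^esub> c \<odot>\<^bsub>W\<^esub> w0 \<in> Domain G" for w e c
    proof (rule ccontr)
      assume "c \<noteq> \<zero>\<^bsub>k\<^esub>"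
      then obtain b where b: "b \<in> carrier k" "b \<otimes>\<^bsub>k\<^esub> c = \<one>\<^bsub>k\<^esub>"
        using ind(2) k.field_Units k.Units_l_inv_ex by blast
      obtain e' where e': "(w \<oplus>\<^bsub>W\<^esub> c \<odot>\<^bsub>W\<^esub> w0, e') \<in> G" using ind(3) by blast
      have "b \<odot>\<^bsub>W\<^esub> (\<ominus>\<^bsub>W\<^esub> w \<oplus>\<^bsub>W\<^esub> (w \<oplus>\<^bsub>W\<^esub> c \<odot>\<^bsub>W\<^esub> w0)) = w0"
        using cl[OF ind(1)] w0 ind(2) b by (simp add: W.M.r_neg1 W.smult_assoc1[symmetric])
      then show False using smult[OF b(1) add[OF minus[OF ind(1)] e']] out by auto
    qed
    have "good ?G"
      unfolding good_def
    proof (intro conjI allI ballI impI)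
      show "?G \<subseteq> carrier W \<times> carrier E" using cl w0 e0 by auto
      have "(\<zero>\<^bsub>W\<^esub>, \<zero>\<^bsub>E\<^esub>) = (\<zero>\<^bsub>W\<^esub> \<oplus>\<^bsub>W\<^esub> \<zero>\<^bsub>k\<^esub> \<odot>\<^bsub>W\<^esub> w0, \<zero>\<^bsub>E\<^esub> \<oplus>\<^bsub>E\<^esub> \<zero>\<^bsub>k\<^esub> \<odot>\<^bsub>E\<^esub> e0)" using w0 e0 by simp
      then show "(\<zero>\<^bsub>W\<^esub>, \<zero>\<^bsub>E\<^esub>) \<in> ?G" using zero k.zero_closed by blast
      fix v f assume "(v, f) \<in> ?G"
      then obtain w e c where p: "v = w \<oplus>\<^bsub>W\<^esub> c \<odot>\<^bsub>W\<^esub> w0" "f = e \<oplus>\<^bsub>E\<^esub> c \<odot>\<^bsub>E\<^esub> e0" "(w, e) \<in> G" "c \<in> carrier k" by blast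
      note clp = cl[OF p(3)]
      show "(v \<oplus>\<^bsub>W\<^esub> v', f \<oplus>\<^bsub>E\<^esub> f') \<in> ?G" if vf: "(v', f') \<in> ?G" for v' f'
      proof -
        obtain w' e' c' where p': "v' = w' \<oplus>\<^bsub>W\<^esub> c' \<odot>\<^bsub>W\<^esub> w0" "f' = e' \<oplus>\<^bsub>E\<^esub> c' \<odot>\<^bsub>E\<^esub> e0" "(w', e') \<in> G" "c' \<in> carrier k"
          using vf by blast
        have "v \<oplus>\<^bsub>W\<^esub> v' = (w \<oplus>\<^bsub>W\<^esub> w') \<oplus>\<^bsub>W\<^esub> (c \<oplus>\<^bsub>k\<^esub> c') \<odot>\<^bsub>W\<^esub> w0" "f \<oplus>\<^bsub>E\<^esub> f' = (e \<oplus>\<^bsub>E\<^esub> e') \<oplus>\<^bsub>E\<^esub> (c \<oplus>\<^bsub>k\<^esub> c') \<odot>\<^bsub>E\<^esub> e0"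
          using p p' clp cl[OF p'(3)] w0 e0 by (simp_all add: W.smult_l_distr W.M.a_ac E.smult_l_distr E.M.a_ac)
        then show ?thesis using add[OF p(3) p'(3)] k.a_closed[OF p(4) p'(4)] by blast
      qed
      show "(b \<odot>\<^bsub>W\<^esub> v, b \<odot>\<^bsub>E\<^esub> f) \<in> ?G" if b: "b \<in> carrier k" for b
      proof -
        have "b \<odot>\<^bsub>W\<^esub> v = b \<odot>\<^bsub>W\<^esub> w \<oplus>\<^bsub>W\<^esub> (b \<otimes>\<^bsub>k\<^esub> c) \<odot>\<^bsub>W\<^esub> w0" "b \<odot>\<^bsub>E\<^esub> f = b \<odot>\<^bsub>E\<^esub> e \<oplus>\<^bsub>E\<^esub> (b \<otimes>\<^bsub>k\<^esub> c) \<odot>\<^bsub>E\<^esub> e0"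
          using p clp b w0 e0 by (simp_all add: W.smult_r_distr W.smult_assoc1 E.smult_r_distr E.smult_assoc1)
        then show ?thesis using smult[OF b p(3)] k.m_closed[OF b p(4)] by blast
      qed
      show "d f = v" if vd: "v \<in> d ` carrier E"
      proof (cases "c = \<zero>\<^bsub>k\<^esub>")
        case True
        then show ?thesis using p clp w0 e0 sec[OF p(3)] vd by simp
      next
        case False
        then have "w0 = d e0" using indep[OF p(3,4)] vd alt unfolding p(1) by blast
        moreover obtain x where x: "x \<in> carrier E" "v = d x" using vd by blast
        ultimately have "w \<oplus>\<^bsub>W\<^esub> c \<odot>\<^bsub>W\<^esub> d e0 = d x" using p(1) by simp
        then have "w = d (x \<oplus>\<^bsub>E\<^esub> (\<ominus>\<^bsub>k\<^esub> c) \<odot>\<^bsub>E\<^esub> e0)"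
          using x(1) e0 p(4) clp by (simp add: W.smult_l_minus W.M.a_assoc W.M.r_neg flip: \<open>w \<oplus>\<^bsub>W\<^esub> c \<odot>\<^bsub>W\<^esub> d e0 = d x\<close>)
        then have "d e = w" using x(1) e0 p(4) by (intro sec[OF p(3)] image_eqI[of _ _ "x \<oplus>\<^bsub>E\<^esub> (\<ominus>\<^bsub>k\<^esub> c) \<odot>\<^bsub>E\<^esub> e0"]) simp_all
        then show ?thesis using p clp e0 \<open>w0 = d e0\<close> by simp
      qed
    next
      fix f assume "(\<zero>\<^bsub>W\<^esub>, f) \<in> ?G"
      then obtain w e c where p: "\<zero>\<^bsub>W\<^esub> = w \<oplus>\<^bsub>W\<^esub> c \<odot>\<^bsub>W\<^esub> w0" "f = e \<oplus>\<^bsub>E\<^esub> c \<odot>\<^bsub>E\<^esub> e0" "(w, e) \<in> G" "c \<in> carrier k" by blast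
      have "w \<oplus>\<^bsub>W\<^esub> c \<odot>\<^bsub>W\<^esub> w0 \<in> Domain G" unfolding p(1)[symmetric] using zero by blast
      from indep[OF p(3,4) this] show "f = \<zero>\<^bsub>E\<^esub>" using p cl[OF p(3)] w0 e0 sv[of e] by simp
    qed
    moreover have sub: "G \<subseteq> ?G"
    proof
      fix p assume p: "p \<in> G"
      obtain w e where we: "p = (w, e)" by (cases p)
      then have "p = (w \<oplus>\<^bsub>W\<^esub> \<zero>\<^bsub>k\<^esub> \<odot>\<^bsub>W\<^esub> w0, e \<oplus>\<^bsub>E\<^esub> \<zero>\<^bsub>k\<^esub> \<odot>\<^bsub>E\<^esub> e0)" using p cl[of w e] w0 e0 by simp
      moreover have "(w, e) \<in> G" using p we by simp
      ultimately show "p \<in> ?G" using k.zero_closed unfolding mem_Collect_eq by blast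
    qed
    ultimately have "?G = G" by (rule max)
    moreover have "(w0, e0) = (\<zero>\<^bsub>W\<^esub> \<oplus>\<^bsub>W\<^esub> \<one>\<^bsub>k\<^esub> \<odot>\<^bsub>W\<^esub> w0, \<zero>\<^bsub>E\<^esub> \<oplus>\<^bsub>E\<^esub> \<one>\<^bsub>k\<^esub> \<odot>\<^bsub>E\<^esub> e0)" using w0 e0 by simp
    then have "(w0, e0) \<in> ?G" using zero k.one_closed by blast
    ultimately show False using out by blast
  qed
  have im: "d ` carrier E \<subseteq> Domain G" using extend by auto
  have total: "w \<in> Domain G" if "w \<in> carrier W" for w using extend[OF that E.zero_closed] im by blast
  define r where "r w = (SOME e. (w, e) \<in> G)" for w
  have r: "(w, r w) \<in> G" if "w \<in> carrier W" for w
    unfolding r_def by (rule someI_ex) (use total[OF that] in blast)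
  have uniq: "r w = e" if "(w, e) \<in> G" for w e
  proof -
    note c = cl[OF that] cl[OF r[OF cl(1)[OF that]]]
    have "(\<zero>\<^bsub>W\<^esub>, \<ominus>\<^bsub>E\<^esub> e \<oplus>\<^bsub>E\<^esub> r w) \<in> G"
      using add[OF minus[OF that] r[OF cl(1)[OF that]]] c by (simp add: W.M.l_neg)
    from sv[OF this] have "\<ominus>\<^bsub>E\<^esub> e \<oplus>\<^bsub>E\<^esub> r w = \<zero>\<^bsub>E\<^esub>" .
    then show ?thesis using E.M.r_neg2[of e "r w"] c by simp
  qed
  show ?thesis
  proof (rule that)
    show "lin W E r"
      by (rule linI) (use cl(2)[OF r] uniq[OF add[OF r r]] uniq[OF smult[OF _ r]] in simp_all)
    show "d (r (d e)) = d e" if "e \<in> carrier E" for e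
      using that by (intro sec[OF r]) simp_all
  qed
qed

text \<open>Tensoring with a vector space preserves equalizers, because a generalized inverse of \<open>f - g\<close>
  yields a projection onto the equalizer.\<close>

lemma equalizer_tensor:
  assumes E: "module k E" and W: "module k W" and V: "module k V"
    and f: "lin E W f" and g: "lin E W g" and U: "U = E\<lparr>carrier := {e \<in> carrier E. f e = g e}\<rparr>"
    and w: "w \<in> carrier (ktens k E V)"
    and eq: "tsum (ktens k W V) w (\<lambda>e v. ktens_elem k W V (f e) v) = tsum (ktens k W V) w (\<lambda>e v. ktens_elem k W V (g e) v)"
  shows "w \<in> (\<lambda>Y. tsum (ktens k E V) Y (ktens_elem k E V)) ` carrier (ktens k U V)"
proof -
  interpret E: module k E by fact
  interpret W: module k W by fact
  let ?EV = "ktens k E V" and ?WV = "ktens k W V" and ?e = "ktens_elem k E V" and ?w = "ktens_elem k W V"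
  have "subspace E {e \<in> carrier E. f e = g e}"
    unfolding subspace_def
    by (simp add: lin_add[OF f] lin_add[OF g] lin_smult[OF f] lin_smult[OF g]
        additive_zero[OF lin_additive[OF f]] additive_zero[OF lin_additive[OF g]] E W)
  then have modU: "module k U" unfolding U by (rule subspace_module[OF E])
  have EV: "module k ?EV" and WV: "module k ?WV" and UV: "module k (ktens k U V)" using E W V modU by simp_all
  interpret WV: module k ?WV by (rule WV)
  interpret EV: module k ?EV by (rule EV)
  have UE: "carrier U \<subseteq> carrier E" "lin U E (\<lambda>x. x)" by (auto intro!: linI simp: U)
  note ov = over_ktens[OF E V w]
  define d where "d e = f e \<oplus>\<^bsub>W\<^esub> (\<ominus>\<^bsub>k\<^esub> \<one>\<^bsub>k\<^esub>) \<odot>\<^bsub>W\<^esub> g e" for e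
  have d: "lin E W d" unfolding d_def by (intro lin_plus W f lin_smultR g) simp
  obtain r where r: "lin W E r" and drd: "\<And>e. e \<in> carrier E \<Longrightarrow> d (r (d e)) = d e"
    by (rule generalized_inverse[OF E W d]) blast
  have fd: "f e = g e \<oplus>\<^bsub>W\<^esub> d e" if "e \<in> carrier E" for e
    using lin_closed[OF f that] lin_closed[OF g that]
    by (simp add: d_def W.smult_l_minus W.M.a_lcomm[of "g e" "f e"] W.M.r_neg)
  have rd: "lin E E (\<lambda>e. r (d e))" by (rule lin_comp[OF r d])
  define p where "p e = e \<oplus>\<^bsub>E\<^esub> (\<ominus>\<^bsub>k\<^esub> \<one>\<^bsub>k\<^esub>) \<odot>\<^bsub>E\<^esub> r (d e)" for e
  have pE: "lin E E p" unfolding p_def by (intro lin_plus E lin_id lin_smultR rd) simp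
  have split: "e = p e \<oplus>\<^bsub>E\<^esub> r (d e)" if "e \<in> carrier E" for e
    using that lin_closed[OF rd that] by (simp add: p_def E.smult_l_minus E.M.a_assoc E.M.l_neg)
  have "p e \<in> carrier U" if e: "e \<in> carrier E" for e
  proof -
    note c = lin_closed[OF pE e] lin_closed[OF d e] lin_closed[OF rd e]
    have "d (p e) = d e \<oplus>\<^bsub>W\<^esub> (\<ominus>\<^bsub>k\<^esub> \<one>\<^bsub>k\<^esub>) \<odot>\<^bsub>W\<^esub> d e"
      using e c unfolding p_def by (simp add: lin_add[OF d] lin_smult[OF d] drd)
    also have "\<dots> = \<zero>\<^bsub>W\<^esub>" using c by (simp add: W.smult_l_minus W.M.r_neg)
    finally show ?thesis using fd[OF c(1)] lin_closed[OF g c(1)] c(1) by (simp add: U)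
  qed
  then have p: "lin E U p" by (intro linI) (use pE in \<open>simp_all add: U lin_add lin_smult\<close>)
  have T: "tsum ?WV w (\<lambda>e v. ?w (d e) v) = \<zero>\<^bsub>?WV\<^esub>"
  proof -
    have c: "tsum ?WV w (\<lambda>e v. ?w (q e) v) \<in> carrier ?WV" if "lin E W q" for q
      using W V by (intro tsum_closed[OF module_abelian[OF WV] ov]) (simp add: lin_closed[OF that])
    have "tsum ?WV w (\<lambda>e v. ?w (f e) v) = tsum ?WV w (\<lambda>e v. ?w (g e) v \<oplus>\<^bsub>?WV\<^esub> ?w (d e) v)"
      by (intro tsum_cong[OF ov])
        (simp add: fd lin_add[OF bilin1[OF bilin_ktens_elem[OF W V]]] lin_closed[OF g] lin_closed[OF d])
    also have "\<dots> = tsum ?WV w (\<lambda>e v. ?w (g e) v) \<oplus>\<^bsub>?WV\<^esub> tsum ?WV w (\<lambda>e v. ?w (d e) v)"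
      using W V by (intro tsum_add[OF module_abelian[OF WV] ov]) (simp_all add: lin_closed[OF g] lin_closed[OF d])
    finally show ?thesis using c[OF f] c[OF g] c[OF d] unfolding eq by simp
  qed
  let ?\<iota> = "\<lambda>Y. tsum ?EV Y ?e" and ?Y = "tsum (ktens k U V) w (\<lambda>e v. ktens_elem k U V (p e) v)"
  have bU: "bilin U V ?EV ?e"
    using UE(1) by (intro bilinI lin_comp[OF bilin1[OF bilin_ktens_elem[OF E V]] UE(2)] bilin2[OF bilin_ktens_elem[OF E V]]) blast+
  have b: "bilin W V ?EV (\<lambda>x v. ?e (r x) v)"
    using E V by (intro bilinI lin_elemL lin_elemR r lin_id) (simp_all add: lin_closed[OF r])
  have "w = tsum ?EV w ?e" by (rule ktensor.tsum_self_MN[OF ktensorI[OF E V] w, symmetric])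
  also have "\<dots> = tsum ?EV w (\<lambda>e v. ?e (p e) v \<oplus>\<^bsub>?EV\<^esub> ?e (r (d e)) v)"
    by (intro tsum_cong[OF ov])
      (subst split, simp_all add: lin_add[OF bilin1[OF bilin_ktens_elem[OF E V]]] lin_closed[OF pE] lin_closed[OF rd])
  also have "\<dots> = tsum ?EV w (\<lambda>e v. ?e (p e) v) \<oplus>\<^bsub>?EV\<^esub> tsum ?EV w (\<lambda>e v. ?e (r (d e)) v)"
    using E V by (intro tsum_add[OF module_abelian[OF EV] ov]) (simp_all add: lin_closed[OF pE] lin_closed[OF rd])
  also have "tsum ?EV w (\<lambda>e v. ?e (r (d e)) v) = tsum ?EV (tsum ?WV w (\<lambda>e v. ?w (d e) v)) (\<lambda>x v. ?e (r x) v)"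
  proof -
    have "tsum ?EV (tsum ?WV w (\<lambda>e v. ?w (d e) v)) (\<lambda>x v. ?e (r x) v) =
        tsum ?EV w (\<lambda>e v. tsum ?EV (?w (d e) v) (\<lambda>x v. ?e (r x) v))"
      using W V by (intro tsum_lin[OF lin_tsum[OF W V EV b] WV EV ov]) (simp add: lin_closed[OF d])
    also have "\<dots> = tsum ?EV w (\<lambda>e v. ?e (r (d e)) v)"
      by (intro tsum_cong[OF ov] tsum_ktens_elem[OF W V module_abelian[OF EV] b] lin_closed[OF d])
    finally show ?thesis ..
  qed
  also have "\<dots> = \<zero>\<^bsub>?EV\<^esub>"
    unfolding T by (rule additive_zero[OF lin_additive[OF lin_tsum[OF W V EV b]] module_abelian[OF WV] module_abelian[OF EV]])
  also have "tsum ?EV w (\<lambda>e v. ?e (p e) v) = ?\<iota> ?Y"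
  proof -
    have "?\<iota> ?Y = tsum ?EV w (\<lambda>e v. tsum ?EV (ktens_elem k U V (p e) v) ?e)"
      using modU V by (intro tsum_lin[OF lin_tsum[OF modU V EV bU] UV EV ov]) (simp add: lin_closed[OF p])
    also have "\<dots> = tsum ?EV w (\<lambda>e v. ?e (p e) v)"
      by (intro tsum_cong[OF ov] tsum_ktens_elem[OF modU V module_abelian[OF EV] bU] lin_closed[OF p])
    finally show ?thesis ..
  qed
  finally have "w = ?\<iota> ?Y \<oplus>\<^bsub>?EV\<^esub> \<zero>\<^bsub>?EV\<^esub>" .
  moreover have Y: "?Y \<in> carrier (ktens k U V)"
    using modU V by (intro tsum_closed[OF module_abelian[OF UV] ov]) (simp add: lin_closed[OF p])
  moreover have "?\<iota> ?Y \<in> carrier ?EV" by (rule lin_closed[OF lin_tsum[OF modU V EV bU] Y])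
  ultimately show ?thesis by (intro image_eqI[of _ _ ?Y]) simp_all
qed

end

subsection \<open>The enveloping algebra and its coactions\<close>

lemma (in ground) k_algebra_opposite:
  assumes "k_algebra k X"
  shows "k_algebra k (op_alg X)"
proof -
  interpret X: ring X by (rule k_algebra_ring[OF assms])
  interpret X: module k X by (rule k_algebra_module[OF assms])
  have ab: "abelian_group (op_alg X)"
    by (rule abelian_group_cong[OF X.abelian_group_axioms]) (simp_all add: opposite_simps)
  have "monoid (op_alg X)"
    by (rule monoidI) (simp_all add: opposite_simps X.m_assoc)
  then have "ring (op_alg X)"
    by (intro ringI[OF ab]) (simp_all add: opposite_simps X.l_distr X.r_distr)
  moreover have "module k (op_alg X)"
    by (rule moduleI[OF cring_k ab]) (simp_all add: opposite_simps X.smult_l_distr X.smult_r_distr X.smult_assoc1)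
  ultimately show ?thesis by (simp add: k_algebra_def opposite_simps k_algebra_smult[OF assms])
qed

lemma (in ground) lin_opposite: "lin (op_alg X) G f \<longleftrightarrow> lin X G f" "lin V (op_alg X) g \<longleftrightarrow> lin V X g"
  by (simp_all add: lin_def linear_maps_def additive_maps_def opposite_simps)

locale enveloping = ground k for k :: "'k ring" + fixes X :: "('k, 'a, 'y) module_scheme" (structure)
  assumes alg_X: "k_algebra k X"
begin

sublocale XX: ktensor_alg k X "op_alg X"
  by (rule ktensor_alg.intro[OF ground_axioms ktensor_alg_axioms.intro[OF alg_X k_algebra_opposite[OF alg_X]]])

abbreviation "E \<equiv> env k X"
abbreviation "ee \<equiv> env_elem k X"

lemma alg_E: "k_algebra k E"
  unfolding env_def by (rule XX.alg_AB)

lemma ee_closed [simp]: "a \<in> carrier X \<Longrightarrow> b \<in> carrier X \<Longrightarrow> ee a b \<in> carrier E"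
  unfolding env_def env_elem_def by (rule XX.AB.el_closed) (simp_all add: opposite_simps)

lemma mult_ee: "a \<in> carrier X \<Longrightarrow> b \<in> carrier X \<Longrightarrow> c \<in> carrier X \<Longrightarrow> d \<in> carrier X \<Longrightarrow>
    ee a b \<otimes>\<^bsub>E\<^esub> ee c d = ee (a \<otimes> c) (d \<otimes> b)"
  unfolding env_def env_elem_def by (subst XX.mult_el) (simp_all add: opposite_simps)

lemma bilin_ee: "bilin X X E ee"
  using XX.AB.bilin_el by (simp add: bilin_def env_def env_elem_def lin_opposite opposite_simps)

lemma bilin_opposite: "bilin X X G F \<Longrightarrow> bilin X (op_alg X) G F"
  by (simp add: bilin_def lin_opposite opposite_simps)

lemma tsum_ee:
  "module k G \<Longrightarrow> bilin X X G F \<Longrightarrow> a \<in> carrier X \<Longrightarrow> b \<in> carrier X \<Longrightarrow> tsum G (ee a b) F = F a b"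
  unfolding env_elem_def by (rule XX.AB.tsum_el[OF module_abelian bilin_opposite]) (simp_all add: opposite_simps)

lemma lin_tsum_E: "module k G \<Longrightarrow> bilin X X G F \<Longrightarrow> lin E G (\<lambda>Y. tsum G Y F)"
  unfolding env_def by (rule XX.AB.lin_tsum[OF _ bilin_opposite])

lemma E_induct [consumes 1, case_names gen add]:
  assumes "Y \<in> carrier E" "\<And>a b. a \<in> carrier X \<Longrightarrow> b \<in> carrier X \<Longrightarrow> P (ee a b)"
    and "\<And>Y Y'. Y \<in> carrier E \<Longrightarrow> Y' \<in> carrier E \<Longrightarrow> P Y \<Longrightarrow> P Y' \<Longrightarrow> P (Y \<oplus>\<^bsub>E\<^esub> Y')"
  shows "P Y"
  using assms unfolding env_def env_elem_def
  by (rule XX.AB.MN_induct) (simp_all add: opposite_simps)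

lemma E_eqI:
  assumes f: "lin E G f" and g: "lin E G g" and Y: "Y \<in> carrier E"
    and eq: "\<And>a b. a \<in> carrier X \<Longrightarrow> b \<in> carrier X \<Longrightarrow> f (ee a b) = g (ee a b)"
  shows "f Y = g Y"
  using Y by (induction Y rule: E_induct) (simp_all add: eq lin_add[OF f] lin_add[OF g])

lemma lin_eeL: "b \<in> carrier X \<Longrightarrow> lin V X f \<Longrightarrow> lin V E (\<lambda>v. ee (f v) b)"
  by (rule lin_comp[OF bilin1[OF bilin_ee]])

lemma lin_eeR: "a \<in> carrier X \<Longrightarrow> lin V X f \<Longrightarrow> lin V E (\<lambda>v. ee a (f v))"
  by (rule lin_comp[OF bilin2[OF bilin_ee]])

end

context galois
begin

sublocale EA: enveloping k A
  by (rule enveloping.intro[OF ground_axioms enveloping_axioms.intro[OF alg_A]])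

abbreviation "E \<equiv> env k A"
abbreviation mult_E (infixl "\<bullet>" 70) where "x \<bullet> y \<equiv> x \<otimes>\<^bsub>E\<^esub> y"
abbreviation "ee \<equiv> env_elem k A"
abbreviation "EH \<equiv> ktens k E H"
abbreviation "eh \<equiv> ktens_elem k E H"
abbreviation "eL \<equiv> env_coact_l k H A"
abbreviation "eR \<equiv> env_coact_r k H A"
abbreviation "SQ \<equiv> sq k H A"

lemma module_E [simp]: "module k E"
  by (rule k_algebra_module[OF EA.alg_E])

lemmas elin = glin EA.lin_eeL EA.lin_eeR

lemma bilin_eL: "bilin A A EH (\<lambda>a a'. co EH a (\<lambda>b h. eh (ee b a') h))"
  by (intro elin) simp_all

lemma bilin_eR: "bilin A A EH (\<lambda>a a'. co EH a' (\<lambda>b h. eh (ee a b) (antipode H h)))"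
  by (intro elin) simp_all

lemma lin_eL: "lin E EH eL"
  unfolding env_coact_l_def Let_def by (rule EA.lin_tsum_E[OF _ bilin_eL]) simp

lemma lin_eR: "lin E EH eR"
  unfolding env_coact_r_def Let_def by (rule EA.lin_tsum_E[OF _ bilin_eR]) simp

lemma eL_closed [simp]: "x \<in> carrier E \<Longrightarrow> eL x \<in> carrier EH"
  and eR_closed [simp]: "x \<in> carrier E \<Longrightarrow> eR x \<in> carrier EH"
  using lin_closed[OF lin_eL] lin_closed[OF lin_eR] by blast+

lemma tsum_eL:
  assumes F: "bilin E H G F" and G: "module k G" and a: "a \<in> carrier A" and a': "a' \<in> carrier A"
  shows "tsum G (eL (ee a a')) F = co G a (\<lambda>b h. F (ee b a') h)"
proof -
  have "eL (ee a a') = co EH a (\<lambda>b h. eh (ee b a') h)"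
    unfolding env_coact_l_def Let_def by (rule EA.tsum_ee[OF _ bilin_eL a a']) simp
  also have "tsum G \<dots> F = co G a (\<lambda>b h. tsum G (eh (ee b a') h) F)"
    using F G a' by (intro co_lin[OF lin_tsum _ _ a]) simp_all
  also have "\<dots> = co G a (\<lambda>b h. F (ee b a') h)"
    using F G a' by (intro co_cong[OF a] tsum_ktens_elem) simp_all
  finally show ?thesis .
qed

lemma tsum_eR:
  assumes F: "bilin E H G F" and G: "module k G" and a: "a \<in> carrier A" and a': "a' \<in> carrier A"
  shows "tsum G (eR (ee a a')) F = co G a' (\<lambda>b h. F (ee a b) (antipode H h))"
proof -
  have "eR (ee a a') = co EH a' (\<lambda>b h. eh (ee a b) (antipode H h))"
    unfolding env_coact_r_def Let_def by (rule EA.tsum_ee[OF _ bilin_eR a a']) simp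
  also have "tsum G \<dots> F = co G a' (\<lambda>b h. tsum G (eh (ee a b) (antipode H h)) F)"
    using F G a by (intro co_lin[OF lin_tsum _ _ a']) simp_all
  also have "\<dots> = co G a' (\<lambda>b h. F (ee a b) (antipode H h))"
    using F G a by (intro co_cong[OF a'] tsum_ktens_elem) simp_all
  finally show ?thesis .
qed

lemma eL_ee: "a \<in> carrier A \<Longrightarrow> a' \<in> carrier A \<Longrightarrow> eL (ee a a') = co EH a (\<lambda>b h. eh (ee b a') h)"
  unfolding env_coact_l_def Let_def by (rule EA.tsum_ee[OF _ bilin_eL]) simp

lemma eR_ee: "a \<in> carrier A \<Longrightarrow> a' \<in> carrier A \<Longrightarrow> eR (ee a a') = co EH a' (\<lambda>b h. eh (ee a b) (antipode H h))"
  unfolding env_coact_r_def Let_def by (rule EA.tsum_ee[OF _ bilin_eR]) simp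

lemma SQ_mem: "x \<in> carrier SQ \<longleftrightarrow> x \<in> carrier E \<and> eL x = eR x"
  by (simp add: sq_def)

lemma SQ_in_E [simp]: "x \<in> carrier SQ \<Longrightarrow> x \<in> carrier E"
  by (simp add: SQ_mem)

lemma SQ_simps [simp]: "add SQ = add E" "zero SQ = zero E" "smult SQ = smult E"
  unfolding sq_def by (rule restrict_carrier_simps)+

lemma module_SQ [simp]: "module k SQ"
proof -
  have E: "module k E" by (rule module_E)
  note ab = module_abelian[OF E] module_abelian[OF module_ktens[OF E module_H]]
  note z = additive_zero[OF lin_additive[OF lin_eL] ab] additive_zero[OF lin_additive[OF lin_eR] ab]
  have zc: "\<zero>\<^bsub>E\<^esub> \<in> carrier E" by (rule abelian_groupE(2)[OF ab(1)])
  have ac: "x \<oplus>\<^bsub>E\<^esub> y \<in> carrier E" if "x \<in> carrier E" "y \<in> carrier E" for x y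
    by (rule abelian_groupE(1)[OF ab(1) that])
  have "subspace E {x \<in> carrier E. eL x = eR x}"
    unfolding subspace_def mem_Collect_eq
  proof (intro conjI ballI)
    show "{x \<in> carrier E. eL x = eR x} \<subseteq> carrier E" by blast
    show "eL \<zero>\<^bsub>E\<^esub> = eR \<zero>\<^bsub>E\<^esub>" by (simp only: z)
  qed (auto simp only: mem_Collect_eq zc ac module.smult_closed[OF E] lin_add[OF lin_eL] lin_add[OF lin_eR] lin_smult[OF lin_eL] lin_smult[OF lin_eR])
  then show ?thesis unfolding sq_def by (rule subspace_module[OF module_E])
qed

lemma lin_SQ_E: "lin SQ E (\<lambda>x. x)"
  by (rule linI) simp_all

abbreviation "EHH \<equiv> ktens k EH H"
abbreviation "ehh \<equiv> ktens_elem k EH H"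

text \<open>The two coactions of the enveloping algebra commute, and each is coassociative up to the order
  of the factors, which is irrelevant for cocommutative \<open>H\<close>. Hence the coaction does not lead out of
  the equalizer.\<close>

lemma SQ_subcomodule:
  assumes u: "u \<in> carrier SQ"
  shows "tsum EHH (eL u) (\<lambda>e h. ehh (eL e) h) = tsum EHH (eL u) (\<lambda>e h. ehh (eR e) h)"
proof -
  have T: "module k EHH" by simp
  let ?b = "\<lambda>e h. tsum EHH (eL e) (\<lambda>e0 e1. ehh (eh e0 h) e1)"
  have bb: "bilin E H EHH (\<lambda>e0 e1. ehh (eh e0 h) e1)" if "h \<in> carrier H" for h
    using that by (intro elin) simp_all
  have lb: "lin EH EHH (\<lambda>Y. tsum EHH Y (\<lambda>e0 e1. ehh (eh e0 h) e1))" if "h \<in> carrier H" for h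
    using that by (intro lin_tsum bb) simp_all
  have b: "bilin E H EHH ?b"
  proof (rule bilinI)
    show "lin E EHH (\<lambda>e. ?b e h)" if "h \<in> carrier H" for h by (rule lin_comp[OF lb[OF that] lin_eL])
    show "lin H EHH (\<lambda>h. ?b e h)" if "e \<in> carrier E" for e
      using that by (intro lin_tsum_ktens[of E H] elin) simp_all
  qed
  have bL: "bilin E H EHH (\<lambda>e h. ehh (eL e) h)" by (intro bilinI elin lin_eL) simp_all
  have bR: "bilin E H EHH (\<lambda>e h. ehh (eR e) h)" by (intro bilinI elin lin_eR) simp_all
  note LE = lin_comp[OF lin_tsum[OF module_E module_H T] lin_eL] lin_comp[OF lin_tsum[OF module_E module_H T] lin_eR]
  have A: "tsum EHH (eL x) (\<lambda>e h. ehh (eR e) h) = tsum EHH (eR x) ?b" if "x \<in> carrier E" for x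
  proof (rule EA.E_eqI[OF LE(1)[OF bR] LE(2)[OF b] that])
    fix a a' assume a: "a \<in> carrier A" and a': "a' \<in> carrier A"
    have "tsum EHH (eL (ee a a')) (\<lambda>e h. ehh (eR e) h) = co EHH a (\<lambda>c h. ehh (eR (ee c a')) h)"
      by (rule tsum_eL[OF bR T a a'])
    also have "\<dots> = co EHH a (\<lambda>c h. co EHH a' (\<lambda>d g. ehh (eh (ee c d) (antipode H g)) h))"
    proof (rule co_cong[OF a])
      fix c h assume c: "c \<in> carrier A" and h: "h \<in> carrier H"
      show "ehh (eR (ee c a')) h = co EHH a' (\<lambda>d g. ehh (eh (ee c d) (antipode H g)) h)"
        unfolding eR_ee[OF c a'] using c h by (intro co_lin[where \<phi> = "\<lambda>w. ehh w h"] elin a') simp_all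
    qed
    also have "\<dots> = co EHH a' (\<lambda>d g. co EHH a (\<lambda>c h. ehh (eh (ee c d) (antipode H g)) h))"
      by (rule tsum_swap[OF module_abelian[OF T] over_coact[OF a] over_coact[OF a']]) simp
    also have "\<dots> = co EHH a' (\<lambda>d g. ?b (ee a d) (antipode H g))"
      by (intro co_cong[OF a'] tsum_eL[symmetric] bb a T) simp_all
    also have "\<dots> = tsum EHH (eR (ee a a')) ?b"
      by (rule tsum_eR[OF b T a a', symmetric])
    finally show "tsum EHH (eL (ee a a')) (\<lambda>e h. ehh (eR e) h) = tsum EHH (eR (ee a a')) ?b" .
  qed
  have B: "tsum EHH (eL x) ?b = tsum EHH (eL x) (\<lambda>e h. ehh (eL e) h)" if "x \<in> carrier E" for x
  proof (rule EA.E_eqI[OF LE(1)[OF b] LE(1)[OF bL] that])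
    fix a a' assume a: "a \<in> carrier A" and a': "a' \<in> carrier A"
    have "tsum EHH (eL (ee a a')) ?b = co EHH a (\<lambda>c h. ?b (ee c a') h)"
      by (rule tsum_eL[OF b T a a'])
    also have "\<dots> = co EHH a (\<lambda>c h. co EHH c (\<lambda>d g. ehh (eh (ee d a') h) g))"
      by (intro co_cong[OF a] tsum_eL bb a' T) simp_all
    also have "\<dots> = co EHH a (\<lambda>d u. sw EHH u (\<lambda>g h. ehh (eh (ee d a') h) g))"
      using a' by (intro co_coassoc[OF T a] elin) simp_all
    also have "\<dots> = co EHH a (\<lambda>d u. sw EHH u (\<lambda>h g. ehh (eh (ee d a') h) g))"
      using a' by (intro co_cong[OF a] sw_cocomm elin) simp_all
    also have "\<dots> = co EHH a (\<lambda>c h. co EHH c (\<lambda>d g. ehh (eh (ee d a') g) h))"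
      using a' by (intro co_coassoc[OF T a, symmetric] elin) simp_all
    also have "\<dots> = co EHH a (\<lambda>c h. ehh (eL (ee c a')) h)"
    proof (rule co_cong[OF a])
      fix c h assume c: "c \<in> carrier A" and h: "h \<in> carrier H"
      show "co EHH c (\<lambda>d g. ehh (eh (ee d a') g) h) = ehh (eL (ee c a')) h"
        unfolding eL_ee[OF c a'] using a' h by (intro co_lin[where \<phi> = "\<lambda>w. ehh w h", symmetric] elin c) simp_all
    qed
    also have "\<dots> = tsum EHH (eL (ee a a')) (\<lambda>e h. ehh (eL e) h)"
      by (rule tsum_eL[OF bL T a a', symmetric])
    finally show "tsum EHH (eL (ee a a')) ?b = \<dots>" .
  qed
  have "x \<in> carrier E" "eL u = eR u" if "x = u" for x using u that by (simp_all add: SQ_mem)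
  then show ?thesis using A[of u] B[of u] u by simp
qed

text \<open>The preimage in the definition of \<open>sq_coact\<close> exists.\<close>

lemma sq_coact_closed [simp]: "x \<in> carrier SQ \<Longrightarrow> sq_coact k H A x \<in> carrier (ktens k SQ H)"
  and sq_coact_incl: "x \<in> carrier SQ \<Longrightarrow> tsum EH (sq_coact k H A x) eh = eL x"
proof -
  assume x: "x \<in> carrier SQ"
  have m: "eL x \<in> (\<lambda>Y. tsum EH Y eh) ` carrier (ktens k SQ H)"
    by (rule equalizer_tensor[OF module_E module_ktens[OF module_E module_H] module_H lin_eL lin_eR sq_def
          eL_closed[OF SQ_in_E[OF x]] SQ_subcomodule[OF x]])
  then show "sq_coact k H A x \<in> carrier (ktens k SQ H)" "tsum EH (sq_coact k H A x) eh = eL x"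
    unfolding sq_coact_def using inv_into_into[OF m] f_inv_into_f[OF m] by (simp_all only:)
qed

lemma over_sq_coact: "x \<in> carrier SQ \<Longrightarrow> over (carrier SQ) (carrier H) (sq_coact k H A x)"
  by (rule over_ktens[OF module_SQ module_H]) simp

lemma tsum_sq_coact:
  assumes F: "bilin E H E F" and x: "x \<in> carrier SQ"
  shows "tsum E (sq_coact k H A x) F = tsum E (eL x) F"
proof -
  have "tsum E (eL x) F = tsum E (sq_coact k H A x) (\<lambda>e h. tsum E (eh e h) F)"
    unfolding sq_coact_incl[OF x, symmetric] using F
    by (intro tsum_lin[OF lin_tsum _ _ over_sq_coact[OF x]]) simp_all
  also have "\<dots> = tsum E (sq_coact k H A x) F"
    using F by (intro tsum_cong[OF over_sq_coact[OF x]] tsum_ktens_elem) simp_all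
  finally show ?thesis ..
qed

text \<open>Coinvariants pass through the coaction, so both coactions of the enveloping algebra commute with
  multiplication by elements of the enveloping algebra of \<open>B\<close>; hence so does the condition \<open>eL x = eR x\<close>.\<close>

lemma SQ_lact:
  assumes x: "x \<in> carrier SQ" and b: "b \<in> carrier B" and b': "b' \<in> carrier B"
  shows "ee b b' \<bullet> x \<in> carrier SQ"
proof -
  note [simp] = EA.alg_E EA.mult_ee k_algebra_ring[OF EA.alg_E] ring.ring_simprules(5)[OF k_algebra_ring[OF EA.alg_E]]
  have L: "lin EH EH (\<lambda>Y. tsum EH Y (\<lambda>e h. eh (ee b b' \<bullet> e) h))"
    using b b' by (intro lin_tsum elin) simp_all
  have M: "lin E E (\<lambda>x. ee b b' \<bullet> x)" using b b' by (intro elin) simp_all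
  have bF: "bilin E H EH (\<lambda>e h. eh (ee b b' \<bullet> e) h)" using b b' by (intro elin) simp_all
  have "eL (ee b b' \<bullet> x) = tsum EH (eL x) (\<lambda>e h. eh (ee b b' \<bullet> e) h)" if "x \<in> carrier E" for x
  proof (rule EA.E_eqI[OF lin_comp[OF lin_eL M] lin_comp[OF L lin_eL] that])
    fix a a' assume a: "a \<in> carrier A" "a' \<in> carrier A"
    show "eL (ee b b' \<bullet> ee a a') = tsum EH (eL (ee a a')) (\<lambda>e h. eh (ee b b' \<bullet> e) h)"
      unfolding tsum_eL[OF bF module_ktens[OF module_E module_H] a] using a b b'
      by (simp add: eL_ee co_mult_B_left[where F = "\<lambda>d h. eh (ee d (a' \<otimes> b')) h"] elin cong: co_cong)
  qed
  moreover have "eR (ee b b' \<bullet> x) = tsum EH (eR x) (\<lambda>e h. eh (ee b b' \<bullet> e) h)" if "x \<in> carrier E" for x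
  proof (rule EA.E_eqI[OF lin_comp[OF lin_eR M] lin_comp[OF L lin_eR] that])
    fix a a' assume a: "a \<in> carrier A" "a' \<in> carrier A"
    show "eR (ee b b' \<bullet> ee a a') = tsum EH (eR (ee a a')) (\<lambda>e h. eh (ee b b' \<bullet> e) h)"
      unfolding tsum_eR[OF bF module_ktens[OF module_E module_H] a] using a b b'
      by (simp add: eR_ee co_mult_B_right[where F = "\<lambda>d h. eh (ee (b \<otimes> a) d) (antipode H h)"] elin cong: co_cong)
  qed
  ultimately show ?thesis using x b b' by (simp add: SQ_mem)
qed

lemma SQ_ract:
  assumes x: "x \<in> carrier SQ" and b: "b \<in> carrier B" and b': "b' \<in> carrier B"
  shows "x \<bullet> ee b b' \<in> carrier SQ"
proof -
  note [simp] = EA.alg_E EA.mult_ee k_algebra_ring[OF EA.alg_E] ring.ring_simprules(5)[OF k_algebra_ring[OF EA.alg_E]]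
  have L: "lin EH EH (\<lambda>Y. tsum EH Y (\<lambda>e h. eh (e \<bullet> ee b b') h))"
    using b b' by (intro lin_tsum elin) simp_all
  have M: "lin E E (\<lambda>x. x \<bullet> ee b b')" using b b' by (intro elin) simp_all
  have bF: "bilin E H EH (\<lambda>e h. eh (e \<bullet> ee b b') h)" using b b' by (intro elin) simp_all
  have "eL (x \<bullet> ee b b') = tsum EH (eL x) (\<lambda>e h. eh (e \<bullet> ee b b') h)" if "x \<in> carrier E" for x
  proof (rule EA.E_eqI[OF lin_comp[OF lin_eL M] lin_comp[OF L lin_eL] that])
    fix a a' assume a: "a \<in> carrier A" "a' \<in> carrier A"
    show "eL (ee a a' \<bullet> ee b b') = tsum EH (eL (ee a a')) (\<lambda>e h. eh (e \<bullet> ee b b') h)"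
      unfolding tsum_eL[OF bF module_ktens[OF module_E module_H] a] using a b b'
      by (simp add: eL_ee co_mult_B_right[where F = "\<lambda>d h. eh (ee d (b' \<otimes> a')) h"] elin cong: co_cong)
  qed
  moreover have "eR (x \<bullet> ee b b') = tsum EH (eR x) (\<lambda>e h. eh (e \<bullet> ee b b') h)" if "x \<in> carrier E" for x
  proof (rule EA.E_eqI[OF lin_comp[OF lin_eR M] lin_comp[OF L lin_eR] that])
    fix a a' assume a: "a \<in> carrier A" "a' \<in> carrier A"
    show "eR (ee a a' \<bullet> ee b b') = tsum EH (eR (ee a a')) (\<lambda>e h. eh (e \<bullet> ee b b') h)"
      unfolding tsum_eR[OF bF module_ktens[OF module_E module_H] a] using a b b'
      by (simp add: eR_ee co_mult_B_left[where F = "\<lambda>d h. eh (ee (a \<otimes> b) d) (antipode H h)"] elin cong: co_cong)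
  qed
  ultimately show ?thesis using x b b' by (simp add: SQ_mem)
qed

text \<open>On \<open>a \<otimes> a'\<close> this is the rule \<open>a z = (a\<^sub>[\<^sub>1\<^sub>] \<cdot> z) a\<^sub>[\<^sub>0\<^sub>]\<close> in the first factor.\<close>

lemma eL_act:
  assumes z: "z \<in> carrier Z" and x: "x \<in> carrier E"
  shows "tsum E (eL x) (\<lambda>e h. ee (act h z) \<one> \<bullet> e) = x \<bullet> ee z \<one>"
proof -
  note [simp] = EA.alg_E EA.mult_ee z
  note L = lin_comp[OF lin_Z_A act_linH[OF z]]
  have b: "bilin E H E (\<lambda>e h. ee (act h z) \<one> \<bullet> e)" by (intro elin L) simp_all
  show ?thesis
  proof (rule EA.E_eqI[OF lin_comp[OF lin_tsum[OF module_E module_H module_E b] lin_eL] _ x])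
    show "lin E E (\<lambda>x. x \<bullet> ee z \<one>)" by (intro elin) simp_all
    fix a a' assume a: "a \<in> carrier A" and a': "a' \<in> carrier A"
    have "tsum E (eL (ee a a')) (\<lambda>e h. ee (act h z) \<one> \<bullet> e) = co E a (\<lambda>c h. ee (act h z) \<one> \<bullet> ee c a')"
      by (rule tsum_eL[OF b module_E a a'])
    also have "\<dots> = co E a (\<lambda>c h. ee (act h z \<otimes> c) a')"
      using a' by (intro co_cong[OF a]) simp
    also have "\<dots> = ee (co A a (\<lambda>c h. act h z \<otimes> c)) a'"
      using a' by (intro co_lin[OF EA.lin_eeL[OF a' lin_id] _ _ a, symmetric]) simp_all
    finally show "tsum E (eL (ee a a')) (\<lambda>e h. ee (act h z) \<one> \<bullet> e) = ee a a' \<bullet> ee z \<one>"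
      using a a' by (simp add: act_commute_left)
  qed
qed

text \<open>The mirror image of \<open>eL_act\<close>. The antipode in \<open>eR\<close> is the one that occurs when \<open>y\<close> moves past the
  second factor from the left.\<close>

lemma eR_act:
  assumes y: "y \<in> carrier Z" and x: "x \<in> carrier E"
  shows "tsum E (eR x) (\<lambda>e h. ee \<one> (act h y) \<bullet> e) = x \<bullet> ee \<one> y"
proof -
  note [simp] = EA.alg_E EA.mult_ee y
  note L = lin_comp[OF lin_Z_A act_linH[OF y]]
  have b: "bilin E H E (\<lambda>e h. ee \<one> (act h y) \<bullet> e)" by (intro elin L) simp_all
  show ?thesis
  proof (rule EA.E_eqI[OF lin_comp[OF lin_tsum[OF module_E module_H module_E b] lin_eR] _ x])
    show "lin E E (\<lambda>x. x \<bullet> ee \<one> y)" by (intro elin) simp_all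
    fix a a' assume a: "a \<in> carrier A" and a': "a' \<in> carrier A"
    have "tsum E (eR (ee a a')) (\<lambda>e h. ee \<one> (act h y) \<bullet> e) =
        co E a' (\<lambda>c h. ee \<one> (act (antipode H h) y) \<bullet> ee a c)"
      by (rule tsum_eR[OF b module_E a a'])
    also have "\<dots> = co E a' (\<lambda>c h. ee a (c \<otimes> act (antipode H h) y))"
      using a by (intro co_cong[OF a']) simp
    also have "\<dots> = ee a (co A a' (\<lambda>c h. c \<otimes> act (antipode H h) y))"
      using a by (intro co_lin[OF EA.lin_eeR[OF a lin_id] _ _ a', symmetric]) simp_all
    finally show "tsum E (eR (ee a a')) (\<lambda>e h. ee \<one> (act h y) \<bullet> e) = ee a a' \<bullet> ee \<one> y"
      using a a' by (simp add: act_commute_right)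
  qed
qed

end

subsection \<open>Equivariance\<close>

context kalg
begin

lemma bim_lin_lact: "bim M \<Longrightarrow> b \<in> carrier B \<Longrightarrow> lin M M (lact M b)"
  by (rule lin_of_additive[OF additive_lact]) (simp_all add: smult_ract lact_ract)

lemma bim_lin_ract: "bim M \<Longrightarrow> b \<in> carrier B \<Longrightarrow> lin M M (\<lambda>x. ract M x b)"
  by (rule lin_of_additive[OF additive_ract]) (simp_all add: smult_lact lact_ract)

lemma bim_lin_lact_ring: "bim M \<Longrightarrow> x \<in> carrier M \<Longrightarrow> lin B M (\<lambda>b. lact M b x)"
proof (rule lin_of_additive[OF additive_lact_ring])
  fix c b assume M: "bim M" and x: "x \<in> carrier M" and c: "c \<in> carrier k" and b: "b \<in> carrier B"
  have "c \<odot> b = (c \<odot> \<one>) \<otimes> b" using c b by (simp add: k_algebra_smult[OF alg])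
  then show "lact M (c \<odot> b) x = c \<odot>\<^bsub>M\<^esub> lact M b x"
    using M x c b by (simp add: lact_mult smult_lact)
qed

lemma bim_lin_ract_ring: "bim M \<Longrightarrow> x \<in> carrier M \<Longrightarrow> lin B M (\<lambda>b. ract M x b)"
proof (rule lin_of_additive[OF additive_ract_ring])
  fix c b assume M: "bim M" and x: "x \<in> carrier M" and c: "c \<in> carrier k" and b: "b \<in> carrier B"
  have "c \<odot> b = b \<otimes> (c \<odot> \<one>)" using c b by (simp add: k_algebra_smult[OF alg])
  then show "ract M x (c \<odot> b) = c \<odot>\<^bsub>M\<^esub> ract M x b"
    using M x c b by (simp add: ract_mult smult_ract)
qed

end

locale galois_bimodule = galois k H A for k :: "'k ring" and H :: "('k, 'h) hopf" and A :: "('k, 'a, 'h) comod_alg" (structure) +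
  fixes M :: "('k, 'm, 'a) bimod"
  assumes bimM: "bimodule k (coinv k H A) M"
begin

lemma kalg_B: "kalg k B"
  by (rule kalg.intro[OF ground_axioms kalg_axioms.intro[OF alg_B]])

lemma module_M [simp]: "module k M"
  by (rule kalg.bim_module[OF kalg_B bimM])

lemmas M_lact_closed [simp] = kalg.lact_closed[OF kalg_B bimM]
  and M_ract_closed [simp] = kalg.ract_closed[OF kalg_B bimM]
  and M_lact_one [simp] = kalg.lact_one[OF kalg_B bimM, unfolded B_simps]
  and M_ract_one [simp] = kalg.ract_one[OF kalg_B bimM, unfolded B_simps]
  and lin_lact_M = kalg.bim_lin_lact[OF kalg_B bimM]
  and lin_ract_M = kalg.bim_lin_ract[OF kalg_B bimM]
  and lin_lact_B = kalg.bim_lin_lact_ring[OF kalg_B bimM]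
  and lin_ract_B = kalg.bim_lin_ract_ring[OF kalg_B bimM]

sublocale EB: enveloping k B
  by (rule enveloping.intro[OF ground_axioms enveloping_axioms.intro[OF alg_B]])

abbreviation "eb \<equiv> env_elem k B"
abbreviation "incl \<equiv> env_incl k A"

lemma lin_B_A: "lin B A (\<lambda>x. x)"
  by (rule linI) simp_all

lemma bilin_incl: "bilin B B E ee"
  by (rule bilinI) (intro elin lin_B_A, simp)+

lemma lin_incl: "lin (env k B) E incl"
  unfolding env_incl_def by (rule EB.lin_tsum_E[OF module_E bilin_incl])

lemma incl_eb: "b \<in> carrier B \<Longrightarrow> b' \<in> carrier B \<Longrightarrow> incl (eb b b') = ee b b'"
  unfolding env_incl_def by (rule EB.tsum_ee[OF module_E bilin_incl])

lemma bilin_env_act: "m \<in> carrier M \<Longrightarrow> bilin B B M (\<lambda>b b'. ract M (lact M b m) b')"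
  by (intro bilinI lin_comp[OF lin_ract_M lin_lact_B] lin_ract_B) simp_all

lemma env_act_eb: "m \<in> carrier M \<Longrightarrow> b \<in> carrier B \<Longrightarrow> b' \<in> carrier B \<Longrightarrow> env_act M (eb b b') m = ract M (lact M b m) b'"
  unfolding env_act_def by (rule EB.tsum_ee[OF module_M bilin_env_act])

lemma env_act_closed: "m \<in> carrier M \<Longrightarrow> r \<in> carrier (env k B) \<Longrightarrow> env_act M r m \<in> carrier M"
  unfolding env_act_def by (rule lin_closed[OF EB.lin_tsum_E[OF module_M bilin_env_act]])

lemma E_mult_closed: "x \<in> carrier E \<Longrightarrow> y \<in> carrier E \<Longrightarrow> x \<bullet> y \<in> carrier E"
  and E_assoc: "x \<in> carrier E \<Longrightarrow> y \<in> carrier E \<Longrightarrow> z \<in> carrier E \<Longrightarrow> x \<bullet> y \<bullet> z = x \<bullet> (y \<bullet> z)"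
  using ring.ring_simprules(5,11)[OF k_algebra_ring[OF EA.alg_E]] by blast+

lemma SQ_incl:
  assumes x: "x \<in> carrier SQ" and r: "r \<in> carrier (env k B)"
  shows "x \<bullet> incl r \<in> carrier SQ"
  using r
proof (induction r rule: EB.E_induct)
  case (gen a b)
  then show ?case using SQ_ract[OF x] by (simp only: incl_eb)
next
  case (add Y Y')
  have "x \<bullet> incl (Y \<oplus>\<^bsub>env k B\<^esub> Y') = x \<bullet> incl Y \<oplus>\<^bsub>E\<^esub> x \<bullet> incl Y'"
    using x add by (simp only: lin_add[OF lin_incl] lin_add[OF lin_multR[OF EA.alg_E SQ_in_E[OF x] lin_id]] lin_closed[OF lin_incl])
  then show ?case
    using abelian_groupE(1)[OF module_abelian[OF module_SQ] add(3,4)] by (simp only: SQ_simps)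
qed

abbreviation "P \<equiv> sqtens k H A M"

sublocale PT: bal_tensor "carrier (env k B)" "\<lambda>x r. x \<bullet> incl r" "env_act M" SQ M
  by (rule bal_tensor.intro)
    (simp_all add: module_abelian[OF module_SQ] module_abelian[OF module_M] SQ_incl env_act_closed)

abbreviation "pe \<equiv> sqtens_elem k H A M"

lemma pe_eq: "pe = PT.te"
  by (intro ext) (simp only: sqtens_elem_def)

lemma P_simps: "carrier P = carrier PT.T" "add P = add PT.T" "zero P = zero PT.T"
  "smult P = (\<lambda>c Y. tsum PT.T Y (\<lambda>x m. pe (c \<odot>\<^bsub>E\<^esub> x) m))"
  "lact P = (\<lambda>b Y. tsum PT.T Y (\<lambda>x m. pe (ee b \<one> \<bullet> x) m))"
  "ract P = (\<lambda>Y b. tsum PT.T Y (\<lambda>x m. pe (ee \<one> b \<bullet> x) m))"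
  by (simp_all only: sqtens_def Let_def make_bimod_simps)

lemma tsum_P: "tsum P = tsum PT.T"
  by (intro ext tsum_same_add) (simp_all only: P_simps)

lemma additive_P: "additive P G f \<longleftrightarrow> additive PT.T G f" "additive V P g \<longleftrightarrow> additive V PT.T g"
  by (simp_all only: additive_def additive_maps_def P_simps)

lemma pe_closed [simp]: "x \<in> carrier SQ \<Longrightarrow> m \<in> carrier M \<Longrightarrow> pe x m \<in> carrier P"
  by (simp only: pe_eq P_simps PT.te_closed)

lemma additive_SQ: "lin E E f \<Longrightarrow> (\<And>x. x \<in> carrier SQ \<Longrightarrow> f x \<in> carrier SQ) \<Longrightarrow> lin SQ SQ f"
  by (rule linI) (simp_all only: SQ_simps lin_add lin_smult SQ_in_E)

lemma left_mult:
  assumes b: "b \<in> carrier B" and b': "b' \<in> carrier B"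
  shows "additive PT.T PT.T (\<lambda>Y. tsum PT.T Y (\<lambda>x m. pe (ee b b' \<bullet> x) m))"
    and "x \<in> carrier SQ \<Longrightarrow> m \<in> carrier M \<Longrightarrow>
      tsum PT.T (pe x m) (\<lambda>x m. pe (ee b b' \<bullet> x) m) = pe (ee b b' \<bullet> x) m"
proof -
  have e: "ee b b' \<in> carrier E" using b b' by simp
  have 1: "additive SQ SQ (\<lambda>x. ee b b' \<bullet> x)"
    by (rule lin_additive[OF additive_SQ[OF lin_multR[OF EA.alg_E e lin_id] SQ_lact]]) (use b b' in simp_all)
  have 2: "ee b b' \<bullet> (x \<bullet> incl r) = ee b b' \<bullet> x \<bullet> incl r"
    if "x \<in> carrier SQ" "r \<in> carrier (env k B)" for x r
    by (rule E_assoc[OF e SQ_in_E[OF that(1)] lin_closed[OF lin_incl that(2)], symmetric])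
  note PT.left_map[OF 1 2]
  then show "additive PT.T PT.T (\<lambda>Y. tsum PT.T Y (\<lambda>x m. pe (ee b b' \<bullet> x) m))"
    and "x \<in> carrier SQ \<Longrightarrow> m \<in> carrier M \<Longrightarrow>
      tsum PT.T (pe x m) (\<lambda>x m. pe (ee b b' \<bullet> x) m) = pe (ee b b' \<bullet> x) m"
    unfolding pe_eq by blast+
qed

lemma module_P [simp]: "module k P"
  and left_smult: "c \<in> carrier k \<Longrightarrow> additive PT.T PT.T (smult P c)"
    "c \<in> carrier k \<Longrightarrow> x \<in> carrier SQ \<Longrightarrow> m \<in> carrier M \<Longrightarrow> c \<odot>\<^bsub>P\<^esub> pe x m = pe (c \<odot>\<^bsub>E\<^esub> x) m"
proof -
  interpret S: module k SQ by (rule module_SQ)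
  have fr: "c \<odot>\<^bsub>SQ\<^esub> (x \<bullet> incl r) = c \<odot>\<^bsub>SQ\<^esub> x \<bullet> incl r"
    if "c \<in> carrier k" "x \<in> carrier SQ" "r \<in> carrier (env k B)" for c x r
    unfolding SQ_simps
    by (rule k_algebra_smult(1)[OF EA.alg_E that(1) SQ_in_E[OF that(2)] lin_closed[OF lin_incl that(3)], symmetric])
  note P4 = P_simps(4)[unfolded pe_eq, folded SQ_simps(3)]
  note * = PT.left_module[where f = "smult SQ", OF cring_k lin_additive[OF lin_smultR[OF module_SQ lin_id]]
      S.smult_l_distr S.smult_assoc1 S.smult_one fr P_simps(1-3) P4]
  show "module k P" by (rule *(1))
  show "c \<in> carrier k \<Longrightarrow> additive PT.T PT.T (smult P c)" by (rule *(2))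
  show "c \<in> carrier k \<Longrightarrow> x \<in> carrier SQ \<Longrightarrow> m \<in> carrier M \<Longrightarrow> c \<odot>\<^bsub>P\<^esub> pe x m = pe (c \<odot>\<^bsub>E\<^esub> x) m"
    unfolding pe_eq using *(3) by (simp only: SQ_simps)
qed

lemma lin_peL: "m \<in> carrier M \<Longrightarrow> lin SQ P (\<lambda>x. pe x m)"
  by (rule linI) (simp, simp only: pe_eq P_simps PT.te_add_left, simp only: left_smult SQ_simps)

lemma over_P: "Y \<in> carrier P \<Longrightarrow> over (carrier SQ) (carrier M) Y"
  by (rule PT.over_T) (simp only: P_simps)

lemma lin_left_mult:
  assumes b: "b \<in> carrier B" and b': "b' \<in> carrier B"
  shows "lin P P (\<lambda>Y. tsum PT.T Y (\<lambda>x m. pe (ee b b' \<bullet> x) m))"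
proof (rule lin_of_additive)
  note ad = left_mult(1)[OF b b'] and el = left_mult(2)[OF b b']
  show "additive P P (\<lambda>Y. tsum PT.T Y (\<lambda>x m. pe (ee b b' \<bullet> x) m))" using ad by (simp only: additive_P)
  fix c Y assume c: "c \<in> carrier k" and Y: "Y \<in> carrier P"
  show "tsum PT.T (c \<odot>\<^bsub>P\<^esub> Y) (\<lambda>x m. pe (ee b b' \<bullet> x) m) = c \<odot>\<^bsub>P\<^esub> tsum PT.T Y (\<lambda>x m. pe (ee b b' \<bullet> x) m)"
  proof (rule PT.additive_eqI[OF additive_comp[OF left_smult(1)[OF c] ad] additive_comp[OF ad left_smult(1)[OF c]]])
    show "Y \<in> carrier PT.T" using Y by (simp only: P_simps)
    fix x m assume x: "x \<in> carrier SQ" and m: "m \<in> carrier M"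
    have s: "c \<odot>\<^bsub>E\<^esub> x \<in> carrier SQ" using module.smult_closed[OF module_SQ c x] by (simp only: SQ_simps)
    have "ee b b' \<bullet> (c \<odot>\<^bsub>E\<^esub> x) = c \<odot>\<^bsub>E\<^esub> (ee b b' \<bullet> x)"
      using b b' by (intro k_algebra_smult(2)[OF EA.alg_E c _ SQ_in_E[OF x]]) simp
    then show "tsum PT.T (c \<odot>\<^bsub>P\<^esub> PT.te x m) (\<lambda>x m. pe (ee b b' \<bullet> x) m) =
        c \<odot>\<^bsub>P\<^esub> tsum PT.T (PT.te x m) (\<lambda>x m. pe (ee b b' \<bullet> x) m)"
      by (simp only: pe_eq[symmetric] el[OF x m] left_smult(2)[OF c x m] el[OF s m] left_smult(2)[OF c SQ_lact[OF x b b'] m])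
  qed
qed

lemma lin_lact_P: "b \<in> carrier B \<Longrightarrow> lin P P (lact P b)"
  and lin_ract_P: "b \<in> carrier B \<Longrightarrow> lin P P (\<lambda>q. ract P q b)"
  unfolding P_simps by (rule lin_left_mult, simp_all)+

lemma lact_pe: "b \<in> carrier B \<Longrightarrow> x \<in> carrier SQ \<Longrightarrow> m \<in> carrier M \<Longrightarrow> lact P b (pe x m) = pe (ee b \<one> \<bullet> x) m"
  and ract_pe: "b \<in> carrier B \<Longrightarrow> x \<in> carrier SQ \<Longrightarrow> m \<in> carrier M \<Longrightarrow> ract P (pe x m) b = pe (ee \<one> b \<bullet> x) m"
  unfolding P_simps by (rule left_mult(2); simp)+

lemma lin_mult_B_SQ:
  assumes x: "x \<in> carrier SQ"
  shows "lin B SQ (\<lambda>b. ee b \<one> \<bullet> x)" "lin B SQ (\<lambda>b. ee \<one> b \<bullet> x)"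
proof -
  have *: "lin B SQ f" if "lin B E f" "\<And>b. b \<in> carrier B \<Longrightarrow> f b \<in> carrier SQ" for f
    by (rule linI) (simp_all only: SQ_simps lin_add[OF that(1)] lin_smult[OF that(1)] that(2))
  show "lin B SQ (\<lambda>b. ee b \<one> \<bullet> x)" "lin B SQ (\<lambda>b. ee \<one> b \<bullet> x)"
    by (rule *; (intro lin_multL[OF EA.alg_E SQ_in_E[OF x]] EA.lin_eeL EA.lin_eeR lin_B_A)?; simp add: SQ_lact[OF x])+
qed

lemma lin_lact_P_B:
  assumes q: "q \<in> carrier P"
  shows "lin B P (\<lambda>b. lact P b q)" "lin B P (\<lambda>b. ract P q b)"
  unfolding P_simps tsum_P[symmetric]
  by (rule lin_tsum_fun[OF module_P over_P[OF q]], rule lin_comp[OF lin_peL], assumption, rule lin_mult_B_SQ, assumption)+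

abbreviation "PH \<equiv> ktens k P H"
abbreviation "pt \<equiv> ktens_elem k P H"
abbreviation "rho \<equiv> sqtens_coact k H A M"

lemma rho_inner_closed: "x \<in> carrier SQ \<Longrightarrow> m \<in> carrier M \<Longrightarrow> tsum PH (sq_coact k H A x) (\<lambda>u h. pt (pe u m) h) \<in> carrier PH"
  by (rule tsum_closed[OF module_abelian over_sq_coact]) simp_all

lemma rho_closed: "p \<in> carrier P \<Longrightarrow> rho p \<in> carrier PH"
  unfolding sqtens_coact_def Let_def
  by (rule tsum_closed[OF module_abelian over_P rho_inner_closed]) simp_all

lemma tsum_rho:
  assumes F: "bilin P H G F" and G: "module k G" and p: "p \<in> carrier P"
  shows "tsum G (rho p) F = tsum G p (\<lambda>x m. tsum G (sq_coact k H A x) (\<lambda>u h. F (pe u m) h))"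
proof -
  note L = lin_tsum[OF module_P module_H G F]
  have PH: "module k PH" by simp
  have "tsum G (rho p) F = tsum G p (\<lambda>x m. tsum G (tsum PH (sq_coact k H A x) (\<lambda>u h. pt (pe u m) h)) F)"
    unfolding sqtens_coact_def Let_def by (rule tsum_lin[OF L PH G over_P[OF p] rho_inner_closed])
  also have "\<dots> = tsum G p (\<lambda>x m. tsum G (sq_coact k H A x) (\<lambda>u h. F (pe u m) h))"
  proof (rule tsum_cong[OF over_P[OF p]])
    fix x m assume x: "x \<in> carrier SQ" and m: "m \<in> carrier M"
    have "tsum G (tsum PH (sq_coact k H A x) (\<lambda>u h. pt (pe u m) h)) F =
        tsum G (sq_coact k H A x) (\<lambda>u h. tsum G (pt (pe u m) h) F)"
      using m by (intro tsum_lin[OF L PH G over_sq_coact[OF x]]) simp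
    also have "\<dots> = tsum G (sq_coact k H A x) (\<lambda>u h. F (pe u m) h)"
      using m by (intro tsum_cong[OF over_sq_coact[OF x]] tsum_ktens_elem[OF _ _ _ F]) (simp_all add: G)
    finally show "tsum G (tsum PH (sq_coact k H A x) (\<lambda>u h. pt (pe u m) h)) F = \<dots>" .
  qed
  finally show ?thesis .
qed

lemma act_B [simp]: "h \<in> carrier H \<Longrightarrow> z \<in> carrier Z \<Longrightarrow> act h z \<in> carrier B"
  by (intro Z_in_B act_closed)

lemma lin_act_B: "z \<in> carrier Z \<Longrightarrow> lin H B (\<lambda>h. act h z)"
  by (rule linI) (simp_all only: act_B B_simps lin_add[OF act_linH] lin_smult[OF act_linH] Z_simps)

text \<open>At \<open>x \<otimes> m\<close> the left-hand side is \<open>x \<otimes> z m\<close> by \<open>eL_act\<close>, and the right-hand side is \<open>x \<otimes> m y\<close> by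
  \<open>eR_act\<close>: on \<open>A\<^sup>\<box>\<^sup>e\<close> the two coactions coincide, and elements of the enveloping algebra of \<open>B\<close> cross
  the tensor sign.\<close>

lemma rho_act:
  assumes y: "y \<in> carrier Z" and z: "z \<in> carrier Z" and eq: "\<And>m. m \<in> carrier M \<Longrightarrow> ract M m y = lact M z m"
    and p: "p \<in> carrier P"
  shows "tsum P (rho p) (\<lambda>q h. lact P (act h z) q) = tsum P (rho p) (\<lambda>q h. ract P q (act h y))"
proof -
  note zB = Z_in_B[OF z] and yB = Z_in_B[OF y]
  note o = B.one_closed
  have b1: "bilin P H P (\<lambda>q h. lact P (act h z) q)"
    using z by (intro bilinI lin_lact_P lin_comp[OF lin_lact_P_B(1) lin_act_B]) simp_all
  have b2: "bilin P H P (\<lambda>q h. ract P q (act h y))"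
    using y by (intro bilinI lin_ract_P lin_comp[OF lin_lact_P_B(2) lin_act_B]) simp_all
  have LA: "lin H A (\<lambda>h. act h w)" if "w \<in> carrier Z" for w by (rule lin_comp[OF lin_Z_A act_linH[OF that]])
  have bE: "bilin E H E (\<lambda>e h. ee (act h z) \<one> \<bullet> e)" "bilin E H E (\<lambda>e h. ee \<one> (act h y) \<bullet> e)"
    using y z by (intro elin LA; simp add: EA.alg_E)+
  have S1: "tsum P (sq_coact k H A x) (\<lambda>u h. lact P (act h z) (pe u m)) = pe x (lact M z m)"
    if x: "x \<in> carrier SQ" and m: "m \<in> carrier M" for x m
  proof -
    have "tsum P (sq_coact k H A x) (\<lambda>u h. lact P (act h z) (pe u m)) =
        tsum P (sq_coact k H A x) (\<lambda>u h. pe (ee (act h z) \<one> \<bullet> u) m)"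
      by (intro tsum_cong[OF over_sq_coact[OF x]] lact_pe m act_B z)
    also have "\<dots> = pe (tsum SQ (sq_coact k H A x) (\<lambda>u h. ee (act h z) \<one> \<bullet> u)) m"
      by (intro tsum_lin[OF lin_peL[OF m] module_SQ module_P over_sq_coact[OF x], symmetric] SQ_lact act_B z o)
    also have "tsum SQ (sq_coact k H A x) (\<lambda>u h. ee (act h z) \<one> \<bullet> u) =
        tsum E (sq_coact k H A x) (\<lambda>u h. ee (act h z) \<one> \<bullet> u)"
      by (intro tsum_lin[OF lin_SQ_E module_SQ module_E over_sq_coact[OF x]] SQ_lact act_B z o)
    also have "\<dots> = x \<bullet> incl (eb z \<one>)"
      by (simp only: tsum_sq_coact[OF bE(1) x] eL_act[OF z SQ_in_E[OF x]] incl_eb[OF zB o])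
    also have "pe \<dots> m = pe x (env_act M (eb z \<one>) m)"
      unfolding pe_eq by (rule PT.te_balanced[OF x EB.ee_closed[OF zB o] m])
    also have "\<dots> = pe x (lact M z m)"
      using zB m by (simp only: env_act_eb[OF m zB o] M_ract_one M_lact_closed)
    finally show ?thesis .
  qed
  have S2: "tsum P (sq_coact k H A x) (\<lambda>u h. ract P (pe u m) (act h y)) = pe x (ract M m y)"
    if x: "x \<in> carrier SQ" and m: "m \<in> carrier M" for x m
  proof -
    have LR: "eL x = eR x" using x unfolding SQ_mem by blast
    have "tsum P (sq_coact k H A x) (\<lambda>u h. ract P (pe u m) (act h y)) =
        tsum P (sq_coact k H A x) (\<lambda>u h. pe (ee \<one> (act h y) \<bullet> u) m)"
      by (intro tsum_cong[OF over_sq_coact[OF x]] ract_pe m act_B y)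
    also have "\<dots> = pe (tsum SQ (sq_coact k H A x) (\<lambda>u h. ee \<one> (act h y) \<bullet> u)) m"
      by (intro tsum_lin[OF lin_peL[OF m] module_SQ module_P over_sq_coact[OF x], symmetric] SQ_lact act_B y o)
    also have "tsum SQ (sq_coact k H A x) (\<lambda>u h. ee \<one> (act h y) \<bullet> u) =
        tsum E (sq_coact k H A x) (\<lambda>u h. ee \<one> (act h y) \<bullet> u)"
      by (intro tsum_lin[OF lin_SQ_E module_SQ module_E over_sq_coact[OF x]] SQ_lact act_B y o)
    also have "\<dots> = x \<bullet> incl (eb \<one> y)"
      by (simp only: tsum_sq_coact[OF bE(2) x] LR eR_act[OF y SQ_in_E[OF x]] incl_eb[OF o yB])
    also have "pe \<dots> m = pe x (env_act M (eb \<one> y) m)"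
      unfolding pe_eq by (rule PT.te_balanced[OF x EB.ee_closed[OF o yB] m])
    also have "\<dots> = pe x (ract M m y)"
      using m by (simp only: env_act_eb[OF m o yB] M_lact_one)
    finally show ?thesis .
  qed
  have "tsum P (rho p) (\<lambda>q h. lact P (act h z) q) = tsum P p (\<lambda>x m. pe x (lact M z m))"
    unfolding tsum_rho[OF b1 module_P p] by (rule tsum_cong[OF over_P[OF p] S1])
  also have "\<dots> = tsum P p (\<lambda>x m. pe x (ract M m y))"
    by (rule tsum_cong[OF over_P[OF p]]) (simp only: eq)
  also have "\<dots> = tsum P (rho p) (\<lambda>q h. ract P q (act h y))"
    unfolding tsum_rho[OF b2 module_P p] by (rule tsum_cong[OF over_P[OF p] S2[symmetric]])
  finally show ?thesis .
qed

end

context galois_bimodule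
begin

abbreviation "MT \<equiv> ktens k M H"
abbreviation "em \<equiv> ktens_elem k M H"
abbreviation "MH \<equiv> bimod_H k H M"
abbreviation "MHH \<equiv> ktens k MH H"
abbreviation "emh \<equiv> ktens_elem k MH H"
abbreviation "rhoM \<equiv> bimod_H_coact k H M"

lemma MH_simps: "carrier MH = carrier MT" "add MH = add MT" "zero MH = zero MT" "smult MH = smult MT"
  "lact MH = (\<lambda>b X. tsum MT X (\<lambda>m h. em (lact M b m) h))"
  "ract MH = (\<lambda>X b. tsum MT X (\<lambda>m h. em (ract M m b) h))"
  by (simp_all only: bimod_H_def Let_def make_bimod_simps)

lemma module_MH [simp]: "module k MH"
  by (rule module_cong[OF module_ktens[OF module_M module_H]]) (simp_all only: MH_simps)

lemma lin_MH: "lin MH G f \<longleftrightarrow> lin MT G f" "lin V MH g \<longleftrightarrow> lin V MT g"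
  by (simp_all only: lin_def linear_maps_def additive_maps_def MH_simps)

lemma em_closed [simp]: "m \<in> carrier M \<Longrightarrow> h \<in> carrier H \<Longrightarrow> em m h \<in> carrier MH"
  by (simp add: MH_simps)

lemma lin_emL: "h \<in> carrier H \<Longrightarrow> lin V M f \<Longrightarrow> lin V MH (\<lambda>v. em (f v) h)"
  unfolding lin_MH by (intro elin) simp_all

lemma lin_emR: "m \<in> carrier M \<Longrightarrow> lin V H f \<Longrightarrow> lin V MH (\<lambda>v. em m (f v))"
  unfolding lin_MH by (intro elin) simp_all

lemma lact_MH:
  assumes b: "b \<in> carrier B"
  shows "lin MH MH (lact MH b)" "lin MH MH (\<lambda>X. ract MH X b)"
    and "m \<in> carrier M \<Longrightarrow> h \<in> carrier H \<Longrightarrow> lact MH b (em m h) = em (lact M b m) h"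
    and "m \<in> carrier M \<Longrightarrow> h \<in> carrier H \<Longrightarrow> ract MH (em m h) b = em (ract M m b) h"
proof -
  have l: "bilin M H MT (\<lambda>m h. em (lact M b m) h)" by (intro elin lin_lact_M b) (simp_all add: b)
  have r: "bilin M H MT (\<lambda>m h. em (ract M m b) h)" by (intro elin lin_ract_M b) (simp_all add: b)
  note T = module_ktens[OF module_M module_H]
  show "lin MH MH (lact MH b)" "lin MH MH (\<lambda>X. ract MH X b)"
    unfolding lin_MH unfolding MH_simps by (rule lin_tsum[OF module_M module_H T l], rule lin_tsum[OF module_M module_H T r])
  show "m \<in> carrier M \<Longrightarrow> h \<in> carrier H \<Longrightarrow> lact MH b (em m h) = em (lact M b m) h"
    unfolding MH_simps by (rule tsum_ktens_elem[OF module_M module_H module_abelian[OF T] l])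
  show "m \<in> carrier M \<Longrightarrow> h \<in> carrier H \<Longrightarrow> ract MH (em m h) b = em (ract M m b) h"
    unfolding MH_simps by (rule tsum_ktens_elem[OF module_M module_H module_abelian[OF T] r])
qed

lemma lin_act_MH:
  assumes z: "z \<in> carrier Z" and w: "w \<in> carrier MH"
  shows "lin H MH (\<lambda>h. lact MH (act h z) w)" "lin H MH (\<lambda>h. ract MH w (act h z))"
proof -
  have w': "w \<in> carrier MT" using w by (simp only: MH_simps)
  note T = module_ktens[OF module_M module_H]
  show "lin H MH (\<lambda>h. lact MH (act h z) w)"
    unfolding lin_MH unfolding MH_simps
    by (rule lin_tsum_ktens[OF module_M module_H w' T], rule lin_elemL[OF module_M module_H], assumption)
      (rule lin_comp[OF lin_lact_B lin_act_B[OF z]])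
  show "lin H MH (\<lambda>h. ract MH w (act h z))"
    unfolding lin_MH unfolding MH_simps
    by (rule lin_tsum_ktens[OF module_M module_H w' T], rule lin_elemL[OF module_M module_H], assumption)
      (rule lin_comp[OF lin_ract_B lin_act_B[OF z]])
qed

lemma tsum_rhoM:
  assumes F: "bilin MH H G F" and G: "module k G" and m: "m \<in> carrier M" and g: "g \<in> carrier H"
  shows "tsum G (rhoM (em m g)) F = sw G g (\<lambda>u v. F (em m u) v)"
proof -
  have b: "bilin M H MHH (\<lambda>m h. sw MHH h (\<lambda>u v. emh (em m u) v))"
    by (intro elin lin_emL lin_emR) simp_all
  have "rhoM (em m g) = sw MHH g (\<lambda>u v. emh (em m u) v)"
    unfolding bimod_H_coact_def Let_def by (rule tsum_ktens_elem[OF module_M module_H _ b m g]) simp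
  then have "tsum G (rhoM (em m g)) F = sw G g (\<lambda>u v. tsum G (emh (em m u) v) F)"
    using m by (simp only:) (intro sw_lin[OF lin_tsum[OF module_MH module_H G F] _ G g]; simp)
  also have "\<dots> = sw G g (\<lambda>u v. F (em m u) v)"
    using m by (intro sw_cong[OF g] tsum_ktens_elem[OF module_MH module_H module_abelian[OF G] F]) simp_all
  finally show ?thesis .
qed

text \<open>An isomorphism of \<open>P\<close> with \<open>M \<otimes> H\<close> turns the cancellation law for \<open>P\<close> into equivariance on \<open>M\<close>:
  evaluate it on the preimage of \<open>m \<otimes> g\<close> and apply the counit.\<close>

lemma stable_action:
  assumes \<phi>: "\<phi> \<in> cobimod_iso k H B P rho MH rhoM"
    and y: "y \<in> carrier Z" and z: "z \<in> carrier Z" and eq: "\<And>m. m \<in> carrier M \<Longrightarrow> ract M m y = lact M z m"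
    and g: "g \<in> carrier H" and m: "m \<in> carrier M"
  shows "ract M m (act g y) = lact M (act g z) m"
proof -
  have iso: "\<phi> \<in> bimod_iso k B P MH" and co: "\<And>p. p \<in> carrier P \<Longrightarrow> rhoM (\<phi> p) = tsum MHH (rho p) (\<lambda>q h. emh (\<phi> q) h)"
    using \<phi> unfolding cobimod_iso_def by blast+
  have L: "lin P MH \<phi>" and bij: "bij_betw \<phi> (carrier P) (carrier MH)"
    and \<phi>l: "\<And>b q. b \<in> carrier B \<Longrightarrow> q \<in> carrier P \<Longrightarrow> \<phi> (lact P b q) = lact MH b (\<phi> q)"
    and \<phi>r: "\<And>b q. b \<in> carrier B \<Longrightarrow> q \<in> carrier P \<Longrightarrow> \<phi> (ract P q b) = ract MH (\<phi> q) b"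
    using iso unfolding bimod_iso_def lin_def by blast+
  note \<phi>c = lin_closed[OF L]
  have "em m g \<in> \<phi> ` carrier P" using bij m g by (simp add: bij_betw_def)
  then obtain p where p: "p \<in> carrier P" "em m g = \<phi> p" by blast
  have ov: "over (carrier P) (carrier H) (rho p)"
    by (rule over_ktens[OF module_P module_H rho_closed[OF p(1)]])
  have T: "tsum MH (rhoM (em m g)) F = tsum MH (rho p) (\<lambda>q h. F (\<phi> q) h)" if F: "bilin MH H MH F" for F
  proof -
    have "tsum MH (rhoM (em m g)) F = tsum MH (rho p) (\<lambda>q h. tsum MH (emh (\<phi> q) h) F)"
      unfolding p(2) co[OF p(1)]
      by (rule tsum_lin[OF lin_tsum[OF module_MH module_H module_MH F] _ module_MH ov]) (simp_all add: \<phi>c)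
    also have "\<dots> = tsum MH (rho p) (\<lambda>q h. F (\<phi> q) h)"
      by (intro tsum_cong[OF ov] tsum_ktens_elem[OF module_MH module_H module_abelian[OF module_MH] F] \<phi>c)
    finally show ?thesis .
  qed
  let ?FL = "\<lambda>w h. lact MH (act h z) w" and ?FR = "\<lambda>w h. ract MH w (act h y)"
  have bL: "bilin MH H MH ?FL" by (intro bilinI lact_MH(1) act_B lin_act_MH(1) z)
  have bR: "bilin MH H MH ?FR" by (intro bilinI lact_MH(2) act_B lin_act_MH(2) y)
  have "sw MH g (\<lambda>u v. em (lact M (act v z) m) u) = sw MH g (\<lambda>u v. ?FL (em m u) v)"
    using m by (intro sw_cong[OF g]) (simp only: lact_MH(3)[OF act_B[OF _ z]])
  also have "\<dots> = tsum MH (rho p) (\<lambda>q h. ?FL (\<phi> q) h)"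
    unfolding T[OF bL, symmetric] by (rule tsum_rhoM[OF bL module_MH m g, symmetric])
  also have "\<dots> = tsum MH (rho p) (\<lambda>q h. \<phi> (lact P (act h z) q))"
    by (intro tsum_cong[OF ov]) (simp only: \<phi>l act_B z)
  also have "\<dots> = \<phi> (tsum P (rho p) (\<lambda>q h. lact P (act h z) q))"
    by (rule tsum_lin[OF L module_P module_MH ov, symmetric]) (rule lin_closed[OF lin_lact_P], simp_all add: z)
  also have "\<dots> = \<phi> (tsum P (rho p) (\<lambda>q h. ract P q (act h y)))"
    by (simp only: rho_act[OF y z eq p(1)])
  also have "\<dots> = tsum MH (rho p) (\<lambda>q h. \<phi> (ract P q (act h y)))"
    by (rule tsum_lin[OF L module_P module_MH ov]) (rule lin_closed[OF lin_ract_P], simp_all add: y)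
  also have "\<dots> = tsum MH (rho p) (\<lambda>q h. ?FR (\<phi> q) h)"
    by (intro tsum_cong[OF ov]) (simp only: \<phi>r act_B y)
  also have "\<dots> = sw MH g (\<lambda>u v. ?FR (em m u) v)"
    unfolding T[OF bR, symmetric] by (rule tsum_rhoM[OF bR module_MH m g])
  also have "\<dots> = sw MH g (\<lambda>u v. em (ract M m (act v y)) u)"
    using m by (intro sw_cong[OF g]) (simp only: lact_MH(4)[OF act_B[OF _ y]])
  finally have *: "sw MH g (\<lambda>u v. em (lact M (act v z) m) u) = sw MH g (\<lambda>u v. em (ract M m (act v y)) u)" .
  let ?J = "\<lambda>X. tsum M X (\<lambda>m h. counit H h \<odot>\<^bsub>M\<^esub> m)"
  have bJ: "bilin M H M (\<lambda>m h. counit H h \<odot>\<^bsub>M\<^esub> m)" by (intro elin) simp_all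
  have J: "lin MH M ?J" unfolding lin_MH by (rule lin_tsum[OF module_M module_H module_M bJ])
  have e: "?J (sw MH g (\<lambda>u v. em (f v) u)) = f g" if f: "lin H M f" for f
  proof -
    have "?J (sw MH g (\<lambda>u v. em (f v) u)) = sw M g (\<lambda>u v. ?J (em (f v) u))"
      by (rule sw_lin[OF J module_MH module_M g]) (simp add: lin_closed[OF f])
    also have "\<dots> = sw M g (\<lambda>u v. counit H u \<odot>\<^bsub>M\<^esub> f v)"
      by (intro sw_cong[OF g] tsum_ktens_elem[OF module_M module_H module_abelian[OF module_M] bJ] lin_closed[OF f])
    also have "\<dots> = f g" by (rule sw_counit_left[OF f module_M g])
    finally show ?thesis .
  qed
  show ?thesis
    using e[OF lin_comp[OF lin_lact_B[OF m] lin_act_B[OF z]]] e[OF lin_comp[OF lin_ract_B[OF m] lin_act_B[OF y]]] *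
    by simp
qed

end

context galois
begin

lemma kalg_B: "kalg k B"
  by (rule kalg.intro[OF ground_axioms kalg_axioms.intro[OF alg_B]])

text \<open>For \<open>z = \<xi>\<^sub>M(x)\<close>, \<open>stable_action\<close> is the characterization of \<open>\<xi>\<^sub>M(h \<cdot> x)\<close>.\<close>

lemma stable_equivariant:
  assumes X: "strict_morita k B X" and st: "H_stable k H A X"
  shows "equivariant (xi B X)"
proof -
  obtain s t where "context_pairings k B (modM X) (modN X)
      (\<lambda>m n. alpha X (btens_elem B (modM X) (modN X) m n)) (\<lambda>n m. beta X (btens_elem B (modN X) (modM X) n m)) s t"
    by (rule kalg.strict_context[OF kalg_B X])
  note c = this
  define \<xi> where "\<xi> = context_pairings.XI B (modM X)"
  have \<xi>: "xi B X = \<xi>" unfolding \<xi>_def by (rule context_pairings.xi_eq_XI[OF c refl])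
  note zc = ZB_def[of k H A, symmetric]
  note facts = context_pairings.XI_closed[OF c, folded \<xi>_def, unfolded zc] context_pairings.XI_act[OF c, folded \<xi>_def, unfolded zc]
    context_pairings.XI_eqI[OF c, folded \<xi>_def, unfolded zc]
  have M: "bimodule k B (modM X)" using X unfolding strict_morita_def Let_def by blast
  interpret GM: galois_bimodule k H A "modM X"
    by (rule galois_bimodule.intro[OF galois_axioms galois_bimodule_axioms.intro[OF M]])
  obtain \<phi> where \<phi>: "\<phi> \<in> cobimod_iso k H B GM.P GM.rho GM.MH GM.rhoM"
    using st unfolding H_stable_def Let_def by blast
  show ?thesis
    unfolding \<xi> equivariant_def
  proof (intro conjI ballI)
    show "bij_betw \<xi> (carrier Z) (carrier Z)"
      unfolding \<xi>_def ZB_def by (rule context_pairings.XI_bij[OF c])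
    show "lin Z Z \<xi>"
      by (rule linI) (use context_pairings.XI_add[OF c, folded \<xi>_def, unfolded zc B_simps]
          context_pairings.XI_smult[OF c, folded \<xi>_def, unfolded zc B_simps] facts(1) in \<open>simp_all only: Z_simps\<close>)
    show "\<xi> \<one> = \<one>" using context_pairings.XI_one[OF c, folded \<xi>_def, unfolded B_simps] .
    show "\<xi> (x \<otimes> y) = \<xi> x \<otimes> \<xi> y" if "x \<in> carrier Z" "y \<in> carrier Z" for x y
      using context_pairings.XI_mult[OF c, folded \<xi>_def, unfolded zc B_simps] that .
    show "\<xi> (act h x) = act h (\<xi> x)" if h: "h \<in> carrier H" and x: "x \<in> carrier Z" for h x
      by (rule facts(3)[OF act_closed[OF h x] act_closed[OF h facts(1)[OF x]]
            GM.stable_action[OF \<phi> x facts(1)[OF x] facts(2)[OF x] h]])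
  qed
qed

lemma equivariant_cong:
  assumes "equivariant \<phi>" "\<And>x. x \<in> carrier Z \<Longrightarrow> \<psi> x = \<phi> x"
  shows "equivariant \<psi>"
  unfolding equivariant_def
proof (intro conjI ballI)
  note e = equivariantD[OF assms(1)]
  show "bij_betw \<psi> (carrier Z) (carrier Z)" using e(1) bij_betw_cong[of "carrier Z" \<psi> \<phi>] assms(2) by blast
  show "lin Z Z \<psi>" by (rule lin_cong[OF e(2)]) (simp_all add: assms(2))
  show "\<psi> \<one> = \<one>" by (simp only: assms(2)[OF Z.one_closed] e(3))
  show "\<psi> (x \<otimes> y) = \<psi> x \<otimes> \<psi> y" if "x \<in> carrier Z" "y \<in> carrier Z" for x y
    by (simp only: assms(2) that Z.m_closed e(4))
  show "\<psi> (act h x) = act h (\<psi> x)" if "h \<in> carrier H" "x \<in> carrier Z" for h x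
    by (simp only: assms(2) that act_closed e(5))
qed

lemma push_compose:
  assumes f: "f \<in> carrier (CM n)" and eq: "\<And>x. x \<in> carrier Z \<Longrightarrow> \<chi> x = \<phi> (\<psi> x)"
  shows "push n \<chi> f = push n \<phi> (push n \<psi> f)"
  unfolding push_def compose_def by (rule restrict_ext) (simp add: eq lin_closed[OF conv_lin[OF f]])

lemma push_id:
  assumes f: "f \<in> carrier (CM n)" and eq: "\<And>x. x \<in> carrier Z \<Longrightarrow> \<chi> x = x"
  shows "push n \<chi> f = f"
proof -
  have "push n \<chi> f x = f x" for x
  proof (cases "x \<in> carrier (TP n)")
    case True
    then show ?thesis by (simp add: push_def compose_def eq lin_closed[OF conv_lin[OF f]])
  next
    case False
    moreover have "f \<in> extensional (carrier (TP n))" using f unfolding conv_mem by blast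
    ultimately show ?thesis by (simp add: push_def compose_def extensional_def)
  qed
  then show ?thesis by (rule ext)
qed

lemma act_cochain_push: "act_cochain k H A n C = push n (xi_class B C)"
  by (simp add: fun_eq_iff act_cochain_def push_def)

end

text \<open>The product of \<open>AutoGroup E\<close> is the composition of restricted functions; \<open>F\<close> supplies the closure that
  composing the restrictions requires.\<close>

lemma acts_by_automorphismsI:
  assumes F: "\<And>C. C \<in> carrier G \<Longrightarrow> restrict (a C) (carrier E) \<in> auto E"
    and m: "\<And>C D x. C \<in> carrier G \<Longrightarrow> D \<in> carrier G \<Longrightarrow> x \<in> carrier E \<Longrightarrow> a (C \<otimes>\<^bsub>G\<^esub> D) x = a C (a D x)"
    and o: "\<And>x. x \<in> carrier E \<Longrightarrow> a \<one>\<^bsub>G\<^esub> x = x"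
  shows "acts_by_automorphisms G E a"
  unfolding acts_by_automorphisms_def
proof
  have B: "restrict (a C) (carrier E) \<in> Bij (carrier E)" if "C \<in> carrier G" for C
    using F[OF that] by (simp add: auto_def)
  have cl: "a C x \<in> carrier E" if "C \<in> carrier G" "x \<in> carrier E" for C x
    using B[OF that(1)] that(2) by (auto simp: Bij_def bij_betw_def)
  show "(\<lambda>c. restrict (a c) (carrier E)) \<in> hom G (AutoGroup E)"
  proof (rule homI)
    show "restrict (a C) (carrier E) \<in> carrier (AutoGroup E)" if "C \<in> carrier G" for C
      using F[OF that] by (simp add: AutoGroup_def)
    fix C D assume C: "C \<in> carrier G" and D: "D \<in> carrier G"
    have "restrict (a (C \<otimes>\<^bsub>G\<^esub> D)) (carrier E) = compose (carrier E) (restrict (a C) (carrier E)) (restrict (a D) (carrier E))"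
      unfolding compose_def by (rule restrict_ext) (simp add: m[OF C D] cl[OF D])
    then show "restrict (a (C \<otimes>\<^bsub>G\<^esub> D)) (carrier E) =
        restrict (a C) (carrier E) \<otimes>\<^bsub>AutoGroup E\<^esub> restrict (a D) (carrier E)"
      by (simp add: AutoGroup_def BijGroup_def B[OF C] B[OF D])
  qed
  show "restrict (a \<one>\<^bsub>G\<^esub>) (carrier E) = \<one>\<^bsub>AutoGroup E\<^esub>"
    by (simp add: AutoGroup_def BijGroup_def o cong: restrict_cong)
qed

section \<open>The action of the stable classes\<close>

context galois
begin

lemma PicH_simps:
  "C \<in> carrier (PicH k H A) \<longleftrightarrow> (\<exists>X :: ('k, 'a, nat \<Rightarrow> 'a, nat \<Rightarrow> 'a) morita.
     C = morita_class k B X \<and> strict_morita k B X \<and> H_stable k H A X)"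
  "mult (PicH k H A) = mult (Pic k B)" "one (PicH k H A) = one (Pic k B)"
  by (auto simp: PicH_def Let_def)

lemma PicH_equivariant:
  assumes "C \<in> carrier (PicH k H A)"
  shows "equivariant (xi_class B C)"
proof -
  obtain X :: "('k, 'a, nat \<Rightarrow> 'a, nat \<Rightarrow> 'a) morita"
    where X: "C = morita_class k B X" "strict_morita k B X" "H_stable k H A X"
    using assms unfolding PicH_simps by blast
  show ?thesis
    by (rule equivariant_cong[OF stable_equivariant[OF X(2,3)]])
      (simp only: X(1) kalg.xi_class_eq[OF kalg_B X(2)] ZB_def)
qed

lemma PicH_xi_mult:
  assumes C: "C \<in> carrier (PicH k H A)" and D: "D \<in> carrier (PicH k H A)" and x: "x \<in> carrier Z"
  shows "xi_class B (C \<otimes>\<^bsub>PicH k H A\<^esub> D) x = xi_class B C (xi_class B D x)"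
proof -
  obtain X Y :: "('k, 'a, nat \<Rightarrow> 'a, nat \<Rightarrow> 'a) morita"
    where X: "C = morita_class k B X" "strict_morita k B X"
      and Y: "D = morita_class k B Y" "strict_morita k B Y"
    using C D unfolding PicH_simps by blast
  have x': "x \<in> carrier (center B)" using x by (simp only: ZB_def)
  have "xi_class B D x \<in> carrier Z" by (rule equivariantD(6)[OF PicH_equivariant[OF D] x])
  then have y: "xi B Y x \<in> carrier (center B)"
    unfolding Y(1) kalg.xi_class_eq[OF kalg_B Y(2) x'] by (simp only: ZB_def)
  show ?thesis
    unfolding PicH_simps X(1) Y(1) kalg.xi_class_mult[OF kalg_B X(2) Y(2) x'] kalg.xi_class_eq[OF kalg_B Y(2) x']
      kalg.xi_class_eq[OF kalg_B X(2) y] ..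
qed

lemma PicH_xi_one: "x \<in> carrier Z \<Longrightarrow> xi_class B \<one>\<^bsub>PicH k H A\<^esub> x = x"
  unfolding PicH_simps ZB_def by (rule kalg.xi_class_one[OF kalg_B])

lemma PicH_acts:
  assumes K: "carrier K \<subseteq> carrier (CM n)"
    and auto: "\<And>\<phi>. equivariant \<phi> \<Longrightarrow> restrict (push n \<phi>) (carrier K) \<in> auto K"
  shows "acts_by_automorphisms (PicH k H A) K (act_cochain k H A n)"
proof (rule acts_by_automorphismsI, unfold act_cochain_push)
  show "restrict (push n (xi_class B C)) (carrier K) \<in> auto K" if "C \<in> carrier (PicH k H A)" for C
    by (rule auto[OF PicH_equivariant[OF that]])
  fix f assume "f \<in> carrier K"
  then have f: "f \<in> carrier (CM n)" using K by blast
  show "push n (xi_class B \<one>\<^bsub>PicH k H A\<^esub>) f = f" by (rule push_id[OF f PicH_xi_one])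
  show "push n (xi_class B (C \<otimes>\<^bsub>PicH k H A\<^esub> D)) f = push n (xi_class B C) (push n (xi_class B D) f)"
    if "C \<in> carrier (PicH k H A)" "D \<in> carrier (PicH k H A)" for C D
    by (rule push_compose[OF f]) (rule PicH_xi_mult[OF that])
qed

lemma PicH_acts_cohomology:
  "acts_by_automorphisms (PicH k H A) (cohomology k H A n) (\<lambda>C. image (act_cochain k H A n C))"
proof (rule acts_by_automorphismsI, unfold act_cochain_push)
  show "restrict (image (push n (xi_class B C))) (carrier (cohomology k H A n)) \<in> auto (cohomology k H A n)"
    if "C \<in> carrier (PicH k H A)" for C
    by (rule push_auto_cohomology[OF PicH_equivariant[OF that]])
  fix U assume "U \<in> carrier (cohomology k H A n)"
  then obtain f where f: "U = Bn n #>\<^bsub>RG n\<^esub> f" "f \<in> carrier (RG n)"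
    unfolding cohomology_carrier cocycles_carrier by blast
  interpret R: comm_group "RG n" by (rule Reg_comm_group)
  have U: "g \<in> carrier (CM n)" if "g \<in> U" for g
  proof (rule Reg_in_conv)
    show "g \<in> carrier (RG n)"
      using that R.r_coset_subset_G[OF subgroup.subset[OF coboundaries_subgroup] f(2)] unfolding f(1) by blast
  qed
  show "push n (xi_class B \<one>\<^bsub>PicH k H A\<^esub>) ` U = U"
    using push_id[OF U PicH_xi_one] by (simp cong: image_cong)
  show "push n (xi_class B (C \<otimes>\<^bsub>PicH k H A\<^esub> D)) ` U = push n (xi_class B C) ` push n (xi_class B D) ` U"
    if "C \<in> carrier (PicH k H A)" "D \<in> carrier (PicH k H A)" for C D
    unfolding image_image by (rule image_cong[OF refl], rule push_compose[OF U], assumption, rule PicH_xi_mult[OF that])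
qed

end

theorem proposition8p4:
  fixes k :: "'k ring" and H :: "('k, 'h) hopf" and A :: "('k, 'a, 'h) comod_alg"
    and n :: nat and M :: "('k, 'a, 'm, 'n) morita"
  assumes "field k"
    and "hopf_algebra k H"
    and "cocommutative k H"
    and "ff_galois k H A"
  shows "acts_by_automorphisms (PicH k H A) (cocycles k H A n) (act_cochain k H A n) \<and>
    acts_by_automorphisms (PicH k H A) (coboundaries k H A n) (act_cochain k H A n) \<and>
    acts_by_automorphisms (PicH k H A) (cohomology k H A n) (\<lambda>C. image (act_cochain k H A n C)) \<and>
    (strict_morita k (coinv k H A) M \<and> H_stable k H A M \<longrightarrow>
      (\<forall>f\<in>carrier (cocycles k H A n).
         compose (carrier (tpow k H n)) (xi (coinv k H A) M) f \<in> carrier (cocycles k H A n)) \<and>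
      (\<forall>f\<in>carrier (coboundaries k H A n).
         compose (carrier (tpow k H n)) (xi (coinv k H A) M) f \<in> carrier (coboundaries k H A n)))"
proof -
  interpret galois k H A
    by (rule galois.intro[OF cocomm_hopf.intro[OF ground.intro[OF assms(1)] cocomm_hopf_axioms.intro[OF assms(2,3)]]
          galois_axioms.intro[OF assms(4)]])
  have sub: "carrier (cocycles k H A n) \<subseteq> carrier (CM n)" "carrier (coboundaries k H A n) \<subseteq> carrier (CM n)"
    using Reg_in_conv subgroup.mem_carrier[OF coboundaries_subgroup] unfolding cocycles_carrier subset_iff by blast+
  show ?thesis
  proof (intro conjI impI ballI)
    show "acts_by_automorphisms (PicH k H A) (cocycles k H A n) (act_cochain k H A n)"
      by (rule PicH_acts[OF sub(1) push_auto_cocycles])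
    show "acts_by_automorphisms (PicH k H A) (coboundaries k H A n) (act_cochain k H A n)"
      by (rule PicH_acts[OF sub(2) push_auto_coboundaries])
    show "acts_by_automorphisms (PicH k H A) (cohomology k H A n) (\<lambda>C. image (act_cochain k H A n C))"
      by (rule PicH_acts_cohomology)
    fix f assume M: "strict_morita k B M \<and> H_stable k H A M"
    then have e: "equivariant (xi B M)" using stable_equivariant by blast
    show "compose (carrier (tpow k H n)) (xi B M) f \<in> carrier (cocycles k H A n)" if "f \<in> carrier (cocycles k H A n)"
      using push_cocycle[OF e that] by (simp only: push_def)
    show "compose (carrier (tpow k H n)) (xi B M) f \<in> carrier (coboundaries k H A n)" if "f \<in> carrier (coboundaries k H A n)"
      using push_coboundary[OF e that] by (simp only: push_def)
  qed
qed

end
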